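(* If $F(0)=1$, then $\mathcal C=\varnothing$ and $u(z)=1+z$ for $z>0$. If instead $F(0)<1$, then there exist two points $0<a_*<z_0<b_*<\infty$ such that $\mathcal C=(a_*,b_* )$, where $z_0=\inf\{z>0:(\Pi u)(z)>1\}>0$.
   Context: $B^1,B^2$ are independent Brownian motions on $(\Omega,\mathcal F,\mathsf P)$, $\mathbb F$ their completed natural filtration, $\mathcal T$ the set of $\mathbb F$-stopping times with values in $[0,\infty]$. Constants: $\mu_1,\mu_2\in\mathbb R$, $\sigma_1,\sigma_2>0$, $\nu\in[-1,1]$, $p\in(0,1)$, $r>0$ with $r>\mu_i+\sigma_i^2/2$ for $i=1,2$. $F$ is the cumulative distribution function of a non-negative random variable (integrals against $F(\mathrm dt)$ include a possible atom at $0$). Let $\beta_1=\sigma_2\nu-\sigma_1$, $\beta_2=\sigma_2\sqrt{1-\nu^2}$, assume $\beta_1^2+\beta_2^2>0$, let $\tilde B=(\beta_1B^1+\beta_2B^2)/\sqrt{\beta_1^2+\beta_2^2}$ and let $Z$ solve $\mathrm dZ_t=(\mu_2-\mu_1)Z_t\,\mathrm dt+\sqrt{\beta_1^2+\beta_2^2}\,Z_t\,\mathrm d\tilde B_t$, with $Z_0=z>0$ under $\mathsf P_z$. $\mathcal A_1^+$ is the set of continuous $g:(0,\infty)\to[0,\infty)$ with $\|g\|^2_{\mathcal A_1^+}=\sup_{z>0}|g(z)|^2/(1+z^2)<\infty$. For $g\in\mathcal A_1^+$, $(\Pi g)(z)=\int_0^\infty e^{-(r-\mu_1)t}\mathsf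 E_z[p(1+Z_t)+(1-p)g(Z_t)]F(\mathrm dt)$. $u$ denotes the unique function in $\mathcal A_1^+$ (it exists) with $$u(z)=\sup_{\tau\in\mathcal T}\mathsf E_z[e^{-(r-\mu_1)\tau}\max\{1,(\Pi u)(Z_\tau)\}],\qquad z>0,$$ where payoffs are $0$ on $\{\tau=\infty\}$ (coinciding with the $\limsup$ as $t\to\infty$ of the discounted payoff). The continuation set is $\mathcal C=\{z>0:\ u(z)>\max[1,(\Pi u)(z)]\}$. *)

theory Defs
  imports "HOL-Probability.Probability"
begin

section \<open>Brownian motion and its completed natural filtration\<close>

text \<open>Processes are functions \<^typ>\<open>real \<Rightarrow> 'a \<Rightarrow> real\<close>, of which only the values at times
  \<^prop>\<open>t \<ge> (0::real)\<close> matter.\<close>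

definition brownian_motion :: "'a measure \<Rightarrow> (real \<Rightarrow> 'a \<Rightarrow> real) \<Rightarrow> bool" where
  "brownian_motion M B \<longleftrightarrow>
     (\<forall>t\<ge>0. B t \<in> borel_measurable M) \<and>
     (AE \<omega> in M. B 0 \<omega> = 0) \<and>
     (AE \<omega> in M. continuous_on {0..} (\<lambda>t. B t \<omega>)) \<and>
     (\<forall>s t. 0 \<le> s \<and> s < t \<longrightarrow>
        distributed M lborel (\<lambda>\<omega>. B t \<omega> - B s \<omega>) (normal_density 0 (sqrt (t - s)))) \<and>
     (\<forall>(n::nat) t. 0 \<le> t 0 \<and> (\<forall>i<n. t i \<le> t (Suc i)) \<longrightarrow>
        prob_space.indep_vars M (\<lambda>_. borel) (\<lambda>i \<omega>. B (t (Suc i)) \<omega> - B (t i) \<omega>) {..<n})"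

definition indep_processes ::
  "'a measure \<Rightarrow> (real \<Rightarrow> 'a \<Rightarrow> real) \<Rightarrow> (real \<Rightarrow> 'a \<Rightarrow> real) \<Rightarrow> bool" where
  "indep_processes M X Y \<longleftrightarrow>
     prob_space.indep_var M
       (PiM {0..} (\<lambda>_. borel)) (\<lambda>\<omega>. \<lambda>t\<in>{0..}. X t \<omega>)
       (PiM {0..} (\<lambda>_. borel)) (\<lambda>\<omega>. \<lambda>t\<in>{0..}. Y t \<omega>)"

text \<open>The time axis is \<open>[0,\<infty>]\<close>, i.e. \<^typ>\<open>ennreal\<close>, so that the library's
  \<^const>\<open>stopping_time\<close> describes stopping times that may be infinite. The null sets are those
  of the completed probability space; thus \<open>M\<close> itself need not be complete.\<close>

definition completed_filtration ::
  "'a measure \<Rightarrow> (real \<Rightarrow> 'a \<Rightarrow> real) \<Rightarrow> (real \<Rightarrow> 'a \<Rightarrow> real) \<Rightarrow> ennreal \<Rightarrow> 'a measure" where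
  "completed_filtration M B1 B2 t =
     sigma (space M)
       ({B1 s -` A \<inter> space M | s A. 0 \<le> s \<and> ennreal s \<le> t \<and> A \<in> sets borel} \<union>
        {B2 s -` A \<inter> space M | s A. 0 \<le> s \<and> ennreal s \<le> t \<and> A \<in> sets borel} \<union>
        null_sets (completion M))"

section \<open>Ito integral and stochastic differential equations\<close>

text \<open>A simple process \<open>\<Sum>i<n. \<xi> i \<cdot> indicator (t i, t (i+1)]\<close> with bounded coefficients
  \<open>\<xi> i\<close> known at time \<open>t i\<close>.\<close>

definition is_simple_process ::
  "'a measure \<Rightarrow> (ennreal \<Rightarrow> 'a measure) \<Rightarrow> nat \<Rightarrow> (nat \<Rightarrow> real) \<Rightarrow> (nat \<Rightarrow> 'a \<Rightarrow> real) \<Rightarrow> bool" where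
  "is_simple_process M \<F> n t \<xi> \<longleftrightarrow>
     0 \<le> t 0 \<and> (\<forall>i<n. t i \<le> t (Suc i)) \<and>
     (\<forall>i<n. \<xi> i \<in> borel_measurable (\<F> (ennreal (t i)))) \<and>
     (\<exists>c. \<forall>i<n. \<forall>\<omega>\<in>space M. \<bar>\<xi> i \<omega>\<bar> \<le> c)"

definition simple_process ::
  "nat \<Rightarrow> (nat \<Rightarrow> real) \<Rightarrow> (nat \<Rightarrow> 'a \<Rightarrow> real) \<Rightarrow> real \<Rightarrow> 'a \<Rightarrow> real" where
  "simple_process n t \<xi> s \<omega> = (\<Sum>i<n. \<xi> i \<omega> * indicator {t i<..t (Suc i)} s)"

definition simple_ito_integral ::
  "(real \<Rightarrow> 'a \<Rightarrow> real) \<Rightarrow> nat \<Rightarrow> (nat \<Rightarrow> real) \<Rightarrow> (nat \<Rightarrow> 'a \<Rightarrow> real) \<Rightarrow> real \<Rightarrow> 'a \<Rightarrow> real" where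
  "simple_ito_integral W n t \<xi> T \<omega> =
     (\<Sum>i<n. \<xi> i \<omega> * (W (min (t (Suc i)) T) \<omega> - W (min (t i) T) \<omega>))"

definition vanishes_in_prob :: "'a measure \<Rightarrow> (nat \<Rightarrow> 'a \<Rightarrow> ennreal) \<Rightarrow> bool" where
  "vanishes_in_prob M Y \<longleftrightarrow>
     (\<forall>\<epsilon>::real. \<epsilon> > 0 \<longrightarrow>
        (\<lambda>k. measure (completion M) {\<omega> \<in> space M. ennreal \<epsilon> < Y k \<omega>}) \<longlonglongrightarrow> 0)"

text \<open>\<open>I = \<integral>\<^sub>0\<^sup>T H dW\<close> for a measurable adapted \<open>H\<close> with \<open>\<integral>\<^sub>0\<^sup>T H\<^sup>2 ds < \<infinity>\<close> almost surely, where
  \<open>W\<close> is a Brownian motion relative to the filtration \<open>\<F>\<close>: \<open>I\<close> is the limit in probability of the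
  integrals of simple processes approximating \<open>H\<close>. It is determined up to a null set.\<close>

definition has_ito_integral ::
  "'a measure \<Rightarrow> (ennreal \<Rightarrow> 'a measure) \<Rightarrow> (real \<Rightarrow> 'a \<Rightarrow> real) \<Rightarrow> (real \<Rightarrow> 'a \<Rightarrow> real) \<Rightarrow>
     real \<Rightarrow> ('a \<Rightarrow> real) \<Rightarrow> bool" where
  "has_ito_integral M \<F> W H T I \<longleftrightarrow>
     I \<in> borel_measurable (completion M) \<and>
     (\<forall>s\<in>{0..T}. H s \<in> borel_measurable (\<F> (ennreal s))) \<and>
     (\<lambda>(s, \<omega>). H s \<omega>) \<in> borel_measurable (restrict_space borel {0..T} \<Otimes>\<^sub>M completion M) \<and>
     (AE \<omega> in M. (\<integral>\<^sup>+ s\<in>{0..T}. ennreal ((H s \<omega>)\<^sup>2) \<partial>lborel) < \<infinity>) \<and>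
     (\<exists>n t \<xi>.
        (\<forall>k. is_simple_process M \<F> (n k) (t k) (\<xi> k)) \<and>
        vanishes_in_prob M (\<lambda>k \<omega>.
          \<integral>\<^sup>+ s\<in>{0..T}. ennreal ((H s \<omega> - simple_process (n k) (t k) (\<xi> k) s \<omega>)\<^sup>2) \<partial>lborel) \<and>
        vanishes_in_prob M (\<lambda>k \<omega>.
          ennreal \<bar>simple_ito_integral W (n k) (t k) (\<xi> k) T \<omega> - I \<omega>\<bar>))"

text \<open>\<open>Z\<close> is a continuous adapted solution of \<open>dZ\<^sub>t = b(Z\<^sub>t) dt + \<sigma>(Z\<^sub>t) dW\<^sub>t\<close>, \<open>Z\<^sub>0 = z\<close>.\<close>

definition solves_sde ::
  "'a measure \<Rightarrow> (ennreal \<Rightarrow> 'a measure) \<Rightarrow> (real \<Rightarrow> 'a \<Rightarrow> real) \<Rightarrow> (real \<Rightarrow> real) \<Rightarrow> (real \<Rightarrow> real) \<Rightarrow>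
     real \<Rightarrow> (real \<Rightarrow> 'a \<Rightarrow> real) \<Rightarrow> bool" where
  "solves_sde M \<F> W b \<sigma> z Z \<longleftrightarrow>
     (\<forall>t\<ge>0. Z t \<in> borel_measurable (\<F> (ennreal t))) \<and>
     (AE \<omega> in M. continuous_on {0..} (\<lambda>t. Z t \<omega>)) \<and>
     (AE \<omega> in M. Z 0 \<omega> = z) \<and>
     (\<forall>T\<ge>0. \<exists>I. has_ito_integral M \<F> W (\<lambda>t \<omega>. \<sigma> (Z t \<omega>)) T I \<and>
        (AE \<omega> in M. Z T \<omega> = z + (LBINT t:{0..T}. b (Z t \<omega>)) + I \<omega>))"

section \<open>The optimal stopping problem\<close>

text \<open>Functions on \<open>(0,\<infty>)\<close> are represented by functions on \<^typ>\<open>real\<close> whose values outside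
  \<open>(0,\<infty>)\<close> are irrelevant.\<close>

definition A1_plus :: "(real \<Rightarrow> real) set" where
  "A1_plus = {g. continuous_on {0<..} g \<and> (\<forall>z>0. 0 \<le> g z) \<and>
                 bdd_above ((\<lambda>z. \<bar>g z\<bar>\<^sup>2 / (1 + z\<^sup>2)) ` {0<..})}"

text \<open>The laws \<open>P\<^sub>z\<close> are realised on one probability space by a family \<open>Z z\<close> of processes started
  at \<open>z\<close>. \<open>D\<close> is the distribution with cumulative distribution function \<open>F\<close>, and \<open>\<rho> = r - \<mu>\<^sub>1\<close>.
  Expectations are taken in the completed space because \<open>Z\<close> is only adapted to the completed
  filtration. For \<open>g\<close> in \<^const>\<open>A1_plus\<close> one has \<open>0 \<le> g z \<le> c (1 + z)\<close>, so under
  \<open>r > \<mu>\<^sub>i + \<sigma>\<^sub>i\<^sup>2 / 2\<close> both integrals converge absolutely.\<close>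

definition Pi_op ::
  "'a measure \<Rightarrow> (real \<Rightarrow> real \<Rightarrow> 'a \<Rightarrow> real) \<Rightarrow> real measure \<Rightarrow> real \<Rightarrow> real \<Rightarrow>
     (real \<Rightarrow> real) \<Rightarrow> real \<Rightarrow> real" where
  "Pi_op M Z D \<rho> p g z =
     (LINT t:{0..}|D. exp (- \<rho> * t) *
        (LINT \<omega>|completion M. p * (1 + Z z t \<omega>) + (1 - p) * g (Z z t \<omega>)))"

definition discounted_payoff ::
  "real \<Rightarrow> (real \<Rightarrow> real) \<Rightarrow> (real \<Rightarrow> 'a \<Rightarrow> real) \<Rightarrow> ('a \<Rightarrow> ennreal) \<Rightarrow> 'a \<Rightarrow> real" where
  "discounted_payoff \<rho> h X \<tau> \<omega> =
     (if \<tau> \<omega> = \<infinity> then 0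
      else exp (- \<rho> * enn2real (\<tau> \<omega>)) * h (X (enn2real (\<tau> \<omega>)) \<omega>))"

text \<open>For a nonnegative reward \<open>h\<close>; the value is taken in \<open>[0,\<infty>]\<close>, so no integrability or
  boundedness convention enters.\<close>

definition stopping_value ::
  "'a measure \<Rightarrow> (ennreal \<Rightarrow> 'a measure) \<Rightarrow> real \<Rightarrow> (real \<Rightarrow> real) \<Rightarrow> (real \<Rightarrow> 'a \<Rightarrow> real) \<Rightarrow> ennreal" where
  "stopping_value M \<F> \<rho> h X =
     (SUP \<tau> \<in> {\<tau>. stopping_time \<F> \<tau>}.
        \<integral>\<^sup>+ \<omega>. ennreal (discounted_payoff \<rho> h X \<tau> \<omega>) \<partial>completion M)"

end

theory Submission
  imports Defs "HOL-Real_Asymp.Real_Asymp"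
begin

text \<open>Let \<open>\<rho> = r - \<mu>1\<close> and let \<open>\<gamma>1 < 0\<close>, \<open>1 < \<gamma>2\<close> be the exponents for which \<open>exp (- \<rho> t) Z\<^sub>t powr \<gamma>\<close> is a
  martingale. Optional sampling bounds \<open>u\<close> by every function \<open>a y powr \<gamma>1 + b y powr \<gamma>2\<close>
  (\<open>a, b \<ge> 0\<close>) above the reward \<open>max 1 (\<Pi>u)\<close>, and stopping on leaving an interval bounds \<open>u\<close> from
  below by the combinations that interpolate the reward at the endpoints. Hence, after division
  by \<open>y powr \<gamma>1\<close> and in the variable \<open>y powr (\<gamma>2 - \<gamma>1)\<close>, \<open>u\<close> is the least concave majorant of the
  reward, and supporting lines replace all further use of stopping times. This concavity is
  invariant under scaling of \<open>y\<close>, so \<open>\<Pi>u\<close> inherits it from \<open>u\<close>. Comparison up to multiples of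
  \<open>1 + y\<close>, with contraction factor \<open>1 - p\<close>, gives \<open>u y \<le> 1 + y\<close> and monotonicity of \<open>u\<close>.

  Below \<open>z\<^sub>0\<close> the continuation set is \<open>{u > 1}\<close>, an interval by monotonicity. A supporting line at a
  stopping point above \<open>z\<^sub>0\<close> can be continued to the right by supporting lines of \<open>\<Pi>u\<close>, so
  stopping propagates upwards. At \<open>z\<^sub>0\<close> itself the reward has a convex kink, which excludes stopping.\<close>

section \<open>Brownian motion relative to a filtration\<close>

text \<open>The process \<open>Z\<close> is given only through a stochastic equation whose integral
  is a limit in probability along unspecified simple processes, so no martingale of the form above
  is available until \<open>Z\<close> is known explicitly. It is identified with an exponential of
  \<open>W\<close> by means of discretised equations: stochastic integrals are limits of left
  endpoint sums, the exponential satisfies the same limit relation, and linearity leaves a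
  homogeneous equation for the difference.

  The exponents lie on the two sides of 0 and of 1 because the growth rate of
  \<open>Z powr \<gamma>\<close> is 0 at \<open>\<gamma> = 0\<close> and
  \<open>\<mu>2 - \<mu>1\<close> at \<open>\<gamma> = 1\<close>, both below \<rho>. Hence 1 and
  \<open>y\<close> are themselves concave in the transformed sense; this makes the explicit part of
  \<open>\<Pi>u\<close> concave and lets \<open>1 + y\<close> serve as the weight of the comparison.

  The explicit part, with its weight \<open>p > 0\<close>, has two more uses: its linear summand
  gives \<open>\<Pi>u\<close> a positive slope, from which the kink at \<open>z0\<close> arises, and
  its constant summand forces stopping for large \<open>z\<close>.\<close>

lemma normal_density_times_exp:
  assumes "\<sigma> > 0"
  shows "normal_density 0 \<sigma> x * exp (\<theta> * x) = exp (\<theta>\<^sup>2 * \<sigma>\<^sup>2 / 2) * normal_density (\<theta> * \<sigma>\<^sup>2) \<sigma> x"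
proof -
  have "- ((x - 0)\<^sup>2) / (2 * \<sigma>\<^sup>2) + \<theta> * x = \<theta>\<^sup>2 * \<sigma>\<^sup>2 / 2 + - ((x - \<theta> * \<sigma>\<^sup>2)\<^sup>2) / (2 * \<sigma>\<^sup>2)"
    using assms by (simp add: field_simps power2_eq_square)
  then show ?thesis
    by (simp add: normal_density_def exp_add[symmetric])
qed

text \<open>Multiplying a centred Gaussian density by \<open>exp (\<theta> * x)\<close> shifts its
  mean to \<open>\<theta> * \<sigma>\<^sup>2\<close>, up to a constant factor, so these are the
  zeroth and the first moment of the shifted density. They yield the moments of \<open>gbm\<close>
  and the local error of its Euler scheme.\<close>

lemma normal_exp_moment:
  assumes "\<sigma> > 0"
  shows "has_bochner_integral lborel (\<lambda>x. normal_density 0 \<sigma> x * exp (\<theta> * x)) (exp (\<theta>\<^sup>2 * \<sigma>\<^sup>2 / 2))"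
    and "has_bochner_integral lborel (\<lambda>x. normal_density 0 \<sigma> x * (x * exp (\<theta> * x)))
      (\<theta> * \<sigma>\<^sup>2 * exp (\<theta>\<^sup>2 * \<sigma>\<^sup>2 / 2))"
proof -
  have "has_bochner_integral lborel (normal_density (\<theta> * \<sigma>\<^sup>2) \<sigma>) 1"
    using assms by (simp add: has_bochner_integral_iff)
  then have "has_bochner_integral lborel (\<lambda>x. exp (\<theta>\<^sup>2 * \<sigma>\<^sup>2 / 2) * normal_density (\<theta> * \<sigma>\<^sup>2) \<sigma> x)
      (exp (\<theta>\<^sup>2 * \<sigma>\<^sup>2 / 2) * 1)"
    by (rule has_bochner_integral_mult_right)
  then show "has_bochner_integral lborel (\<lambda>x. normal_density 0 \<sigma> x * exp (\<theta> * x)) (exp (\<theta>\<^sup>2 * \<sigma>\<^sup>2 / 2))"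
    by (simp add: normal_density_times_exp[OF assms])
  have "has_bochner_integral lborel (\<lambda>x. exp (\<theta>\<^sup>2 * \<sigma>\<^sup>2 / 2) * (normal_density (\<theta> * \<sigma>\<^sup>2) \<sigma> x * x))
      (exp (\<theta>\<^sup>2 * \<sigma>\<^sup>2 / 2) * (\<theta> * \<sigma>\<^sup>2))"
    by (intro has_bochner_integral_mult_right normal_moment_nz_1 assms)
  moreover have "normal_density 0 \<sigma> x * (x * exp (\<theta> * x)) =
      exp (\<theta>\<^sup>2 * \<sigma>\<^sup>2 / 2) * (normal_density (\<theta> * \<sigma>\<^sup>2) \<sigma> x * x)" for x
    using normal_density_times_exp[OF assms, of x \<theta>] by (simp add: ac_simps)
  ultimately show "has_bochner_integral lborel (\<lambda>x. normal_density 0 \<sigma> x * (x * exp (\<theta> * x)))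
      (\<theta> * \<sigma>\<^sup>2 * exp (\<theta>\<^sup>2 * \<sigma>\<^sup>2 / 2))"
    by (simp only: ac_simps)
qed

text \<open>A Brownian motion relative to a filtration, on what will be the completed space.
  \<open>F_null\<close> puts every subset of a null set into every \<open>\<F> t1\<close>: paths are
  continuous only almost surely, so exit times are measurable only after correction on a null set.
  Independence is stated for events because it is obtained later from generators of the
  past.\<close>

locale brownian_basis = prob_space +
  fixes \<F> :: "ennreal \<Rightarrow> 'a measure" and W :: "real \<Rightarrow> 'a \<Rightarrow> real"
  assumes space_F: "space (\<F> t1) = space M"
    and F_events: "sets (\<F> t1) \<subseteq> events"
    and F_mono: "t1 \<le> t2 \<Longrightarrow> sets (\<F> t1) \<subseteq> sets (\<F> t2)"
    and F_null: "N \<in> null_sets M \<Longrightarrow> A \<subseteq> N \<Longrightarrow> A \<in> sets (\<F> t1)"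
    and W_adapted: "0 \<le> t \<Longrightarrow> W t \<in> borel_measurable (\<F> (ennreal t))"
    and W_0: "AE \<omega> in M. W 0 \<omega> = 0"
    and W_cont: "AE \<omega> in M. continuous_on {0..} (\<lambda>t. W t \<omega>)"
    and W_dist: "0 \<le> s \<Longrightarrow> s < t \<Longrightarrow>
      distributed M lborel (\<lambda>\<omega>. W t \<omega> - W s \<omega>) (normal_density 0 (sqrt (t - s)))"
    and W_indep: "0 \<le> s \<Longrightarrow> s < t \<Longrightarrow> A \<in> sets (\<F> (ennreal s)) \<Longrightarrow> B \<in> sets borel \<Longrightarrow>
      prob (A \<inter> ((\<lambda>\<omega>. W t \<omega> - W s \<omega>) -` B \<inter> space M)) =
      prob A * prob ((\<lambda>\<omega>. W t \<omega> - W s \<omega>) -` B \<inter> space M)"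
begin

lemma F_measurable_mono:
  assumes "X \<in> borel_measurable (\<F> s)" "s \<le> t"
  shows "X \<in> borel_measurable (\<F> t)"
  by (rule measurableI)
     (use assms F_mono[OF assms(2)] in \<open>auto simp: space_F dest: measurable_sets[OF assms(1)] measurable_space\<close>)

lemma F_measurable:
  assumes "X \<in> borel_measurable (\<F> s)"
  shows "X \<in> borel_measurable M"
  by (rule measurableI)
     (use assms F_events[of s] in \<open>auto simp: space_F dest: measurable_sets[OF assms(1)]\<close>)

lemma W_adapted': "0 \<le> s \<Longrightarrow> s \<le> t \<Longrightarrow> W s \<in> borel_measurable (\<F> (ennreal t))"
  by (rule F_measurable_mono[OF W_adapted]) (auto intro: ennreal_leI)

lemma W_borel: "0 \<le> t \<Longrightarrow> W t \<in> borel_measurable M"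
  by (rule F_measurable[OF W_adapted])

lemma increment_borel: "0 \<le> s \<Longrightarrow> s \<le> t \<Longrightarrow> (\<lambda>\<omega>. W t \<omega> - W s \<omega>) \<in> borel_measurable M"
  by (intro borel_measurable_diff W_borel) auto

lemma increment_indep:
  assumes "0 \<le> s" "s < t" "X \<in> borel_measurable (\<F> (ennreal s))"
  shows "indep_var borel X borel (\<lambda>\<omega>. W t \<omega> - W s \<omega>)"
proof -
  let ?U = "\<lambda>\<omega>. W t \<omega> - W s \<omega>"
  have X: "X \<in> borel_measurable M" and U: "?U \<in> borel_measurable M"
    using assms F_measurable increment_borel by auto
  have "sigma_sets (space M) {Y -` A \<inter> space M |A. A \<in> sets borel} = {Y -` A \<inter> space M |A. A \<in> sets borel}"
    for Y :: "'a \<Rightarrow> real"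
    using sets_vimage_algebra2[of Y "space M" borel] by (simp add: sets_vimage_algebra)
  moreover have "indep_set {X -` A \<inter> space M |A. A \<in> sets borel} {?U -` A \<inter> space M |A. A \<in> sets borel}"
    unfolding indep_sets2_eq
  proof (intro conjI ballI)
    fix a b assume "a \<in> {X -` A \<inter> space M |A. A \<in> sets borel}" "b \<in> {?U -` A \<inter> space M |A. A \<in> sets borel}"
    then show "prob (a \<inter> b) = prob a * prob b"
      using W_indep[OF assms(1,2)] measurable_sets[OF assms(3)] by (auto simp: space_F)
  qed (use X U in auto)
  ultimately show ?thesis
    unfolding indep_var_eq using X U by simp
qed

text \<open>Does the work of conditional expectation given \<open>\<F> (ennreal s)\<close>: by
  independence the increment contributes its Gaussian moment \<open>c\<close> as a factor.
  Orthogonality and the martingale properties below are instances.\<close>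

lemma
  assumes "0 \<le> s" "s < t" "X \<in> borel_measurable (\<F> (ennreal s))" "integrable M X"
    and "\<phi> \<in> borel_measurable borel"
    and "has_bochner_integral lborel (\<lambda>x. normal_density 0 (sqrt (t - s)) x * \<phi> x) c"
  shows integrable_times_increment: "integrable M (\<lambda>\<omega>. X \<omega> * \<phi> (W t \<omega> - W s \<omega>))"
    and expectation_times_increment: "(\<integral>\<omega>. X \<omega> * \<phi> (W t \<omega> - W s \<omega>) \<partial>M) = (\<integral>\<omega>. X \<omega> \<partial>M) * c"
proof -
  have ind: "indep_var borel X borel (\<lambda>\<omega>. \<phi> (W t \<omega> - W s \<omega>))"
    using indep_var_compose[OF increment_indep[OF assms(1-3)], of "\<lambda>x. x" borel \<phi> borel] assms(5)
    by (simp add: comp_def)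
  have int: "integrable M (\<lambda>\<omega>. \<phi> (W t \<omega> - W s \<omega>))"
    using assms(6) distributed_integrable[OF W_dist[OF assms(1,2)], of \<phi>] assms(5)
    by (simp add: has_bochner_integral_iff)
  have "(\<integral>\<omega>. \<phi> (W t \<omega> - W s \<omega>) \<partial>M) = c"
    using assms(6) distributed_integral[OF W_dist[OF assms(1,2)], of \<phi>] assms(5)
    by (simp add: has_bochner_integral_iff)
  then show "(\<integral>\<omega>. X \<omega> * \<phi> (W t \<omega> - W s \<omega>) \<partial>M) = (\<integral>\<omega>. X \<omega> \<partial>M) * c"
    using indep_var_lebesgue_integral[OF ind assms(4) int] by simp
  show "integrable M (\<lambda>\<omega>. X \<omega> * \<phi> (W t \<omega> - W s \<omega>))"
    by (rule indep_var_integrable[OF ind assms(4) int])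
qed

end

section \<open>The Ito isometry for sums\<close>

lemma integrable_mult_square:
  fixes X Y :: "'a \<Rightarrow> real"
  assumes [measurable]: "X \<in> borel_measurable M" "Y \<in> borel_measurable M"
    and "integrable M (\<lambda>x. (X x)\<^sup>2)" "integrable M (\<lambda>x. (Y x)\<^sup>2)"
  shows "integrable M (\<lambda>x. X x * Y x)"
proof (rule Bochner_Integration.integrable_bound)
  show "integrable M (\<lambda>x. (X x)\<^sup>2 + (Y x)\<^sup>2)"
    using assms by simp
  have "2 * \<bar>X x * Y x\<bar> \<le> (X x)\<^sup>2 + (Y x)\<^sup>2" for x
    using sum_squares_bound[of "\<bar>X x\<bar>" "\<bar>Y x\<bar>"] by (simp add: abs_mult)
  then have "\<bar>X x * Y x\<bar> \<le> (X x)\<^sup>2 + (Y x)\<^sup>2" for x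
    by (smt (verit) abs_ge_zero)
  then show "AE x in M. norm (X x * Y x) \<le> norm ((X x)\<^sup>2 + (Y x)\<^sup>2)"
    by simp
qed simp

context brownian_basis
begin

text \<open>Mixed terms vanish because \<open>\<phi> i\<close> of the new increment has mean zero
  and is independent of everything before it. The general \<open>\<phi>\<close> serves two purposes:
  the identity gives the Ito isometry, the centred remainder of the exponential gives the Euler
  estimate for \<open>gbm\<close>.\<close>

lemma
  assumes "0 \<le> p 0" "\<And>i. i < n \<Longrightarrow> p i < p (Suc i)"
    and X: "\<And>i. i < n \<Longrightarrow> X i \<in> borel_measurable (\<F> (ennreal (p i)))"
    and X2: "\<And>i. i < n \<Longrightarrow> integrable M (\<lambda>\<omega>. (X i \<omega>)\<^sup>2)"
    and \<phi>: "\<And>i. i < n \<Longrightarrow> \<phi> i \<in> borel_measurable borel"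
    and mean: "\<And>i. i < n \<Longrightarrow>
      has_bochner_integral lborel (\<lambda>x. normal_density 0 (sqrt (p (Suc i) - p i)) x * \<phi> i x) 0"
    and var: "\<And>i. i < n \<Longrightarrow>
      has_bochner_integral lborel (\<lambda>x. normal_density 0 (sqrt (p (Suc i) - p i)) x * (\<phi> i x)\<^sup>2) (v i)"
  shows integrable_sum_increments_square:
      "integrable M (\<lambda>\<omega>. (\<Sum>i<n. X i \<omega> * \<phi> i (W (p (Suc i)) \<omega> - W (p i) \<omega>))\<^sup>2)" (is "integrable M (\<lambda>\<omega>. (?S n \<omega>)\<^sup>2)")
    and expectation_sum_increments_square:
      "(\<integral>\<omega>. (\<Sum>i<n. X i \<omega> * \<phi> i (W (p (Suc i)) \<omega> - W (p i) \<omega>))\<^sup>2 \<partial>M) = (\<Sum>i<n. (\<integral>\<omega>. (X i \<omega>)\<^sup>2 \<partial>M) * v i)"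
proof -
  \<comment> \<open>The induction also carries measurability of the partial sum at time
    \<open>p m\<close>, because \<open>?S m\<close> times \<open>X m\<close> is the factor known
    before the next increment.\<close>
  have "integrable M (\<lambda>\<omega>. (?S m \<omega>)\<^sup>2) \<and> (\<integral>\<omega>. (?S m \<omega>)\<^sup>2 \<partial>M) = (\<Sum>i<m. (\<integral>\<omega>. (X i \<omega>)\<^sup>2 \<partial>M) * v i) \<and>
      ?S m \<in> borel_measurable (\<F> (ennreal (p m))) \<and> 0 \<le> p m" if "m \<le> n" for m
    using that
  proof (induction m)
    case 0
    then show ?case using assms(1) by simp
  next
    case (Suc m)
    then have m: "m < n" and IH: "integrable M (\<lambda>\<omega>. (?S m \<omega>)\<^sup>2)"
      "(\<integral>\<omega>. (?S m \<omega>)\<^sup>2 \<partial>M) = (\<Sum>i<m. (\<integral>\<omega>. (X i \<omega>)\<^sup>2 \<partial>M) * v i)"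
      "?S m \<in> borel_measurable (\<F> (ennreal (p m)))" "0 \<le> p m"
      by auto
    note lt = assms(2)[OF m]
    let ?U = "\<lambda>\<omega>. W (p (Suc m)) \<omega> - W (p m) \<omega>"
    note [measurable] = F_measurable[OF IH(3)] F_measurable[OF X[OF m]] \<phi>[OF m]
    have SX: "integrable M (\<lambda>\<omega>. ?S m \<omega> * X m \<omega>)"
      by (rule integrable_mult_square) (use IH X2[OF m] in auto)
    have SXm: "(\<lambda>\<omega>. ?S m \<omega> * X m \<omega>) \<in> borel_measurable (\<F> (ennreal (p m)))"
      by (intro borel_measurable_times IH X m)
    have X2m: "(\<lambda>\<omega>. (X m \<omega>)\<^sup>2) \<in> borel_measurable (\<F> (ennreal (p m)))"
      by (intro borel_measurable_power X m)
    have eq: "(?S (Suc m) \<omega>)\<^sup>2 = (?S m \<omega>)\<^sup>2 + 2 * (?S m \<omega> * X m \<omega> * \<phi> m (?U \<omega>)) + (X m \<omega>)\<^sup>2 * (\<phi> m (?U \<omega>))\<^sup>2" for \<omega>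
      by (simp add: power2_eq_square algebra_simps)
    note i1 = integrable_times_increment[OF IH(4) lt SXm SX \<phi>[OF m] mean[OF m]]
    note e1 = expectation_times_increment[OF IH(4) lt SXm SX \<phi>[OF m] mean[OF m]]
    have phi2: "(\<lambda>x. (\<phi> m x)\<^sup>2) \<in> borel_measurable borel"
      by measurable
    note i2 = integrable_times_increment[OF IH(4) lt X2m X2[OF m] phi2 var[OF m]]
    note e2 = expectation_times_increment[OF IH(4) lt X2m X2[OF m] phi2 var[OF m]]
    have W1: "W (p (Suc m)) \<in> borel_measurable (\<F> (ennreal (p (Suc m))))"
      "W (p m) \<in> borel_measurable (\<F> (ennreal (p (Suc m))))"
      using IH(4) lt by (auto intro!: W_adapted')
    have le: "ennreal (p m) \<le> ennreal (p (Suc m))"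
      using lt by (intro ennreal_leI) simp
    have "?S (Suc m) \<in> borel_measurable (\<F> (ennreal (p (Suc m))))"
      unfolding sum.lessThan_Suc
      by (intro borel_measurable_add borel_measurable_times F_measurable_mono[OF IH(3) le]
          F_measurable_mono[OF X[OF m] le] measurable_compose[OF _ \<phi>[OF m]] borel_measurable_diff W1)
    then show ?case
      using IH(1,2,4) lt i1 i2 e1 e2 unfolding eq by simp
  qed
  from this[of n] show "integrable M (\<lambda>\<omega>. (?S n \<omega>)\<^sup>2)"
    "(\<integral>\<omega>. (?S n \<omega>)\<^sup>2 \<partial>M) = (\<Sum>i<n. (\<integral>\<omega>. (X i \<omega>)\<^sup>2 \<partial>M) * v i)"
    by auto
qed

lemma
  assumes "0 \<le> p 0" "\<And>i. i < n \<Longrightarrow> p i < p (Suc i)"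
    and X: "\<And>i. i < n \<Longrightarrow> X i \<in> borel_measurable (\<F> (ennreal (p i)))"
    and X2: "\<And>i. i < n \<Longrightarrow> integrable M (\<lambda>\<omega>. (X i \<omega>)\<^sup>2)"
  shows integrable_ito_sum_square:
      "integrable M (\<lambda>\<omega>. (\<Sum>i<n. X i \<omega> * (W (p (Suc i)) \<omega> - W (p i) \<omega>))\<^sup>2)"
    and ito_isometry_sum:
      "(\<integral>\<omega>. (\<Sum>i<n. X i \<omega> * (W (p (Suc i)) \<omega> - W (p i) \<omega>))\<^sup>2 \<partial>M) =
       (\<Sum>i<n. (\<integral>\<omega>. (X i \<omega>)\<^sup>2 \<partial>M) * (p (Suc i) - p i))"
proof -
  have "has_bochner_integral lborel (\<lambda>x. normal_density 0 (sqrt (p (Suc i) - p i)) x * x) 0" if "i < n" for i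
    using normal_moment_nz_1[of "sqrt (p (Suc i) - p i)" 0] assms(2)[OF that] by simp
  moreover have "has_bochner_integral lborel (\<lambda>x. normal_density 0 (sqrt (p (Suc i) - p i)) x * x\<^sup>2)
      (p (Suc i) - p i)" if "i < n" for i
    using normal_moment_even[of "sqrt (p (Suc i) - p i)" 0 1] assms(2)[OF that]
    by (simp add: diff_divide_distrib)
  ultimately show "integrable M (\<lambda>\<omega>. (\<Sum>i<n. X i \<omega> * (W (p (Suc i)) \<omega> - W (p i) \<omega>))\<^sup>2)"
    "(\<integral>\<omega>. (\<Sum>i<n. X i \<omega> * (W (p (Suc i)) \<omega> - W (p i) \<omega>))\<^sup>2 \<partial>M) =
       (\<Sum>i<n. (\<integral>\<omega>. (X i \<omega>)\<^sup>2 \<partial>M) * (p (Suc i) - p i))"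
    using integrable_sum_increments_square[OF assms, where \<phi> = "\<lambda>_ x. x" and v = "\<lambda>i. p (Suc i) - p i"]
      expectation_sum_increments_square[OF assms, where \<phi> = "\<lambda>_ x. x" and v = "\<lambda>i. p (Suc i) - p i"]
    by auto
qed

text \<open>The coefficients are not assumed square integrable. Truncating them once the accumulated
  square sum exceeds \<delta> makes the isometry and Chebyshev's inequality available, at the price
  of the probability that the truncation acts.\<close>

lemma ito_sum_prob_bound:
  assumes p: "0 \<le> p 0" "\<And>i. i < n \<Longrightarrow> p i < p (Suc i)"
    and X: "\<And>i. i < n \<Longrightarrow> X i \<in> borel_measurable (\<F> (ennreal (p i)))"
    and "0 \<le> \<delta>" "0 < \<epsilon>"
  shows "prob {\<omega> \<in> space M. \<epsilon> < \<bar>\<Sum>i<n. X i \<omega> * (W (p (Suc i)) \<omega> - W (p i) \<omega>)\<bar>} \<le>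
    \<delta> / \<epsilon>\<^sup>2 + prob {\<omega> \<in> space M. \<delta> < (\<Sum>i<n. (X i \<omega>)\<^sup>2 * (p (Suc i) - p i))}"
proof -
  define V where "V i \<omega> = (\<Sum>j<i. (X j \<omega>)\<^sup>2 * (p (Suc j) - p j))" for i \<omega>
  \<comment> \<open>The test uses \<open>V (Suc i)\<close>, which includes the present coefficient:
    it is still known at time \<open>p i\<close>, and with it the truncated square sum never exceeds
    \<delta>.\<close>
  define Y where "Y i \<omega> = (if V (Suc i) \<omega> \<le> \<delta> then X i \<omega> else 0)" for i \<omega>
  let ?I = "\<lambda>X \<omega>. \<Sum>i<n. X i \<omega> * (W (p (Suc i)) \<omega> - W (p i) \<omega>)"
  have p_mono: "p i \<le> p j" if "i \<le> j" "j \<le> n" for i j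
    using that by (induction j) (auto simp: le_Suc_eq intro: order_trans[OF _ less_imp_le[OF p(2)]])
  have p_nonneg: "0 \<le> p i" if "i \<le> n" for i
    using p_mono[of 0 i] p(1) that by simp
  have XF: "X j \<in> borel_measurable (\<F> (ennreal (p i)))" if "j \<le> i" "i < n" for i j
    by (rule F_measurable_mono[OF X]) (use that p_mono[of j i] in \<open>auto intro: ennreal_leI\<close>)
  have YF: "Y i \<in> borel_measurable (\<F> (ennreal (p i)))" if "i < n" for i
  proof -
    have [measurable]: "V (Suc i) \<in> borel_measurable (\<F> (ennreal (p i)))"
      unfolding V_def using that by (intro borel_measurable_sum borel_measurable_times borel_measurable_power XF) auto
    note [measurable] = X[OF that]
    show ?thesis
      unfolding Y_def by measurable
  qed
  have V_mono: "V i \<omega> \<le> V j \<omega>" if "i \<le> j" "j \<le> n" for i j \<omega>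
    unfolding V_def by (rule sum_mono2) (use that p(2) in \<open>auto intro!: mult_nonneg_nonneg simp: less_imp_le\<close>)
  have Y_le: "(\<Sum>i<m. (Y i \<omega>)\<^sup>2 * (p (Suc i) - p i)) \<le> min \<delta> (V m \<omega>)" if "m \<le> n" for m \<omega>
    using that
  proof (induction m)
    case 0
    then show ?case using \<open>0 \<le> \<delta>\<close> by (simp add: V_def)
  next
    case (Suc m)
    then have IH: "(\<Sum>i<m. (Y i \<omega>)\<^sup>2 * (p (Suc i) - p i)) \<le> min \<delta> (V m \<omega>)" by simp
    have VS: "V (Suc m) \<omega> = V m \<omega> + (X m \<omega>)\<^sup>2 * (p (Suc m) - p m)"
      by (simp add: V_def)
    show ?case
      using IH VS V_mono[of m "Suc m" \<omega>] Suc.prems by (auto simp: Y_def)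
  qed
  have Y2_le: "(Y i \<omega>)\<^sup>2 \<le> \<delta> / (p (Suc i) - p i)" if "i < n" for i \<omega>
  proof -
    have "(Y i \<omega>)\<^sup>2 * (p (Suc i) - p i) \<le> (\<Sum>i<n. (Y i \<omega>)\<^sup>2 * (p (Suc i) - p i))"
      by (rule member_le_sum[of i "{..<n}" "\<lambda>i. (Y i \<omega>)\<^sup>2 * (p (Suc i) - p i)"])
         (use that p(2) in \<open>auto intro!: mult_nonneg_nonneg simp: less_imp_le\<close>)
    then show ?thesis
      using Y_le[of n \<omega>] p(2)[OF that] by (simp add: field_simps)
  qed
  have Y2: "integrable M (\<lambda>\<omega>. (Y i \<omega>)\<^sup>2)" if "i < n" for i
    by (rule integrable_const_bound[of _ "\<delta> / (p (Suc i) - p i)"])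
       (use Y2_le[OF that] F_measurable[OF YF[OF that]] in auto)
  note int = integrable_ito_sum_square[OF p YF Y2]
  have "(\<integral>\<omega>. (?I Y \<omega>)\<^sup>2 \<partial>M) = (\<integral>\<omega>. (\<Sum>i<n. (Y i \<omega>)\<^sup>2 * (p (Suc i) - p i)) \<partial>M)"
    by (subst ito_isometry_sum[OF p YF Y2]) (auto simp: Y2)
  also have "\<dots> \<le> (\<integral>\<omega>. \<delta> \<partial>M)"
    by (rule integral_mono) (use Y_le[of n] in \<open>auto simp: Y2\<close>)
  finally have second: "(\<integral>\<omega>. (?I Y \<omega>)\<^sup>2 \<partial>M) \<le> \<delta>"
    by (simp add: prob_space)
  have W_meas [measurable]: "W (p i) \<in> borel_measurable M" if "i \<le> n" for i
    by (rule W_borel) (use p_nonneg that in auto)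
  have X_meas: "X i \<in> borel_measurable M" "Y i \<in> borel_measurable M" if "i < n" for i
    using that X YF F_measurable by auto
  have [measurable]: "?I Y \<in> borel_measurable M" "?I X \<in> borel_measurable M" "V n \<in> borel_measurable M"
    unfolding V_def by (auto intro!: borel_measurable_sum borel_measurable_times borel_measurable_diff
      borel_measurable_power X_meas W_meas)
  have "prob {\<omega> \<in> space M. \<epsilon> < \<bar>?I X \<omega>\<bar>} \<le> prob ({\<omega> \<in> space M. \<epsilon>\<^sup>2 \<le> (?I Y \<omega>)\<^sup>2} \<union> {\<omega> \<in> space M. \<delta> < V n \<omega>})"
  proof (rule finite_measure_mono)
    show "{\<omega> \<in> space M. \<epsilon> < \<bar>?I X \<omega>\<bar>} \<subseteq> {\<omega> \<in> space M. \<epsilon>\<^sup>2 \<le> (?I Y \<omega>)\<^sup>2} \<union> {\<omega> \<in> space M. \<delta> < V n \<omega>}"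
    proof safe
      fix \<omega> assume \<omega>: "\<omega> \<in> space M" "\<epsilon> < \<bar>?I X \<omega>\<bar>" "\<not> \<delta> < V n \<omega>"
      have "Y i \<omega> = X i \<omega>" if "i < n" for i
        using V_mono[of "Suc i" n \<omega>] that \<omega>(3) by (simp add: Y_def)
      then have "?I Y \<omega> = ?I X \<omega>"
        by simp
      then show "\<epsilon>\<^sup>2 \<le> (?I Y \<omega>)\<^sup>2"
        using \<omega>(2) \<open>0 < \<epsilon>\<close> by (simp add: abs_le_square_iff[symmetric])
    qed
  qed measurable
  also have "\<dots> \<le> prob {\<omega> \<in> space M. \<epsilon>\<^sup>2 \<le> (?I Y \<omega>)\<^sup>2} + prob {\<omega> \<in> space M. \<delta> < V n \<omega>}"
    by (rule measure_subadditive) auto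
  also have "prob {\<omega> \<in> space M. \<epsilon>\<^sup>2 \<le> (?I Y \<omega>)\<^sup>2} \<le> (\<integral>\<omega>. (?I Y \<omega>)\<^sup>2 \<partial>M) / \<epsilon>\<^sup>2"
    by (rule integral_Markov_inequality_measure[OF int sets.empty_sets]) (use \<open>0 < \<epsilon>\<close> in auto)
  also have "\<dots> \<le> \<delta> / \<epsilon>\<^sup>2"
    using second by (intro divide_right_mono) auto
  finally show ?thesis
    by (simp add: V_def)
qed

end

section \<open>Ito integrals as limits of Riemann sums\<close>

lemma finite_set_enumeration:
  fixes P :: "real set"
  assumes "finite P" "P \<noteq> {}"
  obtains q :: "nat \<Rightarrow> real" and N where "\<forall>j<N. q j < q (Suc j)" "q ` {..N} = P"
proof
  define xs where "xs = sorted_list_of_set P"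
  have xs: "set xs = P" "sorted_wrt (<) xs" "xs \<noteq> []"
    using assms by (auto simp: xs_def)
  show "\<forall>j<length xs - 1. xs ! j < xs ! Suc j"
    using xs(2) by (auto simp: sorted_wrt_iff_nth_less)
  have "{..length xs - 1} = {..<length xs}"
    using xs(3) by (cases xs) auto
  then show "(!) xs ` {..length xs - 1} = P"
    using xs(1) by (auto simp: set_conv_nth)
qed

lemma strict_chain_less_iff:
  fixes q :: "nat \<Rightarrow> real"
  assumes "\<forall>j<N. q j < q (Suc j)" "i \<le> N" "j \<le> N"
  shows "q i < q j \<longleftrightarrow> i < j"
proof -
  have *: "q i < q j" if "i < j" "j \<le> N" for i j
    using that
  proof (induction j)
    case (Suc j)
    have "q j < q (Suc j)"
      using assms(1) Suc.prems by simp
    moreover have "q i \<le> q j"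
      using Suc.IH Suc.prems by (cases "i = j") auto
    ultimately show ?case by simp
  qed simp
  show ?thesis
  proof
    assume "q i < q j"
    then show "i < j"
      using *[of j i] assms(2) by (cases i j rule: linorder_cases) auto
  qed (use * assms(3) in simp)
qed

lemma strict_chain_le_iff:
  fixes q :: "nat \<Rightarrow> real"
  assumes "\<forall>j<N. q j < q (Suc j)" "i \<le> N" "j \<le> N"
  shows "q i \<le> q j \<longleftrightarrow> i \<le> j"
  using strict_chain_less_iff[of N q j i, OF assms(1) assms(3,2)] by (simp add: not_less[symmetric])

lemma sum_telescope_between:
  fixes q :: "nat \<Rightarrow> real" and f :: "real \<Rightarrow> real"
  assumes q: "\<forall>j<N. q j < q (Suc j)" and "a \<le> b" "b \<le> N"
  shows "(\<Sum>j<N. indicator {q a<..q b} (q (Suc j)) * (f (q (Suc j)) - f (q j))) = f (q b) - f (q a)"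
proof -
  have "(\<Sum>j<N. indicator {q a<..q b} (q (Suc j)) * (f (q (Suc j)) - f (q j))) =
      (\<Sum>j<N. if j \<in> {a..<b} then f (q (Suc j)) - f (q j) else 0)"
  proof (rule sum.cong)
    fix j assume "j \<in> {..<N}"
    then have "q a < q (Suc j) \<longleftrightarrow> a \<le> j" "q (Suc j) \<le> q b \<longleftrightarrow> j < b"
      using strict_chain_less_iff[OF q, of a "Suc j"] strict_chain_le_iff[OF q, of "Suc j" b] assms by auto
    then show "indicator {q a<..q b} (q (Suc j)) * (f (q (Suc j)) - f (q j)) =
        (if j \<in> {a..<b} then f (q (Suc j)) - f (q j) else 0)"
      by (auto simp: indicator_def)
  qed simp
  also have "\<dots> = (\<Sum>j\<in>{a..<b}. f (q (Suc j)) - f (q j))"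
    using assms by (subst sum.inter_restrict[symmetric]) (auto intro!: sum.cong)
  also have "\<dots> = f (q b) - f (q a)"
    using sum_Suc_diff'[OF assms(2), of "\<lambda>j. f (q j)"] by simp
  finally show ?thesis .
qed

text \<open>Integrals with different partitions can be subtracted only on a common grid. The cells
  of a simple process are open on the left and closed on the right, so its value on the cell from
  \<open>q j\<close> to \<open>q (Suc j)\<close> is the value at the right endpoint.\<close>

lemma simple_ito_integral_refine:
  assumes q: "\<forall>j<N. q j < q (Suc j)" and T: "q N = T"
    and t: "\<And>i. i < n \<Longrightarrow> t i \<le> t (Suc i)"
    and sub: "\<And>i. i \<le> n \<Longrightarrow> min (t i) T \<in> q ` {..N}"
  shows "simple_ito_integral W n t \<xi> T \<omega> =
    (\<Sum>j<N. simple_process n t \<xi> (q (Suc j)) \<omega> * (W (q (Suc j)) \<omega> - W (q j) \<omega>))"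
proof -
  have "(\<Sum>j<N. simple_process n t \<xi> (q (Suc j)) \<omega> * (W (q (Suc j)) \<omega> - W (q j) \<omega>)) =
     (\<Sum>i<n. \<xi> i \<omega> * (\<Sum>j<N. indicator {t i<..t (Suc i)} (q (Suc j)) * (W (q (Suc j)) \<omega> - W (q j) \<omega>)))"
    unfolding simple_process_def sum_distrib_right sum_distrib_left
    by (subst sum.swap) (simp add: mult.assoc)
  also have "\<dots> = (\<Sum>i<n. \<xi> i \<omega> * (W (min (t (Suc i)) T) \<omega> - W (min (t i) T) \<omega>))"
  proof (rule sum.cong)
    fix i assume "i \<in> {..<n}"
    then have i: "i < n" by simp
    from sub[of i] i obtain a where a: "a \<le> N" "min (t i) T = q a" by auto
    from sub[of "Suc i"] i obtain b where b: "b \<le> N" "min (t (Suc i)) T = q b" by auto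
    have "q a \<le> q b"
      using t[OF i] a b by (metis min.mono order_refl)
    then have ab: "a \<le> b"
      using strict_chain_le_iff[OF q, of a b] a b by simp
    have "indicator {t i<..t (Suc i)} (q (Suc j)) = (indicator {q a<..q b} (q (Suc j)) :: real)" if "j < N" for j
    proof -
      have "q (Suc j) \<le> T"
        using strict_chain_le_iff[OF q, of "Suc j" N] that T by simp
      then show ?thesis
        using a(2) b(2) by (auto simp: indicator_def min_def split: if_splits)
    qed
    then have "(\<Sum>j<N. indicator {t i<..t (Suc i)} (q (Suc j)) * (W (q (Suc j)) \<omega> - W (q j) \<omega>)) =
        (\<Sum>j<N. indicator {q a<..q b} (q (Suc j)) * (W (q (Suc j)) \<omega> - W (q j) \<omega>))"
      by simp
    also have "\<dots> = W (q b) \<omega> - W (q a) \<omega>"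
      by (rule sum_telescope_between[OF q ab b(1), of "\<lambda>s. W s \<omega>"])
    finally show "\<xi> i \<omega> * (\<Sum>j<N. indicator {t i<..t (Suc i)} (q (Suc j)) * (W (q (Suc j)) \<omega> - W (q j) \<omega>)) =
        \<xi> i \<omega> * (W (min (t (Suc i)) T) \<omega> - W (min (t i) T) \<omega>)"
      by (simp add: a b)
  qed simp
  finally show ?thesis
    by (simp add: simple_ito_integral_def)
qed

lemma simple_process_refine_const:
  assumes q: "\<forall>j<N. q j < q (Suc j)" and T: "q N = T"
    and sub: "\<And>i. i \<le> n \<Longrightarrow> min (t i) T \<in> q ` {..N}"
    and j: "j < N" and s: "s \<in> {q j<..q (Suc j)}"
  shows "simple_process n t \<xi> s \<omega> = simple_process n t \<xi> (q (Suc j)) \<omega>"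
proof -
  have le: "q (Suc j) \<le> T"
    using strict_chain_le_iff[OF q, of "Suc j" N] j T by simp
  have *: "t i < s \<longleftrightarrow> t i < q (Suc j)" "s \<le> t i \<longleftrightarrow> q (Suc j) \<le> t i" if "i \<le> n" for i
  proof -
    from sub[OF that] obtain a where a: "a \<le> N" "min (t i) T = q a" by auto
    have "q a < q (Suc j) \<longleftrightarrow> q a \<le> q j"
      using strict_chain_less_iff[OF q, of a "Suc j"] strict_chain_le_iff[OF q, of a j] a j by auto
    then show "t i < s \<longleftrightarrow> t i < q (Suc j)" "s \<le> t i \<longleftrightarrow> q (Suc j) \<le> t i"
      using s le a(2) by (auto simp: min_def split: if_splits)
  qed
  show ?thesis
    unfolding simple_process_def by (intro sum.cong) (auto simp: indicator_def *)
qed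

lemma sum_square_le_nn_integral:
  assumes q: "\<forall>j<N. q j < q (Suc j)" and "q 0 = 0" "q N = T"
    and const: "\<And>j s. j < N \<Longrightarrow> s \<in> {q j<..q (Suc j)} \<Longrightarrow> S s = S (q (Suc j))"
  shows "ennreal (\<Sum>j<N. (S (q (Suc j)))\<^sup>2 * (q (Suc j) - q j)) \<le> (\<integral>\<^sup>+s\<in>{0..T}. ennreal ((S s)\<^sup>2) \<partial>lborel)"
proof -
  have "ennreal (\<Sum>j<N. (S (q (Suc j)))\<^sup>2 * (q (Suc j) - q j)) =
      (\<Sum>j<N. \<integral>\<^sup>+s. ennreal ((S (q (Suc j)))\<^sup>2) * indicator {q j<..q (Suc j)} s \<partial>lborel)"
    using q by (subst sum_ennreal[symmetric])
      (auto simp: nn_integral_cmult ennreal_mult[symmetric] less_imp_le intro!: sum.cong)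
  also have "\<dots> = (\<integral>\<^sup>+s. (\<Sum>j<N. ennreal ((S (q (Suc j)))\<^sup>2) * indicator {q j<..q (Suc j)} s) \<partial>lborel)"
    by (rule nn_integral_sum[symmetric]) measurable
  also have "\<dots> \<le> (\<integral>\<^sup>+s\<in>{0..T}. ennreal ((S s)\<^sup>2) \<partial>lborel)"
  proof (rule nn_integral_mono)
    fix s
    show "(\<Sum>j<N. ennreal ((S (q (Suc j)))\<^sup>2) * indicator {q j<..q (Suc j)} s) \<le> ennreal ((S s)\<^sup>2) * indicator {0..T} s"
    proof (cases "\<exists>j<N. s \<in> {q j<..q (Suc j)}")
      case True
      then obtain j where j: "j < N" "s \<in> {q j<..q (Suc j)}" by auto
      have unique: "i = j" if "i < N" "s \<in> {q i<..q (Suc i)}" for i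
      proof -
        have "q i < q (Suc j)" "q j < q (Suc i)"
          using that j by auto
        then show "i = j"
          using strict_chain_less_iff[OF q, of i "Suc j"] strict_chain_less_iff[OF q, of j "Suc i"] that j by auto
      qed
      have "(\<Sum>i<N. ennreal ((S (q (Suc i)))\<^sup>2) * indicator {q i<..q (Suc i)} s) =
          (\<Sum>i<N. if i = j then ennreal ((S (q (Suc j)))\<^sup>2) else 0)"
      proof (rule sum.cong)
        fix i assume "i \<in> {..<N}"
        then show "ennreal ((S (q (Suc i)))\<^sup>2) * indicator {q i<..q (Suc i)} s =
            (if i = j then ennreal ((S (q (Suc j)))\<^sup>2) else 0)"
          using unique[of i] j(2) by (cases "i = j") (auto simp: indicator_def)
      qed simp
      also have "\<dots> = ennreal ((S s)\<^sup>2)"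
        using const[OF j] j(1) by simp
      finally show ?thesis
        using j strict_chain_le_iff[OF q, of 0 j] strict_chain_le_iff[OF q, of "Suc j" N] assms(2,3)
        by (auto simp: indicator_def)
    next
      case False
      then have "(\<Sum>j<N. ennreal ((S (q (Suc j)))\<^sup>2) * indicator {q j<..q (Suc j)} s) = 0"
        by (intro sum.neutral) (auto simp: indicator_def)
      then show ?thesis by simp
    qed
  qed
  finally show ?thesis .
qed

section \<open>Convergence in probability\<close>

definition (in prob_space) tendsto_prob :: "(nat \<Rightarrow> 'a \<Rightarrow> real) \<Rightarrow> ('a \<Rightarrow> real) \<Rightarrow> bool" where
  "tendsto_prob Y X \<longleftrightarrow> (\<forall>\<epsilon>>0. (\<lambda>k. prob {\<omega> \<in> space M. \<epsilon> < \<bar>Y k \<omega> - X \<omega>\<bar>}) \<longlonglongrightarrow> 0)"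

lemma (in prob_space) prob_tendsto_0_of_AE_eventually:
  assumes "\<And>k. A k \<in> events" "AE \<omega> in M. \<forall>\<^sub>F k in sequentially. \<omega> \<notin> A k"
  shows "(\<lambda>k. prob (A k)) \<longlonglongrightarrow> 0"
proof -
  have "(\<lambda>k. \<integral>\<omega>. indicator (A k) \<omega> \<partial>M) \<longlonglongrightarrow> (\<integral>\<omega>. 0 \<partial>M :: real)"
  proof (rule integral_dominated_convergence)
    show "AE \<omega> in M. (\<lambda>k. indicator (A k) \<omega>) \<longlonglongrightarrow> (0::real)"
      using assms(2)
    proof eventually_elim
      case (elim \<omega>)
      then have "\<forall>\<^sub>F k in sequentially. indicator (A k) \<omega> = (0::real)"
        by eventually_elim simp
      then show ?case by (rule tendsto_eventually)
    qed
    show "integrable M (\<lambda>_. 1::real)" by simp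
  qed (use assms(1) in auto)
  then show ?thesis
    using assms(1) by simp
qed

lemma (in prob_space) tendsto_prob_of_AE:
  assumes [measurable]: "\<And>k. Y k \<in> borel_measurable M" "X \<in> borel_measurable M"
    and "AE \<omega> in M. (\<lambda>k. Y k \<omega>) \<longlonglongrightarrow> X \<omega>"
  shows "tendsto_prob Y X"
  unfolding tendsto_prob_def
proof (intro allI impI prob_tendsto_0_of_AE_eventually)
  fix \<epsilon> :: real assume "0 < \<epsilon>"
  show "AE \<omega> in M. \<forall>\<^sub>F k in sequentially. \<omega> \<notin> {\<omega> \<in> space M. \<epsilon> < \<bar>Y k \<omega> - X \<omega>\<bar>}"
    using assms(3)
  proof eventually_elim
    case (elim \<omega>)
    from tendstoD[OF this \<open>0 < \<epsilon>\<close>] show ?case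
      by eventually_elim (auto simp: dist_real_def)
  qed
qed measurable

lemma (in prob_space) tendsto_prob_of_square:
  assumes [measurable]: "\<And>k. Y k \<in> borel_measurable M" "X \<in> borel_measurable M"
    and int: "\<And>k. integrable M (\<lambda>\<omega>. (Y k \<omega> - X \<omega>)\<^sup>2)"
    and lim: "(\<lambda>k. \<integral>\<omega>. (Y k \<omega> - X \<omega>)\<^sup>2 \<partial>M) \<longlonglongrightarrow> 0"
  shows "tendsto_prob Y X"
  unfolding tendsto_prob_def
proof (intro allI impI)
  fix \<epsilon> :: real assume "0 < \<epsilon>"
  have "prob {\<omega> \<in> space M. \<epsilon> < \<bar>Y k \<omega> - X \<omega>\<bar>} \<le> (\<integral>\<omega>. (Y k \<omega> - X \<omega>)\<^sup>2 \<partial>M) / \<epsilon>\<^sup>2" for k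
  proof -
    have "prob {\<omega> \<in> space M. \<epsilon> < \<bar>Y k \<omega> - X \<omega>\<bar>} \<le> prob {\<omega> \<in> space M. \<epsilon>\<^sup>2 \<le> (Y k \<omega> - X \<omega>)\<^sup>2}"
      using \<open>0 < \<epsilon>\<close> by (intro finite_measure_mono) (auto simp: abs_le_square_iff[symmetric])
    also have "\<dots> \<le> (\<integral>\<omega>. (Y k \<omega> - X \<omega>)\<^sup>2 \<partial>M) / \<epsilon>\<^sup>2"
      by (rule integral_Markov_inequality_measure[OF int sets.empty_sets]) (use \<open>0 < \<epsilon>\<close> in auto)
    finally show ?thesis .
  qed
  moreover have "(\<lambda>k. (\<integral>\<omega>. (Y k \<omega> - X \<omega>)\<^sup>2 \<partial>M) / \<epsilon>\<^sup>2) \<longlonglongrightarrow> 0"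
    using tendsto_divide[OF lim tendsto_const[of "\<epsilon>\<^sup>2"]] \<open>0 < \<epsilon>\<close> by simp
  ultimately show "(\<lambda>k. prob {\<omega> \<in> space M. \<epsilon> < \<bar>Y k \<omega> - X \<omega>\<bar>}) \<longlonglongrightarrow> 0"
    by - (rule Lim_null_comparison[OF always_eventually], auto)
qed

lemma (in prob_space) tendsto_prob_add:
  assumes [measurable]: "\<And>k. Y k \<in> borel_measurable M" "X \<in> borel_measurable M"
    "\<And>k. Y' k \<in> borel_measurable M" "X' \<in> borel_measurable M"
    and lim: "tendsto_prob Y X" "tendsto_prob Y' X'"
  shows "tendsto_prob (\<lambda>k \<omega>. Y k \<omega> + Y' k \<omega>) (\<lambda>\<omega>. X \<omega> + X' \<omega>)"
  unfolding tendsto_prob_def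
proof (intro allI impI)
  fix \<epsilon> :: real assume "0 < \<epsilon>"
  have "prob {\<omega> \<in> space M. \<epsilon> < \<bar>Y k \<omega> + Y' k \<omega> - (X \<omega> + X' \<omega>)\<bar>} \<le>
      prob {\<omega> \<in> space M. \<epsilon> / 2 < \<bar>Y k \<omega> - X \<omega>\<bar>} + prob {\<omega> \<in> space M. \<epsilon> / 2 < \<bar>Y' k \<omega> - X' \<omega>\<bar>}" for k
  proof -
    have "prob {\<omega> \<in> space M. \<epsilon> < \<bar>Y k \<omega> + Y' k \<omega> - (X \<omega> + X' \<omega>)\<bar>} \<le>
        prob ({\<omega> \<in> space M. \<epsilon> / 2 < \<bar>Y k \<omega> - X \<omega>\<bar>} \<union> {\<omega> \<in> space M. \<epsilon> / 2 < \<bar>Y' k \<omega> - X' \<omega>\<bar>})"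
      by (intro finite_measure_mono subsetI) (auto simp: abs_if split: if_splits)
    also have "\<dots> \<le> prob {\<omega> \<in> space M. \<epsilon> / 2 < \<bar>Y k \<omega> - X \<omega>\<bar>} + prob {\<omega> \<in> space M. \<epsilon> / 2 < \<bar>Y' k \<omega> - X' \<omega>\<bar>}"
      by (intro measure_subadditive) auto
    finally show ?thesis .
  qed
  moreover have "(\<lambda>k. prob {\<omega> \<in> space M. \<epsilon> / 2 < \<bar>Y k \<omega> - X \<omega>\<bar>} + prob {\<omega> \<in> space M. \<epsilon> / 2 < \<bar>Y' k \<omega> - X' \<omega>\<bar>}) \<longlonglongrightarrow> 0"
    using tendsto_add[OF lim(1)[unfolded tendsto_prob_def, rule_format, of "\<epsilon> / 2"]
        lim(2)[unfolded tendsto_prob_def, rule_format, of "\<epsilon> / 2"]] \<open>0 < \<epsilon>\<close> by simp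
  ultimately show "(\<lambda>k. prob {\<omega> \<in> space M. \<epsilon> < \<bar>Y k \<omega> + Y' k \<omega> - (X \<omega> + X' \<omega>)\<bar>}) \<longlonglongrightarrow> 0"
    by - (rule Lim_null_comparison[OF always_eventually], auto)
qed

lemma (in prob_space) tendsto_prob_cmult:
  assumes "tendsto_prob Y X"
  shows "tendsto_prob (\<lambda>k \<omega>. c * Y k \<omega>) (\<lambda>\<omega>. c * X \<omega>)"
proof (cases "c = 0")
  case False
  have "\<epsilon> < \<bar>c * y - c * x\<bar> \<longleftrightarrow> \<epsilon> / \<bar>c\<bar> < \<bar>y - x\<bar>" for \<epsilon> x y
    using False by (simp add: right_diff_distrib[symmetric] abs_mult divide_less_eq mult.commute)
  then show ?thesis
    using assms False unfolding tendsto_prob_def by simp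
qed (simp add: tendsto_prob_def)

lemma borel_measurable_set_nn_integral_square:
  fixes f :: "real \<Rightarrow> 'a \<Rightarrow> real"
  assumes f: "(\<lambda>(s, \<omega>). f s \<omega>) \<in> borel_measurable (restrict_space borel {a..b} \<Otimes>\<^sub>M M)"
  shows "(\<lambda>\<omega>. \<integral>\<^sup>+s\<in>{a..b}. ennreal ((f s \<omega>)\<^sup>2) \<partial>lborel) \<in> borel_measurable M"
proof -
  let ?L = "restrict_space lborel {a..b}"
  interpret L: sigma_finite_measure ?L
    by (rule sigma_finite_measure_restrict_space) (auto intro: lborel.sigma_finite_measure_axioms)
  have sets: "sets (?L \<Otimes>\<^sub>M M) = sets (restrict_space borel {a..b} \<Otimes>\<^sub>M M)"
    by (intro sets_pair_measure_cong sets_restrict_space_cong) auto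
  have "(\<lambda>(s, \<omega>). f s \<omega>) \<in> borel_measurable (?L \<Otimes>\<^sub>M M)"
    using f by (simp add: measurable_cong_sets[OF sets refl])
  from measurable_compose[OF measurable_pair_swap'[of M ?L] this]
  have [measurable]: "(\<lambda>(\<omega>, s). f s \<omega>) \<in> borel_measurable (M \<Otimes>\<^sub>M ?L)"
    by (simp add: case_prod_beta)
  have "(\<lambda>\<omega>. \<integral>\<^sup>+s. ennreal ((f s \<omega>)\<^sup>2) \<partial>?L) \<in> borel_measurable M"
    by measurable
  then show ?thesis
    by (simp add: nn_integral_restrict_space)
qed

lemma simple_process_measurable_pair:
  assumes "\<And>i. i < n \<Longrightarrow> \<xi> i \<in> borel_measurable M"
  shows "(\<lambda>(s, \<omega>). simple_process n t \<xi> s \<omega>) \<in> borel_measurable (restrict_space borel A \<Otimes>\<^sub>M M)"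
proof -
  have "(\<lambda>x. \<xi> i (snd x) * indicator {t i<..t (Suc i)} (fst x)) \<in> borel_measurable (restrict_space borel A \<Otimes>\<^sub>M M)"
    if "i < n" for i
  proof (rule borel_measurable_times)
    show "(\<lambda>x. \<xi> i (snd x)) \<in> borel_measurable (restrict_space borel A \<Otimes>\<^sub>M M)"
      by (rule measurable_compose[OF measurable_snd assms[OF that]])
    have "indicator {t i<..t (Suc i)} \<in> borel_measurable (restrict_space borel A)"
      by (rule measurable_restrict_space1) simp
    from measurable_compose[OF measurable_fst this]
    show "(\<lambda>x. indicator {t i<..t (Suc i)} (fst x) :: real) \<in> borel_measurable (restrict_space borel A \<Otimes>\<^sub>M M)" .
  qed
  then show ?thesis
    unfolding simple_process_def case_prod_beta by (intro borel_measurable_sum) auto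
qed

section \<open>Step processes on the uniform grid\<close>

lemma step_process_eq:
  assumes "0 < T" "0 < m" "s \<in> {0<..T}"
  obtains i where "i < m" "s \<in> {real i * T / real m<..real (Suc i) * T / real m}"
    "\<And>\<xi> \<omega>. simple_process m (\<lambda>i. real i * T / real m) \<xi> s \<omega> = \<xi> i \<omega>"
proof -
  \<comment> \<open>The cells contain their right endpoint, hence the ceiling minus one in place of
    a floor.\<close>
  define i where "i = nat (\<lceil>s * m / T\<rceil> - 1)"
  have pos: "0 < s * m / T" and le: "s * m / T \<le> m"
    using assms by (auto simp: field_simps)
  have c: "1 \<le> \<lceil>s * m / T\<rceil>"
    using pos by linarith
  have "\<lceil>s * m / T\<rceil> \<le> int m"
    using le by (simp add: ceiling_le_iff)
  then have i: "i < m"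
    using c unfolding i_def by linarith
  have ri: "real i = real_of_int \<lceil>s * m / T\<rceil> - 1"
    using c by (simp add: i_def)
  have "real i < s * m / T" "s * m / T \<le> real (Suc i)"
    using ri by linarith+
  then have s: "s \<in> {real i * T / real m<..real (Suc i) * T / real m}"
    using assms by (simp add: field_simps)
  have "simple_process m (\<lambda>i. real i * T / real m) \<xi> s \<omega> = \<xi> i \<omega>" for \<xi> :: "nat \<Rightarrow> 'a \<Rightarrow> real" and \<omega>
  proof -
    have unique: "j = i" if "s \<in> {real j * T / real m<..real (Suc j) * T / real m}" for j
    proof -
      have "real j * T / real m < real (Suc i) * T / real m" "real i * T / real m < real (Suc j) * T / real m"
        using that s by (meson greaterThanAtMost_iff less_le_trans)+
      then have "real j < real (Suc i)" "real i < real (Suc j)"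
        using assms by (simp_all add: divide_less_cancel)
      then show "j = i" by simp
    qed
    have "simple_process m (\<lambda>i. real i * T / real m) \<xi> s \<omega> = (\<Sum>j<m. if j = i then \<xi> i \<omega> else 0)"
      unfolding simple_process_def
    proof (intro sum.cong refl)
      fix j
      show "\<xi> j \<omega> * indicator {real j * T / real m<..real (Suc j) * T / real m} s = (if j = i then \<xi> i \<omega> else 0)"
        using unique[of j] s by (cases "j = i") (simp_all only: indicator_simps mult_1_right mult_zero_right if_True if_False, auto simp: indicator_def)
    qed
    then show ?thesis using i by simp
  qed
  with i s show ?thesis by (rule that)
qed

lemma step_process_uniform_error:
  assumes T: "0 < T" and cont: "continuous_on {0..T} (\<lambda>s. H s \<omega>)" and "0 < e"
  shows "\<forall>\<^sub>F m in sequentially. \<forall>s\<in>{0<..T}.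
    \<bar>H s \<omega> - simple_process m (\<lambda>i. real i * T / real m) (\<lambda>i. H (real i * T / real m)) s \<omega>\<bar> \<le> e"
proof -
  have "uniformly_continuous_on {0..T} (\<lambda>s. H s \<omega>)"
    using cont by (rule compact_uniformly_continuous) simp
  then obtain d where d: "0 < d" "\<And>s s'. s \<in> {0..T} \<Longrightarrow> s' \<in> {0..T} \<Longrightarrow> dist s' s < d \<Longrightarrow> dist (H s' \<omega>) (H s \<omega>) < e"
    using \<open>0 < e\<close> unfolding uniformly_continuous_on_def by metis
  have "(\<lambda>m. T / real m) \<longlonglongrightarrow> 0"
    by real_asymp
  from order_tendstoD(2)[OF this d(1)] have "\<forall>\<^sub>F m in sequentially. T / real m < d \<and> 0 < m"
    using eventually_gt_at_top[of 0] by eventually_elim simp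
  then show ?thesis
  proof eventually_elim
    case (elim m)
    let ?G = "\<lambda>s. simple_process m (\<lambda>i. real i * T / real m) (\<lambda>i. H (real i * T / real m)) s \<omega>"
    have "\<bar>H s \<omega> - ?G s\<bar> \<le> e" if "s \<in> {0<..T}" for s
    proof -
      from elim have "0 < m" by simp
      from step_process_eq[OF T this \<open>s \<in> {0<..T}\<close>] obtain i where i: "i < m"
        "s \<in> {real i * T / real m<..real (Suc i) * T / real m}" "?G s = H (real i * T / real m) \<omega>"
        by metis
      have "0 \<le> real i * T / real m" using T by simp
      moreover have "s - real i * T / real m \<le> T / real m"
        using i(2) by (simp add: field_simps add_divide_distrib)
      ultimately have "dist (H s \<omega>) (H (real i * T / real m) \<omega>) < e"
        using that i(2) elim by (intro d(2)) (auto simp: dist_real_def)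
      then show ?thesis
        using i(3) by (simp add: dist_real_def)
    qed
    then show ?case by blast
  qed
qed

lemma step_process_square_error:
  assumes T: "0 < T" and cont: "continuous_on {0..T} (\<lambda>s. H s \<omega>)" and "0 < \<delta>"
  shows "\<forall>\<^sub>F m in sequentially.
    (\<integral>\<^sup>+s\<in>{0..T}. ennreal ((H s \<omega> - simple_process m (\<lambda>i. real i * T / real m) (\<lambda>i. H (real i * T / real m)) s \<omega>)\<^sup>2) \<partial>lborel)
      \<le> ennreal \<delta>"
proof -
  \<comment> \<open>Chosen so that a uniform error \<open>e\<close> on an interval of length
    \<open>T\<close> has square integral \<delta>.\<close>
  define e where "e = sqrt (\<delta> / T)"
  have e: "0 < e" "e\<^sup>2 * T = \<delta>"
    using assms by (auto simp: e_def)
  from step_process_uniform_error[OF T, where H = H and \<omega> = \<omega>, OF cont e(1)] show ?thesis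
  proof eventually_elim
    case (elim m)
    let ?G = "\<lambda>s. simple_process m (\<lambda>i. real i * T / real m) (\<lambda>i. H (real i * T / real m)) s \<omega>"
    have "(\<integral>\<^sup>+s\<in>{0..T}. ennreal ((H s \<omega> - ?G s)\<^sup>2) \<partial>lborel) \<le> (\<integral>\<^sup>+s. ennreal (e\<^sup>2) * indicator {0..T} s \<partial>lborel)"
    proof (rule nn_integral_mono_AE)
      \<comment> \<open>At time 0 the step process is 0, because its first cell is open on the left;
        a single point does not affect the integral.\<close>
      show "AE s in lborel. ennreal ((H s \<omega> - ?G s)\<^sup>2) * indicator {0..T} s \<le> ennreal (e\<^sup>2) * indicator {0..T} s"
        using AE_lborel_singleton[of 0]
      proof eventually_elim
        fix s :: real assume "s \<noteq> 0"
        then show "ennreal ((H s \<omega> - ?G s)\<^sup>2) * indicator {0..T} s \<le> ennreal (e\<^sup>2) * indicator {0..T} s"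
          using bspec[OF elim, of s] e(1) by (auto simp: indicator_def intro!: ennreal_leI simp: abs_le_square_iff[symmetric])
      qed
    qed
    also have "\<dots> = ennreal \<delta>"
      using T e by (simp add: nn_integral_cmult ennreal_mult[symmetric])
    finally show ?case .
  qed
qed

lemma riemann_sums_tendsto_integral:
  fixes f :: "real \<Rightarrow> real"
  assumes T: "0 < T" and cont: "continuous_on {0..T} f"
  shows "(\<lambda>m. \<Sum>i<m. f (real i * T / real m) * (T / real m)) \<longlonglongrightarrow> (LBINT t:{0..T}. f t)"
proof -
  \<comment> \<open>A deterministic integrand is a step process over the one-point sample space
    \<open>unit\<close>, so the uniform error estimate applies to it.\<close>
  define G where "G m s = simple_process m (\<lambda>i. real i * T / real m) (\<lambda>i (_::unit). f (real i * T / real m)) s ()" for m s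
  have "bounded (f ` {0..T})"
    by (intro compact_imp_bounded compact_continuous_image cont) simp
  then obtain c where "\<forall>x\<in>f ` {0..T}. norm x \<le> c"
    unfolding bounded_iff by blast
  then have c: "\<bar>f s\<bar> \<le> c" if "s \<in> {0..T}" for s
    using that by auto
  have G_bound: "\<bar>G m s\<bar> \<le> c" if "s \<in> {0<..T}" for m s
  proof (cases "m = 0")
    case True
    then show ?thesis using c[of 0] T by (simp add: G_def simple_process_def)
  next
    case False
    then have "0 < m" by simp
    from step_process_eq[OF T this that] obtain i where i: "i < m" "G m s = f (real i * T / real m)"
      unfolding G_def by metis
    have "real i * T / real m \<in> {0..T}"
      using i(1) T by (auto simp: field_simps)
    then show ?thesis using c i(2) by simp
  qed
  have lim: "(\<lambda>m. \<integral>s. indicator {0..T} s *\<^sub>R G m s \<partial>lborel) \<longlonglongrightarrow> (\<integral>s. indicator {0..T} s *\<^sub>R f s \<partial>lborel)"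
  proof (rule integral_dominated_convergence[where w = "\<lambda>s. c * indicator {0..T} s"])
    show "(\<lambda>s. indicator {0..T} s *\<^sub>R f s) \<in> borel_measurable lborel"
      using borel_measurable_continuous_on_indicator[OF _ cont] by simp
    show "(\<lambda>s. indicator {0..T} s *\<^sub>R G m s) \<in> borel_measurable lborel" for m
      unfolding G_def simple_process_def by measurable
    show "AE s in lborel. norm (indicator {0..T} s *\<^sub>R G m s) \<le> c * indicator {0..T} s" for m
      using AE_lborel_singleton[of 0] by eventually_elim (use G_bound in \<open>auto simp: indicator_def\<close>)
    show "AE s in lborel. (\<lambda>m. indicator {0..T} s *\<^sub>R G m s) \<longlonglongrightarrow> indicator {0..T} s *\<^sub>R f s"
      using AE_lborel_singleton[of 0]
    proof eventually_elim
      fix s :: real assume "s \<noteq> 0"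
      show "(\<lambda>m. indicator {0..T} s *\<^sub>R G m s) \<longlonglongrightarrow> indicator {0..T} s *\<^sub>R f s"
      proof (cases "s \<in> {0..T}")
        case True
        have "(\<lambda>m. G m s) \<longlonglongrightarrow> f s"
        proof (rule LIMSEQ_I, unfold eventually_sequentially[symmetric])
          fix e :: real assume "0 < e"
          then have "0 < e / 2" by simp
          from step_process_uniform_error[OF T, where H = "\<lambda>s _. f s" and \<omega> = "()", OF cont this]
          show "\<forall>\<^sub>F m in sequentially. norm (G m s - f s) < e"
          proof eventually_elim
            case (elim m)
            then have "\<bar>f s - G m s\<bar> \<le> e / 2"
              using True \<open>s \<noteq> 0\<close> by (auto simp: G_def)
            then show ?case using \<open>0 < e\<close> by (simp add: abs_minus_commute)
          qed
        qed
        then show ?thesis using True by simp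
      qed simp
    qed
    show "integrable lborel (\<lambda>s. c * indicator {0..T} s)"
      using T by (intro integrable_mult_right integrable_real_indicator) auto
  qed
  have "(\<integral>s. indicator {0..T} s *\<^sub>R G m s \<partial>lborel) = (\<Sum>i<m. f (real i * T / real m) * (T / real m))" for m
  proof -
    have "(\<integral>s. indicator {0..T} s *\<^sub>R G m s \<partial>lborel) =
        (\<integral>s. (\<Sum>i<m. f (real i * T / real m) * indicator {real i * T / real m<..real (Suc i) * T / real m} s) \<partial>lborel)"
    proof (rule Bochner_Integration.integral_cong[OF refl])
      fix s
      have "indicator {0..T} s * (f (real i * T / real m) * indicator {real i * T / real m<..real (Suc i) * T / real m} s) =
          f (real i * T / real m) * indicator {real i * T / real m<..real (Suc i) * T / real m} s" if "i < m" for i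
      proof -
        have "0 \<le> real i * T / real m" "real (Suc i) * T / real m \<le> T"
          using T that by (auto simp: field_simps simp del: of_nat_Suc)
        then show ?thesis by (auto simp: indicator_def simp del: of_nat_Suc)
      qed
      then show "indicator {0..T} s *\<^sub>R G m s =
          (\<Sum>i<m. f (real i * T / real m) * indicator {real i * T / real m<..real (Suc i) * T / real m} s)"
        unfolding G_def simple_process_def real_scaleR_def sum_distrib_left by (intro sum.cong) auto
    qed
    also have "\<dots> = (\<Sum>i<m. f (real i * T / real m) * (T / real m))"
    proof -
      have "measure lborel {real i * T / real m<..real (Suc i) * T / real m} = T / real m" for i
        using T by (simp add: divide_right_mono add_divide_distrib[symmetric] diff_divide_distrib[symmetric] algebra_simps)
      moreover have "emeasure lborel {real i * T / real m<..real (Suc i) * T / real m} < \<top>" for i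
        using T by (subst emeasure_lborel_Ioc) (auto intro!: divide_right_mono)
      ultimately show ?thesis
        by (subst Bochner_Integration.integral_sum) (auto intro!: integrable_mult_right integrable_real_indicator simp del: of_nat_Suc)
    qed
    finally show ?thesis .
  qed
  with lim show ?thesis
    by (simp add: set_lebesgue_integral_def)
qed

context brownian_basis
begin

text \<open>The value is taken at the right end of a cell but is known at its left end: a
  coefficient active at \<open>q (Suc j)\<close> starts at a grid point strictly before
  \<open>q (Suc j)\<close>, hence at or before \<open>q j\<close>.\<close>

lemma simple_process_refine_adapted:
  assumes q: "\<forall>j<N. q j < q (Suc j)" and T: "q N = T"
    and sub: "\<And>i. i \<le> n \<Longrightarrow> min (t i) T \<in> q ` {..N}"
    and \<xi>: "\<And>i. i < n \<Longrightarrow> t i < T \<Longrightarrow> \<xi> i \<in> borel_measurable (\<F> (ennreal (t i)))"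
    and j: "j < N"
  shows "simple_process n t \<xi> (q (Suc j)) \<in> borel_measurable (\<F> (ennreal (q j)))"
proof -
  have "(\<lambda>\<omega>. \<xi> i \<omega> * indicator {t i<..t (Suc i)} (q (Suc j))) \<in> borel_measurable (\<F> (ennreal (q j)))"
    if "i < n" for i
  proof (cases "q (Suc j) \<in> {t i<..t (Suc i)}")
    case True
    have le: "q (Suc j) \<le> T"
      using strict_chain_le_iff[OF q, of "Suc j" N] j T by simp
    from sub[of i] \<open>i < n\<close> obtain a where a: "a \<le> N" "min (t i) T = q a" by auto
    have "t i = q a" using a(2) True le by auto
    then have "q a < q (Suc j)" using True by simp
    then have "a \<le> j"
      using strict_chain_less_iff[OF q, of a "Suc j"] a j by auto
    then have "t i \<le> q j"
      using strict_chain_le_iff[OF q, of a j] a j \<open>t i = q a\<close> by auto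
    then show ?thesis
      using True F_measurable_mono[OF \<xi>[OF that] ennreal_leI] le by simp
  qed simp
  then show ?thesis
    unfolding simple_process_def by (intro borel_measurable_sum) auto
qed

text \<open>The definition provides some approximating simple processes, whereas the later arguments
  need left endpoint sums of \<open>H\<close> itself. On a common refinement the difference of the
  two sums is an Ito sum whose coefficients are small in square integral, because both processes
  approximate \<open>H\<close>. As \<open>H\<close> may be unbounded, its step process need not
  satisfy \<open>is_simple_process\<close>.\<close>

lemma ito_integral_riemann_sums:
  assumes M: "M = completion M0" and ito: "has_ito_integral M0 \<F> W H T I" and T: "0 < T"
    and cont: "AE \<omega> in M. continuous_on {0..T} (\<lambda>s. H s \<omega>)"
  shows "tendsto_prob (\<lambda>m \<omega>. \<Sum>i<m. H (real i * T / real m) \<omega> *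
    (W (real (Suc i) * T / real m) \<omega> - W (real i * T / real m) \<omega>)) I"
proof -
  define g where "g m i = real i * T / real m" for m i
  define G where "G m = simple_process m (g m) (\<lambda>i. H (g m i))" for m
  define R where "R m \<omega> = (\<Sum>i<m. H (g m i) \<omega> * (W (g m (Suc i)) \<omega> - W (g m i) \<omega>))" for m \<omega>
  from ito obtain n t \<xi> where
    I [measurable]: "I \<in> borel_measurable M" and
    H: "\<And>s. s \<in> {0..T} \<Longrightarrow> H s \<in> borel_measurable (\<F> (ennreal s))" and
    H_pair: "(\<lambda>(s, \<omega>). H s \<omega>) \<in> borel_measurable (restrict_space borel {0..T} \<Otimes>\<^sub>M M)" and
    simple: "\<And>k. is_simple_process M0 \<F> (n k) (t k) (\<xi> k)" and
    van1: "vanishes_in_prob M0 (\<lambda>k \<omega>.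
          \<integral>\<^sup>+ s\<in>{0..T}. ennreal ((H s \<omega> - simple_process (n k) (t k) (\<xi> k) s \<omega>)\<^sup>2) \<partial>lborel)" and
    van2: "vanishes_in_prob M0 (\<lambda>k \<omega>.
          ennreal \<bar>simple_ito_integral W (n k) (t k) (\<xi> k) T \<omega> - I \<omega>\<bar>)"
    unfolding has_ito_integral_def M by blast
  define S where "S k = simple_process (n k) (t k) (\<xi> k)" for k
  define J where "J k = simple_ito_integral W (n k) (t k) (\<xi> k) T" for k
  have space_M0: "space M0 = space M"
    by (simp add: M)
  have t_mono: "t k i \<le> t k (Suc i)" if "i < n k" for k i
    using simple[of k] that by (simp add: is_simple_process_def)
  have t_nonneg: "0 \<le> t k i" if "i \<le> n k" for k i
    using that
  proof (induction i)
    case 0 then show ?case using simple[of k] by (simp add: is_simple_process_def)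
  next
    case (Suc i) then show ?case using t_mono[of i k] by simp
  qed
  have \<xi>: "\<xi> k i \<in> borel_measurable (\<F> (ennreal (t k i)))" if "i < n k" for k i
    using simple[of k] that by (simp add: is_simple_process_def)
  have g_mem: "g m i \<in> {0..T}" if "i \<le> m" for m i
    using that T by (cases "m = 0") (auto simp: g_def field_simps)
  have g_mono: "g m i \<le> g m (Suc i)" for m i
    unfolding g_def using T by (intro divide_right_mono mult_right_mono) auto
  have [measurable]: "J k \<in> borel_measurable M" for k
    unfolding J_def simple_ito_integral_def
    by (intro borel_measurable_sum borel_measurable_times borel_measurable_diff W_borel F_measurable[OF \<xi>])
      (use T t_nonneg in \<open>auto simp: less_imp_le\<close>)
  have R_meas [measurable]: "R m \<in> borel_measurable M" for m
    unfolding R_def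
    by (intro borel_measurable_sum borel_measurable_times borel_measurable_diff W_borel F_measurable[OF H])
      (use g_mem[of _ m] in auto)
  have E1: "(\<lambda>\<omega>. \<integral>\<^sup>+ s\<in>{0..T}. ennreal ((H s \<omega> - S k s \<omega>)\<^sup>2) \<partial>lborel) \<in> borel_measurable M" for k
  proof (rule borel_measurable_set_nn_integral_square)
    have "(\<lambda>(s, \<omega>). S k s \<omega>) \<in> borel_measurable (restrict_space borel {0..T} \<Otimes>\<^sub>M M)"
      unfolding S_def by (intro simple_process_measurable_pair F_measurable[OF \<xi>])
    then show "(\<lambda>(s, \<omega>). H s \<omega> - S k s \<omega>) \<in> borel_measurable (restrict_space borel {0..T} \<Otimes>\<^sub>M M)"
      using borel_measurable_diff[OF H_pair] by (simp add: case_prod_beta)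
  qed
  have E2: "(\<lambda>\<omega>. \<integral>\<^sup>+ s\<in>{0..T}. ennreal ((H s \<omega> - G m s \<omega>)\<^sup>2) \<partial>lborel) \<in> borel_measurable M" for m
  proof (rule borel_measurable_set_nn_integral_square)
    have "(\<lambda>(s, \<omega>). G m s \<omega>) \<in> borel_measurable (restrict_space borel {0..T} \<Otimes>\<^sub>M M)"
      unfolding G_def by (intro simple_process_measurable_pair F_measurable[OF H]) (use g_mem[of _ m] in auto)
    then show "(\<lambda>(s, \<omega>). H s \<omega> - G m s \<omega>) \<in> borel_measurable (restrict_space borel {0..T} \<Otimes>\<^sub>M M)"
      using borel_measurable_diff[OF H_pair] by (simp add: case_prod_beta)
  qed
  note [measurable] = E1 E2
  \<comment> \<open>The factor 4 comes from
    \<open>(x - y)\<^sup>2 \<le> 2 * x\<^sup>2 + 2 * y\<^sup>2\<close>, applied to two square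
    integrals of at most \<delta>.\<close>
  have key: "prob {\<omega> \<in> space M. \<epsilon> < \<bar>J k \<omega> - R m \<omega>\<bar>} \<le> 4 * \<delta> / \<epsilon>\<^sup>2 +
      (prob {\<omega> \<in> space M. ennreal \<delta> < (\<integral>\<^sup>+ s\<in>{0..T}. ennreal ((H s \<omega> - S k s \<omega>)\<^sup>2) \<partial>lborel)} +
       prob {\<omega> \<in> space M. ennreal \<delta> < (\<integral>\<^sup>+ s\<in>{0..T}. ennreal ((H s \<omega> - G m s \<omega>)\<^sup>2) \<partial>lborel)})"
    if "0 < \<epsilon>" "0 < \<delta>" for k m \<epsilon> \<delta>
  proof -
    \<comment> \<open>The common refinement. Partition points of the simple process beyond
      \<open>T\<close> are moved to \<open>T\<close>, in agreement with the \<open>min\<close> in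
      \<open>simple_ito_integral\<close>.\<close>
    define P where "P = {0, T} \<union> (\<lambda>i. min (t k i) T) ` {..n k} \<union> g m ` {..m}"
    obtain q :: "nat \<Rightarrow> real" and N where q: "\<forall>j<N. q j < q (Suc j)" and qP: "q ` {..N} = P"
      by (rule finite_set_enumeration[of P]) (auto simp: P_def)
    have P_sub: "P \<subseteq> {0..T}"
      using T t_nonneg g_mem[of _ m] by (auto simp: P_def)
    have q0: "q 0 = 0"
    proof -
      have "0 \<in> q ` {..N}" by (simp add: qP P_def)
      then obtain a where "a \<le> N" "q a = 0" by auto
      moreover have "q 0 \<in> {0..T}" using qP P_sub by auto
      ultimately show ?thesis
        using strict_chain_le_iff[OF q, of 0 a] by auto
    qed
    have qN: "q N = T"
    proof -
      have "T \<in> q ` {..N}" by (simp add: qP P_def)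
      then obtain a where "a \<le> N" "q a = T" by auto
      moreover have "q N \<in> {0..T}" using qP P_sub by auto
      ultimately show ?thesis
        using strict_chain_le_iff[OF q, of a N] by auto
    qed
    have sub_t: "min (t k i) T \<in> q ` {..N}" if "i \<le> n k" for i
      using that by (simp add: qP P_def)
    have sub_g: "min (g m i) T \<in> q ` {..N}" if "i \<le> m" for i
      using that g_mem[OF that] by (simp add: qP P_def min_absorb1)
    define X where "X j \<omega> = S k (q (Suc j)) \<omega> - G m (q (Suc j)) \<omega>" for j \<omega>
    have X: "X j \<in> borel_measurable (\<F> (ennreal (q j)))" if "j < N" for j
      unfolding X_def S_def G_def
      by (intro borel_measurable_diff simple_process_refine_adapted[OF q qN] sub_t sub_g \<xi> H g_mem that) auto
    have "R m \<omega> = simple_ito_integral W m (g m) (\<lambda>i. H (g m i)) T \<omega>" for \<omega>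
      unfolding R_def simple_ito_integral_def
      by (intro sum.cong refl) (use g_mem[of _ m] in \<open>simp add: min_absorb1\<close>)
    also have "\<dots> \<omega> = (\<Sum>j<N. G m (q (Suc j)) \<omega> * (W (q (Suc j)) \<omega> - W (q j) \<omega>))" for \<omega>
      unfolding G_def by (rule simple_ito_integral_refine[OF q qN]) (use g_mono sub_g in blast)+
    finally have R_eq: "R m \<omega> = (\<Sum>j<N. G m (q (Suc j)) \<omega> * (W (q (Suc j)) \<omega> - W (q j) \<omega>))" for \<omega> .
    have J_eq: "J k \<omega> = (\<Sum>j<N. S k (q (Suc j)) \<omega> * (W (q (Suc j)) \<omega> - W (q j) \<omega>))" for \<omega>
      unfolding S_def J_def by (rule simple_ito_integral_refine[OF q qN]) (use t_mono sub_t in blast)+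
    have JR: "J k \<omega> - R m \<omega> = (\<Sum>j<N. X j \<omega> * (W (q (Suc j)) \<omega> - W (q j) \<omega>))" for \<omega>
      by (simp add: R_eq J_eq X_def sum_subtractf[symmetric] left_diff_distrib)
    have "prob {\<omega> \<in> space M. \<epsilon> < \<bar>J k \<omega> - R m \<omega>\<bar>} \<le>
        4 * \<delta> / \<epsilon>\<^sup>2 + prob {\<omega> \<in> space M. 4 * \<delta> < (\<Sum>j<N. (X j \<omega>)\<^sup>2 * (q (Suc j) - q j))}"
      unfolding JR by (rule ito_sum_prob_bound) (use q q0 X that in auto)
    also have "prob {\<omega> \<in> space M. 4 * \<delta> < (\<Sum>j<N. (X j \<omega>)\<^sup>2 * (q (Suc j) - q j))} \<le>
      prob ({\<omega> \<in> space M. ennreal \<delta> < (\<integral>\<^sup>+ s\<in>{0..T}. ennreal ((H s \<omega> - S k s \<omega>)\<^sup>2) \<partial>lborel)} \<union>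
       {\<omega> \<in> space M. ennreal \<delta> < (\<integral>\<^sup>+ s\<in>{0..T}. ennreal ((H s \<omega> - G m s \<omega>)\<^sup>2) \<partial>lborel)})"
    proof (rule finite_measure_mono)
      show "{\<omega> \<in> space M. 4 * \<delta> < (\<Sum>j<N. (X j \<omega>)\<^sup>2 * (q (Suc j) - q j))} \<subseteq>
        {\<omega> \<in> space M. ennreal \<delta> < (\<integral>\<^sup>+ s\<in>{0..T}. ennreal ((H s \<omega> - S k s \<omega>)\<^sup>2) \<partial>lborel)} \<union>
        {\<omega> \<in> space M. ennreal \<delta> < (\<integral>\<^sup>+ s\<in>{0..T}. ennreal ((H s \<omega> - G m s \<omega>)\<^sup>2) \<partial>lborel)}"
      proof (rule subsetI, rule ccontr)
        fix \<omega> assume "\<omega> \<in> {\<omega> \<in> space M. 4 * \<delta> < (\<Sum>j<N. (X j \<omega>)\<^sup>2 * (q (Suc j) - q j))}"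
          and "\<omega> \<notin> {\<omega> \<in> space M. ennreal \<delta> < (\<integral>\<^sup>+ s\<in>{0..T}. ennreal ((H s \<omega> - S k s \<omega>)\<^sup>2) \<partial>lborel)} \<union>
            {\<omega> \<in> space M. ennreal \<delta> < (\<integral>\<^sup>+ s\<in>{0..T}. ennreal ((H s \<omega> - G m s \<omega>)\<^sup>2) \<partial>lborel)}"
        then have \<omega>: "\<omega> \<in> space M" and big: "4 * \<delta> < (\<Sum>j<N. (X j \<omega>)\<^sup>2 * (q (Suc j) - q j))"
          and small: "(\<integral>\<^sup>+ s\<in>{0..T}. ennreal ((H s \<omega> - S k s \<omega>)\<^sup>2) \<partial>lborel) \<le> ennreal \<delta>"
            "(\<integral>\<^sup>+ s\<in>{0..T}. ennreal ((H s \<omega> - G m s \<omega>)\<^sup>2) \<partial>lborel) \<le> ennreal \<delta>"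
          by (auto simp: not_less)
        have "(\<lambda>s. H s \<omega>) \<in> borel_measurable (restrict_space borel {0..T})"
          using measurable_compose[OF measurable_Pair2'[OF \<omega>] H_pair] by simp
        then have Hm: "(\<lambda>s. H s \<omega> * indicator {0..T} s) \<in> borel_measurable borel"
          by (subst (asm) borel_measurable_restrict_space_iff) (auto simp: mult.commute)
        have Sm [measurable]: "(\<lambda>s. S k s \<omega>) \<in> borel_measurable borel" "(\<lambda>s. G m s \<omega>) \<in> borel_measurable borel"
          unfolding S_def G_def simple_process_def by measurable
        \<comment> \<open>The section of \<open>H\<close> is measurable only on the interval up to
          \<open>T\<close>; extended by 0 it is Borel on the line.\<close>
        define Hi where "Hi s = H s \<omega> * indicator {0..T} s" for s
        have [measurable]: "Hi \<in> borel_measurable borel"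
          using Hm by (simp add: Hi_def[abs_def])
        have ind: "ennreal ((H s \<omega> - L s)\<^sup>2) * indicator {0..T} s =
            ennreal ((Hi s - L s)\<^sup>2) * indicator {0..T} s" for s and L :: "real \<Rightarrow> real"
          by (simp add: indicator_def Hi_def)
        have Em: "(\<lambda>s. ennreal ((H s \<omega> - S k s \<omega>)\<^sup>2) * indicator {0..T} s) \<in> borel_measurable borel"
          "(\<lambda>s. ennreal ((H s \<omega> - G m s \<omega>)\<^sup>2) * indicator {0..T} s) \<in> borel_measurable borel"
          unfolding ind[of _ "\<lambda>s. S k s \<omega>"] ind[of _ "\<lambda>s. G m s \<omega>"] by measurable
        have "ennreal (\<Sum>j<N. (X j \<omega>)\<^sup>2 * (q (Suc j) - q j)) \<le>
            (\<integral>\<^sup>+ s\<in>{0..T}. ennreal ((S k s \<omega> - G m s \<omega>)\<^sup>2) \<partial>lborel)"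
          unfolding X_def
        proof (rule sum_square_le_nn_integral[OF q q0 qN])
          fix j s assume "j < N" "s \<in> {q j<..q (Suc j)}"
          then show "S k s \<omega> - G m s \<omega> = S k (q (Suc j)) \<omega> - G m (q (Suc j)) \<omega>"
            unfolding S_def G_def
            using simple_process_refine_const[OF q qN, of "n k" "t k" j s "\<xi> k" \<omega>] sub_t
              simple_process_refine_const[OF q qN, of m "g m" j s "\<lambda>i. H (g m i)" \<omega>] sub_g by auto
        qed
        also have "\<dots> \<le> (\<integral>\<^sup>+ s. 2 * (ennreal ((H s \<omega> - S k s \<omega>)\<^sup>2) * indicator {0..T} s) +
            2 * (ennreal ((H s \<omega> - G m s \<omega>)\<^sup>2) * indicator {0..T} s) \<partial>lborel)"
        proof (rule nn_integral_mono)
          fix s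
          have "(S k s \<omega> - G m s \<omega>)\<^sup>2 \<le> 2 * (H s \<omega> - S k s \<omega>)\<^sup>2 + 2 * (H s \<omega> - G m s \<omega>)\<^sup>2"
            using sum_squares_bound[of "H s \<omega> - S k s \<omega>" "- (H s \<omega> - G m s \<omega>)"]
            by (simp add: power2_eq_square algebra_simps)
          then have "ennreal ((S k s \<omega> - G m s \<omega>)\<^sup>2) \<le> ennreal (2 * (H s \<omega> - S k s \<omega>)\<^sup>2 + 2 * (H s \<omega> - G m s \<omega>)\<^sup>2)"
            by (rule ennreal_leI)
          then show "ennreal ((S k s \<omega> - G m s \<omega>)\<^sup>2) * indicator {0..T} s \<le>
            2 * (ennreal ((H s \<omega> - S k s \<omega>)\<^sup>2) * indicator {0..T} s) +
            2 * (ennreal ((H s \<omega> - G m s \<omega>)\<^sup>2) * indicator {0..T} s)"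
            by (simp add: ennreal_plus ennreal_mult indicator_def)
        qed
        also have "\<dots> = 2 * (\<integral>\<^sup>+ s\<in>{0..T}. ennreal ((H s \<omega> - S k s \<omega>)\<^sup>2) \<partial>lborel) +
            2 * (\<integral>\<^sup>+ s\<in>{0..T}. ennreal ((H s \<omega> - G m s \<omega>)\<^sup>2) \<partial>lborel)"
          using borel_measurable_times_ennreal[OF borel_measurable_const Em(1), of 2]
            borel_measurable_times_ennreal[OF borel_measurable_const Em(2), of 2]
          by (subst nn_integral_add) (simp_all add: nn_integral_cmult Em)
        also have "\<dots> \<le> 2 * ennreal \<delta> + 2 * ennreal \<delta>"
          by (intro add_mono mult_left_mono small) auto
        also have "\<dots> = ennreal (4 * \<delta>)"
          using \<open>0 < \<delta>\<close> by (simp add: ennreal_mult ennreal_plus[symmetric] mult_2[symmetric] del: ennreal_plus)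
        finally show False
          using big \<open>0 < \<delta>\<close> by (simp add: ennreal_le_iff2)
      qed
    qed measurable
    also have "\<dots> \<le> prob {\<omega> \<in> space M. ennreal \<delta> < (\<integral>\<^sup>+ s\<in>{0..T}. ennreal ((H s \<omega> - S k s \<omega>)\<^sup>2) \<partial>lborel)} +
       prob {\<omega> \<in> space M. ennreal \<delta> < (\<integral>\<^sup>+ s\<in>{0..T}. ennreal ((H s \<omega> - G m s \<omega>)\<^sup>2) \<partial>lborel)}"
      by (rule measure_Un_le; measurable)
    finally show ?thesis by simp
  qed
  have "tendsto_prob R I"
    unfolding tendsto_prob_def
  proof (intro allI impI)
    fix \<epsilon> :: real assume "0 < \<epsilon>"
    show "(\<lambda>m. prob {\<omega> \<in> space M. \<epsilon> < \<bar>R m \<omega> - I \<omega>\<bar>}) \<longlonglongrightarrow> 0"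
    proof (rule LIMSEQ_I, unfold eventually_sequentially[symmetric])
      fix \<eta> :: real assume "0 < \<eta>"
      \<comment> \<open>There are four error terms: the distance of \<open>J k\<close> from
        \<open>I\<close>, the Chebyshev term and the two square integrals. The choice of \<delta>
        makes the Chebyshev term equal to \<open>\<eta>'\<close>.\<close>
      define \<eta>' where "\<eta>' = \<eta> / 4"
      define \<delta> where "\<delta> = \<eta>' * (\<epsilon> / 2)\<^sup>2 / 4"
      have \<eta>': "0 < \<eta>'" "4 * \<eta>' = \<eta>" and \<delta>: "0 < \<delta>" "4 * \<delta> / (\<epsilon> / 2)\<^sup>2 = \<eta>'"
        using \<open>0 < \<eta>\<close> \<open>0 < \<epsilon>\<close> by (auto simp: \<eta>'_def \<delta>_def)
      have "\<forall>\<^sub>F k in sequentially.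
          prob {\<omega> \<in> space M. ennreal \<delta> < (\<integral>\<^sup>+ s\<in>{0..T}. ennreal ((H s \<omega> - S k s \<omega>)\<^sup>2) \<partial>lborel)} < \<eta>' \<and>
          prob {\<omega> \<in> space M. ennreal (\<epsilon> / 2) < ennreal \<bar>J k \<omega> - I \<omega>\<bar>} < \<eta>'"
        using order_tendstoD(2)[OF van1[unfolded vanishes_in_prob_def, rule_format, OF \<delta>(1)] \<eta>'(1)]
          order_tendstoD(2)[OF van2[unfolded vanishes_in_prob_def, rule_format, of "\<epsilon> / 2"] \<eta>'(1)] \<open>0 < \<epsilon>\<close>
        unfolding M[symmetric] space_M0 S_def J_def by (auto elim: eventually_elim2)
      then obtain k where k:
        "prob {\<omega> \<in> space M. ennreal \<delta> < (\<integral>\<^sup>+ s\<in>{0..T}. ennreal ((H s \<omega> - S k s \<omega>)\<^sup>2) \<partial>lborel)} < \<eta>'"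
        "prob {\<omega> \<in> space M. ennreal (\<epsilon> / 2) < ennreal \<bar>J k \<omega> - I \<omega>\<bar>} < \<eta>'"
        by (auto simp: eventually_sequentially)
      have "(\<lambda>m. prob {\<omega> \<in> space M. ennreal \<delta> < (\<integral>\<^sup>+ s\<in>{0..T}. ennreal ((H s \<omega> - G m s \<omega>)\<^sup>2) \<partial>lborel)}) \<longlonglongrightarrow> 0"
      proof (rule prob_tendsto_0_of_AE_eventually)
        show "AE \<omega> in M. \<forall>\<^sub>F m in sequentially.
          \<omega> \<notin> {\<omega> \<in> space M. ennreal \<delta> < (\<integral>\<^sup>+ s\<in>{0..T}. ennreal ((H s \<omega> - G m s \<omega>)\<^sup>2) \<partial>lborel)}"
          using cont
        proof eventually_elim
          case (elim \<omega>)
          from step_process_square_error[OF T, where H = H and \<omega> = \<omega>, OF elim \<delta>(1)] show ?case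
            unfolding G_def g_def by eventually_elim (simp add: not_less)
        qed
      qed measurable
      from order_tendstoD(2)[OF this \<eta>'(1)]
      have "\<forall>\<^sub>F m in sequentially. prob {\<omega> \<in> space M. \<epsilon> < \<bar>R m \<omega> - I \<omega>\<bar>} < \<eta>"
      proof eventually_elim
        case (elim m)
        have "prob {\<omega> \<in> space M. \<epsilon> < \<bar>R m \<omega> - I \<omega>\<bar>} \<le>
          prob ({\<omega> \<in> space M. ennreal (\<epsilon> / 2) < ennreal \<bar>J k \<omega> - I \<omega>\<bar>} \<union> {\<omega> \<in> space M. \<epsilon> / 2 < \<bar>J k \<omega> - R m \<omega>\<bar>})"
          using \<open>0 < \<epsilon>\<close> by (intro finite_measure_mono subsetI) (auto simp: abs_if ennreal_less_iff split: if_splits)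
        also have "\<dots> \<le> prob {\<omega> \<in> space M. ennreal (\<epsilon> / 2) < ennreal \<bar>J k \<omega> - I \<omega>\<bar>} +
            prob {\<omega> \<in> space M. \<epsilon> / 2 < \<bar>J k \<omega> - R m \<omega>\<bar>}"
          by (rule measure_Un_le; measurable)
        also have "\<dots> < \<eta>"
          using key[of "\<epsilon> / 2" \<delta> k m] \<open>0 < \<epsilon>\<close> \<delta> k elim \<eta>' by simp
        finally show ?case .
      qed
      then show "\<forall>\<^sub>F m in sequentially. norm (prob {\<omega> \<in> space M. \<epsilon> < \<bar>R m \<omega> - I \<omega>\<bar>} - 0) < \<eta>"
        by simp
    qed
  qed
  then show ?thesis
    unfolding R_def g_def .
qed

end

section \<open>Geometric Brownian motion\<close>

lemma power_Suc_add_one_ge: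
  fixes x :: real
  assumes "0 \<le> x"
  shows "x ^ Suc k + real (Suc k) * x ^ k \<le> (x + 1) ^ Suc k"
proof (induction k)
  case (Suc k)
  have "x ^ Suc (Suc k) + real (Suc (Suc k)) * x ^ Suc k \<le> (x + 1) * (x ^ Suc k + real (Suc k) * x ^ k)"
    using assms by (simp add: algebra_simps)
  also have "\<dots> \<le> (x + 1) * (x + 1) ^ Suc k"
    using assms Suc by (intro mult_left_mono) auto
  finally show ?case by simp
qed simp

text \<open>Discrete version of integrating a power; it produces the factorial in the iteration for
  the linear equation.\<close>

lemma sum_power_le: "real (Suc k) * (\<Sum>i<m. real i ^ k) \<le> real m ^ Suc k"
proof (induction m)
  case (Suc m)
  have "real (Suc k) * (\<Sum>i<Suc m. real i ^ k) \<le> real m ^ Suc k + real (Suc k) * real m ^ k"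
    using Suc by (simp add: distrib_left)
  also have "\<dots> \<le> (real m + 1) ^ Suc k"
    by (rule power_Suc_add_one_ge) simp
  finally show ?case by (simp add: add.commute)
qed simp

text \<open>A sum of \<open>m\<close> local errors, each small compared with the step
  \<open>T / m\<close>, vanishes in the limit. The Euler estimate is thereby reduced to derivatives
  at 0.\<close>

lemma grid_sum_tendsto_zero:
  assumes f: "(f has_real_derivative 0) (at 0)" "f 0 = 0" and T: "0 < T"
  shows "(\<lambda>m. real m * f (T / real m)) \<longlonglongrightarrow> 0"
proof -
  have "(\<lambda>h. f h / h) \<midarrow>0\<rightarrow> 0"
    using DERIV_D[OF f(1)] f(2) by simp
  moreover have "filterlim (\<lambda>m. T / real m) (at 0) sequentially"
    using T by real_asymp
  ultimately have "(\<lambda>m. f (T / real m) / (T / real m)) \<longlonglongrightarrow> 0"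
    by (rule filterlim_compose)
  then have "(\<lambda>m. T * (f (T / real m) / (T / real m))) \<longlonglongrightarrow> T * 0"
    by (intro tendsto_intros)
  moreover have "T * (f (T / real m) / (T / real m)) = real m * f (T / real m)" for m
    using T by (cases "m = 0") (auto simp: field_simps)
  ultimately show ?thesis by simp
qed

text \<open>The eigenvalue of the generator on \<open>y powr \<gamma>\<close>: this power of the
  process with drift \<mu> and volatility \<beta> grows in expectation at this exponential
  rate.\<close>

definition gbm_rate :: "real \<Rightarrow> real \<Rightarrow> real \<Rightarrow> real" where
  "gbm_rate \<mu> \<beta> \<gamma> = \<mu> * \<gamma> + \<beta>\<^sup>2 * \<gamma> * (\<gamma> - 1) / 2"

context brownian_basis
begin

definition gbm :: "real \<Rightarrow> real \<Rightarrow> real \<Rightarrow> 'a \<Rightarrow> real" where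
  "gbm \<mu> \<beta> t \<omega> = exp ((\<mu> - \<beta>\<^sup>2 / 2) * t + \<beta> * W t \<omega>)"

lemma gbm_pos: "0 < gbm \<mu> \<beta> t \<omega>"
  by (simp add: gbm_def)

lemma gbm_adapted: "0 \<le> s \<Longrightarrow> s \<le> t \<Longrightarrow> gbm \<mu> \<beta> s \<in> borel_measurable (\<F> (ennreal t))"
  unfolding gbm_def[abs_def] using W_adapted'[of s t] by simp

lemma gbm_borel: "0 \<le> s \<Longrightarrow> gbm \<mu> \<beta> s \<in> borel_measurable M"
  by (rule F_measurable[OF gbm_adapted[of s s]]) auto

lemma gbm_powr_eq:
  "gbm \<mu> \<beta> t \<omega> powr \<gamma> = gbm \<mu> \<beta> s \<omega> powr \<gamma> *
    (exp (\<gamma> * (\<mu> - \<beta>\<^sup>2 / 2) * (t - s)) * exp (\<gamma> * \<beta> * (W t \<omega> - W s \<omega>)))"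
  unfolding gbm_def powr_def by (simp add: exp_add[symmetric]) (simp add: field_simps)

lemma
  assumes "0 \<le> s" "s \<le> t" and X: "X \<in> borel_measurable (\<F> (ennreal s))"
    and int: "integrable M (\<lambda>\<omega>. X \<omega> * gbm \<mu> \<beta> s \<omega> powr \<gamma>)"
  shows integrable_times_gbm_powr: "integrable M (\<lambda>\<omega>. X \<omega> * gbm \<mu> \<beta> t \<omega> powr \<gamma>)"
    and expectation_times_gbm_powr: "(\<integral>\<omega>. X \<omega> * gbm \<mu> \<beta> t \<omega> powr \<gamma> \<partial>M) =
      exp (gbm_rate \<mu> \<beta> \<gamma> * (t - s)) * (\<integral>\<omega>. X \<omega> * gbm \<mu> \<beta> s \<omega> powr \<gamma> \<partial>M)"
proof -
  have "integrable M (\<lambda>\<omega>. X \<omega> * gbm \<mu> \<beta> t \<omega> powr \<gamma>) \<and> (\<integral>\<omega>. X \<omega> * gbm \<mu> \<beta> t \<omega> powr \<gamma> \<partial>M) =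
      exp (gbm_rate \<mu> \<beta> \<gamma> * (t - s)) * (\<integral>\<omega>. X \<omega> * gbm \<mu> \<beta> s \<omega> powr \<gamma> \<partial>M)"
  proof (cases "s = t")
    case True
    then show ?thesis using int by simp
  next
    case False
    then have st: "s < t" using assms by simp
    let ?\<phi> = "\<lambda>x. exp (\<gamma> * (\<mu> - \<beta>\<^sup>2 / 2) * (t - s)) * exp (\<gamma> * \<beta> * x)"
    have "has_bochner_integral lborel (\<lambda>x. exp (\<gamma> * (\<mu> - \<beta>\<^sup>2 / 2) * (t - s)) *
        (normal_density 0 (sqrt (t - s)) x * exp (\<gamma> * \<beta> * x)))
        (exp (\<gamma> * (\<mu> - \<beta>\<^sup>2 / 2) * (t - s)) * exp ((\<gamma> * \<beta>)\<^sup>2 * (sqrt (t - s))\<^sup>2 / 2))"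
      using st by (intro has_bochner_integral_mult_right normal_exp_moment) auto
    moreover have "exp (\<gamma> * (\<mu> - \<beta>\<^sup>2 / 2) * (t - s)) * exp ((\<gamma> * \<beta>)\<^sup>2 * (sqrt (t - s))\<^sup>2 / 2) =
        exp (gbm_rate \<mu> \<beta> \<gamma> * (t - s))"
      using st unfolding gbm_rate_def exp_add[symmetric]
      by (intro arg_cong[where f = exp]) (simp add: field_simps power2_eq_square)
    ultimately have c: "has_bochner_integral lborel (\<lambda>x. normal_density 0 (sqrt (t - s)) x * ?\<phi> x)
        (exp (gbm_rate \<mu> \<beta> \<gamma> * (t - s)))"
      by (simp add: mult.left_commute)
    have Y: "(\<lambda>\<omega>. X \<omega> * gbm \<mu> \<beta> s \<omega> powr \<gamma>) \<in> borel_measurable (\<F> (ennreal s))"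
      using gbm_adapted[OF assms(1) order_refl, of \<mu> \<beta>] X by measurable
    have \<phi>: "?\<phi> \<in> borel_measurable borel"
      by measurable
    have eq: "X \<omega> * gbm \<mu> \<beta> t \<omega> powr \<gamma> = (X \<omega> * gbm \<mu> \<beta> s \<omega> powr \<gamma>) * ?\<phi> (W t \<omega> - W s \<omega>)" for \<omega>
      by (subst gbm_powr_eq[of _ _ t _ _ s]) (simp only: mult.assoc)
    show ?thesis
      using integrable_times_increment[OF assms(1) st Y int \<phi> c] expectation_times_increment[OF assms(1) st Y int \<phi> c]
      unfolding eq by simp
  qed
  then show "integrable M (\<lambda>\<omega>. X \<omega> * gbm \<mu> \<beta> t \<omega> powr \<gamma>)"
    "(\<integral>\<omega>. X \<omega> * gbm \<mu> \<beta> t \<omega> powr \<gamma> \<partial>M) =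
      exp (gbm_rate \<mu> \<beta> \<gamma> * (t - s)) * (\<integral>\<omega>. X \<omega> * gbm \<mu> \<beta> s \<omega> powr \<gamma> \<partial>M)"
    by auto
qed

lemma gbm_0: "AE \<omega> in M. gbm \<mu> \<beta> 0 \<omega> = 1"
  using W_0 by eventually_elim (simp add: gbm_def)

lemma
  assumes "0 \<le> t"
  shows integrable_gbm_powr: "integrable M (\<lambda>\<omega>. gbm \<mu> \<beta> t \<omega> powr \<gamma>)"
    and expectation_gbm_powr: "(\<integral>\<omega>. gbm \<mu> \<beta> t \<omega> powr \<gamma> \<partial>M) = exp (gbm_rate \<mu> \<beta> \<gamma> * t)"
proof -
  have [measurable]: "gbm \<mu> \<beta> 0 \<in> borel_measurable M"
    by (rule gbm_borel) simp
  have AE: "AE \<omega> in M. gbm \<mu> \<beta> 0 \<omega> powr \<gamma> = 1"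
    using gbm_0[of \<mu> \<beta>] by eventually_elim simp
  have int: "integrable M (\<lambda>\<omega>. 1 * gbm \<mu> \<beta> 0 \<omega> powr \<gamma>)"
    using integrable_cong_AE[of "\<lambda>\<omega>. 1 * gbm \<mu> \<beta> 0 \<omega> powr \<gamma>" M "\<lambda>_. 1"] AE by simp
  have "(\<integral>\<omega>. 1 * gbm \<mu> \<beta> 0 \<omega> powr \<gamma> \<partial>M) = 1"
    using integral_cong_AE[of "\<lambda>\<omega>. 1 * gbm \<mu> \<beta> 0 \<omega> powr \<gamma>" M "\<lambda>_. 1"] AE by (simp add: prob_space)
  then show "integrable M (\<lambda>\<omega>. gbm \<mu> \<beta> t \<omega> powr \<gamma>)" "(\<integral>\<omega>. gbm \<mu> \<beta> t \<omega> powr \<gamma> \<partial>M) = exp (gbm_rate \<mu> \<beta> \<gamma> * t)"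
    using integrable_times_gbm_powr[OF order_refl assms borel_measurable_const int]
      expectation_times_gbm_powr[OF order_refl assms borel_measurable_const int] by auto
qed

lemma gbm_continuous: "AE \<omega> in M. continuous_on {0..} (\<lambda>t. gbm \<mu> \<beta> t \<omega>)"
  using W_cont
proof eventually_elim
  case (elim \<omega>)
  then show ?case
    unfolding gbm_def by (intro continuous_intros)
qed

text \<open>Takes the place of Ito's formula: the exponential satisfies the linear equation in
  discretised form. The error of one Euler step, relative to the present value, is the deterministic
  \<open>e1\<close> plus the centred \<open>\<phi>\<close> of the increment. The sum of the former
  is estimated by Cauchy-Schwarz, that of the latter by orthogonality.\<close>

lemma gbm_euler_sums:
  assumes T: "0 < T"
  shows "tendsto_prob (\<lambda>m \<omega>. \<Sum>i<m. gbm \<mu> \<beta> (real i * T / real m) \<omega> *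
    (\<mu> * (T / real m) + \<beta> * (W (real (Suc i) * T / real m) \<omega> - W (real i * T / real m) \<omega>)))
    (\<lambda>\<omega>. gbm \<mu> \<beta> T \<omega> - gbm \<mu> \<beta> 0 \<omega>)" (is "tendsto_prob ?S ?X")
proof (rule tendsto_prob_of_square)
  define g where "g m i = real i * T / real m" for m i
  define G where "G m i = gbm \<mu> \<beta> (g m i)" for m i
  define a where "a = \<mu> - \<beta>\<^sup>2 / 2"
  \<comment> \<open>Centred, because for the step \<open>\<Delta> = T / real m\<close> the Gaussian
    mean of \<open>exp (a * \<Delta>) * exp (\<beta> * x)\<close> is
    \<open>exp (\<mu> * \<Delta>)\<close>.\<close>
  define \<phi> where "\<phi> m x = exp (a * (T / real m)) * exp (\<beta> * x) - exp (\<mu> * (T / real m)) - \<beta> * x" for m x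
  define e1 where "e1 m = exp (\<mu> * (T / real m)) - 1 - \<mu> * (T / real m)" for m
  \<comment> \<open>The second moment of \<open>\<phi> m\<close>. As a function of the step size it
    vanishes at 0 together with its derivative, so \<open>m * v m\<close> tends to 0.\<close>
  define v where "v m = exp ((2 * \<mu> + \<beta>\<^sup>2) * (T / real m)) - exp (2 * \<mu> * (T / real m)) +
    \<beta>\<^sup>2 * (T / real m) - 2 * \<beta>\<^sup>2 * (T / real m) * exp (\<mu> * (T / real m))" for m
  define C where "C = exp (\<bar>gbm_rate \<mu> \<beta> 2\<bar> * T)"
  have g_mem: "g m i \<in> {0..T}" if "i \<le> m" for m i
    using that T by (cases "m = 0") (auto simp: g_def field_simps)
  have g_step: "g m (Suc i) - g m i = T / real m" for m i
    by (simp add: g_def field_simps add_divide_distrib)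
  have G_meas [measurable]: "G m i \<in> borel_measurable M" if "i \<le> m" for m i
    unfolding G_def using g_mem[OF that] by (intro gbm_borel) auto
  have G2: "integrable M (\<lambda>\<omega>. (G m i \<omega>)\<^sup>2)" "(\<integral>\<omega>. (G m i \<omega>)\<^sup>2 \<partial>M) \<le> C" "0 \<le> (\<integral>\<omega>. (G m i \<omega>)\<^sup>2 \<partial>M)" if "i \<le> m" for m i
  proof -
    have eq: "(G m i \<omega>)\<^sup>2 = gbm \<mu> \<beta> (g m i) \<omega> powr 2" for \<omega>
      using gbm_pos[of \<mu> \<beta> "g m i" \<omega>] by (simp add: G_def powr_numeral)
    show "integrable M (\<lambda>\<omega>. (G m i \<omega>)\<^sup>2)"
      unfolding eq by (rule integrable_gbm_powr) (use g_mem[OF that] in auto)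
    have "gbm_rate \<mu> \<beta> 2 * g m i \<le> \<bar>gbm_rate \<mu> \<beta> 2\<bar> * T"
      using g_mem[OF that] by (intro mult_mono) auto
    then show "(\<integral>\<omega>. (G m i \<omega>)\<^sup>2 \<partial>M) \<le> C"
      unfolding eq C_def using g_mem[OF that] by (subst expectation_gbm_powr) auto
  qed simp
  show S_meas [measurable]: "?S m \<in> borel_measurable M" for m
    using T by (intro borel_measurable_sum borel_measurable_times borel_measurable_add borel_measurable_diff
        borel_measurable_const gbm_borel W_borel) auto
  show [measurable]: "?X \<in> borel_measurable M"
    using T by (intro borel_measurable_diff gbm_borel) auto
  define A where "A m \<omega> = e1 m * (\<Sum>i<m. G m i \<omega>)" for m \<omega>
  define E where "E m \<omega> = (\<Sum>i<m. G m i \<omega> * \<phi> m (W (g m (Suc i)) \<omega> - W (g m i) \<omega>))" for m \<omega>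
  have split: "?S m \<omega> - ?X \<omega> = - (A m \<omega> + E m \<omega>)" if "0 < m" for m \<omega>
  proof -
    have "G m (Suc i) \<omega> - G m i \<omega> = G m i \<omega> * (\<mu> * (T / real m) + \<beta> * (W (g m (Suc i)) \<omega> - W (g m i) \<omega>)) +
        (e1 m * G m i \<omega> + G m i \<omega> * \<phi> m (W (g m (Suc i)) \<omega> - W (g m i) \<omega>))" for i
    proof -
      have "G m (Suc i) \<omega> = G m i \<omega> * (exp (a * (T / real m)) * exp (\<beta> * (W (g m (Suc i)) \<omega> - W (g m i) \<omega>)))"
        unfolding G_def gbm_def g_step[of m i, symmetric] a_def exp_add[symmetric]
        by (simp add: field_simps)
      then show ?thesis
        by (simp add: \<phi>_def e1_def algebra_simps)
    qed
    then have "(\<Sum>i<m. G m (Suc i) \<omega> - G m i \<omega>) = ?S m \<omega> + (A m \<omega> + E m \<omega>)"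
      by (simp add: sum.distrib A_def E_def sum_distrib_left G_def g_def)
    moreover have "(\<Sum>i<m. G m (Suc i) \<omega> - G m i \<omega>) = ?X \<omega>"
      using that by (subst sum_lessThan_telescope) (simp add: G_def g_def)
    ultimately show ?thesis by simp
  qed
  have mean: "has_bochner_integral lborel (\<lambda>x. normal_density 0 (sqrt (g m (Suc i) - g m i)) x * \<phi> m x) 0"
    and var: "has_bochner_integral lborel (\<lambda>x. normal_density 0 (sqrt (g m (Suc i) - g m i)) x * (\<phi> m x)\<^sup>2) (v m)"
    if m: "0 < m" for m i
  proof -
    define \<Delta> where "\<Delta> = T / real m"
    have \<Delta>: "0 < \<Delta>" using T m by (simp add: \<Delta>_def)
    let ?n = "normal_density 0 (sqrt \<Delta>)"
    have n0: "has_bochner_integral lborel ?n 1"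
      using \<Delta> by (simp add: has_bochner_integral_iff)
    have n1: "has_bochner_integral lborel (\<lambda>x. ?n x * x) 0"
      using normal_moment_nz_1[of "sqrt \<Delta>" 0] \<Delta> by simp
    have n2: "has_bochner_integral lborel (\<lambda>x. ?n x * x\<^sup>2) \<Delta>"
      using normal_moment_even[of "sqrt \<Delta>" 0 1] \<Delta> by simp
    note x1 = normal_exp_moment(1)[of "sqrt \<Delta>" \<beta>] and x2 = normal_exp_moment(1)[of "sqrt \<Delta>" "2 * \<beta>"]
      and y1 = normal_exp_moment(2)[of "sqrt \<Delta>" \<beta>]
    have "has_bochner_integral lborel
        (\<lambda>x. exp (a * \<Delta>) * (?n x * exp (\<beta> * x)) - exp (\<mu> * \<Delta>) * ?n x - \<beta> * (?n x * x))
        (exp (a * \<Delta>) * exp (\<beta>\<^sup>2 * (sqrt \<Delta>)\<^sup>2 / 2) - exp (\<mu> * \<Delta>) * 1 - \<beta> * 0)"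
      using \<Delta> by (intro has_bochner_integral_diff has_bochner_integral_mult_right n0 n1 x1) auto
    moreover have "exp (a * \<Delta>) * exp (\<beta>\<^sup>2 * (sqrt \<Delta>)\<^sup>2 / 2) = exp (\<mu> * \<Delta>)"
      using \<Delta> by (simp add: a_def exp_add[symmetric] algebra_simps)
    moreover have "exp (a * \<Delta>) * (?n x * exp (\<beta> * x)) - exp (\<mu> * \<Delta>) * ?n x - \<beta> * (?n x * x) = ?n x * \<phi> m x" for x
      by (simp add: \<phi>_def \<Delta>_def algebra_simps)
    ultimately show "has_bochner_integral lborel (\<lambda>x. normal_density 0 (sqrt (g m (Suc i) - g m i)) x * \<phi> m x) 0"
      by (simp add: g_step \<Delta>_def)
    have "has_bochner_integral lborel
        (\<lambda>x. exp (2 * a * \<Delta>) * (?n x * exp (2 * \<beta> * x)) + exp (2 * \<mu> * \<Delta>) * ?n x + \<beta>\<^sup>2 * (?n x * x\<^sup>2)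
          - 2 * exp (a * \<Delta>) * exp (\<mu> * \<Delta>) * (?n x * exp (\<beta> * x))
          - 2 * \<beta> * exp (a * \<Delta>) * (?n x * (x * exp (\<beta> * x))) + 2 * \<beta> * exp (\<mu> * \<Delta>) * (?n x * x))
        (exp (2 * a * \<Delta>) * exp ((2 * \<beta>)\<^sup>2 * (sqrt \<Delta>)\<^sup>2 / 2) + exp (2 * \<mu> * \<Delta>) * 1 + \<beta>\<^sup>2 * \<Delta>
          - 2 * exp (a * \<Delta>) * exp (\<mu> * \<Delta>) * exp (\<beta>\<^sup>2 * (sqrt \<Delta>)\<^sup>2 / 2)
          - 2 * \<beta> * exp (a * \<Delta>) * (\<beta> * (sqrt \<Delta>)\<^sup>2 * exp (\<beta>\<^sup>2 * (sqrt \<Delta>)\<^sup>2 / 2)) + 2 * \<beta> * exp (\<mu> * \<Delta>) * 0)"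
      using \<Delta> by (intro has_bochner_integral_diff has_bochner_integral_add has_bochner_integral_mult_right n0 n1 n2 x1 x2 y1) auto
    moreover have "exp (2 * a * \<Delta>) * (?n x * exp (2 * \<beta> * x)) + exp (2 * \<mu> * \<Delta>) * ?n x + \<beta>\<^sup>2 * (?n x * x\<^sup>2)
          - 2 * exp (a * \<Delta>) * exp (\<mu> * \<Delta>) * (?n x * exp (\<beta> * x))
          - 2 * \<beta> * exp (a * \<Delta>) * (?n x * (x * exp (\<beta> * x))) + 2 * \<beta> * exp (\<mu> * \<Delta>) * (?n x * x)
        = ?n x * (\<phi> m x)\<^sup>2" for x
    proof -
      have dbl: "exp (2 * c) = (exp c)\<^sup>2" for c :: real
        by (simp add: exp_double)
      show ?thesis
        unfolding \<phi>_def \<Delta>_def[symmetric] mult.assoc[of 2] dbl by (simp add: power2_eq_square algebra_simps)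
    qed
    moreover have "exp (2 * a * \<Delta>) * exp ((2 * \<beta>)\<^sup>2 * (sqrt \<Delta>)\<^sup>2 / 2) + exp (2 * \<mu> * \<Delta>) * 1 + \<beta>\<^sup>2 * \<Delta>
          - 2 * exp (a * \<Delta>) * exp (\<mu> * \<Delta>) * exp (\<beta>\<^sup>2 * (sqrt \<Delta>)\<^sup>2 / 2)
          - 2 * \<beta> * exp (a * \<Delta>) * (\<beta> * (sqrt \<Delta>)\<^sup>2 * exp (\<beta>\<^sup>2 * (sqrt \<Delta>)\<^sup>2 / 2)) + 2 * \<beta> * exp (\<mu> * \<Delta>) * 0 = v m"
    proof -
      have i: "exp (2 * a * \<Delta>) * exp ((2 * \<beta>)\<^sup>2 * (sqrt \<Delta>)\<^sup>2 / 2) = exp ((2 * \<mu> + \<beta>\<^sup>2) * \<Delta>)"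
        using \<Delta> by (simp add: a_def exp_add[symmetric] algebra_simps)
      have ii: "exp (a * \<Delta>) * exp (\<beta>\<^sup>2 * (sqrt \<Delta>)\<^sup>2 / 2) = exp (\<mu> * \<Delta>)"
        using \<Delta> by (simp add: a_def exp_add[symmetric] algebra_simps)
      have iii: "exp (\<mu> * \<Delta>) * exp (\<mu> * \<Delta>) = exp (2 * \<mu> * \<Delta>)"
        by (simp add: exp_add[symmetric])
      have "2 * exp (a * \<Delta>) * exp (\<mu> * \<Delta>) * exp (\<beta>\<^sup>2 * (sqrt \<Delta>)\<^sup>2 / 2) = 2 * exp (2 * \<mu> * \<Delta>)"
        unfolding iii[symmetric] ii[symmetric] by (simp add: ac_simps)
      moreover have "2 * \<beta> * exp (a * \<Delta>) * (\<beta> * (sqrt \<Delta>)\<^sup>2 * exp (\<beta>\<^sup>2 * (sqrt \<Delta>)\<^sup>2 / 2)) = 2 * \<beta>\<^sup>2 * \<Delta> * exp (\<mu> * \<Delta>)"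
        unfolding ii[symmetric] using \<Delta> by (simp add: ac_simps power2_eq_square)
      ultimately show ?thesis
        unfolding i v_def \<Delta>_def[symmetric] by simp
    qed
    ultimately show "has_bochner_integral lborel (\<lambda>x. normal_density 0 (sqrt (g m (Suc i) - g m i)) x * (\<phi> m x)\<^sup>2) (v m)"
      by (simp add: g_step \<Delta>_def)
  qed
  have \<phi>_meas: "\<phi> m \<in> borel_measurable borel" for m
    unfolding \<phi>_def by measurable
  have GF: "G m i \<in> borel_measurable (\<F> (ennreal (g m i)))" if "i < m" for m i
    unfolding G_def by (rule gbm_adapted) (use g_mem[of i m] that in auto)
  have E_int: "integrable M (\<lambda>\<omega>. (E m \<omega>)\<^sup>2)" and E_eq: "(\<integral>\<omega>. (E m \<omega>)\<^sup>2 \<partial>M) = (\<Sum>i<m. (\<integral>\<omega>. (G m i \<omega>)\<^sup>2 \<partial>M) * v m)"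
    for m
  proof (atomize (full), cases "m = 0")
    case False
    have "g m i < g m (Suc i)" for i
      using g_step[of m i] T False by (metis diff_gt_0_iff_gt divide_pos_pos of_nat_0_less_iff neq0_conv)
    moreover have "0 \<le> g m 0" by (simp add: g_def)
    ultimately show "integrable M (\<lambda>\<omega>. (E m \<omega>)\<^sup>2) \<and> (\<integral>\<omega>. (E m \<omega>)\<^sup>2 \<partial>M) = (\<Sum>i<m. (\<integral>\<omega>. (G m i \<omega>)\<^sup>2 \<partial>M) * v m)"
      unfolding E_def
      using integrable_sum_increments_square[of "g m" m "G m" "\<lambda>_. \<phi> m" "\<lambda>_. v m"]
        expectation_sum_increments_square[of "g m" m "G m" "\<lambda>_. \<phi> m" "\<lambda>_. v m"] False
      by (auto simp: GF G2 \<phi>_meas mean var)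
  qed (simp add: E_def)
  have [measurable]: "E m \<in> borel_measurable M" for m
    unfolding E_def using g_mem[of _ m]
    by (intro borel_measurable_sum borel_measurable_times G_meas measurable_compose[OF _ \<phi>_meas] borel_measurable_diff W_borel) auto
  have [measurable]: "A m \<in> borel_measurable M" for m
    unfolding A_def by (intro borel_measurable_times borel_measurable_const borel_measurable_sum G_meas) auto
  have A_le: "(A m \<omega>)\<^sup>2 \<le> (e1 m)\<^sup>2 * (real m * (\<Sum>i<m. (G m i \<omega>)\<^sup>2))" for m \<omega>
    unfolding A_def power_mult_distrib
    using sum_squared_le_sum_of_squares[of "\<lambda>i. G m i \<omega>" "{..<m}"] by (intro mult_left_mono) (auto simp: mult.commute)
  have G2s: "integrable M (\<lambda>\<omega>. (e1 m)\<^sup>2 * (real m * (\<Sum>i<m. (G m i \<omega>)\<^sup>2)))" for m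
    by (intro integrable_mult_right Bochner_Integration.integrable_sum G2) auto
  have A_int: "integrable M (\<lambda>\<omega>. (A m \<omega>)\<^sup>2)" for m
    by (rule Bochner_Integration.integrable_bound[OF G2s[of m]]) (use A_le in \<open>auto simp: sum_nonneg\<close>)
  have A_bound: "(\<integral>\<omega>. (A m \<omega>)\<^sup>2 \<partial>M) \<le> (e1 m)\<^sup>2 * (real m * (real m * C))" for m
  proof -
    have "(\<integral>\<omega>. (A m \<omega>)\<^sup>2 \<partial>M) \<le> (\<integral>\<omega>. (e1 m)\<^sup>2 * (real m * (\<Sum>i<m. (G m i \<omega>)\<^sup>2)) \<partial>M)"
      by (rule integral_mono[OF A_int G2s A_le])
    also have "\<dots> = (e1 m)\<^sup>2 * (real m * (\<Sum>i<m. \<integral>\<omega>. (G m i \<omega>)\<^sup>2 \<partial>M))"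
      by (simp add: Bochner_Integration.integral_sum G2)
    also have "(\<Sum>i<m. \<integral>\<omega>. (G m i \<omega>)\<^sup>2 \<partial>M) \<le> real m * C"
      using sum_bounded_above[of "{..<m}" "\<lambda>i. \<integral>\<omega>. (G m i \<omega>)\<^sup>2 \<partial>M" C] G2(2)[of _ m] by auto
    finally show ?thesis
      by (simp add: mult_left_mono)
  qed
  have E_bound: "(\<integral>\<omega>. (E m \<omega>)\<^sup>2 \<partial>M) \<le> \<bar>v m\<bar> * (real m * C)" for m
  proof -
    have "(\<integral>\<omega>. (E m \<omega>)\<^sup>2 \<partial>M) \<le> (\<Sum>i<m. (\<integral>\<omega>. (G m i \<omega>)\<^sup>2 \<partial>M) * \<bar>v m\<bar>)"
      unfolding E_eq by (intro sum_mono mult_left_mono G2) auto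
    also have "\<dots> = (\<Sum>i<m. \<integral>\<omega>. (G m i \<omega>)\<^sup>2 \<partial>M) * \<bar>v m\<bar>"
      by (simp add: sum_distrib_right)
    also have "\<dots> \<le> real m * C * \<bar>v m\<bar>"
      using sum_bounded_above[of "{..<m}" "\<lambda>i. \<integral>\<omega>. (G m i \<omega>)\<^sup>2 \<partial>M" C] G2(2)[of _ m]
      by (intro mult_right_mono) auto
    finally show ?thesis by (simp add: ac_simps)
  qed
  have AE_int: "integrable M (\<lambda>\<omega>. (- (A m \<omega> + E m \<omega>))\<^sup>2)" for m
  proof -
    have "integrable M (\<lambda>\<omega>. A m \<omega> * E m \<omega>)"
      by (rule integrable_mult_square) (auto simp: A_int E_int)
    then have "integrable M (\<lambda>\<omega>. (A m \<omega>)\<^sup>2 + 2 * (A m \<omega> * E m \<omega>) + (E m \<omega>)\<^sup>2)"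
      by (intro Bochner_Integration.integrable_add integrable_mult_right A_int E_int)
    moreover have "(- (A m \<omega> + E m \<omega>))\<^sup>2 = (A m \<omega>)\<^sup>2 + 2 * (A m \<omega> * E m \<omega>) + (E m \<omega>)\<^sup>2" for \<omega>
      by (simp add: power2_eq_square algebra_simps)
    ultimately show ?thesis by simp
  qed
  \<comment> \<open>This serves the case \<open>m = 0\<close>, in which the sum is empty and the
    error is \<open>?X\<close> itself.\<close>
  have X2_int: "integrable M (\<lambda>\<omega>. (?X \<omega>)\<^sup>2)"
  proof -
    have "integrable M (\<lambda>\<omega>. G 1 1 \<omega> * G 1 0 \<omega>)"
      by (rule integrable_mult_square) (auto simp: G2)
    then have "integrable M (\<lambda>\<omega>. (G 1 1 \<omega>)\<^sup>2 - 2 * (G 1 1 \<omega> * G 1 0 \<omega>) + (G 1 0 \<omega>)\<^sup>2)"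
      by (intro Bochner_Integration.integrable_add Bochner_Integration.integrable_diff integrable_mult_right G2) auto
    moreover have "(?X \<omega>)\<^sup>2 = (G 1 1 \<omega>)\<^sup>2 - 2 * (G 1 1 \<omega> * G 1 0 \<omega>) + (G 1 0 \<omega>)\<^sup>2" for \<omega>
      by (simp add: G_def g_def power2_eq_square algebra_simps)
    ultimately show ?thesis by simp
  qed
  show "integrable M (\<lambda>\<omega>. (?S m \<omega> - ?X \<omega>)\<^sup>2)" for m
  proof (cases "m = 0")
    case True
    then show ?thesis using X2_int by (simp add: power2_commute)
  next
    case False
    then show ?thesis
      using AE_int[of m] split[of m] by simp
  qed
  have "(\<lambda>m. real m * e1 m) \<longlonglongrightarrow> 0"
    unfolding e1_def
    by (rule grid_sum_tendsto_zero[of "\<lambda>\<Delta>. exp (\<mu> * \<Delta>) - 1 - \<mu> * \<Delta>", OF _ _ T]) (auto intro!: derivative_eq_intros)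
  from tendsto_power[OF this, of 2] have "(\<lambda>m. real m * real m * (e1 m)\<^sup>2) \<longlonglongrightarrow> 0"
    by (simp add: power2_eq_square mult.assoc mult.left_commute)
  moreover have "(\<lambda>m. real m * v m) \<longlonglongrightarrow> 0"
    unfolding v_def
    by (rule grid_sum_tendsto_zero[of "\<lambda>\<Delta>. exp ((2 * \<mu> + \<beta>\<^sup>2) * \<Delta>) - exp (2 * \<mu> * \<Delta>) + \<beta>\<^sup>2 * \<Delta> -
        2 * \<beta>\<^sup>2 * \<Delta> * exp (\<mu> * \<Delta>)", OF _ _ T]) (auto intro!: derivative_eq_intros)
  ultimately have "(\<lambda>m. 2 * C * (real m * real m * (e1 m)\<^sup>2) + 2 * C * \<bar>real m * v m\<bar>) \<longlonglongrightarrow> 2 * C * 0 + 2 * C * \<bar>0\<bar>"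
    by (intro tendsto_intros)
  then have lim: "(\<lambda>m. 2 * C * (real m * real m * (e1 m)\<^sup>2) + 2 * C * \<bar>real m * v m\<bar>) \<longlonglongrightarrow> 0"
    by simp
  show "(\<lambda>m. \<integral>\<omega>. (?S m \<omega> - ?X \<omega>)\<^sup>2 \<partial>M) \<longlonglongrightarrow> 0"
  proof (rule Lim_null_comparison[OF _ lim])
    show "\<forall>\<^sub>F m in sequentially. norm (\<integral>\<omega>. (?S m \<omega> - ?X \<omega>)\<^sup>2 \<partial>M) \<le>
        2 * C * (real m * real m * (e1 m)\<^sup>2) + 2 * C * \<bar>real m * v m\<bar>"
      using eventually_gt_at_top[of 0]
    proof eventually_elim
      case (elim m)
      have "(\<integral>\<omega>. (?S m \<omega> - ?X \<omega>)\<^sup>2 \<partial>M) = (\<integral>\<omega>. (- (A m \<omega> + E m \<omega>))\<^sup>2 \<partial>M)"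
        using split[OF elim] by simp
      also have "\<dots> \<le> (\<integral>\<omega>. 2 * (A m \<omega>)\<^sup>2 + 2 * (E m \<omega>)\<^sup>2 \<partial>M)"
      proof (rule integral_mono[OF AE_int])
        fix \<omega>
        show "(- (A m \<omega> + E m \<omega>))\<^sup>2 \<le> 2 * (A m \<omega>)\<^sup>2 + 2 * (E m \<omega>)\<^sup>2"
          using sum_squares_bound[of "A m \<omega>" "E m \<omega>"] by (simp add: power2_eq_square algebra_simps)
      qed (use A_int E_int in auto)
      also have "\<dots> = 2 * (\<integral>\<omega>. (A m \<omega>)\<^sup>2 \<partial>M) + 2 * (\<integral>\<omega>. (E m \<omega>)\<^sup>2 \<partial>M)"
        using A_int E_int by simp
      also have "\<dots> \<le> 2 * ((e1 m)\<^sup>2 * (real m * (real m * C))) + 2 * (\<bar>v m\<bar> * (real m * C))"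
        using A_bound[of m] E_bound[of m] by simp
      also have "\<dots> = 2 * C * (real m * real m * (e1 m)\<^sup>2) + 2 * C * \<bar>real m * v m\<bar>"
        by (simp add: abs_mult ac_simps)
      finally show ?case by simp
    qed
  qed
qed

end

section \<open>The linear stochastic differential equation\<close>

lemma (in prob_space) tendsto_prob_AE_limit:
  assumes [measurable]: "\<And>k. Y k \<in> borel_measurable M" "X \<in> borel_measurable M" "X' \<in> borel_measurable M"
    and "tendsto_prob Y X" "AE \<omega> in M. X \<omega> = X' \<omega>"
  shows "tendsto_prob Y X'"
proof -
  have "prob {\<omega> \<in> space M. \<epsilon> < \<bar>Y k \<omega> - X \<omega>\<bar>} = prob {\<omega> \<in> space M. \<epsilon> < \<bar>Y k \<omega> - X' \<omega>\<bar>}" for \<epsilon> k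
    using assms(5) by (intro finite_measure_eq_AE) (auto elim: eventually_mono)
  then show ?thesis
    using assms(4) by (simp add: tendsto_prob_def)
qed

context brownian_basis
begin

text \<open>Uniqueness for the linear equation: the second moment of \<open>D\<close>, cut off where \<open>\<bar>D\<bar>\<close> exceeds \<open>K\<close>,
  is at most \<open>K\<^sup>2 (C t)\<^sup>k / k!\<close> for every \<open>k\<close>. Only the countably many times in \<open>\<rat> T\<close> are needed.\<close>

lemma linear_equation_zero:
  assumes D: "\<And>t. 0 \<le> t \<Longrightarrow> D t \<in> borel_measurable (\<F> (ennreal t))"
    and cont: "AE \<omega> in M. continuous_on {0..} (\<lambda>t. D t \<omega>)"
    and D0: "AE \<omega> in M. D 0 \<omega> = 0"
    and lim: "\<And>T. 0 < T \<Longrightarrow> tendsto_prob (\<lambda>m \<omega>. \<Sum>i<m. D (real i * T / real m) \<omega> *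
      (\<mu> * (T / real m) + \<beta> * (W (real (Suc i) * T / real m) \<omega> - W (real i * T / real m) \<omega>))) (D T)"
    and "0 < T"
  shows "AE \<omega> in M. D T \<omega> = 0"
proof -
  \<comment> \<open>Closed under passing from \<open>t\<close> to the grid points
    \<open>i * t / m\<close>, so the iteration over earlier times stays inside \<open>Q\<close>;
    countable, so the cutoff events are measurable.\<close>
  define Q where "Q = (\<lambda>q. real_of_rat q * T) ` UNIV \<inter> {0..T}"
  have "countable Q"
    by (auto simp: Q_def)
  have QT: "T \<in> Q"
    using \<open>0 < T\<close> by (auto simp: Q_def intro!: image_eqI[of _ _ 1])
  have Q_grid: "real i * t / real m \<in> Q" if "t \<in> Q" "i \<le> m" for t i m
  proof -
    from that obtain q where q: "t = real_of_rat q * T" "0 \<le> t" "t \<le> T" by (auto simp: Q_def)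
    have "real i * t / real m = real_of_rat (of_nat i * q / of_nat m) * T"
      by (simp add: q(1) of_rat_mult of_rat_divide)
    moreover have "real i / real m * t \<le> 1 * t"
      using that q by (intro mult_right_mono) (auto simp: divide_le_eq)
    moreover have "0 \<le> real i * t / real m"
      using q by simp
    ultimately show ?thesis
      using q by (auto simp: Q_def)
  qed
  have Q_pos: "0 \<le> t" "t \<le> T" if "t \<in> Q" for t
    using that by (auto simp: Q_def)
  \<comment> \<open>The square of a sum is twice bounded by double the sum of squares, hence the 4;
    \<open>\<mu>\<^sup>2 * T\<close> comes from Cauchy-Schwarz on the drift and
    \<open>\<beta>\<^sup>2\<close> from the isometry.\<close>
  define C where "C = 4 * (\<mu>\<^sup>2 * T + \<beta>\<^sup>2)"
  have C: "0 \<le> C" using \<open>0 < T\<close> by (simp add: C_def)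
  have DM [measurable]: "D t \<in> borel_measurable M" if "0 \<le> t" for t
    using F_measurable[OF D[OF that]] .
  have zero_K: "AE \<omega> in M. (\<forall>s\<in>Q. \<bar>D s \<omega>\<bar> \<le> K) \<longrightarrow> D T \<omega> = 0" if K: "0 \<le> K" for K :: real
  proof -
    \<comment> \<open>The cutoff looks only at times up to \<open>t\<close>. Thus \<open>A t\<close>
      is known at time \<open>t\<close>, and since it shrinks as \<open>t\<close> grows, on
      \<open>A t\<close> every earlier \<open>D\<close> agrees with its truncation
      \<open>Y\<close>.\<close>
    define A where "A t = {\<omega> \<in> space M. \<forall>s\<in>Q \<inter> {..t}. \<bar>D s \<omega>\<bar> \<le> K}" for t
    have A_F: "A t \<in> sets (\<F> (ennreal t))" for t
    proof -
      have "Measurable.pred (\<F> (ennreal t)) (\<lambda>\<omega>. \<forall>s\<in>Q \<inter> {..t}. \<bar>D s \<omega>\<bar> \<le> K)"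
      proof (rule measurable_pred_countable(1))
        show "countable (Q \<inter> {..t})" using \<open>countable Q\<close> by auto
        fix s assume s: "s \<in> Q \<inter> {..t}"
        have [measurable]: "D s \<in> borel_measurable (\<F> (ennreal t))"
          by (rule F_measurable_mono[OF D]) (use s Q_pos[of s] in \<open>auto intro: ennreal_leI\<close>)
        show "Measurable.pred (\<F> (ennreal t)) (\<lambda>\<omega>. \<bar>D s \<omega>\<bar> \<le> K)"
          by measurable
      qed
      then show ?thesis by (simp add: A_def space_F pred_def)
    qed
    have A_M [measurable]: "A t \<in> events" for t
      using A_F[of t] F_events by auto
    have A_anti: "A t \<subseteq> A s" if "s \<le> t" for s t
      using that by (auto simp: A_def)
    define Y where "Y t \<omega> = indicator (A t) \<omega> * D t \<omega>" for t \<omega>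
    have Y_F: "Y t \<in> borel_measurable (\<F> (ennreal t))" if "0 \<le> t" for t
      unfolding Y_def using A_F[of t] D[OF that] by measurable
    have Y_M [measurable]: "Y t \<in> borel_measurable M" if "0 \<le> t" for t
      using F_measurable[OF Y_F[OF that]] .
    have Y_bound: "\<bar>Y t \<omega>\<bar> \<le> K" if "t \<in> Q" for t \<omega>
      using that K by (auto simp: Y_def A_def indicator_def)
    have Y2_bound: "(Y t \<omega>)\<^sup>2 \<le> K\<^sup>2" if "t \<in> Q" for t \<omega>
      using Y_bound[OF that, of \<omega>] K by (metis abs_le_square_iff abs_of_nonneg)
    have Y2_int: "integrable M (\<lambda>\<omega>. (Y t \<omega>)\<^sup>2)" if "t \<in> Q" for t
      by (rule integrable_const_bound[of _ "K\<^sup>2"]) (use Y2_bound[OF that] Q_pos[OF that] in auto)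
    define \<phi> where "\<phi> t = (\<integral>\<omega>. (Y t \<omega>)\<^sup>2 \<partial>M)" for t
    have bound: "\<forall>t\<in>Q. \<phi> t \<le> K\<^sup>2 * (C * t) ^ k / fact k" for k
    proof (induction k)
      case 0
      show ?case
      proof
        fix t assume "t \<in> Q"
        have "\<phi> t \<le> (\<integral>\<omega>. K\<^sup>2 \<partial>M)"
          unfolding \<phi>_def by (rule integral_mono) (use Y2_int Y2_bound \<open>t \<in> Q\<close> in auto)
        then show "\<phi> t \<le> K\<^sup>2 * (C * t) ^ 0 / fact 0" by (simp add: prob_space)
      qed
    next
      case (Suc k)
      show ?case
      proof
        fix t assume t: "t \<in> Q"
        show "\<phi> t \<le> K\<^sup>2 * (C * t) ^ Suc k / fact (Suc k)"
        proof (cases "t = 0")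
          case True
          have "AE \<omega> in M. (Y 0 \<omega>)\<^sup>2 = 0"
            using D0 by eventually_elim (simp add: Y_def)
          then have "\<phi> 0 = (\<integral>\<omega>. 0 \<partial>M)"
            unfolding \<phi>_def by (intro integral_cong_AE) auto
          then show ?thesis using True by simp
        next
          case False
          then have tpos: "0 < t" using Q_pos[OF t] by simp
          define g where "g m i = real i * t / real m" for m i
          have gQ: "g m i \<in> Q" if "i \<le> m" for m i
            unfolding g_def by (rule Q_grid[OF t that])
          have g_step: "g m (Suc i) - g m i = t / real m" for m i
            by (simp add: g_def field_simps add_divide_distrib)
          define S where "S m \<omega> = (\<Sum>i<m. D (g m i) \<omega> * (\<mu> * (t / real m) + \<beta> * (W (g m (Suc i)) \<omega> - W (g m i) \<omega>)))" for m \<omega>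
          define U where "U m \<omega> = (\<mu> * (t / real m)) * (\<Sum>i<m. Y (g m i) \<omega>)" for m \<omega>
          define V where "V m \<omega> = (\<Sum>i<m. Y (g m i) \<omega> * (W (g m (Suc i)) \<omega> - W (g m i) \<omega>))" for m \<omega>
          have S_eq: "S m \<omega> = U m \<omega> + \<beta> * V m \<omega>" if "\<omega> \<in> A t" for m \<omega>
          proof -
            have "D (g m i) \<omega> = Y (g m i) \<omega>" if "i < m" for i
            proof -
              have "g m i \<le> 1 * t"
                unfolding g_def times_divide_eq_left[symmetric] using that tpos by (intro mult_right_mono) (auto simp: divide_le_eq)
              then have "\<omega> \<in> A (g m i)" using A_anti[of "g m i" t] \<open>\<omega> \<in> A t\<close> by auto
              then show ?thesis by (simp add: Y_def)
            qed
            then have "S m \<omega> = (\<Sum>i<m. Y (g m i) \<omega> * (\<mu> * (t / real m) + \<beta> * (W (g m (Suc i)) \<omega> - W (g m i) \<omega>)))"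
              unfolding S_def by (intro sum.cong refl) simp
            then show ?thesis
              unfolding U_def V_def by (simp add: sum_distrib_left sum.distrib[symmetric] algebra_simps)
          qed
          have [measurable]: "S m \<in> borel_measurable M" for m
            unfolding S_def using Q_pos[OF gQ[of _ m]]
            by (intro borel_measurable_sum borel_measurable_times borel_measurable_add borel_measurable_diff
                borel_measurable_const W_borel DM) auto
          have [measurable]: "U m \<in> borel_measurable M" for m
            unfolding U_def using Q_pos[OF gQ[of _ m]]
            by (intro borel_measurable_sum borel_measurable_times borel_measurable_const Y_M) auto
          have [measurable]: "V m \<in> borel_measurable M" for m
            unfolding V_def using Q_pos[OF gQ[of _ m]]
            by (intro borel_measurable_sum borel_measurable_times borel_measurable_diff W_borel Y_M) auto
          have V2: "integrable M (\<lambda>\<omega>. (V m \<omega>)\<^sup>2) \<and> (\<integral>\<omega>. (V m \<omega>)\<^sup>2 \<partial>M) = (t / real m) * (\<Sum>i<m. \<phi> (g m i))" if "0 < m" for m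
          proof -
            have "g m i < g m (Suc i)" for i
            proof -
              have "0 < t / real m" using tpos that by simp
              then show ?thesis using g_step[of m i] by linarith
            qed
            moreover have "0 \<le> g m 0" by (simp add: g_def)
            ultimately show ?thesis
              unfolding V_def
              using integrable_ito_sum_square[of "g m" m "\<lambda>i. Y (g m i)"] ito_isometry_sum[of "g m" m "\<lambda>i. Y (g m i)"]
                Y_F[OF Q_pos(1)[OF gQ]] Y2_int[OF gQ]
              by (simp add: g_step \<phi>_def sum_distrib_left mult.commute)
          qed
          have U2: "(U m \<omega>)\<^sup>2 \<le> (\<mu> * (t / real m))\<^sup>2 * (real m * (\<Sum>i<m. (Y (g m i) \<omega>)\<^sup>2))" for m \<omega>
            unfolding U_def power_mult_distrib[of "\<mu> * (t / real m)"]
            using sum_squared_le_sum_of_squares[of "\<lambda>i. Y (g m i) \<omega>" "{..<m}"] by (intro mult_left_mono) (auto simp: mult.commute)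
          have U2_int': "integrable M (\<lambda>\<omega>. (\<mu> * (t / real m))\<^sup>2 * (real m * (\<Sum>i<m. (Y (g m i) \<omega>)\<^sup>2)))" for m
            by (intro integrable_mult_right Bochner_Integration.integrable_sum Y2_int gQ) auto
          have U2_int: "integrable M (\<lambda>\<omega>. (U m \<omega>)\<^sup>2)" for m
            by (rule Bochner_Integration.integrable_bound[OF U2_int'[of m]]) (use U2 in \<open>auto simp: sum_nonneg\<close>)
          have U2_exp: "(\<integral>\<omega>. (U m \<omega>)\<^sup>2 \<partial>M) \<le> (\<mu> * (t / real m))\<^sup>2 * (real m * (\<Sum>i<m. \<phi> (g m i)))" for m
          proof -
            have "(\<integral>\<omega>. (U m \<omega>)\<^sup>2 \<partial>M) \<le> (\<integral>\<omega>. (\<mu> * (t / real m))\<^sup>2 * (real m * (\<Sum>i<m. (Y (g m i) \<omega>)\<^sup>2)) \<partial>M)"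
              by (rule integral_mono[OF U2_int U2_int' U2])
            also have "\<dots> = (\<mu> * (t / real m))\<^sup>2 * (real m * (\<Sum>i<m. \<phi> (g m i)))"
              by (simp add: \<phi>_def Bochner_Integration.integral_sum Y2_int gQ)
            finally show ?thesis .
          qed
          have sum_bound: "(t / real m) * (\<Sum>i<m. \<phi> (g m i)) \<le> K\<^sup>2 * C ^ k * t ^ Suc k / fact (Suc k)" if m: "0 < m" for m
          proof -
            have "(\<Sum>i<m. \<phi> (g m i)) \<le> (\<Sum>i<m. K\<^sup>2 * (C * g m i) ^ k / fact k)"
              using Suc gQ by (intro sum_mono) auto
            also have "\<dots> = K\<^sup>2 * C ^ k * (t / real m) ^ k / fact k * (\<Sum>i<m. real i ^ k)"
              unfolding sum_distrib_left by (intro sum.cong refl) (simp add: g_def power_mult_distrib power_divide)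
            also have "\<dots> \<le> K\<^sup>2 * C ^ k * (t / real m) ^ k / fact k * (real m ^ Suc k / real (Suc k))"
              using sum_power_le[of k m] tpos C
              by (intro mult_left_mono) (auto simp: field_simps)
            finally have "(t / real m) * (\<Sum>i<m. \<phi> (g m i)) \<le>
                (t / real m) * (K\<^sup>2 * C ^ k * (t / real m) ^ k / fact k * (real m ^ Suc k / real (Suc k)))"
              using tpos by (intro mult_left_mono) auto
            also have "\<dots> = K\<^sup>2 * C ^ k * ((t / real m) ^ Suc k * real m ^ Suc k) / (fact k * real (Suc k))"
              by (simp add: mult.commute mult.left_commute mult.assoc)
            also have "\<dots> = K\<^sup>2 * C ^ k * t ^ Suc k / fact (Suc k)"
              unfolding power_mult_distrib[symmetric] using m by (simp add: mult.commute)
            finally show ?thesis .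
          qed
          \<comment> \<open>Outside \<open>A t\<close> the truncation \<open>Y t\<close> is 0, and
            on the exceptional event it is still bounded by \<open>K\<close>. Elsewhere
            \<open>D t\<close> is within \<epsilon> of its Euler sum, which splits into drift and
            noise.\<close>
          have est: "\<phi> t \<le> K\<^sup>2 * (C * t) ^ Suc k / fact (Suc k) + 2 * \<epsilon>\<^sup>2 + K\<^sup>2 * prob {\<omega> \<in> space M. \<epsilon> < \<bar>S m \<omega> - D t \<omega>\<bar>}"
            if m: "0 < m" and \<epsilon>: "0 < \<epsilon>" for m \<epsilon>
          proof -
            let ?E = "{\<omega> \<in> space M. \<epsilon> < \<bar>S m \<omega> - D t \<omega>\<bar>}"
            have [measurable]: "?E \<in> events"
              using Q_pos[OF t] by measurable
            have "\<phi> t \<le> (\<integral>\<omega>. 4 * (U m \<omega>)\<^sup>2 + 4 * \<beta>\<^sup>2 * (V m \<omega>)\<^sup>2 + 2 * \<epsilon>\<^sup>2 + K\<^sup>2 * indicator ?E \<omega> \<partial>M)"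
              unfolding \<phi>_def
            proof (rule integral_mono[OF Y2_int[OF t]])
              show "integrable M (\<lambda>\<omega>. 4 * (U m \<omega>)\<^sup>2 + 4 * \<beta>\<^sup>2 * (V m \<omega>)\<^sup>2 + 2 * \<epsilon>\<^sup>2 + K\<^sup>2 * indicator ?E \<omega>)"
                using U2_int V2[OF m] by (intro Bochner_Integration.integrable_add integrable_mult_right integrable_real_indicator)
                  (auto simp: emeasure_eq_measure)
              fix \<omega> assume \<omega>: "\<omega> \<in> space M"
              show "(Y t \<omega>)\<^sup>2 \<le> 4 * (U m \<omega>)\<^sup>2 + 4 * \<beta>\<^sup>2 * (V m \<omega>)\<^sup>2 + 2 * \<epsilon>\<^sup>2 + K\<^sup>2 * indicator ?E \<omega>"
              proof (cases "\<omega> \<in> A t \<and> \<omega> \<notin> ?E")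
                case True
                then have "\<bar>S m \<omega> - D t \<omega>\<bar> \<le> \<epsilon>" using \<omega> by auto
                then have "(D t \<omega> - S m \<omega>)\<^sup>2 \<le> \<epsilon>\<^sup>2"
                  using \<epsilon> by (metis abs_le_square_iff abs_minus_commute abs_of_pos)
                moreover have "(Y t \<omega>)\<^sup>2 \<le> 2 * (S m \<omega>)\<^sup>2 + 2 * (D t \<omega> - S m \<omega>)\<^sup>2"
                  using True sum_squares_bound[of "S m \<omega>" "D t \<omega> - S m \<omega>"] by (simp add: Y_def power2_eq_square algebra_simps)
                moreover have "(S m \<omega>)\<^sup>2 \<le> 2 * (U m \<omega>)\<^sup>2 + 2 * (\<beta> * V m \<omega>)\<^sup>2"
                  using True sum_squares_bound[of "U m \<omega>" "\<beta> * V m \<omega>"] by (simp add: S_eq power2_eq_square algebra_simps)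
                moreover have "0 \<le> K\<^sup>2 * (indicator ?E \<omega> :: real)"
                  by (intro mult_nonneg_nonneg) auto
                ultimately show ?thesis
                  unfolding power_mult_distrib by linarith
              next
                case False
                have "0 \<le> (U m \<omega>)\<^sup>2" "0 \<le> \<beta>\<^sup>2 * (V m \<omega>)\<^sup>2" "0 \<le> \<epsilon>\<^sup>2" "0 \<le> K\<^sup>2"
                  by auto
                moreover have "(Y t \<omega>)\<^sup>2 \<le> K\<^sup>2 * indicator ?E \<omega>"
                  using False Y2_bound[OF t, of \<omega>] by (cases "\<omega> \<in> ?E") (auto simp: Y_def)
                ultimately show ?thesis by linarith
              qed
            qed
            also have "\<dots> = 4 * (\<integral>\<omega>. (U m \<omega>)\<^sup>2 \<partial>M) + 4 * \<beta>\<^sup>2 * (\<integral>\<omega>. (V m \<omega>)\<^sup>2 \<partial>M) + 2 * \<epsilon>\<^sup>2 + K\<^sup>2 * prob ?E"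
            proof -
              have "integrable M (indicator ?E :: 'a \<Rightarrow> real)"
                by (intro integrable_real_indicator) (auto simp: emeasure_eq_measure)
              then show ?thesis
                using U2_int[of m] conjunct1[OF V2[OF m]] \<open>?E \<in> events\<close>
                by (simp add: prob_space)
            qed
            also have "\<dots> \<le> 4 * ((\<mu> * (t / real m))\<^sup>2 * (real m * (\<Sum>i<m. \<phi> (g m i)))) +
                4 * \<beta>\<^sup>2 * ((t / real m) * (\<Sum>i<m. \<phi> (g m i))) + 2 * \<epsilon>\<^sup>2 + K\<^sup>2 * prob ?E"
              using U2_exp[of m] V2[OF m] by simp
            also have "\<dots> = 4 * (\<mu>\<^sup>2 * t + \<beta>\<^sup>2) * ((t / real m) * (\<Sum>i<m. \<phi> (g m i))) + 2 * \<epsilon>\<^sup>2 + K\<^sup>2 * prob ?E"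
              using m by (simp add: field_simps power2_eq_square)
            also have "4 * (\<mu>\<^sup>2 * t + \<beta>\<^sup>2) * ((t / real m) * (\<Sum>i<m. \<phi> (g m i))) \<le> C * (K\<^sup>2 * C ^ k * t ^ Suc k / fact (Suc k))"
            proof (rule mult_mono)
              show "4 * (\<mu>\<^sup>2 * t + \<beta>\<^sup>2) \<le> C"
                unfolding C_def using Q_pos[OF t] by (simp add: mult_left_mono)
              show "0 \<le> (t / real m) * (\<Sum>i<m. \<phi> (g m i))"
                using tpos by (intro mult_nonneg_nonneg sum_nonneg) (auto simp: \<phi>_def)
            qed (use C sum_bound[OF m] in auto)
            finally show ?thesis
              by (simp add: power_mult_distrib ac_simps)
          qed
          have le_eps: "\<phi> t \<le> K\<^sup>2 * (C * t) ^ Suc k / fact (Suc k) + 2 * \<epsilon>\<^sup>2" if \<epsilon>: "0 < \<epsilon>" for \<epsilon>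
          proof (rule tendsto_lowerbound)
            have "(\<lambda>m. prob {\<omega> \<in> space M. \<epsilon> < \<bar>S m \<omega> - D t \<omega>\<bar>}) \<longlonglongrightarrow> 0"
              using lim[OF tpos] \<epsilon> unfolding tendsto_prob_def S_def g_def by blast
            then have "(\<lambda>m. K\<^sup>2 * (C * t) ^ Suc k / fact (Suc k) + 2 * \<epsilon>\<^sup>2 + K\<^sup>2 * prob {\<omega> \<in> space M. \<epsilon> < \<bar>S m \<omega> - D t \<omega>\<bar>})
                \<longlonglongrightarrow> K\<^sup>2 * (C * t) ^ Suc k / fact (Suc k) + 2 * \<epsilon>\<^sup>2 + K\<^sup>2 * 0"
              by (intro tendsto_intros)
            then show "(\<lambda>m. K\<^sup>2 * (C * t) ^ Suc k / fact (Suc k) + 2 * \<epsilon>\<^sup>2 + K\<^sup>2 * prob {\<omega> \<in> space M. \<epsilon> < \<bar>S m \<omega> - D t \<omega>\<bar>})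
                \<longlonglongrightarrow> K\<^sup>2 * (C * t) ^ Suc k / fact (Suc k) + 2 * \<epsilon>\<^sup>2"
              by simp
            show "\<forall>\<^sub>F m in sequentially. \<phi> t \<le> K\<^sup>2 * (C * t) ^ Suc k / fact (Suc k) + 2 * \<epsilon>\<^sup>2 +
                K\<^sup>2 * prob {\<omega> \<in> space M. \<epsilon> < \<bar>S m \<omega> - D t \<omega>\<bar>}"
              using eventually_gt_at_top[of 0] by eventually_elim (rule est[OF _ \<epsilon>])
          qed simp
          show ?thesis
          proof (rule field_le_epsilon)
            fix e :: real assume "0 < e"
            then show "\<phi> t \<le> K\<^sup>2 * (C * t) ^ Suc k / fact (Suc k) + e"
              using le_eps[of "sqrt (e / 2)"] by simp
          qed
        qed
      qed
    qed
    have "(\<lambda>k. K\<^sup>2 * (inverse (fact k) * (C * T) ^ k)) \<longlonglongrightarrow> K\<^sup>2 * 0"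
      by (intro tendsto_intros summable_LIMSEQ_zero summable_exp)
    moreover have "\<phi> T \<le> K\<^sup>2 * (inverse (fact k) * (C * T) ^ k)" for k
      using bspec[OF bound[of k] QT] by (simp add: divide_inverse mult.commute mult.left_commute)
    ultimately have "\<phi> T \<le> 0"
      by (intro LIMSEQ_le_const[of _ 0 "\<phi> T"]) auto
    then have "(\<integral>\<omega>. (Y T \<omega>)\<^sup>2 \<partial>M) = 0"
      unfolding \<phi>_def by (intro antisym) auto
    then have "AE \<omega> in M. (Y T \<omega>)\<^sup>2 = 0"
      using integral_nonneg_eq_0_iff_AE[OF Y2_int[OF QT]] by simp
    then show ?thesis
      using AE_space
    proof eventually_elim
      case (elim \<omega>)
      then show ?case by (auto simp: Y_def A_def indicator_def split: if_splits)
    qed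
  qed
  \<comment> \<open>A continuous path is bounded on \<open>{0..T}\<close>, so some integer cutoff
    does not act on it.\<close>
  have "AE \<omega> in M. \<forall>n::nat. (\<forall>s\<in>Q. \<bar>D s \<omega>\<bar> \<le> real n) \<longrightarrow> D T \<omega> = 0"
    unfolding AE_all_countable using zero_K by simp
  then show ?thesis
    using cont
  proof eventually_elim
    case (elim \<omega>)
    have "bounded ((\<lambda>t. D t \<omega>) ` {0..T})"
      by (intro compact_imp_bounded compact_continuous_image continuous_on_subset[OF elim(2)]) auto
    then obtain c where c: "\<forall>x\<in>(\<lambda>t. D t \<omega>) ` {0..T}. norm x \<le> c"
      unfolding bounded_iff by blast
    obtain n :: nat where "c \<le> real n"
      using real_arch_simple by blast
    then have "\<forall>s\<in>Q. \<bar>D s \<omega>\<bar> \<le> real n"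
      using c Q_pos by force
    then show ?case using elim(1) by blast
  qed
qed

text \<open>\<open>Z\<close> is the limit of its own Euler sums, and so is the multiple of
  \<open>gbm\<close>; by linearity their difference satisfies the hypotheses of
  \<open>linear_equation_zero\<close>. Equality at rational times extends by continuity to all times
  off one null set, which later permits random times.\<close>

lemma linear_sde_solution:
  assumes M: "M = completion M0" and Z: "solves_sde M0 \<F> W (\<lambda>x. \<mu> * x) (\<lambda>x. \<beta> * x) z Z"
  shows "AE \<omega> in M. \<forall>t\<ge>0. Z t \<omega> = z * gbm \<mu> \<beta> t \<omega>"
proof -
  from Z have Z_F: "\<And>t. 0 \<le> t \<Longrightarrow> Z t \<in> borel_measurable (\<F> (ennreal t))"
    and Z_cont: "AE \<omega> in M. continuous_on {0..} (\<lambda>t. Z t \<omega>)"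
    and Z_0: "AE \<omega> in M. Z 0 \<omega> = z"
    and Z_int: "\<And>T. 0 \<le> T \<Longrightarrow> \<exists>I. has_ito_integral M0 \<F> W (\<lambda>t \<omega>. \<beta> * Z t \<omega>) T I \<and>
        (AE \<omega> in M. Z T \<omega> = z + (LBINT t:{0..T}. \<mu> * Z t \<omega>) + I \<omega>)"
    unfolding solves_sde_def M by (auto simp: AE_completion_iff)
  define D where "D t \<omega> = Z t \<omega> - z * gbm \<mu> \<beta> t \<omega>" for t \<omega>
  have ZM: "Z t \<in> borel_measurable M" if "0 \<le> t" for t
    using F_measurable[OF Z_F[OF that]] .
  have D_cont: "AE \<omega> in M. continuous_on {0..} (\<lambda>t. D t \<omega>)"
    using Z_cont gbm_continuous[of \<mu> \<beta>]
    by eventually_elim (auto simp: D_def intro!: continuous_intros)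
  have zero: "AE \<omega> in M. D T \<omega> = 0" if "0 < T" for T
  proof (rule linear_equation_zero[OF _ D_cont _ _ that])
    show "D t \<in> borel_measurable (\<F> (ennreal t))" if "0 \<le> t" for t
      unfolding D_def using Z_F[OF that] gbm_adapted[OF that order_refl] by simp
    show "AE \<omega> in M. D 0 \<omega> = 0"
      using Z_0 gbm_0[of \<mu> \<beta>] by eventually_elim (simp add: D_def)
    fix T :: real assume T: "0 < T"
    then obtain I where I: "has_ito_integral M0 \<F> W (\<lambda>t \<omega>. \<beta> * Z t \<omega>) T I"
      "AE \<omega> in M. Z T \<omega> = z + (LBINT t:{0..T}. \<mu> * Z t \<omega>) + I \<omega>"
      using Z_int[of T] by auto
    have IM: "I \<in> borel_measurable M"
      using I(1) by (simp add: has_ito_integral_def M)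
    define g where "g m i = real i * T / real m" for m i
    have g: "0 \<le> g m i" for m i
      using T by (simp add: g_def)
    have drift: "tendsto_prob (\<lambda>m \<omega>. \<Sum>i<m. \<mu> * Z (g m i) \<omega> * (T / real m)) (\<lambda>\<omega>. Z T \<omega> - z - I \<omega>)"
    proof (rule tendsto_prob_of_AE)
      show "AE \<omega> in M. (\<lambda>m. \<Sum>i<m. \<mu> * Z (g m i) \<omega> * (T / real m)) \<longlonglongrightarrow> Z T \<omega> - z - I \<omega>"
        using I(2) Z_cont
      proof eventually_elim
        case (elim \<omega>)
        have "continuous_on {0..T} (\<lambda>t. \<mu> * Z t \<omega>)"
          by (intro continuous_intros continuous_on_subset[OF elim(2)]) auto
        from riemann_sums_tendsto_integral[OF T this] show ?case
          using elim(1) by (simp add: g_def)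
      qed
      show "(\<lambda>\<omega>. \<Sum>i<m. \<mu> * Z (g m i) \<omega> * (T / real m)) \<in> borel_measurable M" for m
        using g by (intro borel_measurable_sum borel_measurable_times borel_measurable_const ZM)
    qed (use T in \<open>auto intro!: borel_measurable_diff ZM IM\<close>)
    have noise: "tendsto_prob (\<lambda>m \<omega>. \<Sum>i<m. \<beta> * Z (g m i) \<omega> * (W (g m (Suc i)) \<omega> - W (g m i) \<omega>)) I"
      unfolding g_def
    proof (rule ito_integral_riemann_sums[OF M I(1) T])
      show "AE \<omega> in M. continuous_on {0..T} (\<lambda>s. \<beta> * Z s \<omega>)"
        using Z_cont by eventually_elim (auto intro!: continuous_intros intro: continuous_on_subset)
    qed
    have solution: "tendsto_prob (\<lambda>m \<omega>. (- z) * (\<Sum>i<m. gbm \<mu> \<beta> (g m i) \<omega> *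
        (\<mu> * (T / real m) + \<beta> * (W (g m (Suc i)) \<omega> - W (g m i) \<omega>))))
        (\<lambda>\<omega>. (- z) * (gbm \<mu> \<beta> T \<omega> - gbm \<mu> \<beta> 0 \<omega>))"
      unfolding g_def by (rule tendsto_prob_cmult[OF gbm_euler_sums[OF T]])
    have m1: "(\<lambda>\<omega>. \<Sum>i<m. \<mu> * Z (g m i) \<omega> * (T / real m)) \<in> borel_measurable M" for m
      using g by (intro borel_measurable_sum borel_measurable_times borel_measurable_const ZM)
    have m2: "(\<lambda>\<omega>. \<Sum>i<m. \<beta> * Z (g m i) \<omega> * (W (g m (Suc i)) \<omega> - W (g m i) \<omega>)) \<in> borel_measurable M" for m
      using g by (intro borel_measurable_sum borel_measurable_times borel_measurable_const borel_measurable_diff ZM W_borel)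
    have m3: "(\<lambda>\<omega>. (- z) * (\<Sum>i<m. gbm \<mu> \<beta> (g m i) \<omega> *
        (\<mu> * (T / real m) + \<beta> * (W (g m (Suc i)) \<omega> - W (g m i) \<omega>)))) \<in> borel_measurable M" for m
      using g by (intro borel_measurable_sum borel_measurable_times borel_measurable_add borel_measurable_const
          borel_measurable_diff gbm_borel W_borel)
    have m4: "(\<lambda>\<omega>. Z T \<omega> - z - I \<omega>) \<in> borel_measurable M"
      "(\<lambda>\<omega>. (- z) * (gbm \<mu> \<beta> T \<omega> - gbm \<mu> \<beta> 0 \<omega>)) \<in> borel_measurable M"
      using T by (auto intro!: borel_measurable_times borel_measurable_diff ZM IM gbm_borel)
    note tendsto_prob_add[OF borel_measurable_add[OF m1 m2] borel_measurable_add[OF m4(1) IM] m3 m4(2)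
      tendsto_prob_add[OF m1 m4(1) m2 IM drift noise] solution]
    moreover have "((\<Sum>i<m. \<mu> * Z (g m i) \<omega> * (T / real m)) +
        (\<Sum>i<m. \<beta> * Z (g m i) \<omega> * (W (g m (Suc i)) \<omega> - W (g m i) \<omega>))) + (- z) * (\<Sum>i<m. gbm \<mu> \<beta> (g m i) \<omega> *
        (\<mu> * (T / real m) + \<beta> * (W (g m (Suc i)) \<omega> - W (g m i) \<omega>))) =
        (\<Sum>i<m. D (g m i) \<omega> * (\<mu> * (T / real m) + \<beta> * (W (g m (Suc i)) \<omega> - W (g m i) \<omega>)))" for m \<omega>
      unfolding sum_distrib_left sum.distrib[symmetric] by (intro sum.cong refl) (simp add: D_def algebra_simps)
    ultimately have "tendsto_prob (\<lambda>m \<omega>. \<Sum>i<m. D (g m i) \<omega> * (\<mu> * (T / real m) + \<beta> * (W (g m (Suc i)) \<omega> - W (g m i) \<omega>)))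
        (\<lambda>\<omega>. (Z T \<omega> - z - I \<omega> + I \<omega>) + (- z) * (gbm \<mu> \<beta> T \<omega> - gbm \<mu> \<beta> 0 \<omega>))"
      by simp
    moreover have "AE \<omega> in M. (Z T \<omega> - z - I \<omega> + I \<omega>) + (- z) * (gbm \<mu> \<beta> T \<omega> - gbm \<mu> \<beta> 0 \<omega>) = D T \<omega>"
      using gbm_0[of \<mu> \<beta>] by eventually_elim (simp add: D_def algebra_simps)
    ultimately show "tendsto_prob (\<lambda>m \<omega>. \<Sum>i<m. D (real i * T / real m) \<omega> *
      (\<mu> * (T / real m) + \<beta> * (W (real (Suc i) * T / real m) \<omega> - W (real i * T / real m) \<omega>))) (D T)"
      unfolding g_def[symmetric]
    proof (rule tendsto_prob_AE_limit[rotated 3])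
      have DM: "D t \<in> borel_measurable M" if "0 \<le> t" for t
        unfolding D_def using that by (intro borel_measurable_diff borel_measurable_times borel_measurable_const ZM gbm_borel)
      then show "D T \<in> borel_measurable M" using T by simp
      show "(\<lambda>\<omega>. \<Sum>i<m. D (g m i) \<omega> * (\<mu> * (T / real m) + \<beta> * (W (g m (Suc i)) \<omega> - W (g m i) \<omega>))) \<in> borel_measurable M" for m
        using g by (intro borel_measurable_sum borel_measurable_times borel_measurable_add borel_measurable_diff
            borel_measurable_const DM W_borel)
    qed (use T in \<open>auto intro!: borel_measurable_times borel_measurable_diff ZM IM gbm_borel\<close>)
  qed
  have "AE \<omega> in M. \<forall>q::rat. 0 < real_of_rat q \<longrightarrow> D (real_of_rat q) \<omega> = 0"
    unfolding AE_all_countable using zero by auto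
  then show ?thesis
    using D_cont
  proof eventually_elim
    case (elim \<omega>)
    have "D t \<omega> = 0" if "0 \<le> t" for t
    proof -
      let ?S = "{0<..} \<inter> range real_of_rat"
      have "{0<..} \<inter> closure \<rat> \<subseteq> closure ({0<..} \<inter> (\<rat> :: real set))"
        by (rule open_Int_closure_subset) simp
      then have "{0<..} \<subseteq> closure ?S"
        by (simp add: Rats_closure_real flip: Rats_def)
      then have "closure {0<..} \<subseteq> closure ?S"
        by (rule closure_minimal) simp
      moreover have "closure ?S \<subseteq> {0..}"
        by (rule closure_minimal) auto
      ultimately have dense: "closure ?S = {0..}"
        by simp
      show ?thesis
        by (rule continuous_constant_on_closure[of ?S "\<lambda>t. D t \<omega>"]) (use elim that dense in auto)
    qed
    then show ?case by (simp add: D_def)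
  qed
qed

end

section \<open>Optional sampling and exit times\<close>

definition dyadic_ceil :: "nat \<Rightarrow> real \<Rightarrow> real" where
  "dyadic_ceil n t = real_of_int \<lceil>t * 2 ^ n\<rceil> / 2 ^ n"

lemma dyadic_ceil_bounds: "t \<le> dyadic_ceil n t" "dyadic_ceil n t \<le> t + 1 / 2 ^ n"
proof -
  show "t \<le> dyadic_ceil n t"
    unfolding dyadic_ceil_def by (simp add: field_simps)
  have "real_of_int \<lceil>t * 2 ^ n\<rceil> \<le> t * 2 ^ n + 1"
    by linarith
  then show "dyadic_ceil n t \<le> t + 1 / 2 ^ n"
    unfolding dyadic_ceil_def by (simp add: field_simps)
qed

lemma dyadic_ceil_tendsto: "(\<lambda>n. dyadic_ceil n t) \<longlonglongrightarrow> t"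
proof (rule tendsto_sandwich[of "\<lambda>_. t" _ _ "\<lambda>n. t + 1 / 2 ^ n"])
  show "(\<lambda>n. t + 1 / 2 ^ n) \<longlonglongrightarrow> t"
    by real_asymp
qed (auto simp: dyadic_ceil_bounds)

context brownian_basis
begin

text \<open>Holds because every subset of a null set is an event.\<close>

lemma borel_measurable_AE_eq:
  fixes f g :: "'a \<Rightarrow> 'b::topological_space"
  assumes g: "g \<in> borel_measurable M" and eq: "AE \<omega> in M. f \<omega> = g \<omega>"
  shows "f \<in> borel_measurable M"
proof (rule measurableI)
  fix B :: "'b set" assume "B \<in> sets borel"
  from eq obtain N where N: "N \<in> null_sets M" "{\<omega> \<in> space M. f \<omega> \<noteq> g \<omega>} \<subseteq> N"
    by (auto elim!: AE_E3)
  have "f -` B \<inter> space M = (g -` B \<inter> space M - N) \<union> (f -` B \<inter> space M \<inter> N)"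
    using N(2) by force
  moreover have "f -` B \<inter> space M \<inter> N \<in> events"
    using F_null[OF N(1), of "f -` B \<inter> space M \<inter> N" 0] F_events by auto
  moreover have "g -` B \<inter> space M - N \<in> events"
    using N(1) measurable_sets[OF g \<open>B \<in> sets borel\<close>] by auto
  ultimately show "f -` B \<inter> space M \<in> events"
    by (metis sets.Un)
qed simp

lemma stopping_time_le_sets:
  assumes "stopping_time \<F> \<tau>"
  shows "{\<omega> \<in> space M. \<tau> \<omega> \<le> ennreal t} \<in> sets (\<F> (ennreal t))"
  using stopping_timeD[OF assms, of "ennreal t"] by (simp add: pred_def space_F)

text \<open>Sampling at the dyadic times just above \<open>\<tau>\<close> reduces the claim to sums of expectations;
  Fatou's lemma and path continuity give the limit.\<close>

lemma
  assumes X: "\<And>t. 0 \<le> t \<Longrightarrow> X t \<in> borel_measurable (\<F> (ennreal t))"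
    and int: "\<And>t. 0 \<le> t \<Longrightarrow> integrable M (X t)"
    and nonneg: "\<And>t \<omega>. 0 \<le> t \<Longrightarrow> \<omega> \<in> space M \<Longrightarrow> 0 \<le> X t \<omega>"
    and cont: "AE \<omega> in M. continuous_on {0..} (\<lambda>t. X t \<omega>)"
    and super: "\<And>s t A. 0 \<le> s \<Longrightarrow> s \<le> t \<Longrightarrow> A \<in> sets (\<F> (ennreal s)) \<Longrightarrow>
      (\<integral>\<omega>. indicator A \<omega> * X t \<omega> \<partial>M) \<le> (\<integral>\<omega>. indicator A \<omega> * X s \<omega> \<partial>M)"
    and \<tau>: "stopping_time \<F> \<tau>"
  shows optional_sampling_le: "(\<integral>\<^sup>+\<omega>. ennreal (if \<tau> \<omega> = \<infinity> then 0 else X (enn2real (\<tau> \<omega>)) \<omega>) \<partial>M) \<le> ennreal (\<integral>\<omega>. X 0 \<omega> \<partial>M)"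
    and stopped_measurable: "(\<lambda>\<omega>. ennreal (if \<tau> \<omega> = \<infinity> then 0 else X (enn2real (\<tau> \<omega>)) \<omega>)) \<in> borel_measurable M"
proof -
  have XM [measurable]: "X t \<in> borel_measurable M" if "0 \<le> t" for t
    using F_measurable[OF X[OF that]] .
  define h where "h n k = real k / 2 ^ n" for n k :: nat
  define L where "L n k = {\<omega> \<in> space M. \<tau> \<omega> \<le> ennreal (h n k)}" for n k
  \<comment> \<open>The event that \<open>\<tau>\<close>, rounded up to the dyadic grid, equals
    \<open>h n k\<close>; for \<open>k = 0\<close> this means stopping at once.\<close>
  define A where "A n k = (if k = 0 then L n 0 else L n k - L n (k - 1))" for n k
  have h: "0 \<le> h n k" "k \<le> l \<Longrightarrow> h n k \<le> h n l" for n k l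
    by (auto simp: h_def divide_right_mono)
  have L_F: "L n k \<in> sets (\<F> (ennreal (h n k)))" for n k
    unfolding L_def by (rule stopping_time_le_sets[OF \<tau>])
  have L_M [measurable]: "L n k \<in> events" for n k
    using L_F F_events by blast
  have A_M [measurable]: "A n k \<in> events" for n k
    unfolding A_def by simp
  have Xh [measurable]: "X (h n k) \<in> borel_measurable M" for n k
    by (rule XM[OF h(1)])
  have ind_int: "integrable M (\<lambda>\<omega>. indicator B \<omega> * X (h n k) \<omega>)" if "B \<in> events" for B n k
    using integrable_real_mult_indicator[OF that int[OF h(1)]] by (simp add: mult.commute)
  \<comment> \<open>The part not stopped by \<open>h n N\<close> is carried along at time
    \<open>h n N\<close>. In the induction step the two new terms combine to this part evaluated at
    the next grid time, which the supermartingale inequality bounds by its present value.\<close>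
  have partial: "(\<Sum>k\<le>N. \<integral>\<omega>. indicator (A n k) \<omega> * X (h n k) \<omega> \<partial>M) +
      (\<integral>\<omega>. indicator (space M - L n N) \<omega> * X (h n N) \<omega> \<partial>M) \<le> (\<integral>\<omega>. X 0 \<omega> \<partial>M)" for n N
  proof (induction N)
    case 0
    have "(\<integral>\<omega>. indicator (A n 0) \<omega> * X (h n 0) \<omega> \<partial>M) + (\<integral>\<omega>. indicator (space M - L n 0) \<omega> * X (h n 0) \<omega> \<partial>M) =
        (\<integral>\<omega>. indicator (A n 0) \<omega> * X (h n 0) \<omega> + indicator (space M - L n 0) \<omega> * X (h n 0) \<omega> \<partial>M)"
      by (rule Bochner_Integration.integral_add[symmetric]) (auto intro!: ind_int)
    also have "\<dots> = (\<integral>\<omega>. X 0 \<omega> \<partial>M)"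
      by (rule Bochner_Integration.integral_cong) (auto simp: A_def h_def indicator_def)
    finally show ?case by simp
  next
    case (Suc N)
    have "(\<integral>\<omega>. indicator (A n (Suc N)) \<omega> * X (h n (Suc N)) \<omega> \<partial>M) +
        (\<integral>\<omega>. indicator (space M - L n (Suc N)) \<omega> * X (h n (Suc N)) \<omega> \<partial>M) =
        (\<integral>\<omega>. indicator (A n (Suc N)) \<omega> * X (h n (Suc N)) \<omega> + indicator (space M - L n (Suc N)) \<omega> * X (h n (Suc N)) \<omega> \<partial>M)"
      by (rule Bochner_Integration.integral_add[symmetric]) (auto intro!: ind_int)
    also have "\<dots> = (\<integral>\<omega>. indicator (space M - L n N) \<omega> * X (h n (Suc N)) \<omega> \<partial>M)"
    proof (rule Bochner_Integration.integral_cong)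
      fix \<omega> assume "\<omega> \<in> space M"
      have "L n N \<subseteq> L n (Suc N)"
        unfolding L_def using h(2)[of N "Suc N" n] by (auto intro: order_trans ennreal_leI)
      then show "indicator (A n (Suc N)) \<omega> * X (h n (Suc N)) \<omega> + indicator (space M - L n (Suc N)) \<omega> * X (h n (Suc N)) \<omega> =
          indicator (space M - L n N) \<omega> * X (h n (Suc N)) \<omega>"
        using \<open>\<omega> \<in> space M\<close> by (auto simp: A_def indicator_def)
    qed simp
    also have "\<dots> \<le> (\<integral>\<omega>. indicator (space M - L n N) \<omega> * X (h n N) \<omega> \<partial>M)"
    proof (rule super)
      show "space M - L n N \<in> sets (\<F> (ennreal (h n N)))"
        using sets.compl_sets[OF L_F[of n N]] by (simp add: space_F)
    qed (auto simp: h)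
    finally show ?case
      using Suc by simp
  qed
  have dyadic: "(\<integral>\<^sup>+\<omega>. (\<Sum>k. ennreal (indicator (A n k) \<omega> * X (h n k) \<omega>)) \<partial>M) \<le> ennreal (\<integral>\<omega>. X 0 \<omega> \<partial>M)" for n
  proof -
    have term_nonneg: "0 \<le> (\<integral>\<omega>. indicator B \<omega> * X (h n k) \<omega> \<partial>M)" for B k
      using nonneg[OF h(1)] by (intro integral_nonneg_AE) (auto intro!: AE_I2)
    have "(\<integral>\<^sup>+\<omega>. (\<Sum>k. ennreal (indicator (A n k) \<omega> * X (h n k) \<omega>)) \<partial>M) =
        (\<Sum>k. \<integral>\<^sup>+\<omega>. ennreal (indicator (A n k) \<omega> * X (h n k) \<omega>) \<partial>M)"
      by (rule nn_integral_suminf) measurable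
    also have "\<dots> = (\<Sum>k. ennreal (\<integral>\<omega>. indicator (A n k) \<omega> * X (h n k) \<omega> \<partial>M))"
      using nonneg[OF h(1)] by (intro suminf_cong nn_integral_eq_integral ind_int) (auto intro!: AE_I2)
    also have "\<dots> \<le> ennreal (\<integral>\<omega>. X 0 \<omega> \<partial>M)"
    proof (rule suminf_le_const)
      fix N
      have "(\<Sum>k<N. ennreal (\<integral>\<omega>. indicator (A n k) \<omega> * X (h n k) \<omega> \<partial>M)) \<le>
          (\<Sum>k\<le>N. ennreal (\<integral>\<omega>. indicator (A n k) \<omega> * X (h n k) \<omega> \<partial>M))"
        by (rule sum_mono2) auto
      also have "\<dots> = ennreal (\<Sum>k\<le>N. \<integral>\<omega>. indicator (A n k) \<omega> * X (h n k) \<omega> \<partial>M)"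
        by (rule sum_ennreal) (rule term_nonneg)
      also have "\<dots> \<le> ennreal (\<integral>\<omega>. X 0 \<omega> \<partial>M)"
        using partial[of n N] term_nonneg[of "space M - L n N" N] by (intro ennreal_leI) simp
      finally show "(\<Sum>k<N. ennreal (\<integral>\<omega>. indicator (A n k) \<omega> * X (h n k) \<omega> \<partial>M)) \<le> ennreal (\<integral>\<omega>. X 0 \<omega> \<partial>M)" .
    qed simp
    finally show ?thesis .
  qed
  have sampled: "(\<Sum>k. ennreal (indicator (A n k) \<omega> * X (h n k) \<omega>)) =
      ennreal (if \<tau> \<omega> = \<infinity> then 0 else X (dyadic_ceil n (enn2real (\<tau> \<omega>))) \<omega>)" if \<omega>: "\<omega> \<in> space M" for n \<omega>
  proof (cases "\<tau> \<omega>")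
    case top
    then have "indicator (A n k) \<omega> = (0::real)" for k
      by (auto simp: A_def L_def indicator_def top_unique)
    then show ?thesis using top by simp
  next
    case (real t)
    define k0 where "k0 = nat \<lceil>t * 2 ^ n\<rceil>"
    have c: "0 \<le> \<lceil>t * 2 ^ n\<rceil>"
      using real by (simp add: order_less_le_trans[of "-1" 0])
    then have hk: "h n k0 = dyadic_ceil n t"
      by (simp add: h_def dyadic_ceil_def k0_def)
    have L_iff: "\<omega> \<in> L n k \<longleftrightarrow> k0 \<le> k" for k
    proof -
      have "\<omega> \<in> L n k \<longleftrightarrow> t \<le> h n k"
        using \<omega> real h(1)[of n k] by (simp add: L_def)
      also have "\<dots> \<longleftrightarrow> t * 2 ^ n \<le> real k"
        by (simp add: h_def field_simps)
      also have "\<dots> \<longleftrightarrow> \<lceil>t * 2 ^ n\<rceil> \<le> int k"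
        by (simp add: ceiling_le_iff)
      finally show ?thesis by (simp add: k0_def nat_le_iff)
    qed
    have A_iff: "\<omega> \<in> A n k \<longleftrightarrow> k = k0" for k
      using L_iff[of k] L_iff[of "k - 1"] L_iff[of 0] by (auto simp: A_def)
    have "(\<Sum>k. ennreal (indicator (A n k) \<omega> * X (h n k) \<omega>)) = (\<Sum>k\<in>{k0}. ennreal (indicator (A n k) \<omega> * X (h n k) \<omega>))"
      by (rule suminf_finite) (auto simp: A_iff)
    then show ?thesis
      using real hk by (simp add: A_iff)
  qed
  have limit: "AE \<omega> in M. ennreal (if \<tau> \<omega> = \<infinity> then 0 else X (enn2real (\<tau> \<omega>)) \<omega>) =
      liminf (\<lambda>n. \<Sum>k. ennreal (indicator (A n k) \<omega> * X (h n k) \<omega>))"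
    using cont AE_space
  proof eventually_elim
    case (elim \<omega>)
    have "(\<lambda>n. ennreal (if \<tau> \<omega> = \<infinity> then 0 else X (dyadic_ceil n (enn2real (\<tau> \<omega>))) \<omega>)) \<longlonglongrightarrow>
        ennreal (if \<tau> \<omega> = \<infinity> then 0 else X (enn2real (\<tau> \<omega>)) \<omega>)"
    proof (cases "\<tau> \<omega> = \<infinity>")
      case False
      have "(\<lambda>n. X (dyadic_ceil n (enn2real (\<tau> \<omega>))) \<omega>) \<longlonglongrightarrow> X (enn2real (\<tau> \<omega>)) \<omega>"
        by (rule continuous_on_tendsto_compose[OF elim(1) dyadic_ceil_tendsto])
          (auto intro!: always_eventually order_trans[OF enn2real_nonneg dyadic_ceil_bounds(1)])
      then show ?thesis using False by (simp add: tendsto_ennrealI)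
    qed simp
    then have "liminf (\<lambda>n. ennreal (if \<tau> \<omega> = \<infinity> then 0 else X (dyadic_ceil n (enn2real (\<tau> \<omega>))) \<omega>)) =
        ennreal (if \<tau> \<omega> = \<infinity> then 0 else X (enn2real (\<tau> \<omega>)) \<omega>)"
      by (intro lim_imp_Liminf) auto
    then show ?case
      unfolding sampled[OF elim(2)] by simp
  qed
  have "(\<lambda>\<omega>. liminf (\<lambda>n. \<Sum>k. ennreal (indicator (A n k) \<omega> * X (h n k) \<omega>))) \<in> borel_measurable M"
    by measurable
  then show "(\<lambda>\<omega>. ennreal (if \<tau> \<omega> = \<infinity> then 0 else X (enn2real (\<tau> \<omega>)) \<omega>)) \<in> borel_measurable M"
    using limit by (rule borel_measurable_AE_eq)
  have "(\<integral>\<^sup>+\<omega>. ennreal (if \<tau> \<omega> = \<infinity> then 0 else X (enn2real (\<tau> \<omega>)) \<omega>) \<partial>M) =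
      (\<integral>\<^sup>+\<omega>. liminf (\<lambda>n. \<Sum>k. ennreal (indicator (A n k) \<omega> * X (h n k) \<omega>)) \<partial>M)"
    by (rule nn_integral_cong_AE[OF limit])
  also have "\<dots> \<le> liminf (\<lambda>n. \<integral>\<^sup>+\<omega>. (\<Sum>k. ennreal (indicator (A n k) \<omega> * X (h n k) \<omega>)) \<partial>M)"
    by (rule nn_integral_liminf) measurable
  also have "\<dots> \<le> ennreal (\<integral>\<omega>. X 0 \<omega> \<partial>M)"
    by (rule Liminf_le) (auto intro!: always_eventually dyadic)
  finally show "(\<integral>\<^sup>+\<omega>. ennreal (if \<tau> \<omega> = \<infinity> then 0 else X (enn2real (\<tau> \<omega>)) \<omega>) \<partial>M) \<le> ennreal (\<integral>\<omega>. X 0 \<omega> \<partial>M)" .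
qed

section \<open>Power martingales and the exit from an interval\<close>

definition gbm_martingale :: "real \<Rightarrow> real \<Rightarrow> real \<Rightarrow> real \<Rightarrow> 'a \<Rightarrow> real" where
  "gbm_martingale \<mu> \<beta> \<gamma> t \<omega> = exp (- gbm_rate \<mu> \<beta> \<gamma> * t) * gbm \<mu> \<beta> t \<omega> powr \<gamma>"

lemma gbm_martingale_pos: "0 < gbm_martingale \<mu> \<beta> \<gamma> t \<omega>"
  using gbm_pos[of \<mu> \<beta> t \<omega>] by (simp add: gbm_martingale_def)

lemma gbm_martingale_adapted: "0 \<le> s \<Longrightarrow> s \<le> t \<Longrightarrow> gbm_martingale \<mu> \<beta> \<gamma> s \<in> borel_measurable (\<F> (ennreal t))"
  unfolding gbm_martingale_def using gbm_adapted[of s t \<mu> \<beta>] by measurable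

lemma gbm_martingale_integrable: "0 \<le> t \<Longrightarrow> integrable M (gbm_martingale \<mu> \<beta> \<gamma> t)"
  unfolding gbm_martingale_def by (intro integrable_mult_right integrable_gbm_powr)

lemma gbm_martingale_0: "(\<integral>\<omega>. gbm_martingale \<mu> \<beta> \<gamma> 0 \<omega> \<partial>M) = 1"
  using expectation_gbm_powr[of 0 \<mu> \<beta> \<gamma>] by (simp add: gbm_martingale_def)

lemma gbm_martingale_continuous: "AE \<omega> in M. continuous_on {0..} (\<lambda>t. gbm_martingale \<mu> \<beta> \<gamma> t \<omega>)"
  using gbm_continuous[of \<mu> \<beta>]
proof eventually_elim
  case (elim \<omega>)
  show ?case
    unfolding gbm_martingale_def using gbm_pos
    by (intro continuous_intros elim) (metis less_irrefl)
qed

lemma gbm_martingale_indicator: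
  assumes "0 \<le> s" "s \<le> t" "A \<in> sets (\<F> (ennreal s))"
  shows "(\<integral>\<omega>. indicator A \<omega> * gbm_martingale \<mu> \<beta> \<gamma> t \<omega> \<partial>M) =
    (\<integral>\<omega>. indicator A \<omega> * gbm_martingale \<mu> \<beta> \<gamma> s \<omega> \<partial>M)"
proof -
  have A: "A \<in> events" using assms(3) F_events by blast
  have ind: "indicator A \<in> borel_measurable (\<F> (ennreal s))"
    using assms(3) by simp
  have int: "integrable M (\<lambda>\<omega>. indicator A \<omega> * gbm \<mu> \<beta> s \<omega> powr \<gamma>)"
    using integrable_real_mult_indicator[OF A integrable_gbm_powr[OF assms(1)]] by (simp add: mult.commute)
  have "(\<integral>\<omega>. indicator A \<omega> * gbm_martingale \<mu> \<beta> \<gamma> u \<omega> \<partial>M) =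
      exp (- gbm_rate \<mu> \<beta> \<gamma> * u) * (\<integral>\<omega>. indicator A \<omega> * gbm \<mu> \<beta> u \<omega> powr \<gamma> \<partial>M)" for u
    unfolding gbm_martingale_def by (subst integral_mult_right_zero[symmetric]) (simp add: mult.left_commute)
  then show ?thesis
    using expectation_times_gbm_powr[OF assms(1,2) ind int]
    by (simp add: mult.assoc[symmetric] exp_add[symmetric]) (simp add: algebra_simps)
qed

text \<open>Both powers have rate \<rho>, so along the path the discounted combination is a
  combination of two martingales. The signs of \<open>a\<close> and \<open>b\<close> supply the
  nonnegativity on which optional sampling at arbitrary stopping times rests.\<close>

lemma harmonic_optional_sampling:
  assumes \<tau>: "stopping_time \<F> \<tau>" and "0 \<le> a" "0 \<le> b" "0 < z"
    and "gbm_rate \<mu> \<beta> \<gamma>1 = \<rho>" "gbm_rate \<mu> \<beta> \<gamma>2 = \<rho>"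
  shows "(\<integral>\<^sup>+\<omega>. ennreal (discounted_payoff \<rho> (\<lambda>y. a * y powr \<gamma>1 + b * y powr \<gamma>2) (\<lambda>t \<omega>. z * gbm \<mu> \<beta> t \<omega>) \<tau> \<omega>) \<partial>M)
    \<le> ennreal (a * z powr \<gamma>1 + b * z powr \<gamma>2)"
proof -
  let ?X = "\<lambda>t \<omega>. a * z powr \<gamma>1 * gbm_martingale \<mu> \<beta> \<gamma>1 t \<omega> + b * z powr \<gamma>2 * gbm_martingale \<mu> \<beta> \<gamma>2 t \<omega>"
  have eq: "discounted_payoff \<rho> (\<lambda>y. a * y powr \<gamma>1 + b * y powr \<gamma>2) (\<lambda>t \<omega>. z * gbm \<mu> \<beta> t \<omega>) \<tau> \<omega> =
      (if \<tau> \<omega> = \<infinity> then 0 else ?X (enn2real (\<tau> \<omega>)) \<omega>)" for \<omega>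
    using gbm_pos[of \<mu> \<beta> "enn2real (\<tau> \<omega>)" \<omega>] \<open>0 < z\<close> assms(5,6)
    by (simp add: discounted_payoff_def gbm_martingale_def powr_mult algebra_simps)
  have "(\<integral>\<^sup>+\<omega>. ennreal (if \<tau> \<omega> = \<infinity> then 0 else ?X (enn2real (\<tau> \<omega>)) \<omega>) \<partial>M) \<le> ennreal (\<integral>\<omega>. ?X 0 \<omega> \<partial>M)"
  proof (rule optional_sampling_le[OF _ _ _ _ _ \<tau>])
    show "?X t \<in> borel_measurable (\<F> (ennreal t))" if "0 \<le> t" for t
      using gbm_martingale_adapted[OF that order_refl] by simp
    show "integrable M (?X t)" if "0 \<le> t" for t
      using gbm_martingale_integrable[OF that] by simp
    show "0 \<le> ?X t \<omega>" for t \<omega>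
      using assms(2,3) gbm_martingale_pos[of \<mu> \<beta> \<gamma>1 t \<omega>] gbm_martingale_pos[of \<mu> \<beta> \<gamma>2 t \<omega>] by simp
    show "AE \<omega> in M. continuous_on {0..} (\<lambda>t. ?X t \<omega>)"
      using gbm_martingale_continuous[of \<mu> \<beta> \<gamma>1] gbm_martingale_continuous[of \<mu> \<beta> \<gamma>2]
      by eventually_elim (intro continuous_intros)
    fix s t :: real and A assume st: "0 \<le> s" "s \<le> t" "A \<in> sets (\<F> (ennreal s))"
    have A: "A \<in> events" using st(3) F_events by blast
    have int: "integrable M (\<lambda>\<omega>. indicator A \<omega> * gbm_martingale \<mu> \<beta> \<gamma> u \<omega>)" if "0 \<le> u" for u \<gamma>
      using integrable_real_mult_indicator[OF A gbm_martingale_integrable[OF that]] by (simp add: mult.commute)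
    have "(\<integral>\<omega>. indicator A \<omega> * ?X u \<omega> \<partial>M) = a * z powr \<gamma>1 * (\<integral>\<omega>. indicator A \<omega> * gbm_martingale \<mu> \<beta> \<gamma>1 u \<omega> \<partial>M) +
        b * z powr \<gamma>2 * (\<integral>\<omega>. indicator A \<omega> * gbm_martingale \<mu> \<beta> \<gamma>2 u \<omega> \<partial>M)" if "0 \<le> u" for u
    proof -
      have "indicator A \<omega> * ?X u \<omega> = a * z powr \<gamma>1 * (indicator A \<omega> * gbm_martingale \<mu> \<beta> \<gamma>1 u \<omega>) +
          b * z powr \<gamma>2 * (indicator A \<omega> * gbm_martingale \<mu> \<beta> \<gamma>2 u \<omega>)" for \<omega>
        by (simp add: algebra_simps)
      then show ?thesis
        using int[OF that] by simp
    qed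
    then show "(\<integral>\<omega>. indicator A \<omega> * ?X t \<omega> \<partial>M) \<le> (\<integral>\<omega>. indicator A \<omega> * ?X s \<omega> \<partial>M)"
      using st gbm_martingale_indicator[OF st] by simp
  qed
  also have "(\<integral>\<omega>. ?X 0 \<omega> \<partial>M) = a * z powr \<gamma>1 + b * z powr \<gamma>2"
    using gbm_martingale_integrable[of 0 \<mu> \<beta>] by (simp add: gbm_martingale_0)
  finally show ?thesis
    unfolding eq .
qed

text \<open>The coefficients may have either sign and a lower bound is wanted, while optional
  sampling bounds nonnegative processes from above. It is therefore applied to a large constant
  minus the martingale, made nonnegative up to a horizon \<open>N\<close> by adding \<epsilon> times
  the martingales with doubled exponents. The constant cancels in the end; then \<open>N\<close>
  tends to infinity and \<epsilon> to 0.\<close>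

lemma exit_time_value:
  assumes z: "0 < z1" "z1 < z" "z < z2"
    and rate: "gbm_rate \<mu> \<beta> \<gamma>1 = \<rho>" "gbm_rate \<mu> \<beta> \<gamma>2 = \<rho>" and \<rho>: "0 < \<rho>"
    and h: "0 \<le> h z1" "0 \<le> h z2"
    and c: "c1 * z1 powr \<gamma>1 + c2 * z1 powr \<gamma>2 = h z1" "c1 * z2 powr \<gamma>1 + c2 * z2 powr \<gamma>2 = h z2"
  shows "\<exists>\<tau>. stopping_time \<F> \<tau> \<and> ennreal (c1 * z powr \<gamma>1 + c2 * z powr \<gamma>2) \<le>
    (\<integral>\<^sup>+\<omega>. ennreal (discounted_payoff \<rho> h (\<lambda>t \<omega>. z * gbm \<mu> \<beta> t \<omega>) \<tau> \<omega>) \<partial>M)"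
proof -
  define Y where "Y t \<omega> = z * gbm \<mu> \<beta> t \<omega>" for t \<omega>
  define E where "E \<omega> = {t. 0 \<le> t \<and> Y t \<omega> \<notin> {z1<..<z2}}" for \<omega>
  define \<tau> where "\<tau> \<omega> = (if E \<omega> = {} then \<infinity> else ennreal (Inf (E \<omega>)))" for \<omega>
  have Y_F: "Y s \<in> borel_measurable (\<F> (ennreal t))" if "0 \<le> s" "s \<le> t" for s t
    unfolding Y_def using gbm_adapted[OF that] by simp
  have Y_cont: "AE \<omega> in M. continuous_on {0..} (\<lambda>t. Y t \<omega>)"
    using gbm_continuous[of \<mu> \<beta>] by eventually_elim (auto simp: Y_def intro!: continuous_intros)
  have Y_0: "AE \<omega> in M. Y 0 \<omega> = z"
    using gbm_0[of \<mu> \<beta>] by eventually_elim (simp add: Y_def)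
  have E_Inf: "Inf (E \<omega>) \<in> E \<omega>" if "continuous_on {0..} (\<lambda>t. Y t \<omega>)" "E \<omega> \<noteq> {}" for \<omega>
  proof (rule closed_contains_Inf[OF that(2)])
    show "bdd_below (E \<omega>)"
      by (rule bdd_belowI[of _ 0]) (auto simp: E_def)
    have "closed ({0..} \<inter> (\<lambda>t. Y t \<omega>) -` (- {z1<..<z2}))"
      by (rule continuous_closed_preimage[OF that(1)]) (auto intro: open_greaterThanLessThan)
    moreover have "{0..} \<inter> (\<lambda>t. Y t \<omega>) -` (- {z1<..<z2}) = E \<omega>"
      by (auto simp: E_def)
    ultimately show "closed (E \<omega>)" by simp
  qed
  have E_le: "Inf (E \<omega>) \<le> t" if "t \<in> E \<omega>" for t \<omega>
    by (rule cInf_lower[OF that]) (auto simp: E_def intro!: bdd_belowI[of _ 0])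
  have \<tau>_le: "\<tau> \<omega> \<le> ennreal t \<longleftrightarrow> (\<exists>s\<in>{0..t}. Y s \<omega> \<notin> {z1<..<z2})"
    if "continuous_on {0..} (\<lambda>t. Y t \<omega>)" "0 \<le> t" for \<omega> t
  proof
    assume le: "\<tau> \<omega> \<le> ennreal t"
    then have ne: "E \<omega> \<noteq> {}" by (auto simp: \<tau>_def top_unique)
    then have "Inf (E \<omega>) \<le> t"
      using le that(2) by (simp add: \<tau>_def)
    with E_Inf[OF that(1) ne] show "\<exists>s\<in>{0..t}. Y s \<omega> \<notin> {z1<..<z2}"
      by (auto simp: E_def)
  next
    assume "\<exists>s\<in>{0..t}. Y s \<omega> \<notin> {z1<..<z2}"
    then obtain s where "s \<in> {0..t}" "Y s \<omega> \<notin> {z1<..<z2}" by blast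
    then have s: "s \<in> E \<omega>" "s \<le> t" by (simp_all add: E_def)
    then have "E \<omega> \<noteq> {}" by auto
    then show "\<tau> \<omega> \<le> ennreal t"
      using E_le[OF s(1)] s(2) by (auto simp: \<tau>_def intro!: ennreal_leI)
  qed
  \<comment> \<open>On a compact time interval a continuous path stays in the open interval iff it
    keeps a fixed distance from both ends, and this can be tested at rational times.\<close>
  have rational: "(\<exists>s\<in>{0..t}. Y s \<omega> \<notin> {z1<..<z2}) \<longleftrightarrow>
      \<not> (\<exists>n::nat. \<forall>s\<in>\<rat> \<inter> {0..t}. Y s \<omega> \<in> {z1 + 1 / Suc n..z2 - 1 / Suc n})"
    if cont: "continuous_on {0..} (\<lambda>t. Y t \<omega>)" and t: "0 \<le> t" for \<omega> t
  proof -
    have cont': "continuous_on {0..t} (\<lambda>t. Y t \<omega>)"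
      by (rule continuous_on_subset[OF cont]) auto
    have "\<forall>s\<in>{0..t}. Y s \<omega> \<in> {z1<..<z2}"
      if "\<forall>s\<in>\<rat> \<inter> {0..t}. Y s \<omega> \<in> {z1 + 1 / Suc n..z2 - 1 / Suc n}" for n :: nat
    proof -
      have "{0..t} \<subseteq> closure (\<rat> \<inter> {0..t})"
      proof (cases "t = 0")
        case True
        have "{0} \<subseteq> \<rat> \<inter> {0..0::real}" by auto
        then show ?thesis using True closure_subset by fastforce
      next
        case False
        then have "{0..t} = closure {0<..<t}" using t by simp
        also have "\<dots> \<subseteq> closure (\<rat> \<inter> {0..t})"
        proof (rule closure_minimal)
          have "{0<..<t} \<inter> closure \<rat> \<subseteq> closure ({0<..<t} \<inter> \<rat>)"
            by (rule open_Int_closure_subset) simp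
          also have "\<dots> \<subseteq> closure (\<rat> \<inter> {0..t})"
            by (rule closure_mono) auto
          finally show "{0<..<t} \<subseteq> closure (\<rat> \<inter> {0..t})"
            by (simp add: Rats_closure_real)
        qed simp
        finally show ?thesis .
      qed
      moreover have "closure (\<rat> \<inter> {0..t}) \<subseteq> {0..t}"
        by (rule closure_minimal) auto
      then have "continuous_on (closure (\<rat> \<inter> {0..t})) (\<lambda>t. Y t \<omega>)"
        by (rule continuous_on_subset[OF cont'])
      then have "(\<lambda>t. Y t \<omega>) ` closure (\<rat> \<inter> {0..t}) \<subseteq> {z1 + 1 / Suc n..z2 - 1 / Suc n}"
        by (rule image_closure_subset) (use that in auto)
      moreover have "{z1 + 1 / Suc n..z2 - 1 / Suc n} \<subseteq> {z1<..<z2}"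
      proof
        fix x assume x: "x \<in> {z1 + 1 / Suc n..z2 - 1 / Suc n}"
        have "0 < 1 / real (Suc n)" by simp
        then show "x \<in> {z1<..<z2}"
          using x unfolding atLeastAtMost_iff greaterThanLessThan_iff by linarith
      qed
      ultimately show ?thesis by blast
    qed
    moreover have "\<exists>n::nat. \<forall>s\<in>\<rat> \<inter> {0..t}. Y s \<omega> \<in> {z1 + 1 / Suc n..z2 - 1 / Suc n}"
      if inside: "\<forall>s\<in>{0..t}. Y s \<omega> \<in> {z1<..<z2}"
    proof -
      obtain a where a: "a \<in> {0..t}" "\<And>s. s \<in> {0..t} \<Longrightarrow> Y a \<omega> \<le> Y s \<omega>"
        using continuous_attains_inf[OF _ _ cont'] t by auto
      obtain b where b: "b \<in> {0..t}" "\<And>s. s \<in> {0..t} \<Longrightarrow> Y s \<omega> \<le> Y b \<omega>"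
        using continuous_attains_sup[OF _ _ cont'] t by auto
      define d where "d = min (Y a \<omega> - z1) (z2 - Y b \<omega>)"
      have "0 < d" using inside a(1) b(1) by (auto simp: d_def)
      then obtain n :: nat where "1 / Suc n < d"
        using nat_approx_posE by blast
      then have "\<forall>s\<in>\<rat> \<inter> {0..t}. Y s \<omega> \<in> {z1 + 1 / Suc n..z2 - 1 / Suc n}"
        using a(2) b(2) by (fastforce simp: d_def)
      then show ?thesis by blast
    qed
    ultimately show ?thesis by blast
  qed
  have \<tau>_stop: "stopping_time \<F> \<tau>"
    unfolding stopping_time_def
  proof
    fix t
    show "Measurable.pred (\<F> t) (\<lambda>\<omega>. \<tau> \<omega> \<le> t)"
    proof (cases t)
      case top
      then show ?thesis by simp
    next
      case (real r)
      define Q where "Q \<omega> \<longleftrightarrow> \<not> (\<exists>n::nat. \<forall>s\<in>\<rat> \<inter> {0..r}. Y s \<omega> \<in> {z1 + 1 / Suc n..z2 - 1 / Suc n})" for \<omega>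
      have "Measurable.pred (\<F> t) (\<lambda>\<omega>. \<forall>s\<in>\<rat> \<inter> {0..r}. Y s \<omega> \<in> {z1 + 1 / Suc n..z2 - 1 / Suc n})" for n
      proof (rule measurable_pred_countable(1))
        show "countable (\<rat> \<inter> {0..r})"
          using countable_rat by auto
        fix s assume "s \<in> \<rat> \<inter> {0..r}"
        then have "Y s \<in> borel_measurable (\<F> t)"
          using Y_F[of s r] real by auto
        then show "Measurable.pred (\<F> t) (\<lambda>\<omega>. Y s \<omega> \<in> {z1 + 1 / Suc n..z2 - 1 / Suc n})"
          by measurable
      qed
      then have "Measurable.pred (\<F> t) Q"
        unfolding Q_def by (intro pred_intros_logic pred_intros_countable)
      then have P: "{\<omega> \<in> space M. Q \<omega>} \<in> sets (\<F> t)"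
        by (simp add: pred_def space_F)
      \<comment> \<open>The rational description agrees with the exit time on continuous paths; the
        exceptional null set and its subsets lie in every \<open>\<F> t\<close>.\<close>
      have AE_eq: "AE \<omega> in M. (\<tau> \<omega> \<le> t) = Q \<omega>"
        using Y_cont
      proof eventually_elim
        case (elim \<omega>)
        show ?case
          unfolding Q_def \<open>t = ennreal r\<close> \<tau>_le[OF elim \<open>0 \<le> r\<close>] by (rule rational[OF elim \<open>0 \<le> r\<close>])
      qed
      obtain N where N: "\<And>\<omega>. \<omega> \<in> space M - N \<Longrightarrow> (\<tau> \<omega> \<le> t) = Q \<omega>" "N \<in> null_sets M"
        by (rule AE_E3[OF AE_eq]) (rule that)
      have "{\<omega> \<in> space M. \<tau> \<omega> \<le> t} = ({\<omega> \<in> space M. Q \<omega>} - N) \<union> ({\<omega> \<in> space M. \<tau> \<omega> \<le> t} \<inter> N)"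
        using N(1) by auto
      moreover have "{\<omega> \<in> space M. \<tau> \<omega> \<le> t} \<inter> N \<in> sets (\<F> t)" "N \<in> sets (\<F> t)"
        by (auto intro: F_null[OF N(2)])
      ultimately have "{\<omega> \<in> space M. \<tau> \<omega> \<le> t} \<in> sets (\<F> t)"
        using P sets.Un[OF sets.Diff[OF P \<open>N \<in> sets (\<F> t)\<close>] \<open>{\<omega> \<in> space M. \<tau> \<omega> \<le> t} \<inter> N \<in> sets (\<F> t)\<close>] by simp
      then show ?thesis by (simp add: pred_def space_F)
    qed
  qed
  have at_exit: "Y (enn2real (\<tau> \<omega>)) \<omega> \<in> {z1, z2}"
    if cont: "continuous_on {0..} (\<lambda>t. Y t \<omega>)" and "Y 0 \<omega> = z" "\<tau> \<omega> \<noteq> \<infinity>" for \<omega>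
  proof -
    have ne: "E \<omega> \<noteq> {}" using that by (auto simp: \<tau>_def)
    let ?T = "Inf (E \<omega>)"
    have T: "0 \<le> ?T" "Y ?T \<omega> \<notin> {z1<..<z2}"
      using E_Inf[OF cont ne] by (auto simp: E_def)
    then have "?T \<noteq> 0" using that(2) z by auto
    then have "0 < ?T" using T by simp
    have before: "Y s \<omega> \<in> {z1..z2}" if "s \<in> {0..<?T}" for s
      using E_le[of s \<omega>] that by (force simp: E_def)
    have "(\<lambda>t. Y t \<omega>) ` closure {0..<?T} \<subseteq> {z1..z2}"
      by (rule image_closure_subset) (use before \<open>0 < ?T\<close> in \<open>auto intro: continuous_on_subset[OF cont]\<close>)
    moreover have "?T \<in> closure {0..<?T}"
      using \<open>0 < ?T\<close> by simp
    ultimately have "Y ?T \<omega> \<in> {z1..z2}" by blast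
    then show ?thesis
      using T ne by (auto simp: \<tau>_def)
  qed
  let ?P = "\<lambda>\<omega>. discounted_payoff \<rho> h Y \<tau> \<omega>"
  define g where "g y = c1 * y powr \<gamma>1 + c2 * y powr \<gamma>2" for y
  \<comment> \<open>A bound for the combination on the interval: a power is monotone, hence at most
    the sum of its values at the two ends.\<close>
  define R where "R = \<bar>c1\<bar> * (z1 powr \<gamma>1 + z2 powr \<gamma>1) + \<bar>c2\<bar> * (z1 powr \<gamma>2 + z2 powr \<gamma>2)"
  have R: "0 \<le> R"
    by (auto simp: R_def intro!: add_nonneg_nonneg mult_nonneg_nonneg)
  have g_le: "g y \<le> R" if "y \<in> {z1<..<z2}" for y
  proof -
    have p: "y powr \<gamma> \<le> z1 powr \<gamma> + z2 powr \<gamma>" for \<gamma>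
    proof (cases "0 \<le> \<gamma>")
      case True
      then have "y powr \<gamma> \<le> z2 powr \<gamma>" using that z by (intro powr_mono2) auto
      then show ?thesis by (simp add: add_increasing)
    next
      case False
      then have "y powr \<gamma> \<le> z1 powr \<gamma>" using that z by (intro powr_mono2') auto
      then show ?thesis by (simp add: add_increasing2)
    qed
    have "c * y powr \<gamma> \<le> \<bar>c\<bar> * (z1 powr \<gamma> + z2 powr \<gamma>)" for c \<gamma>
      using p[of \<gamma>] by (intro mult_mono) auto
    then show ?thesis
      unfolding g_def R_def by (intro add_mono)
  qed
  define q where "q = z powr (2 * \<gamma>1) + z powr (2 * \<gamma>2)"
  have approx: "ennreal (g z - exp (- \<rho> * N) * R - \<epsilon> * q) \<le> (\<integral>\<^sup>+\<omega>. ennreal (?P \<omega>) \<partial>M)"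
    if \<epsilon>: "0 < \<epsilon>" and N: "0 < N" for \<epsilon> N
  proof -
    define n where "n \<gamma> t \<omega> = z powr \<gamma> * gbm_martingale \<mu> \<beta> \<gamma> t \<omega>" for \<gamma> t \<omega>
    \<comment> \<open>Young's inequality bounds \<open>c * n \<gamma>\<close> by a constant plus
      \<open>\<eta> \<gamma>\<close> times the square of \<open>n \<gamma>\<close>. That square is
      the martingale with exponent \<open>2 * \<gamma>\<close> up to a deterministic factor, which
      the exponential here absorbs for times up to \<open>N\<close>.\<close>
    define \<eta> where "\<eta> \<gamma> = \<epsilon> * exp (- \<bar>2 * \<rho> - gbm_rate \<mu> \<beta> (2 * \<gamma>)\<bar> * N)" for \<gamma>
    define C where "C = c1\<^sup>2 / (4 * \<eta> \<gamma>1) + c2\<^sup>2 / (4 * \<eta> \<gamma>2)"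
    define S where "S t \<omega> = \<epsilon> * (n (2 * \<gamma>1) t \<omega> + n (2 * \<gamma>2) t \<omega>) + C - (c1 * n \<gamma>1 t \<omega> + c2 * n \<gamma>2 t \<omega>)" for t \<omega>
    have n_rho: "n \<gamma> t \<omega> = exp (- \<rho> * t) * Y t \<omega> powr \<gamma>" if "gbm_rate \<mu> \<beta> \<gamma> = \<rho>" for \<gamma> t \<omega>
      using gbm_pos[of \<mu> \<beta> t \<omega>] z that by (simp add: n_def gbm_martingale_def Y_def powr_mult)
    have young: "c * n \<gamma> t \<omega> \<le> c\<^sup>2 / (4 * \<eta> \<gamma>) + \<epsilon> * n (2 * \<gamma>) t \<omega>"
      if \<gamma>: "gbm_rate \<mu> \<beta> \<gamma> = \<rho>" and t: "0 \<le> t" "t \<le> N" for c \<gamma> t \<omega>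
    proof -
      have \<eta>: "0 < \<eta> \<gamma>" using \<epsilon> by (simp add: \<eta>_def)
      have "0 \<le> (c - 2 * \<eta> \<gamma> * n \<gamma> t \<omega>)\<^sup>2 / (4 * \<eta> \<gamma>)"
        using \<eta> by simp
      also have "\<dots> = c\<^sup>2 / (4 * \<eta> \<gamma>) + \<eta> \<gamma> * (n \<gamma> t \<omega>)\<^sup>2 - c * n \<gamma> t \<omega>"
        using \<eta> by (simp add: power2_eq_square field_simps)
      finally have "c * n \<gamma> t \<omega> \<le> c\<^sup>2 / (4 * \<eta> \<gamma>) + \<eta> \<gamma> * (n \<gamma> t \<omega>)\<^sup>2" by simp
      also have "\<eta> \<gamma> * (n \<gamma> t \<omega>)\<^sup>2 \<le> \<epsilon> * n (2 * \<gamma>) t \<omega>"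
      proof -
        have "n (2 * \<gamma>) t \<omega> = exp ((2 * \<rho> - gbm_rate \<mu> \<beta> (2 * \<gamma>)) * t) * (n \<gamma> t \<omega>)\<^sup>2"
        proof -
          have "z powr (2 * \<gamma>) * gbm \<mu> \<beta> t \<omega> powr (2 * \<gamma>) = (z powr \<gamma> * gbm \<mu> \<beta> t \<omega> powr \<gamma>)\<^sup>2"
            using z gbm_pos[of \<mu> \<beta> t \<omega>] by (simp add: power2_eq_square powr_add[symmetric] mult.commute mult.left_commute)
          moreover have "exp (- gbm_rate \<mu> \<beta> (2 * \<gamma>) * t) = exp ((2 * \<rho> - gbm_rate \<mu> \<beta> (2 * \<gamma>)) * t) * (exp (- \<rho> * t))\<^sup>2"
            by (simp add: power2_eq_square exp_add[symmetric] algebra_simps)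
          ultimately show ?thesis
            unfolding n_def gbm_martingale_def \<gamma> by (simp add: power_mult_distrib mult.commute mult.left_commute)
        qed
        moreover have "exp (- \<bar>2 * \<rho> - gbm_rate \<mu> \<beta> (2 * \<gamma>)\<bar> * N) \<le> exp ((2 * \<rho> - gbm_rate \<mu> \<beta> (2 * \<gamma>)) * t)"
        proof -
          have "\<bar>(2 * \<rho> - gbm_rate \<mu> \<beta> (2 * \<gamma>)) * t\<bar> \<le> \<bar>2 * \<rho> - gbm_rate \<mu> \<beta> (2 * \<gamma>)\<bar> * N"
            unfolding abs_mult using t by (intro mult_left_mono) auto
          then show ?thesis by simp
        qed
        ultimately show ?thesis
          unfolding \<eta>_def using \<epsilon> by (simp add: mult.assoc mult_right_mono)
      qed
      finally show ?thesis by simp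
    qed
    have S_nonneg: "0 \<le> S t \<omega>" if "0 \<le> t" "t \<le> N" for t \<omega>
      using young[OF rate(1) that, of c1 \<omega>] young[OF rate(2) that, of c2 \<omega>]
      by (simp add: S_def C_def distrib_left)
    have n_int: "integrable M (n \<gamma> t)" if "0 \<le> t" for \<gamma> t
      unfolding n_def using gbm_martingale_integrable[OF that] by simp
    have n_0: "(\<integral>\<omega>. n \<gamma> 0 \<omega> \<partial>M) = z powr \<gamma>" for \<gamma>
      by (simp add: n_def gbm_martingale_0)
    have n_F: "n \<gamma> s \<in> borel_measurable (\<F> (ennreal t))" if "0 \<le> s" "s \<le> t" for \<gamma> s t
      unfolding n_def using gbm_martingale_adapted[OF that] by simp
    have S_F: "S s \<in> borel_measurable (\<F> (ennreal t))" if "0 \<le> s" "s \<le> t" for s t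
      unfolding S_def using n_F[OF that] by measurable
    have S_int: "integrable M (S t)" if "0 \<le> t" for t
      unfolding S_def using n_int[OF that] by simp
    have n_ind: "(\<integral>\<omega>. indicator A \<omega> * n \<gamma> t \<omega> \<partial>M) = (\<integral>\<omega>. indicator A \<omega> * n \<gamma> s \<omega> \<partial>M)"
      if "0 \<le> s" "s \<le> t" "A \<in> sets (\<F> (ennreal s))" for A s t \<gamma>
      unfolding n_def mult.left_commute[of "indicator A _"] using gbm_martingale_indicator[OF that] by simp
    have S_ind: "(\<integral>\<omega>. indicator A \<omega> * S t \<omega> \<partial>M) = (\<integral>\<omega>. indicator A \<omega> * S s \<omega> \<partial>M)"
      if st: "0 \<le> s" "s \<le> t" "A \<in> sets (\<F> (ennreal s))" for A s t
    proof -
      have A: "A \<in> events" using st(3) F_events by blast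
      have int: "integrable M (\<lambda>\<omega>. indicator A \<omega> * n \<gamma> u \<omega>)" if "0 \<le> u" for u \<gamma>
        using integrable_real_mult_indicator[OF A n_int[OF that]] by (simp add: mult.commute)
      have intA: "integrable M (indicator A :: 'a \<Rightarrow> real)"
        using A by (intro integrable_real_indicator) (auto simp: emeasure_eq_measure)
      have "(\<integral>\<omega>. indicator A \<omega> * S u \<omega> \<partial>M) = \<epsilon> * (\<integral>\<omega>. indicator A \<omega> * n (2 * \<gamma>1) u \<omega> \<partial>M) +
          \<epsilon> * (\<integral>\<omega>. indicator A \<omega> * n (2 * \<gamma>2) u \<omega> \<partial>M) + C * (\<integral>\<omega>. indicator A \<omega> \<partial>M) -
          c1 * (\<integral>\<omega>. indicator A \<omega> * n \<gamma>1 u \<omega> \<partial>M) - c2 * (\<integral>\<omega>. indicator A \<omega> * n \<gamma>2 u \<omega> \<partial>M)" if "0 \<le> u" for u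
      proof -
        have "indicator A \<omega> * S u \<omega> = \<epsilon> * (indicator A \<omega> * n (2 * \<gamma>1) u \<omega>) + \<epsilon> * (indicator A \<omega> * n (2 * \<gamma>2) u \<omega>) +
            C * indicator A \<omega> - c1 * (indicator A \<omega> * n \<gamma>1 u \<omega>) - c2 * (indicator A \<omega> * n \<gamma>2 u \<omega>)" for \<omega>
          by (simp add: S_def algebra_simps)
        then show ?thesis
          using int[OF that] intA by (simp del: integral_indicator)
      qed
      then show ?thesis
        using st by (simp add: n_ind[OF st])
    qed
    have S_cont: "AE \<omega> in M. continuous_on {0..} (\<lambda>t. S t \<omega>)"
      using gbm_martingale_continuous[of \<mu> \<beta> \<gamma>1] gbm_martingale_continuous[of \<mu> \<beta> \<gamma>2]
        gbm_martingale_continuous[of \<mu> \<beta> "2 * \<gamma>1"] gbm_martingale_continuous[of \<mu> \<beta> "2 * \<gamma>2"]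
      by eventually_elim (auto simp: S_def n_def intro!: continuous_intros)
    \<comment> \<open>Nonnegativity of \<open>S\<close> is known up to \<open>N\<close>, so the
      process is frozen there.\<close>
    define X where "X t = S (min t N)" for t
    define \<sigma> where "\<sigma> \<omega> = min (\<tau> \<omega>) (ennreal N)" for \<omega>
    have \<sigma>: "stopping_time \<F> \<sigma>"
      unfolding stopping_time_def
    proof
      fix t
      show "Measurable.pred (\<F> t) (\<lambda>\<omega>. \<sigma> \<omega> \<le> t)"
        using stopping_timeD[OF \<tau>_stop, of t] by (cases "ennreal N \<le> t") (auto simp: \<sigma>_def min_le_iff_disj)
    qed
    have sampling: "(\<integral>\<^sup>+\<omega>. ennreal (if \<sigma> \<omega> = \<infinity> then 0 else X (enn2real (\<sigma> \<omega>)) \<omega>) \<partial>M) \<le> ennreal (\<integral>\<omega>. X 0 \<omega> \<partial>M)"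
      and X_meas: "(\<lambda>\<omega>. ennreal (if \<sigma> \<omega> = \<infinity> then 0 else X (enn2real (\<sigma> \<omega>)) \<omega>)) \<in> borel_measurable M"
    proof -
      have X_F: "X t \<in> borel_measurable (\<F> (ennreal t))" if "0 \<le> t" for t
        unfolding X_def using that N by (intro S_F) auto
      have X_int: "integrable M (X t)" if "0 \<le> t" for t
        unfolding X_def using that N by (intro S_int) auto
      have X_nonneg: "0 \<le> X t \<omega>" if "0 \<le> t" for t \<omega>
        unfolding X_def using that N by (intro S_nonneg) auto
      have X_cont: "AE \<omega> in M. continuous_on {0..} (\<lambda>t. X t \<omega>)"
        using S_cont
      proof eventually_elim
        case (elim \<omega>)
        show ?case
          unfolding X_def using N
          by (intro continuous_on_compose2[OF elim, of "{0..}" "\<lambda>t. min t N"] continuous_intros) auto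
      qed
      have X_super: "(\<integral>\<omega>. indicator A \<omega> * X t \<omega> \<partial>M) \<le> (\<integral>\<omega>. indicator A \<omega> * X s \<omega> \<partial>M)"
        if st: "0 \<le> s" "s \<le> t" "A \<in> sets (\<F> (ennreal s))" for s t A
      proof (cases "s \<le> N")
        case True
        then show ?thesis
          unfolding X_def using st by (simp add: S_ind[of s "min t N" A] min_absorb1)
      next
        case False
        then show ?thesis
          unfolding X_def using st by (simp add: min_absorb2)
      qed
      show "(\<integral>\<^sup>+\<omega>. ennreal (if \<sigma> \<omega> = \<infinity> then 0 else X (enn2real (\<sigma> \<omega>)) \<omega>) \<partial>M) \<le> ennreal (\<integral>\<omega>. X 0 \<omega> \<partial>M)"
        by (rule optional_sampling_le[OF X_F X_int X_nonneg X_cont X_super \<sigma>])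
      show "(\<lambda>\<omega>. ennreal (if \<sigma> \<omega> = \<infinity> then 0 else X (enn2real (\<sigma> \<omega>)) \<omega>)) \<in> borel_measurable M"
        by (rule stopped_measurable[OF X_F X_int X_nonneg X_cont X_super \<sigma>])
    qed
    have X0: "(\<integral>\<omega>. X 0 \<omega> \<partial>M) = \<epsilon> * q + C - g z"
      using N n_int[of 0] by (simp add: X_def S_def n_0 q_def g_def prob_space)
    define V where "V \<omega> = ennreal (if \<sigma> \<omega> = \<infinity> then 0 else X (enn2real (\<sigma> \<omega>)) \<omega>)" for \<omega>
    define K where "K = C - exp (- \<rho> * N) * R"
    \<comment> \<open>If the exit comes by time \<open>N\<close>, then \<open>V\<close> is at least
      \<open>C\<close> minus the payoff. Otherwise the path is still inside the interval, the
      discounted combination is at most \<open>exp (- \<rho> * N) * R\<close>, and the truncated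
      difference \<open>K - V\<close> is 0.\<close>
    have "AE \<omega> in M. ennreal K - V \<omega> \<le> ennreal (?P \<omega>)"
      using Y_cont Y_0
    proof eventually_elim
      case (elim \<omega>)
      have "\<sigma> \<omega> \<noteq> \<infinity>" using ennreal_neq_top[of N] by (auto simp: \<sigma>_def min_def top_unique simp del: ennreal_neq_top)
      have "K - X (enn2real (\<sigma> \<omega>)) \<omega> \<le> ?P \<omega> \<and> 0 \<le> X (enn2real (\<sigma> \<omega>)) \<omega>"
      proof (cases "\<tau> \<omega> \<le> ennreal N")
        case True
        then have fin: "\<tau> \<omega> \<noteq> \<infinity>" by (metis ennreal_neq_top infinity_ennreal_def top_unique)
        let ?T = "enn2real (\<tau> \<omega>)"
        have \<sigma>\<tau>: "\<sigma> \<omega> = \<tau> \<omega>" using True by (simp add: \<sigma>_def min_absorb1)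
        have T: "0 \<le> ?T" "?T \<le> N"
          using True N by (auto simp: enn2real_leI)
        have nn: "0 \<le> n \<gamma> ?T \<omega>" for \<gamma>
          using z gbm_martingale_pos[of \<mu> \<beta> \<gamma> ?T \<omega>] by (simp add: n_def)
        have "g (Y ?T \<omega>) = h (Y ?T \<omega>)"
          using at_exit[OF elim fin] c by (auto simp: g_def)
        then have "?P \<omega> = exp (- \<rho> * ?T) * g (Y ?T \<omega>)"
          using fin by (simp add: discounted_payoff_def)
        also have "\<dots> = c1 * n \<gamma>1 ?T \<omega> + c2 * n \<gamma>2 ?T \<omega>"
          by (simp add: g_def n_rho rate algebra_simps)
        finally have "S ?T \<omega> = \<epsilon> * (n (2 * \<gamma>1) ?T \<omega> + n (2 * \<gamma>2) ?T \<omega>) + C - ?P \<omega>"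
          by (simp add: S_def)
        moreover have "0 \<le> \<epsilon> * (n (2 * \<gamma>1) ?T \<omega> + n (2 * \<gamma>2) ?T \<omega>)" "0 \<le> exp (- \<rho> * N) * R"
          using \<epsilon> nn R by auto
        ultimately show ?thesis
          using S_nonneg[OF T, of \<omega>] T by (simp add: X_def \<sigma>\<tau> min_absorb1 K_def)
      next
        case False
        then have \<sigma>N: "\<sigma> \<omega> = ennreal N" by (simp add: \<sigma>_def min_def)
        have nn: "0 \<le> n \<gamma> N \<omega>" for \<gamma>
          using z gbm_martingale_pos[of \<mu> \<beta> \<gamma> N \<omega>] by (simp add: n_def)
        have "Y N \<omega> \<in> {z1<..<z2}"
          using False \<tau>_le[OF elim(1), of N] N by auto
        have "c1 * n \<gamma>1 N \<omega> + c2 * n \<gamma>2 N \<omega> = exp (- \<rho> * N) * g (Y N \<omega>)"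
          by (simp add: g_def n_rho rate algebra_simps)
        also have "\<dots> \<le> exp (- \<rho> * N) * R"
          using g_le[OF \<open>Y N \<omega> \<in> {z1<..<z2}\<close>] by (intro mult_left_mono) auto
        finally have "S N \<omega> \<ge> \<epsilon> * (n (2 * \<gamma>1) N \<omega> + n (2 * \<gamma>2) N \<omega>) + K"
          by (simp add: S_def K_def)
        moreover have "0 \<le> \<epsilon> * (n (2 * \<gamma>1) N \<omega> + n (2 * \<gamma>2) N \<omega>)"
          using \<epsilon> nn by auto
        moreover have "0 \<le> ?P \<omega>"
        proof (cases "\<tau> \<omega> = \<infinity>")
          case False
          then show ?thesis using at_exit[OF elim False] h by (auto simp: discounted_payoff_def)
        qed (simp add: discounted_payoff_def)
        ultimately show ?thesis
          using S_nonneg[of N \<omega>] N by (simp add: X_def \<sigma>N)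
      qed
      then show ?case
        using \<open>\<sigma> \<omega> \<noteq> \<infinity>\<close> by (simp add: V_def ennreal_minus ennreal_leI)
    qed
    then have "(\<integral>\<^sup>+\<omega>. ennreal K - V \<omega> \<partial>M) \<le> (\<integral>\<^sup>+\<omega>. ennreal (?P \<omega>) \<partial>M)"
      by (rule nn_integral_mono_AE)
    moreover have "ennreal K \<le> (\<integral>\<^sup>+\<omega>. ennreal K - V \<omega> \<partial>M) + ennreal (\<epsilon> * q + C - g z)"
    proof -
      have [measurable]: "V \<in> borel_measurable M"
        unfolding V_def by (rule X_meas)
      have "ennreal K = (\<integral>\<^sup>+\<omega>. ennreal K \<partial>M)"
        by (simp add: emeasure_space_1)
      also have "\<dots> \<le> (\<integral>\<^sup>+\<omega>. (ennreal K - V \<omega>) + V \<omega> \<partial>M)"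
      proof (rule nn_integral_mono)
        fix \<omega>
        show "ennreal K \<le> (ennreal K - V \<omega>) + V \<omega>"
          using diff_add_cancel_ennreal[of "V \<omega>" "ennreal K"] by (cases "V \<omega> \<le> ennreal K") (auto simp: add_increasing)
      qed
      also have "\<dots> = (\<integral>\<^sup>+\<omega>. ennreal K - V \<omega> \<partial>M) + (\<integral>\<^sup>+\<omega>. V \<omega> \<partial>M)"
        by (rule nn_integral_add) measurable
      also have "\<dots> \<le> (\<integral>\<^sup>+\<omega>. ennreal K - V \<omega> \<partial>M) + ennreal (\<epsilon> * q + C - g z)"
        using sampling unfolding X0 V_def by (rule add_left_mono)
      finally show ?thesis .
    qed
    ultimately have le: "ennreal K \<le> (\<integral>\<^sup>+\<omega>. ennreal (?P \<omega>) \<partial>M) + ennreal (\<epsilon> * q + C - g z)"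
      by (meson add_right_mono order_trans)
    have nn: "0 \<le> \<epsilon> * q + C - g z"
    proof -
      have "0 \<le> (\<integral>\<omega>. X 0 \<omega> \<partial>M)"
        unfolding X_def using N by (intro integral_nonneg_AE) (auto intro!: AE_I2 S_nonneg)
      then show ?thesis by (simp add: X0)
    qed
    show ?thesis
    proof (cases "(\<integral>\<^sup>+\<omega>. ennreal (?P \<omega>) \<partial>M)")
      case (real p)
      then have "ennreal K \<le> ennreal (p + (\<epsilon> * q + C - g z))"
        using le nn by (simp add: ennreal_plus)
      then have "K \<le> p + (\<epsilon> * q + C - g z)"
        using real(1) nn by (subst (asm) ennreal_le_iff) auto
      then show ?thesis
        unfolding real(2) K_def by (intro ennreal_leI) simp
    qed simp
  qed
  have "ennreal (g z) \<le> (\<integral>\<^sup>+\<omega>. ennreal (?P \<omega>) \<partial>M)"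
  proof (rule LIMSEQ_le_const2)
    \<comment> \<open>Horizon \<open>k + 1\<close> and \<epsilon> equal to
      \<open>1 / (k + 1)\<close> are used together.\<close>
    show "(\<lambda>k::nat. ennreal (g z - exp (- \<rho> * real (Suc k)) * R - 1 / real (Suc k) * q)) \<longlonglongrightarrow> ennreal (g z)"
    proof (rule tendsto_ennrealI)
      have "(\<lambda>k::nat. g z - exp (- \<rho> * real (Suc k)) * R - 1 / real (Suc k) * q) \<longlonglongrightarrow> g z - 0 * R - 0 * q"
        using \<rho> by (intro tendsto_intros; real_asymp)
      then show "(\<lambda>k::nat. g z - exp (- \<rho> * real (Suc k)) * R - 1 / real (Suc k) * q) \<longlonglongrightarrow> g z"
        by simp
    qed
    show "\<exists>N. \<forall>k\<ge>N. ennreal (g z - exp (- \<rho> * real (Suc k)) * R - 1 / real (Suc k) * q) \<le> (\<integral>\<^sup>+\<omega>. ennreal (?P \<omega>) \<partial>M)"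
      by (intro exI[of _ 0] allI impI approx) simp_all
  qed
  with \<tau>_stop show ?thesis
    unfolding g_def Y_def[abs_def] by blast
qed

end

section \<open>The completed natural filtration\<close>

context prob_space
begin

text \<open>Brownian motion is defined by increments along one chain of times. With 0 and
  \<open>s\<close> added to \<open>J\<close>, the values at past times are partial sums of
  increments, as \<open>B 0 = 0\<close> almost surely, and \<open>t\<close> continues the chain by
  the increment in question.\<close>

lemma brownian_past_indep:
  assumes B: "brownian_motion M B" and J: "finite J" "J \<subseteq> {0..s}" and st: "0 \<le> s" "s < t"
    and A: "\<And>j. j \<in> J \<Longrightarrow> A j \<in> sets borel" and C: "C \<in> sets borel"
  shows "prob {\<omega> \<in> space M. (\<forall>j\<in>J. B j \<omega> \<in> A j) \<and> B t \<omega> - B s \<omega> \<in> C} =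
    prob {\<omega> \<in> space M. \<forall>j\<in>J. B j \<omega> \<in> A j} * prob {\<omega> \<in> space M. B t \<omega> - B s \<omega> \<in> C}"
proof -
  have B_meas: "B u \<in> borel_measurable M" if "0 \<le> u" for u
    using B that by (simp add: brownian_motion_def)
  have B_0: "AE \<omega> in M. B 0 \<omega> = 0"
    using B by (simp add: brownian_motion_def)
  obtain q :: "nat \<Rightarrow> real" and N where q: "\<forall>j<N. q j < q (Suc j)" and qP: "q ` {..N} = J \<union> {0, s}"
    by (rule finite_set_enumeration[of "J \<union> {0, s}"]) (use J in auto)
  have range: "q k \<in> {0..s}" if "k \<le> N" for k
  proof -
    have "q k \<in> J \<union> {0, s}" using qP that by blast
    then show ?thesis using J st by auto
  qed
  have q0: "q 0 = 0"
  proof -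
    have "0 \<in> q ` {..N}" by (simp add: qP)
    then obtain a where "a \<le> N" "q a = 0" by auto
    then show ?thesis
      using strict_chain_le_iff[OF q, of 0 a] range[of 0] by auto
  qed
  have qN: "q N = s"
  proof -
    have "s \<in> q ` {..N}" by (simp add: qP)
    then obtain a where "a \<le> N" "q a = s" by auto
    then show ?thesis
      using strict_chain_le_iff[OF q, of a N] range[of N] by auto
  qed
  define T where "T i = (if i \<le> N then q i else t)" for i
  define D where "D i \<omega> = B (T (Suc i)) \<omega> - B (T i) \<omega>" for i \<omega>
  have T_mono: "T i \<le> T (Suc i)" if "i < Suc N" for i
  proof (cases "i = N")
    case True
    then show ?thesis using qN st by (simp add: T_def)
  next
    case False
    then show ?thesis using q that by (simp add: T_def less_imp_le)
  qed
  have D_indep: "indep_vars (\<lambda>_. borel) D {..<Suc N}"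
  proof -
    have "0 \<le> T 0" by (simp add: T_def q0)
    then show ?thesis
      using B T_mono unfolding brownian_motion_def D_def by blast
  qed
  have D_meas: "D i \<in> borel_measurable M" if "i < Suc N" for i
    using D_indep that by (auto simp: indep_vars_def)
  have sum_D: "(\<Sum>i<k. D i \<omega>) = B (q k) \<omega> - B 0 \<omega>" if "k \<le> N" for k \<omega>
  proof -
    have "(\<Sum>i<k. D i \<omega>) = B (T k) \<omega> - B (T 0) \<omega>"
      unfolding D_def by (rule sum_lessThan_telescope)
    then show ?thesis using that by (simp add: T_def q0)
  qed
  have D_N: "D N \<omega> = B t \<omega> - B s \<omega>" for \<omega>
    by (simp add: D_def T_def qN)
  let ?V = "\<lambda>\<omega>. \<lambda>i\<in>{..<N}. D i \<omega>" and ?U = "\<lambda>\<omega>. \<lambda>i\<in>{N}. D i \<omega>"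
  have ind: "indep_var (PiM {..<N} (\<lambda>_. borel)) ?V (PiM {N} (\<lambda>_. borel)) ?U"
    by (rule indep_var_restrict[OF D_indep]) auto
  define S where "S = {f \<in> space (PiM {..<N} (\<lambda>_. borel :: real measure)). \<forall>k\<in>{k. k \<le> N \<and> q k \<in> J}. (\<Sum>i<k. f i) \<in> A (q k)}"
  have S: "S \<in> sets (PiM {..<N} (\<lambda>_. borel))"
    unfolding S_def
  proof (rule sets.sets_Collect_finite_All)
    fix k assume k: "k \<in> {k. k \<le> N \<and> q k \<in> J}"
    have "(\<lambda>f. \<Sum>i<k. f i) \<in> borel_measurable (PiM {..<N} (\<lambda>_. borel :: real measure))"
      using k by (intro borel_measurable_sum measurable_component_singleton) auto
    from measurable_sets[OF this A[of "q k"]] k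
    show "{f \<in> space (PiM {..<N} (\<lambda>_. borel :: real measure)). (\<Sum>i<k. f i) \<in> A (q k)} \<in> sets (PiM {..<N} (\<lambda>_. borel))"
      by (simp add: vimage_def Int_def conj_commute)
  qed auto
  define S' where "S' = {f \<in> space (PiM {N} (\<lambda>_. borel :: real measure)). f N \<in> C}"
  have S': "S' \<in> sets (PiM {N} (\<lambda>_. borel))"
    unfolding S'_def using C by measurable
  have VS: "{\<omega> \<in> space M. ?V \<omega> \<in> S} = {\<omega> \<in> space M. \<forall>k\<le>N. q k \<in> J \<longrightarrow> B (q k) \<omega> - B 0 \<omega> \<in> A (q k)}"
    unfolding S_def by (auto simp: space_PiM sum_D[symmetric])
  have US: "{\<omega> \<in> space M. ?U \<omega> \<in> S'} = {\<omega> \<in> space M. B t \<omega> - B s \<omega> \<in> C}"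
    unfolding S'_def by (auto simp: space_PiM D_N)
  have V_meas: "?V \<in> M \<rightarrow>\<^sub>M PiM {..<N} (\<lambda>_. borel)" and U_meas: "?U \<in> M \<rightarrow>\<^sub>M PiM {N} (\<lambda>_. borel)"
    using ind by (auto simp: indep_var_eq)
  have "prob ({\<omega> \<in> space M. ?V \<omega> \<in> S} \<inter> {\<omega> \<in> space M. ?U \<omega> \<in> S'}) =
      prob {\<omega> \<in> space M. ?V \<omega> \<in> S} * prob {\<omega> \<in> space M. ?U \<omega> \<in> S'}"
  proof -
    have "{\<omega> \<in> space M. ?V \<omega> \<in> S} \<inter> {\<omega> \<in> space M. ?U \<omega> \<in> S'} = (\<lambda>\<omega>. (?V \<omega>, ?U \<omega>)) -` (S \<times> S') \<inter> space M"
      "{\<omega> \<in> space M. ?V \<omega> \<in> S} = ?V -` S \<inter> space M" "{\<omega> \<in> space M. ?U \<omega> \<in> S'} = ?U -` S' \<inter> space M"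
      by auto
    then show ?thesis
      using indep_varD[OF ind S S'] by simp
  qed
  moreover have "prob {\<omega> \<in> space M. ?V \<omega> \<in> S} = prob {\<omega> \<in> space M. \<forall>j\<in>J. B j \<omega> \<in> A j}"
    and "prob ({\<omega> \<in> space M. ?V \<omega> \<in> S} \<inter> {\<omega> \<in> space M. ?U \<omega> \<in> S'}) =
      prob {\<omega> \<in> space M. (\<forall>j\<in>J. B j \<omega> \<in> A j) \<and> B t \<omega> - B s \<omega> \<in> C}"
  proof -
    have EJ: "{\<omega> \<in> space M. \<forall>j\<in>J. B j \<omega> \<in> A j} \<in> events"
    proof (rule sets.sets_Collect_finite_All[OF _ J(1)])
      fix j assume j: "j \<in> J"
      then have "B j \<in> borel_measurable M" using B_meas J(2) by auto
      from measurable_sets[OF this A[OF j]] show "{\<omega> \<in> space M. B j \<omega> \<in> A j} \<in> events"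
        by (simp add: vimage_def Int_def conj_commute)
    qed
    have EC: "{\<omega> \<in> space M. B t \<omega> - B s \<omega> \<in> C} \<in> events"
      using measurable_sets[OF U_meas S'] US by (simp add: vimage_def Int_def conj_commute)
    have EV: "{\<omega> \<in> space M. ?V \<omega> \<in> S} \<in> events"
      using measurable_sets[OF V_meas S] by (simp add: vimage_def Int_def conj_commute)
    have AE: "AE \<omega> in M. (\<omega> \<in> {\<omega> \<in> space M. ?V \<omega> \<in> S}) = (\<omega> \<in> {\<omega> \<in> space M. \<forall>j\<in>J. B j \<omega> \<in> A j})"
      using B_0
    proof eventually_elim
      case (elim \<omega>)
      have J_eq: "J = q ` {k. k \<le> N \<and> q k \<in> J}"
      proof -
        have "J \<subseteq> q ` {..N}" unfolding qP by blast
        then show ?thesis by auto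
      qed
      show ?case
        unfolding VS using elim by (subst (2) J_eq) auto
    qed
    show "prob {\<omega> \<in> space M. ?V \<omega> \<in> S} = prob {\<omega> \<in> space M. \<forall>j\<in>J. B j \<omega> \<in> A j}"
      by (rule finite_measure_eq_AE[OF AE EV EJ])
    show "prob ({\<omega> \<in> space M. ?V \<omega> \<in> S} \<inter> {\<omega> \<in> space M. ?U \<omega> \<in> S'}) =
      prob {\<omega> \<in> space M. (\<forall>j\<in>J. B j \<omega> \<in> A j) \<and> B t \<omega> - B s \<omega> \<in> C}"
    proof (rule finite_measure_eq_AE)
      show "AE \<omega> in M. (\<omega> \<in> {\<omega> \<in> space M. ?V \<omega> \<in> S} \<inter> {\<omega> \<in> space M. ?U \<omega> \<in> S'}) =
        (\<omega> \<in> {\<omega> \<in> space M. (\<forall>j\<in>J. B j \<omega> \<in> A j) \<and> B t \<omega> - B s \<omega> \<in> C})"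
        using AE unfolding US by eventually_elim auto
      show "{\<omega> \<in> space M. (\<forall>j\<in>J. B j \<omega> \<in> A j) \<and> B t \<omega> - B s \<omega> \<in> C} \<in> events"
        using sets.Int[OF EJ EC] by (simp add: Int_def conj_ac cong: conj_cong)
      show "{\<omega> \<in> space M. ?V \<omega> \<in> S} \<inter> {\<omega> \<in> space M. ?U \<omega> \<in> S'} \<in> events"
        using EV EC unfolding US by (rule sets.Int)
    qed
  qed
  ultimately show ?thesis
    unfolding US by simp
qed

text \<open>Conditions at several times at once, so that the family is stable under intersection and
  decides independence of the generated sigma algebra.\<close>

definition past_cylinders :: "(real \<Rightarrow> 'a \<Rightarrow> real) \<Rightarrow> real \<Rightarrow> 'a set set" where
  "past_cylinders B s = {{\<omega> \<in> space M. \<forall>j\<in>J. B j \<omega> \<in> A j} | J A. finite J \<and> J \<subseteq> {0..s} \<and> (\<forall>j\<in>J. A j \<in> sets borel)}"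

lemma past_cylinders_Int:
  assumes "a \<in> past_cylinders B s" "b \<in> past_cylinders B s"
  shows "a \<inter> b \<in> past_cylinders B s"
proof -
  from assms obtain J A K A' where
    a: "a = {\<omega> \<in> space M. \<forall>j\<in>J. B j \<omega> \<in> A j}" "finite J" "J \<subseteq> {0..s}" "\<forall>j\<in>J. A j \<in> sets borel" and
    b: "b = {\<omega> \<in> space M. \<forall>j\<in>K. B j \<omega> \<in> A' j}" "finite K" "K \<subseteq> {0..s}" "\<forall>j\<in>K. A' j \<in> sets borel"
    unfolding past_cylinders_def by blast
  define G where "G j = (if j \<in> J then A j else UNIV) \<inter> (if j \<in> K then A' j else UNIV)" for j
  have "a \<inter> b = {\<omega> \<in> space M. \<forall>j\<in>J \<union> K. B j \<omega> \<in> G j}"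
    unfolding a b G_def by auto
  moreover have "finite (J \<union> K) \<and> J \<union> K \<subseteq> {0..s} \<and> (\<forall>j\<in>J \<union> K. G j \<in> sets borel)"
    using a b by (auto simp: G_def)
  ultimately show ?thesis
    unfolding past_cylinders_def by blast
qed

text \<open>Independence of the two paths separates \<open>B1\<close> from \<open>B2\<close>, and
  within each motion the past separates from the increment. The resulting product of four factors is
  regrouped into past and increments.\<close>

lemma past_cylinders_indep:
  assumes B1: "brownian_motion M B1" and B2: "brownian_motion M B2" and ind: "indep_processes M B1 B2"
    and st: "0 \<le> s" "s < t" and a: "a \<in> past_cylinders B1 s" "b \<in> past_cylinders B2 s"
    and C: "C1 \<in> sets borel" "C2 \<in> sets borel"
  shows "prob (a \<inter> b \<inter> {\<omega> \<in> space M. B1 t \<omega> - B1 s \<omega> \<in> C1 \<and> B2 t \<omega> - B2 s \<omega> \<in> C2}) =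
      prob (a \<inter> b) * prob {\<omega> \<in> space M. B1 t \<omega> - B1 s \<omega> \<in> C1 \<and> B2 t \<omega> - B2 s \<omega> \<in> C2}"
    and "a \<inter> b \<in> events"
proof -
  let ?N = "PiM {0..} (\<lambda>_. borel :: real measure)"
  let ?X = "\<lambda>B \<omega>. \<lambda>t\<in>{0..}. B t \<omega> :: real"
  have IND: "indep_var ?N (?X B1) ?N (?X B2)"
    using ind by (simp add: indep_processes_def)
  have X_meas: "?X B1 \<in> M \<rightarrow>\<^sub>M ?N" "?X B2 \<in> M \<rightarrow>\<^sub>M ?N"
    using IND by (auto simp: indep_var_eq)
  \<comment> \<open>Each event is the preimage of a set of paths, the form in which independence of
    the two processes is given.\<close>
  have cyl: "\<exists>S\<in>sets ?N. \<forall>B. {\<omega> \<in> space M. (\<forall>j\<in>J. B j \<omega> \<in> A j) \<and> B t \<omega> - B s \<omega> \<in> C} = ?X B -` S \<inter> space M"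
    if J: "finite J" "J \<subseteq> {0..s}" "\<forall>j\<in>J. A j \<in> sets borel" "C \<in> sets borel" for J A C
  proof (intro bexI allI)
    let ?S = "{f \<in> space ?N. (\<forall>j\<in>J. f j \<in> A j) \<and> f t - f s \<in> C}"
    have comp: "(\<lambda>f. f u) \<in> borel_measurable ?N" if "0 \<le> u" for u
      using that by (intro measurable_component_singleton) auto
    have "{f \<in> space ?N. f j \<in> A j} \<in> sets ?N" if "j \<in> J" for j
      using measurable_sets[OF comp[of j], of "A j"] that J by (auto simp: vimage_def Int_def conj_commute)
    then have SJ: "{f \<in> space ?N. \<forall>j\<in>J. f j \<in> A j} \<in> sets ?N"
      using J(1) by (intro sets.sets_Collect_finite_All) auto
    have SC: "{f \<in> space ?N. f t - f s \<in> C} \<in> sets ?N"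
      using measurable_sets[OF borel_measurable_diff[OF comp[of t] comp[of s]] J(4)] st
      by (auto simp: vimage_def Int_def conj_commute)
    show "?S \<in> sets ?N"
      by (rule sets.sets_Collect_conj[OF SC SJ])
    fix B :: "real \<Rightarrow> 'a \<Rightarrow> real"
    have "?X B \<omega> \<in> space ?N" for \<omega>
      by (simp add: space_PiM)
    moreover have "?X B \<omega> j = B j \<omega>" if "j \<in> J" for j \<omega>
      using J(2) that by auto
    ultimately show "{\<omega> \<in> space M. (\<forall>j\<in>J. B j \<omega> \<in> A j) \<and> B t \<omega> - B s \<omega> \<in> C} = ?X B -` ?S \<inter> space M"
      using st by auto
  qed
  have product: "prob ({\<omega> \<in> space M. (\<forall>j\<in>J. B1 j \<omega> \<in> A j) \<and> B1 t \<omega> - B1 s \<omega> \<in> C} \<inter>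
      {\<omega> \<in> space M. (\<forall>j\<in>K. B2 j \<omega> \<in> A' j) \<and> B2 t \<omega> - B2 s \<omega> \<in> C'}) =
      prob {\<omega> \<in> space M. \<forall>j\<in>J. B1 j \<omega> \<in> A j} * prob {\<omega> \<in> space M. B1 t \<omega> - B1 s \<omega> \<in> C} *
      (prob {\<omega> \<in> space M. \<forall>j\<in>K. B2 j \<omega> \<in> A' j} * prob {\<omega> \<in> space M. B2 t \<omega> - B2 s \<omega> \<in> C'})"
    if J: "finite J" "J \<subseteq> {0..s}" "\<forall>j\<in>J. A j \<in> sets borel" "C \<in> sets borel"
      and K: "finite K" "K \<subseteq> {0..s}" "\<forall>j\<in>K. A' j \<in> sets borel" "C' \<in> sets borel" for J A C K A' C'
  proof -
    from cyl[OF J] obtain S where S: "S \<in> sets ?N"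
      "{\<omega> \<in> space M. (\<forall>j\<in>J. B1 j \<omega> \<in> A j) \<and> B1 t \<omega> - B1 s \<omega> \<in> C} = ?X B1 -` S \<inter> space M" by blast
    from cyl[OF K] obtain S' where S': "S' \<in> sets ?N"
      "{\<omega> \<in> space M. (\<forall>j\<in>K. B2 j \<omega> \<in> A' j) \<and> B2 t \<omega> - B2 s \<omega> \<in> C'} = ?X B2 -` S' \<inter> space M" by blast
    have "prob ((?X B1 -` S \<inter> space M) \<inter> (?X B2 -` S' \<inter> space M)) = prob (?X B1 -` S \<inter> space M) * prob (?X B2 -` S' \<inter> space M)"
    proof -
      have "(?X B1 -` S \<inter> space M) \<inter> (?X B2 -` S' \<inter> space M) = (\<lambda>\<omega>. (?X B1 \<omega>, ?X B2 \<omega>)) -` (S \<times> S') \<inter> space M"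
        by auto
      then show ?thesis
        using indep_varD[OF IND S(1) S'(1)] by simp
    qed
    then have "prob ({\<omega> \<in> space M. (\<forall>j\<in>J. B1 j \<omega> \<in> A j) \<and> B1 t \<omega> - B1 s \<omega> \<in> C} \<inter>
      {\<omega> \<in> space M. (\<forall>j\<in>K. B2 j \<omega> \<in> A' j) \<and> B2 t \<omega> - B2 s \<omega> \<in> C'}) =
      prob {\<omega> \<in> space M. (\<forall>j\<in>J. B1 j \<omega> \<in> A j) \<and> B1 t \<omega> - B1 s \<omega> \<in> C} *
      prob {\<omega> \<in> space M. (\<forall>j\<in>K. B2 j \<omega> \<in> A' j) \<and> B2 t \<omega> - B2 s \<omega> \<in> C'}"
      unfolding S(2) S'(2) .
    then show ?thesis
      using brownian_past_indep[OF B1 J(1,2) st, of A C] brownian_past_indep[OF B2 K(1,2) st, of A' C'] J K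
      by simp
  qed
  from a obtain J A K A' where
    a': "a = {\<omega> \<in> space M. \<forall>j\<in>J. B1 j \<omega> \<in> A j}" and J: "finite J" "J \<subseteq> {0..s}" "\<forall>j\<in>J. A j \<in> sets borel" and
    b': "b = {\<omega> \<in> space M. \<forall>j\<in>K. B2 j \<omega> \<in> A' j}" and K: "finite K" "K \<subseteq> {0..s}" "\<forall>j\<in>K. A' j \<in> sets borel"
    unfolding past_cylinders_def by blast
  have 1: "prob (a \<inter> b \<inter> {\<omega> \<in> space M. B1 t \<omega> - B1 s \<omega> \<in> C1 \<and> B2 t \<omega> - B2 s \<omega> \<in> C2}) =
      prob a * prob {\<omega> \<in> space M. B1 t \<omega> - B1 s \<omega> \<in> C1} * (prob b * prob {\<omega> \<in> space M. B2 t \<omega> - B2 s \<omega> \<in> C2})"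
  proof -
    have "a \<inter> b \<inter> {\<omega> \<in> space M. B1 t \<omega> - B1 s \<omega> \<in> C1 \<and> B2 t \<omega> - B2 s \<omega> \<in> C2} =
      {\<omega> \<in> space M. (\<forall>j\<in>J. B1 j \<omega> \<in> A j) \<and> B1 t \<omega> - B1 s \<omega> \<in> C1} \<inter>
      {\<omega> \<in> space M. (\<forall>j\<in>K. B2 j \<omega> \<in> A' j) \<and> B2 t \<omega> - B2 s \<omega> \<in> C2}"
      unfolding a' b' by auto
    then show ?thesis
      using product[OF J C(1) K C(2)] unfolding a' b' by simp
  qed
  have 2: "prob (a \<inter> b) = prob a * prob b"
  proof -
    have "a \<inter> b = {\<omega> \<in> space M. (\<forall>j\<in>J. B1 j \<omega> \<in> A j) \<and> B1 t \<omega> - B1 s \<omega> \<in> UNIV} \<inter>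
      {\<omega> \<in> space M. (\<forall>j\<in>K. B2 j \<omega> \<in> A' j) \<and> B2 t \<omega> - B2 s \<omega> \<in> UNIV}"
      unfolding a' b' by auto
    then show ?thesis
      using product[OF J _ K, of UNIV UNIV] unfolding a' b' by (simp add: prob_space)
  qed
  have 3: "prob {\<omega> \<in> space M. B1 t \<omega> - B1 s \<omega> \<in> C1 \<and> B2 t \<omega> - B2 s \<omega> \<in> C2} =
      prob {\<omega> \<in> space M. B1 t \<omega> - B1 s \<omega> \<in> C1} * prob {\<omega> \<in> space M. B2 t \<omega> - B2 s \<omega> \<in> C2}"
  proof -
    have "{\<omega> \<in> space M. B1 t \<omega> - B1 s \<omega> \<in> C1 \<and> B2 t \<omega> - B2 s \<omega> \<in> C2} =
        {\<omega> \<in> space M. B1 t \<omega> - B1 s \<omega> \<in> C1} \<inter> {\<omega> \<in> space M. B2 t \<omega> - B2 s \<omega> \<in> C2}"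
      by auto
    then show ?thesis
      using product[of "{}" undefined C1 "{}" undefined C2] C by (simp add: prob_space)
  qed
  show "prob (a \<inter> b \<inter> {\<omega> \<in> space M. B1 t \<omega> - B1 s \<omega> \<in> C1 \<and> B2 t \<omega> - B2 s \<omega> \<in> C2}) =
      prob (a \<inter> b) * prob {\<omega> \<in> space M. B1 t \<omega> - B1 s \<omega> \<in> C1 \<and> B2 t \<omega> - B2 s \<omega> \<in> C2}"
    unfolding 1 2 3 by simp
  from cyl[of J A UNIV] J obtain S where "S \<in> sets ?N" "a = ?X B1 -` S \<inter> space M" unfolding a' by auto
  then have "a \<in> events" using measurable_sets[OF X_meas(1)] by simp
  moreover from cyl[of K A' UNIV] K obtain S where "S \<in> sets ?N" "b = ?X B2 -` S \<inter> space M" unfolding b' by auto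
  then have "b \<in> events" using measurable_sets[OF X_meas(2)] by simp
  ultimately show "a \<inter> b \<in> events" by simp
qed

text \<open>The two increments are kept as a pair, because the increment of a linear combination of
  both motions is measurable with respect to the pair.\<close>

lemma increments_indep_of_past:
  assumes B1: "brownian_motion M B1" and B2: "brownian_motion M B2" and ind: "indep_processes M B1 B2"
    and st: "0 \<le> s" "s < t"
  shows "indep_set (sigma_sets (space M) {a \<inter> b | a b. a \<in> past_cylinders B1 s \<and> b \<in> past_cylinders B2 s})
    (sigma_sets (space M) {{\<omega> \<in> space M. B1 t \<omega> - B1 s \<omega> \<in> C1 \<and> B2 t \<omega> - B2 s \<omega> \<in> C2} | C1 C2. C1 \<in> sets borel \<and> C2 \<in> sets borel})"
proof (rule indep_set_sigma_sets)
  let ?U = "{{\<omega> \<in> space M. B1 t \<omega> - B1 s \<omega> \<in> C1 \<and> B2 t \<omega> - B2 s \<omega> \<in> C2} | C1 C2. C1 \<in> sets borel \<and> C2 \<in> sets borel}"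
  have "?U \<subseteq> events"
  proof safe
    fix C1 C2 :: "real set" assume C: "C1 \<in> sets borel" "C2 \<in> sets borel"
    have B: "(\<lambda>\<omega>. B1 t \<omega> - B1 s \<omega>) \<in> borel_measurable M" "(\<lambda>\<omega>. B2 t \<omega> - B2 s \<omega>) \<in> borel_measurable M"
      using B1 B2 st by (auto simp: brownian_motion_def intro!: borel_measurable_diff)
    have "{\<omega> \<in> space M. B1 t \<omega> - B1 s \<omega> \<in> C1 \<and> B2 t \<omega> - B2 s \<omega> \<in> C2} =
        ((\<lambda>\<omega>. B1 t \<omega> - B1 s \<omega>) -` C1 \<inter> space M) \<inter> ((\<lambda>\<omega>. B2 t \<omega> - B2 s \<omega>) -` C2 \<inter> space M)"
      by auto
    then show "{\<omega> \<in> space M. B1 t \<omega> - B1 s \<omega> \<in> C1 \<and> B2 t \<omega> - B2 s \<omega> \<in> C2} \<in> events"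
      using measurable_sets[OF B(1) C(1)] measurable_sets[OF B(2) C(2)] by simp
  qed
  then show "indep_set {a \<inter> b | a b. a \<in> past_cylinders B1 s \<and> b \<in> past_cylinders B2 s} ?U"
    unfolding indep_sets2_eq
  proof (intro conjI ballI)
    show "{a \<inter> b | a b. a \<in> past_cylinders B1 s \<and> b \<in> past_cylinders B2 s} \<subseteq> events"
      using past_cylinders_indep(2)[OF B1 B2 ind st, of _ _ UNIV UNIV] by auto
    fix x y assume "x \<in> {a \<inter> b | a b. a \<in> past_cylinders B1 s \<and> b \<in> past_cylinders B2 s}" "y \<in> ?U"
    then obtain a b C1 C2 where "x = a \<inter> b" "a \<in> past_cylinders B1 s" "b \<in> past_cylinders B2 s"
      "y = {\<omega> \<in> space M. B1 t \<omega> - B1 s \<omega> \<in> C1 \<and> B2 t \<omega> - B2 s \<omega> \<in> C2}" "C1 \<in> sets borel" "C2 \<in> sets borel"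
      by auto
    then show "prob (x \<inter> y) = prob x * prob y"
      using past_cylinders_indep(1)[OF B1 B2 ind st] by simp
  qed
  show "Int_stable {a \<inter> b | a b. a \<in> past_cylinders B1 s \<and> b \<in> past_cylinders B2 s}"
  proof (rule Int_stableI, safe)
    fix a b a' b' assume cyl: "a \<in> past_cylinders B1 s" "b \<in> past_cylinders B2 s" "a' \<in> past_cylinders B1 s" "b' \<in> past_cylinders B2 s"
    show "\<exists>c d. a \<inter> b \<inter> (a' \<inter> b') = c \<inter> d \<and> c \<in> past_cylinders B1 s \<and> d \<in> past_cylinders B2 s"
    proof (intro exI conjI)
      show "a \<inter> b \<inter> (a' \<inter> b') = (a \<inter> a') \<inter> (b \<inter> b')"
        by blast
    qed (intro past_cylinders_Int cyl)+
  qed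
  show "Int_stable ?U"
  proof (rule Int_stableI, safe)
    fix C1 C2 C1' C2' :: "real set"
    assume "C1 \<in> sets borel" "C2 \<in> sets borel" "C1' \<in> sets borel" "C2' \<in> sets borel"
    then show "\<exists>D1 D2. {\<omega> \<in> space M. B1 t \<omega> - B1 s \<omega> \<in> C1 \<and> B2 t \<omega> - B2 s \<omega> \<in> C2} \<inter>
        {\<omega> \<in> space M. B1 t \<omega> - B1 s \<omega> \<in> C1' \<and> B2 t \<omega> - B2 s \<omega> \<in> C2'} =
        {\<omega> \<in> space M. B1 t \<omega> - B1 s \<omega> \<in> D1 \<and> B2 t \<omega> - B2 s \<omega> \<in> D2} \<and> D1 \<in> sets borel \<and> D2 \<in> sets borel"
      by (intro exI[of _ "C1 \<inter> C1'"] exI[of _ "C2 \<inter> C2'"] conjI sets.Int) blast+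
  qed
qed

text \<open>Null sets among the generators change a set only by a null set, since the sets with this
  property form a sigma algebra. Independence passes in this way from the natural to the completed
  filtration.\<close>

lemma sigma_sets_AE_eq:
  assumes "A \<in> sigma_sets (space M) (G \<union> null_sets (completion M))" "G \<subseteq> sigma_sets (space M) H"
  shows "\<exists>A'\<in>sigma_sets (space M) H. AE \<omega> in M. \<omega> \<in> A \<longleftrightarrow> \<omega> \<in> A'"
  using assms(1)
proof (induction rule: sigma_sets.induct)
  case (Basic a)
  then show ?case
  proof
    assume "a \<in> G"
    then show ?thesis using assms(2) by auto
  next
    assume "a \<in> null_sets (completion M)"
    from AE_not_in[OF this] have "AE \<omega> in M. \<omega> \<notin> a"
      by (simp add: AE_completion_iff)
    then show ?thesis
      by (intro bexI[of _ "{}"]) (auto intro: sigma_sets.Empty)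
  qed
next
  case Empty
  then show ?case by (auto intro: sigma_sets.Empty)
next
  case (Compl a)
  then obtain a' where a': "a' \<in> sigma_sets (space M) H" "AE \<omega> in M. \<omega> \<in> a \<longleftrightarrow> \<omega> \<in> a'" by blast
  then have "AE \<omega> in M. \<omega> \<in> space M - a \<longleftrightarrow> \<omega> \<in> space M - a'"
    by (auto elim: eventually_mono)
  then show ?case
    using a'(1) by (intro bexI[of _ "space M - a'"]) (auto intro: sigma_sets.Compl)
next
  case (Union a)
  then have "\<forall>i. \<exists>a'. a' \<in> sigma_sets (space M) H \<and> (AE \<omega> in M. \<omega> \<in> a i \<longleftrightarrow> \<omega> \<in> a')" by blast
  then obtain a' where a': "\<And>i. a' i \<in> sigma_sets (space M) H" "\<And>i. AE \<omega> in M. \<omega> \<in> a i \<longleftrightarrow> \<omega> \<in> a' i"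
    by metis
  have "AE \<omega> in M. \<forall>i::nat. \<omega> \<in> a i \<longleftrightarrow> \<omega> \<in> a' i"
    unfolding AE_all_countable using a'(2) by blast
  then have "AE \<omega> in M. \<omega> \<in> (\<Union>i. a i) \<longleftrightarrow> \<omega> \<in> (\<Union>i. a' i)"
    by eventually_elim auto
  then show ?case
    using a'(1) by (intro bexI[of _ "\<Union>i. a' i"]) (auto intro: sigma_sets.Union)
qed

lemma past_cylinderI:
  assumes "0 \<le> u" "u \<le> s" "A \<in> sets borel"
  shows "B u -` A \<inter> space M \<in> past_cylinders B s"
proof -
  have "B u -` A \<inter> space M = {\<omega> \<in> space M. \<forall>j\<in>{u}. B j \<omega> \<in> A}" by auto
  then show ?thesis
    unfolding past_cylinders_def using assms by (intro CollectI exI[of _ "{u}"] exI[of _ "\<lambda>_. A"]) auto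
qed

text \<open>Zero coefficients are treated separately, since such a summand would be a normal
  variable of variance 0, which has no density.\<close>

lemma normal_combination:
  assumes X: "distributed M lborel X (normal_density 0 \<sigma>)" and Y: "distributed M lborel Y (normal_density 0 \<sigma>)"
    and ind: "indep_var borel X borel Y" and "0 < \<sigma>" and ab: "a\<^sup>2 + b\<^sup>2 = 1"
  shows "distributed M lborel (\<lambda>\<omega>. a * X \<omega> + b * Y \<omega>) (normal_density 0 \<sigma>)"
proof -
  have scale: "distributed M lborel (\<lambda>\<omega>. c * V \<omega>) (normal_density 0 (\<bar>c\<bar> * \<sigma>))"
    if "distributed M lborel V (normal_density 0 \<sigma>)" "c \<noteq> 0" for V c
    using normal_density_affine[OF that(1) \<open>0 < \<sigma>\<close> that(2), of 0] by simp
  consider "a = 0" | "b = 0" | "a \<noteq> 0" "b \<noteq> 0" by blast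
  then show ?thesis
  proof cases
    case 1
    then have "b \<noteq> 0" "\<bar>b\<bar> = 1" using ab by (auto simp: power2_eq_1_iff)
    then show ?thesis using scale[OF Y, of b] 1 by simp
  next
    case 2
    then have "a \<noteq> 0" "\<bar>a\<bar> = 1" using ab by (auto simp: power2_eq_1_iff)
    then show ?thesis using scale[OF X, of a] 2 by simp
  next
    case 3
    have "indep_var borel (\<lambda>\<omega>. a * X \<omega>) borel (\<lambda>\<omega>. b * Y \<omega>)"
      using indep_var_compose[OF ind, of "\<lambda>x. a * x" borel "\<lambda>y. b * y" borel] by (simp add: comp_def)
    from add_indep_normal[OF this _ _ scale[OF X 3(1)] scale[OF Y 3(2)]]
    have "distributed M lborel (\<lambda>\<omega>. a * X \<omega> + b * Y \<omega>) (normal_density (0 + 0) (sqrt ((\<bar>a\<bar> * \<sigma>)\<^sup>2 + (\<bar>b\<bar> * \<sigma>)\<^sup>2)))"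
      using 3 \<open>0 < \<sigma>\<close> by simp
    moreover have "sqrt ((\<bar>a\<bar> * \<sigma>)\<^sup>2 + (\<bar>b\<bar> * \<sigma>)\<^sup>2) = \<sigma>"
      using \<open>0 < \<sigma>\<close> ab by (simp add: power_mult_distrib distrib_right[symmetric])
    ultimately show ?thesis by simp
  qed
qed

text \<open>The normalisation \<open>a\<^sup>2 + b\<^sup>2 = 1\<close> keeps the variance of the
  increments at \<open>t - s\<close>. Independence from the past is proved on the original space and
  transferred by replacing each event with one of the natural filtration.\<close>

lemma brownian_basis_completed_filtration:
  assumes B1: "brownian_motion M B1" and B2: "brownian_motion M B2" and ind: "indep_processes M B1 B2"
    and ab: "a\<^sup>2 + b\<^sup>2 = 1"
  shows "brownian_basis (completion M) (completed_filtration M B1 B2) (\<lambda>t \<omega>. a * B1 t \<omega> + b * B2 t \<omega>)"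
proof -
  let ?F = "completed_filtration M B1 B2"
  let ?W = "\<lambda>t \<omega>. a * B1 t \<omega> + b * B2 t \<omega>"
  define G where "G t = {B1 s -` A \<inter> space M | s A. 0 \<le> s \<and> ennreal s \<le> t \<and> A \<in> sets borel} \<union>
        {B2 s -` A \<inter> space M | s A. 0 \<le> s \<and> ennreal s \<le> t \<and> A \<in> sets borel}" for t
  have B1_meas: "B1 t \<in> borel_measurable M" and B2_meas: "B2 t \<in> borel_measurable M" if "0 \<le> t" for t
    using B1 B2 that by (auto simp: brownian_motion_def)
  have null_space: "null_sets (completion M) \<subseteq> Pow (space M)"
    using sets.sets_into_space[of _ "completion M"] by auto
  then have gen: "G t \<union> null_sets (completion M) \<subseteq> Pow (space M)" for t
    by (auto simp: G_def)
  have F_eq: "?F t = sigma (space M) (G t \<union> null_sets (completion M))" for t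
    by (simp add: completed_filtration_def G_def)
  have sets_F: "sets (?F t) = sigma_sets (space M) (G t \<union> null_sets (completion M))" for t
    unfolding F_eq using gen by (rule sets_measure_of)
  have space_F: "space (?F t) = space M" for t
    unfolding F_eq using gen by (rule space_measure_of)
  have F_meas: "B1 t \<in> borel_measurable (?F (ennreal t))" "B2 t \<in> borel_measurable (?F (ennreal t))" if "0 \<le> t" for t
  proof -
    have "B1 t -` A \<inter> space M \<in> G (ennreal t)" "B2 t -` A \<inter> space M \<in> G (ennreal t)" if "A \<in> sets borel" for A
      unfolding G_def using \<open>0 \<le> t\<close> that by blast+
    then show "B1 t \<in> borel_measurable (?F (ennreal t))" "B2 t \<in> borel_measurable (?F (ennreal t))"
      by (auto intro!: measurableI sigma_sets.Basic simp: space_F sets_F)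
  qed
  have U_meas: "(\<lambda>\<omega>. B t \<omega> - B s \<omega>) \<in> borel_measurable M" if "brownian_motion M B" "0 \<le> s" "s < t" for B s t
    using that by (auto simp: brownian_motion_def intro!: borel_measurable_diff)
  have W_dist: "distributed M lborel (\<lambda>\<omega>. ?W t \<omega> - ?W s \<omega>) (normal_density 0 (sqrt (t - s)))" if st: "0 \<le> s" "s < t" for s t
  proof -
    have "indep_var borel (\<lambda>\<omega>. B1 t \<omega> - B1 s \<omega>) borel (\<lambda>\<omega>. B2 t \<omega> - B2 s \<omega>)"
      using indep_var_compose[OF ind[unfolded indep_processes_def], of "\<lambda>f. f t - f s" borel "\<lambda>f. f t - f s" borel] st
      by (simp add: comp_def measurable_component_singleton borel_measurable_diff)
    then have "distributed M lborel (\<lambda>\<omega>. a * (B1 t \<omega> - B1 s \<omega>) + b * (B2 t \<omega> - B2 s \<omega>)) (normal_density 0 (sqrt (t - s)))"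
      using B1 B2 st by (intro normal_combination ab) (auto simp: brownian_motion_def)
    then show ?thesis by (simp add: algebra_simps)
  qed
  have W_indep: "prob (A' \<inter> ((\<lambda>\<omega>. ?W t \<omega> - ?W s \<omega>) -` C \<inter> space M)) =
      prob A' * prob ((\<lambda>\<omega>. ?W t \<omega> - ?W s \<omega>) -` C \<inter> space M) \<and> A' \<in> events"
    if st: "0 \<le> s" "s < t" and C: "C \<in> sets borel"
      and A': "A' \<in> sigma_sets (space M) {a \<inter> b | a b. a \<in> past_cylinders B1 s \<and> b \<in> past_cylinders B2 s}" for s t A' C
  proof -
    let ?H = "{{\<omega> \<in> space M. B1 t \<omega> - B1 s \<omega> \<in> C1 \<and> B2 t \<omega> - B2 s \<omega> \<in> C2} | C1 C2. C1 \<in> sets borel \<and> C2 \<in> sets borel}"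
    have H: "?H \<subseteq> Pow (space M)" by auto
    have "(\<lambda>\<omega>. B1 t \<omega> - B1 s \<omega>) \<in> borel_measurable (sigma (space M) ?H)"
    proof (rule measurableI)
      fix C1 :: "real set" assume "C1 \<in> sets borel"
      then have "(\<lambda>\<omega>. B1 t \<omega> - B1 s \<omega>) -` C1 \<inter> space M \<in> ?H"
        by (intro CollectI exI[of _ C1] exI[of _ UNIV]) auto
      then show "(\<lambda>\<omega>. B1 t \<omega> - B1 s \<omega>) -` C1 \<inter> space (sigma (space M) ?H) \<in> sets (sigma (space M) ?H)"
        using H by (simp add: sets_measure_of space_measure_of sigma_sets.Basic)
    qed simp
    moreover have "(\<lambda>\<omega>. B2 t \<omega> - B2 s \<omega>) \<in> borel_measurable (sigma (space M) ?H)"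
    proof (rule measurableI)
      fix C2 :: "real set" assume "C2 \<in> sets borel"
      then have "(\<lambda>\<omega>. B2 t \<omega> - B2 s \<omega>) -` C2 \<inter> space M \<in> ?H"
        by (intro CollectI exI[of _ UNIV] exI[of _ C2]) auto
      then show "(\<lambda>\<omega>. B2 t \<omega> - B2 s \<omega>) -` C2 \<inter> space (sigma (space M) ?H) \<in> sets (sigma (space M) ?H)"
        using H by (simp add: sets_measure_of space_measure_of sigma_sets.Basic)
    qed simp
    ultimately have "(\<lambda>\<omega>. a * (B1 t \<omega> - B1 s \<omega>) + b * (B2 t \<omega> - B2 s \<omega>)) \<in> borel_measurable (sigma (space M) ?H)"
      by measurable
    then have "(\<lambda>\<omega>. ?W t \<omega> - ?W s \<omega>) \<in> borel_measurable (sigma (space M) ?H)"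
      by (simp add: algebra_simps)
    from measurable_sets[OF this C] have "(\<lambda>\<omega>. ?W t \<omega> - ?W s \<omega>) -` C \<inter> space M \<in> sigma_sets (space M) ?H"
      using H by (simp add: sets_measure_of space_measure_of)
    then show ?thesis
      using increments_indep_of_past[OF B1 B2 ind st] A' unfolding indep_sets2_eq by blast
  qed
  have indep: "measure (completion M) (A \<inter> ((\<lambda>\<omega>. ?W t \<omega> - ?W s \<omega>) -` C \<inter> space M)) =
      measure (completion M) A * measure (completion M) ((\<lambda>\<omega>. ?W t \<omega> - ?W s \<omega>) -` C \<inter> space M)"
    if st: "0 \<le> s" "s < t" and A: "A \<in> sets (?F (ennreal s))" and C: "C \<in> sets borel" for s t A C
  proof -
    interpret c: prob_space "completion M" by (rule prob_space_completion)
    let ?E = "(\<lambda>\<omega>. ?W t \<omega> - ?W s \<omega>) -` C \<inter> space M"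
    have "G (ennreal s) \<subseteq> sigma_sets (space M) {a \<inter> b | a b. a \<in> past_cylinders B1 s \<and> b \<in> past_cylinders B2 s}"
    proof -
      have sp: "space M \<in> past_cylinders B s" for B
        unfolding past_cylinders_def by (intro CollectI exI[of _ "{}"]) auto
      have "x \<in> sigma_sets (space M) {a \<inter> b | a b. a \<in> past_cylinders B1 s \<and> b \<in> past_cylinders B2 s}"
        if "x \<in> past_cylinders B1 s" for x
      proof (rule sigma_sets.Basic)
        have "x = x \<inter> space M" using that by (auto simp: past_cylinders_def)
        then show "x \<in> {a \<inter> b | a b. a \<in> past_cylinders B1 s \<and> b \<in> past_cylinders B2 s}"
          using that sp by blast
      qed
      moreover have "x \<in> sigma_sets (space M) {a \<inter> b | a b. a \<in> past_cylinders B1 s \<and> b \<in> past_cylinders B2 s}"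
        if "x \<in> past_cylinders B2 s" for x
      proof (rule sigma_sets.Basic)
        have "x = space M \<inter> x" using that by (auto simp: past_cylinders_def)
        then show "x \<in> {a \<inter> b | a b. a \<in> past_cylinders B1 s \<and> b \<in> past_cylinders B2 s}"
          using that sp by blast
      qed
      moreover have "x \<in> past_cylinders B1 s \<or> x \<in> past_cylinders B2 s" if "x \<in> G (ennreal s)" for x
        using that st past_cylinderI[of _ s] unfolding G_def by (auto simp: ennreal_le_iff)
      ultimately show ?thesis by blast
    qed
    from sigma_sets_AE_eq[OF A[unfolded sets_F] this] obtain A' where
      A': "A' \<in> sigma_sets (space M) {a \<inter> b | a b. a \<in> past_cylinders B1 s \<and> b \<in> past_cylinders B2 s}"
      "AE \<omega> in M. \<omega> \<in> A \<longleftrightarrow> \<omega> \<in> A'" by blast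
    note I = W_indep[OF st C A'(1)]
    have AM: "A \<in> sets (completion M)"
    proof -
      have "G (ennreal s) \<union> null_sets (completion M) \<subseteq> sets (completion M)"
        unfolding G_def using measurable_sets[OF B1_meas] measurable_sets[OF B2_meas] by auto
      then have "sigma_sets (space M) (G (ennreal s) \<union> null_sets (completion M)) \<subseteq> sets (completion M)"
        using sets.sigma_sets_subset[of _ "completion M"] by simp
      then show ?thesis using A sets_F by blast
    qed
    have E: "?E \<in> events"
      using measurable_sets[OF _ C, of "\<lambda>\<omega>. ?W t \<omega> - ?W s \<omega>" M] W_dist[OF st]
      by (auto simp: distributed_def)
    have "measure (completion M) A = prob A'"
      using c.finite_measure_eq_AE[of A A'] A'(2) AM I by (simp add: AE_completion_iff)
    moreover have "measure (completion M) (A \<inter> ?E) = prob (A' \<inter> ?E)"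
    proof -
      have "AE \<omega> in completion M. \<omega> \<in> A \<inter> ?E \<longleftrightarrow> \<omega> \<in> A' \<inter> ?E"
        using A'(2) unfolding AE_completion_iff by eventually_elim auto
      then have "measure (completion M) (A \<inter> ?E) = measure (completion M) (A' \<inter> ?E)"
        using AM I E by (intro c.finite_measure_eq_AE) auto
      then show ?thesis
        by (simp only: measure_completion[OF sets.Int[OF conjunct2[OF I] E]])
    qed
    moreover have "measure (completion M) ?E = prob ?E"
      by (rule measure_completion[OF E])
    ultimately show ?thesis
      using conjunct1[OF I] by (simp only:)
  qed
  show ?thesis
  proof (intro brownian_basis.intro brownian_basis_axioms.intro)
    show "prob_space (completion M)" by (rule prob_space_completion)
    show "space (?F t1) = space (completion M)" for t1
      by (simp add: space_F)
    show "sets (?F t1) \<subseteq> sets (completion M)" for t1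
    proof -
      have "G t1 \<union> null_sets (completion M) \<subseteq> sets (completion M)"
        unfolding G_def using measurable_sets[OF B1_meas] measurable_sets[OF B2_meas] by auto
      then show ?thesis
        using sets.sigma_sets_subset[of _ "completion M"] by (simp add: sets_F)
    qed
    show "sets (?F t1) \<subseteq> sets (?F t2)" if "t1 \<le> t2" for t1 t2
    proof -
      have "G t1 \<union> null_sets (completion M) \<subseteq> G t2 \<union> null_sets (completion M)"
        unfolding G_def by (intro Un_mono order_refl Collect_mono impI; blast intro: order_trans[OF _ that])
      then show ?thesis
        unfolding sets_F by (rule sigma_sets_mono')
    qed
    show "A \<in> sets (?F t1)" if "N \<in> null_sets (completion M)" "A \<subseteq> N" for N A t1
      using null_sets_completion_subset[OF that(2,1)] unfolding sets_F by (intro sigma_sets.Basic) auto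
    show "?W t \<in> borel_measurable (?F (ennreal t))" if "0 \<le> t" for t
      using F_meas[OF that] by measurable
    show "AE \<omega> in completion M. ?W 0 \<omega> = 0"
    proof -
      have "AE \<omega> in M. B1 0 \<omega> = 0" "AE \<omega> in M. B2 0 \<omega> = 0"
        using B1 B2 by (auto simp: brownian_motion_def)
      then have "AE \<omega> in M. ?W 0 \<omega> = 0" by eventually_elim simp
      then show ?thesis by (simp add: AE_completion_iff)
    qed
    show "AE \<omega> in completion M. continuous_on {0..} (\<lambda>t. ?W t \<omega>)"
    proof -
      have "AE \<omega> in M. continuous_on {0..} (\<lambda>t. B1 t \<omega>)" "AE \<omega> in M. continuous_on {0..} (\<lambda>t. B2 t \<omega>)"
        using B1 B2 by (auto simp: brownian_motion_def)
      then have "AE \<omega> in M. continuous_on {0..} (\<lambda>t. ?W t \<omega>)" by eventually_elim (intro continuous_intros)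
      then show ?thesis by (simp add: AE_completion_iff)
    qed
    show "distributed (completion M) lborel (\<lambda>\<omega>. ?W t \<omega> - ?W s \<omega>) (normal_density 0 (sqrt (t - s)))" if "0 \<le> s" "s < t" for s t
      using W_dist[OF that] unfolding distributed_def by (auto simp: distr_completion measurable_completion)
    show "measure (completion M) (A \<inter> ((\<lambda>\<omega>. ?W t \<omega> - ?W s \<omega>) -` C \<inter> space (completion M))) =
        measure (completion M) A * measure (completion M) ((\<lambda>\<omega>. ?W t \<omega> - ?W s \<omega>) -` C \<inter> space (completion M))"
      if "0 \<le> s" "s < t" "A \<in> sets (?F (ennreal s))" "C \<in> sets borel" for s t A C
      using indep[OF that] by simp
  qed
qed

end

section \<open>The fixed point problem as a concavity problem\<close>

text \<open>The tangent bound \<open>1 + x \<le> exp x\<close>; the linear terms cancel by the third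
  assumption.\<close>

lemma exp_combination_ge_one:
  fixes a b s :: real
  assumes "0 \<le> \<alpha>" "\<alpha> \<le> 1" "\<alpha> * a + (1 - \<alpha>) * b = 0"
  shows "1 \<le> \<alpha> * exp (a * s) + (1 - \<alpha>) * exp (b * s)"
proof -
  have "1 = \<alpha> * (1 + a * s) + (1 - \<alpha>) * (1 + b * s)"
    using arg_cong[OF assms(3), of "\<lambda>x. x * s"] by (simp add: algebra_simps)
  also have "\<dots> \<le> \<alpha> * exp (a * s) + (1 - \<alpha>) * exp (b * s)"
    using assms by (intro add_mono mult_left_mono exp_ge_add_one_self) auto
  finally show ?thesis .
qed

lemma powr_quotient:
  fixes y z :: real
  assumes "0 < y" "0 < z"
  shows "(y / z) powr \<gamma> = y powr \<gamma> * z powr (- \<gamma>)"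
  using assms by (simp add: powr_divide powr_minus_divide)

text \<open>Substituting \<open>x = y powr (\<gamma>2 - \<gamma>1)\<close> and dividing by \<open>y powr \<gamma>1\<close> turns the functions
  \<open>a y powr \<gamma>1 + b y powr \<gamma>2\<close> into affine ones; \<open>chord_weights\<close> are the weights of the corresponding
  convex combination. They are invariant under scaling of \<open>z1\<close>, \<open>z\<close>, \<open>z2\<close>.\<close>

definition chord_weights :: "real \<Rightarrow> real \<Rightarrow> real \<Rightarrow> real \<Rightarrow> real \<Rightarrow> real \<Rightarrow> real \<Rightarrow> bool" where
  "chord_weights \<gamma>1 \<gamma>2 z1 z z2 A B \<longleftrightarrow> 0 < z1 \<and> z1 < z \<and> z < z2 \<and> 0 \<le> A \<and> 0 \<le> B \<and>
    A * z1 powr \<gamma>1 + B * z2 powr \<gamma>1 = z powr \<gamma>1 \<and> A * z1 powr \<gamma>2 + B * z2 powr \<gamma>2 = z powr \<gamma>2"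

lemma chord_weights_scale:
  assumes "chord_weights \<gamma>1 \<gamma>2 z1 z z2 A B" "0 < c"
  shows "chord_weights \<gamma>1 \<gamma>2 (c * z1) (c * z) (c * z2) A B"
proof -
  have "A * (c * z1) powr \<gamma> + B * (c * z2) powr \<gamma> = (c * z) powr \<gamma>"
    if "A * z1 powr \<gamma> + B * z2 powr \<gamma> = z powr \<gamma>" for \<gamma>
  proof -
    have "A * (c * z1) powr \<gamma> + B * (c * z2) powr \<gamma> = c powr \<gamma> * (A * z1 powr \<gamma> + B * z2 powr \<gamma>)"
      using assms by (simp add: powr_mult chord_weights_def algebra_simps)
    also have "\<dots> = (c * z) powr \<gamma>"
      unfolding that using assms by (simp add: powr_mult chord_weights_def)
    finally show ?thesis .
  qed
  then show ?thesis
    using assms by (auto simp: chord_weights_def)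
qed

text \<open>After the change of variable, the chord condition says that slopes from the point
  \<open>(x z, V)\<close> to the right never exceed slopes to the left, so a supporting line through
  this point exists. Nonnegativity of \<open>f\<close> on the whole half line makes its slope and
  intercept nonnegative. The height \<open>U\<close> may exceed \<open>f z\<close>: for the reward
  it is the value \<open>u z\<close>.\<close>

lemma supporting_combination:
  fixes \<gamma>1 \<gamma>2 z U :: real and f :: "real \<Rightarrow> real"
  assumes \<gamma>: "\<gamma>1 < \<gamma>2" and z: "0 < z"
    and f: "\<And>y. 0 < y \<Longrightarrow> 0 \<le> f y" and fz: "f z \<le> U"
    and chord: "\<And>z1 z2 A B. chord_weights \<gamma>1 \<gamma>2 z1 z z2 A B \<Longrightarrow> A * f z1 + B * f z2 \<le> U"
  shows "\<exists>a b. 0 \<le> a \<and> 0 \<le> b \<and> a * z powr \<gamma>1 + b * z powr \<gamma>2 = U \<and>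
    (\<forall>y>0. f y \<le> a * y powr \<gamma>1 + b * y powr \<gamma>2)"
proof -
  define \<kappa> where "\<kappa> = \<gamma>2 - \<gamma>1"
  define x where "x y = y powr \<kappa>" for y
  define F where "F y = f y * y powr (- \<gamma>1)" for y
  define V where "V = U * z powr (- \<gamma>1)"
  define r where "r y = (F y - V) / (x y - x z)" for y
  have \<kappa>: "0 < \<kappa>" using \<gamma> by (simp add: \<kappa>_def)
  have x_less: "x y1 < x y2" if "0 < y1" "y1 < y2" for y1 y2
    unfolding x_def using that \<kappa> by (intro powr_less_mono2) auto
  have x_surj: "\<exists>y>0. x y = s" if "0 < s" for s
    using that \<kappa> by (intro exI[of _ "s powr (1 / \<kappa>)"]) (simp add: x_def powr_powr)
  have powr_x: "y powr \<gamma>2 = y powr \<gamma>1 * x y" if "0 < y" for y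
    using that by (simp add: x_def \<kappa>_def powr_add[symmetric])
  have U: "0 \<le> U" using f[OF z] fz by simp
  have V: "0 \<le> V" using U by (simp add: V_def)
  have F: "0 \<le> F y" if "0 < y" for y
    using f[OF that] by (simp add: F_def)
  have slope: "r y2 \<le> r y1" if y: "0 < y1" "y1 < z" "z < y2" for y1 y2
  proof -
    define d1 where "d1 = x z - x y1"
    define d2 where "d2 = x y2 - x z"
    have d: "0 < d1" "0 < d2"
      using x_less[of y1 z] x_less[of z y2] y z by (auto simp: d1_def d2_def)
    \<comment> \<open>The convex weights of \<open>x z\<close> between \<open>x y1\<close> and
      \<open>x y2\<close>, with the division by \<open>y powr \<gamma>1\<close> undone.\<close>
    define A where "A = d2 / (d1 + d2) * z powr \<gamma>1 * y1 powr (- \<gamma>1)"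
    define B where "B = d1 / (d1 + d2) * z powr \<gamma>1 * y2 powr (- \<gamma>1)"
    have A1: "A * y1 powr \<gamma>1 = d2 / (d1 + d2) * z powr \<gamma>1" and B1: "B * y2 powr \<gamma>1 = d1 / (d1 + d2) * z powr \<gamma>1"
      using y z by (simp_all add: A_def B_def powr_minus)
    have "chord_weights \<gamma>1 \<gamma>2 y1 z y2 A B"
      unfolding chord_weights_def
    proof (intro conjI)
      show "0 \<le> A" "0 \<le> B" using d by (auto simp: A_def B_def)
      have "d2 / (d1 + d2) * z powr \<gamma>1 + d1 / (d1 + d2) * z powr \<gamma>1 = (d2 + d1) / (d1 + d2) * z powr \<gamma>1"
        by (simp only: add_divide_distrib distrib_right)
      then show "A * y1 powr \<gamma>1 + B * y2 powr \<gamma>1 = z powr \<gamma>1"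
        unfolding A1 B1 using d by (simp add: add.commute)
      have "A * y1 powr \<gamma>2 + B * y2 powr \<gamma>2 = d2 / (d1 + d2) * z powr \<gamma>1 * x y1 + d1 / (d1 + d2) * z powr \<gamma>1 * x y2"
        using y z by (simp only: powr_x[of y1] powr_x[of y2] mult.assoc[symmetric] A1 B1)
      also have "\<dots> = z powr \<gamma>1 * ((d2 * x y1 + d1 * x y2) / (d1 + d2))"
        by (simp add: add_divide_distrib algebra_simps)
      also have "d2 * x y1 + d1 * x y2 = (d1 + d2) * x z"
        by (simp add: d1_def d2_def algebra_simps)
      finally show "A * y1 powr \<gamma>2 + B * y2 powr \<gamma>2 = z powr \<gamma>2"
        using d z by (simp add: powr_x[of z])
    qed (use y in auto)
    from chord[OF this] have "A * f y1 + B * f y2 \<le> U" .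
    moreover have "A * f y1 = d2 / (d1 + d2) * z powr \<gamma>1 * F y1" "B * f y2 = d1 / (d1 + d2) * z powr \<gamma>1 * F y2"
      by (simp_all add: A_def B_def F_def)
    moreover have "U = V * z powr \<gamma>1"
      using z by (simp add: V_def powr_minus)
    ultimately have "(d2 / (d1 + d2) * F y1 + d1 / (d1 + d2) * F y2) * z powr \<gamma>1 \<le> V * z powr \<gamma>1"
      by (simp add: algebra_simps)
    then have "d2 / (d1 + d2) * F y1 + d1 / (d1 + d2) * F y2 \<le> V"
      using z by simp
    then have "d2 * F y1 + d1 * F y2 \<le> V * (d1 + d2)"
      using d by (simp add: add_divide_distrib[symmetric] divide_le_eq)
    then have "(F y2 - V) * d1 \<le> (V - F y1) * d2"
      by (simp add: algebra_simps)
    then have "(F y2 - V) / d2 \<le> (V - F y1) / d1"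
      using d by (simp add: divide_le_eq le_divide_eq)
    moreover have "(V - F y1) / d1 = r y1"
      unfolding r_def d1_def by (metis minus_diff_eq minus_divide_divide)
    ultimately show ?thesis
      unfolding d2_def r_def by simp
  qed
  \<comment> \<open>The least admissible slope; any number between the right and the left slopes
    would do.\<close>
  define b where "b = Sup (r ` {z<..})"
  define a where "a = V - b * x z"
  have bdd: "bdd_above (r ` {z<..})"
    using slope[of "z / 2"] z by (intro bdd_aboveI2[of _ _ "r (z / 2)"]) auto
  have b_ge: "r y \<le> b" if "z < y" for y
    unfolding b_def by (rule cSup_upper[OF _ bdd]) (use that in auto)
  have b_le: "b \<le> r y" if "0 < y" "y < z" for y
    unfolding b_def by (rule cSup_least) (use slope[OF that] in auto)
  have above: "F y \<le> a + b * x y" if "0 < y" for y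
  proof -
    consider "y < z" | "y = z" | "z < y" by linarith
    then show ?thesis
    proof cases
      case 1
      then have "x y < x z" using x_less that by simp
      moreover have "b \<le> (V - F y) / (x z - x y)"
        using b_le[OF that 1] unfolding r_def by (metis minus_diff_eq minus_divide_divide)
      ultimately have "b * (x z - x y) \<le> V - F y"
        by (simp add: le_divide_eq)
      then show ?thesis by (simp add: a_def algebra_simps)
    next
      case 2
      have "F z \<le> V" unfolding F_def V_def using fz by (intro mult_right_mono) auto
      then show ?thesis using 2 by (simp add: a_def)
    next
      case 3
      then have "x z < x y" using x_less z by simp
      then have "F y - V \<le> b * (x y - x z)"
        using b_ge[OF 3] by (simp add: r_def divide_le_eq)
      then show ?thesis by (simp add: a_def algebra_simps)
    qed
  qed
  have b_nonneg: "0 \<le> b"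
  proof (rule field_le_epsilon)
    fix e :: real assume e: "0 < e"
    \<comment> \<open>So far to the right that a graph starting at height \<open>V\<close> and
      staying nonnegative has average slope at least \<open>- e\<close>.\<close>
    define s where "s = x z + V / e + 1"
    have "0 < x z" using z by (simp add: x_def)
    then have "0 < s" using V e by (simp add: s_def add_pos_nonneg)
    then obtain y where y: "0 < y" "x y = s" using x_surj by blast
    have "x z < x y" using y V e by (simp add: s_def add_nonneg_pos)
    then have "z < y" using x_less[of y z] y z by (metis less_asym linorder_neqE_linordered_idom)
    have "- e \<le> - V / (x y - x z)"
      using \<open>x z < x y\<close> y(2) e V by (simp add: s_def pos_divide_le_eq distrib_left)
    also have "\<dots> \<le> r y"
      unfolding r_def using F[OF y(1)] \<open>x z < x y\<close> by (intro divide_right_mono) auto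
    also have "\<dots> \<le> b" by (rule b_ge[OF \<open>z < y\<close>])
    finally show "0 \<le> b + e" by simp
  qed
  have a_nonneg: "0 \<le> a"
  proof (rule field_le_epsilon)
    fix e :: real assume e: "0 < e"
    \<comment> \<open>So close to 0 that the slope contributes at most \<open>e\<close> to the
      height of the line, which lies above the nonnegative \<open>F\<close>.\<close>
    define s where "s = min (x z / 2) (e / (b + 1))"
    have "0 < x z" using z by (simp add: x_def)
    then have s: "0 < s" "s < x z" "s \<le> e / (b + 1)" using e b_nonneg by (auto simp: s_def)
    then obtain y where y: "0 < y" "x y = s" using x_surj by blast
    have "0 \<le> F y" by (rule F[OF y(1)])
    also have "\<dots> \<le> a + b * s" using above[OF y(1)] y(2) by simp
    also have "b * s \<le> (b + 1) * (e / (b + 1))"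
      using s b_nonneg by (intro mult_mono) auto
    also have "\<dots> = e" using b_nonneg by simp
    finally show "0 \<le> a + e" by simp
  qed
  have "f y \<le> a * y powr \<gamma>1 + b * y powr \<gamma>2" if "0 < y" for y
  proof -
    have "f y = F y * y powr \<gamma>1"
      using that by (simp add: F_def powr_minus)
    also have "\<dots> \<le> (a + b * x y) * y powr \<gamma>1"
      using above[OF that] by (intro mult_right_mono) auto
    finally show ?thesis
      using that by (simp add: powr_x algebra_simps)
  qed
  moreover have "a * z powr \<gamma>1 + b * z powr \<gamma>2 = U"
  proof -
    have "a * z powr \<gamma>1 + b * z powr \<gamma>2 = (a + b * x z) * z powr \<gamma>1"
      using z by (simp add: powr_x algebra_simps)
    then show ?thesis
      using z by (simp add: a_def V_def powr_minus)
  qed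
  ultimately show ?thesis
    using a_nonneg b_nonneg by blast
qed

text \<open>Apart from the fixed point property of \<open>u\<close>, the optimal stopping problem enters only through
  \<open>u_le\<close> (optional sampling) and \<open>u_ge_chord\<close> (stopping on leaving an interval); \<open>\<Phi>\<close> is the value of the
  geometric Brownian motion started at 1 at the random time, and \<open>w\<close> the discount factor.\<close>

locale stopping_fixed_point =
  fixes \<gamma>1 \<gamma>2 p c :: real and N :: "'s measure" and w \<Phi> :: "'s \<Rightarrow> real" and u P :: "real \<Rightarrow> real"
  assumes \<gamma>: "\<gamma>1 < 0" "1 < \<gamma>2" and p: "0 < p" "p < 1"
    and w: "\<And>s. s \<in> space N \<Longrightarrow> 0 \<le> w s" and w_int: "integrable N w"
    and \<Phi>: "\<And>s. s \<in> space N \<Longrightarrow> 0 < \<Phi> s" and \<Phi>_meas: "\<Phi> \<in> borel_measurable N"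
    and w\<Phi>_int: "integrable N (\<lambda>s. w s * \<Phi> s)"
    and mass_le: "(\<integral>s. w s \<partial>N) \<le> 1" and mass_pos: "0 < (\<integral>s. w s \<partial>N)"
    and mean_le: "(\<integral>s. w s * \<Phi> s \<partial>N) \<le> 1" and mean_pos: "0 < (\<integral>s. w s * \<Phi> s \<partial>N)"
    and u_cont: "continuous_on {0<..} u" and u_nonneg: "\<And>z. 0 < z \<Longrightarrow> 0 \<le> u z"
    and u_growth: "\<And>z. 0 < z \<Longrightarrow> u z \<le> c * (1 + z)"
    and P_eq: "\<And>z. 0 < z \<Longrightarrow> P z = p * ((\<integral>s. w s \<partial>N) + (\<integral>s. w s * \<Phi> s \<partial>N) * z) + (1 - p) * (\<integral>s. w s * u (z * \<Phi> s) \<partial>N)"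
    and u_ge: "\<And>z. 0 < z \<Longrightarrow> max 1 (P z) \<le> u z"
    and u_ge_chord: "\<And>z1 z z2 A B. chord_weights \<gamma>1 \<gamma>2 z1 z z2 A B \<Longrightarrow> A * max 1 (P z1) + B * max 1 (P z2) \<le> u z"
    and u_le: "\<And>a b z. 0 \<le> a \<Longrightarrow> 0 \<le> b \<Longrightarrow> (\<And>y. 0 < y \<Longrightarrow> max 1 (P y) \<le> a * y powr \<gamma>1 + b * y powr \<gamma>2) \<Longrightarrow> 0 < z \<Longrightarrow>
      u z \<le> a * z powr \<gamma>1 + b * z powr \<gamma>2"
begin

section \<open>Discounted moments of the delay and touching combinations\<close>

definition q where "q = (\<integral>s. w s \<partial>N)"
definition q2 where "q2 = (\<integral>s. w s * \<Phi> s \<partial>N)"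
definition L where "L z = (\<integral>s. w s * u (z * \<Phi> s) \<partial>N)"
text \<open>The weight for which \<open>\<alpha> * (y / z) powr \<gamma>1 + (1 - \<alpha>) * (y / z)
  powr \<gamma>2\<close> has derivative 0 at \<open>y = z\<close>, so that it touches the constant 1
  from above. The weight \<open>\<alpha>'\<close> does the same for the identity.\<close>

definition \<alpha> where "\<alpha> = \<gamma>2 / (\<gamma>2 - \<gamma>1)"
definition \<alpha>' where "\<alpha>' = (\<gamma>2 - 1) / (\<gamma>2 - \<gamma>1)"

lemma q: "0 < q" "q \<le> 1" and q2: "0 < q2" "q2 \<le> 1"
  using mass_le mass_pos mean_le mean_pos by (auto simp: q_def q2_def)

lemma P_eq': "0 < z \<Longrightarrow> P z = p * (q + q2 * z) + (1 - p) * L z"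
  by (simp add: P_eq q_def q2_def L_def)

lemma \<alpha>: "0 < \<alpha>" "\<alpha> < 1" "\<alpha> * \<gamma>1 + (1 - \<alpha>) * \<gamma>2 = 0"
  and \<alpha>': "0 < \<alpha>'" "\<alpha>' < 1" "\<alpha>' * (\<gamma>1 - 1) + (1 - \<alpha>') * (\<gamma>2 - 1) = 0"
  using \<gamma> by (auto simp: \<alpha>_def \<alpha>'_def field_simps)

lemma tangent_one:
  assumes "0 < y" "0 < z"
  shows "1 \<le> \<alpha> * (y / z) powr \<gamma>1 + (1 - \<alpha>) * (y / z) powr \<gamma>2"
  using exp_combination_ge_one[of \<alpha> \<gamma>1 \<gamma>2 "ln (y / z)"] \<alpha> assms by (simp add: powr_def)

text \<open>Division by \<open>y / z\<close> lowers both exponents by one and leads back to the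
  constant case; \<open>1 < \<gamma>2\<close> keeps the lowered exponents on both sides of
  0.\<close>

lemma tangent_id:
  assumes "0 < y" "0 < z"
  shows "y \<le> z * (\<alpha>' * (y / z) powr \<gamma>1 + (1 - \<alpha>') * (y / z) powr \<gamma>2)"
proof -
  define t where "t = y / z"
  have t: "0 < t" using assms by (simp add: t_def)
  have "1 \<le> \<alpha>' * t powr (\<gamma>1 - 1) + (1 - \<alpha>') * t powr (\<gamma>2 - 1)"
    using exp_combination_ge_one[of \<alpha>' "\<gamma>1 - 1" "\<gamma>2 - 1" "ln t"] \<alpha>' t by (simp add: powr_def)
  then have "t * 1 \<le> t * (\<alpha>' * t powr (\<gamma>1 - 1) + (1 - \<alpha>') * t powr (\<gamma>2 - 1))"
    using t by (intro mult_left_mono) auto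
  also have "\<dots> = \<alpha>' * t powr \<gamma>1 + (1 - \<alpha>') * t powr \<gamma>2"
    using t by (simp add: powr_diff distrib_left)
  finally have "z * t \<le> z * (\<alpha>' * t powr \<gamma>1 + (1 - \<alpha>') * t powr \<gamma>2)"
    using assms by (intro mult_left_mono) auto
  then show ?thesis using assms by (simp add: t_def)
qed

text \<open>With \<open>tb z\<close>, the coefficients of the combination that touches
  \<open>1 + y\<close> at \<open>y = z\<close> from above.\<close>

definition ta where "ta z = (\<alpha> + z * \<alpha>') * z powr (- \<gamma>1)"
definition tb where "tb z = ((1 - \<alpha>) + z * (1 - \<alpha>')) * z powr (- \<gamma>2)"

lemma tangent_one_plus_id:
  assumes "0 < z"
  shows "0 \<le> ta z" "0 \<le> tb z" "ta z * z powr \<gamma>1 + tb z * z powr \<gamma>2 = 1 + z"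
    and "0 < y \<Longrightarrow> 1 + y \<le> ta z * y powr \<gamma>1 + tb z * y powr \<gamma>2"
proof -
  show "0 \<le> ta z" "0 \<le> tb z"
    using assms \<alpha> \<alpha>' by (auto simp: ta_def tb_def)
  show "ta z * z powr \<gamma>1 + tb z * z powr \<gamma>2 = 1 + z"
    using assms by (simp add: ta_def tb_def powr_minus algebra_simps)
  assume y: "0 < y"
  have "1 + y \<le> (\<alpha> * (y / z) powr \<gamma>1 + (1 - \<alpha>) * (y / z) powr \<gamma>2) + z * (\<alpha>' * (y / z) powr \<gamma>1 + (1 - \<alpha>') * (y / z) powr \<gamma>2)"
    by (intro add_mono tangent_one tangent_id y assms)
  also have "\<dots> = ta z * y powr \<gamma>1 + tb z * y powr \<gamma>2"
    using y assms by (simp add: ta_def tb_def powr_quotient algebra_simps)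
  finally show "1 + y \<le> ta z * y powr \<gamma>1 + tb z * y powr \<gamma>2" .
qed

lemma u_meas: "0 < z \<Longrightarrow> (\<lambda>s. u (z * \<Phi> s)) \<in> borel_measurable N"
proof -
  assume z: "0 < z"
  have "(\<lambda>x. indicator {0<..} x *\<^sub>R u x) \<in> borel_measurable borel"
    using borel_measurable_continuous_on_indicator[OF _ u_cont] by simp
  moreover have "(\<lambda>s. z * \<Phi> s) \<in> borel_measurable N"
    using \<Phi>_meas by simp
  ultimately have "(\<lambda>s. indicator {0<..} (z * \<Phi> s) *\<^sub>R u (z * \<Phi> s)) \<in> borel_measurable N"
    by (rule measurable_compose[rotated])
  then show ?thesis
    by (rule measurable_cong[THEN iffD1, rotated]) (use z \<Phi> in simp)
qed

lemma wu_int: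
  assumes z: "0 < z"
  shows "integrable N (\<lambda>s. w s * u (z * \<Phi> s))"
proof (rule Bochner_Integration.integrable_bound)
  show "integrable N (\<lambda>s. c * w s + c * z * (w s * \<Phi> s))"
    using w_int w\<Phi>_int by simp
  show "(\<lambda>s. w s * u (z * \<Phi> s)) \<in> borel_measurable N"
    using u_meas[OF z] borel_measurable_integrable[OF w_int] by simp
  show "AE s in N. norm (w s * u (z * \<Phi> s)) \<le> norm (c * w s + c * z * (w s * \<Phi> s))"
  proof (rule AE_I2)
    fix s assume s: "s \<in> space N"
    have "w s * u (z * \<Phi> s) \<le> w s * (c * (1 + z * \<Phi> s))"
      using w[OF s] u_growth[of "z * \<Phi> s"] z \<Phi>[OF s] by (intro mult_left_mono) auto
    moreover have "0 \<le> w s * u (z * \<Phi> s)"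
      using w[OF s] u_nonneg[of "z * \<Phi> s"] z \<Phi>[OF s] by simp
    ultimately show "norm (w s * u (z * \<Phi> s)) \<le> norm (c * w s + c * z * (w s * \<Phi> s))"
      by (simp add: algebra_simps)
  qed
qed

lemma affine_int: "integrable N (\<lambda>s. w s * (k * (1 + z * \<Phi> s)))"
  and affine_integral: "(\<integral>s. w s * (k * (1 + z * \<Phi> s)) \<partial>N) = k * (q + q2 * z)"
proof -
  have eq: "w s * (k * (1 + z * \<Phi> s)) = k * w s + k * z * (w s * \<Phi> s)" for s
    by (simp add: algebra_simps)
  show "integrable N (\<lambda>s. w s * (k * (1 + z * \<Phi> s)))"
    unfolding eq using w_int w\<Phi>_int by simp
  show "(\<integral>s. w s * (k * (1 + z * \<Phi> s)) \<partial>N) = k * (q + q2 * z)"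
    unfolding eq using w_int w\<Phi>_int by (simp add: q_def q2_def algebra_simps)
qed

lemma affine_le: "0 < z \<Longrightarrow> q + q2 * z \<le> 1 + z"
  using q q2 by (intro add_mono) (auto simp: mult_left_le_one_le)

lemma L_nonneg: "0 < z \<Longrightarrow> 0 \<le> L z"
  unfolding L_def using w u_nonneg \<Phi> by (intro integral_nonneg_AE) (auto intro!: AE_I2)

section \<open>Comparison up to multiples of \<open>1 + y\<close>\<close>

lemma L_le:
  assumes "\<And>y. 0 < y \<Longrightarrow> u y \<le> k * (1 + y)" "0 < z"
  shows "L z \<le> k * (q + q2 * z)"
  unfolding L_def affine_integral[symmetric]
  by (rule integral_mono[OF wu_int affine_int]) (use assms w \<Phi> in \<open>auto intro!: mult_left_mono\<close>)

text \<open>A one-sided contraction argument in the norm with weight \<open>1 + z\<close>, carried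
  out pointwise: a bound with \<delta> improves to one with \<open>(1 - p) * \<delta>\<close>, so
  iteration leaves 0.\<close>

lemma comparison:
  assumes base: "\<And>z. 0 < z \<Longrightarrow> u z - v z \<le> k * (1 + z)" and "0 \<le> k"
    and step: "\<And>\<delta> z. 0 \<le> \<delta> \<Longrightarrow> (\<And>y. 0 < y \<Longrightarrow> u y - v y \<le> \<delta> * (1 + y)) \<Longrightarrow> 0 < z \<Longrightarrow>
      u z - v z \<le> (1 - p) * \<delta> * (1 + z)"
    and z: "0 < z"
  shows "u z \<le> v z"
proof -
  have "\<forall>z>0. u z - v z \<le> ((1 - p) ^ n * k) * (1 + z)" for n
  proof (induction n)
    case (Suc n)
    show ?case
    proof (intro allI impI)
      fix z :: real assume "0 < z"
      have "u z - v z \<le> (1 - p) * ((1 - p) ^ n * k) * (1 + z)"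
        by (rule step) (use Suc p \<open>0 \<le> k\<close> \<open>0 < z\<close> in auto)
      then show "u z - v z \<le> ((1 - p) ^ Suc n * k) * (1 + z)"
        by (simp add: mult.assoc)
    qed
  qed (use base in auto)
  then have "u z - v z \<le> ((1 - p) ^ n * k) * (1 + z)" for n
    using z by blast
  moreover have "(\<lambda>n. ((1 - p) ^ n * k) * (1 + z)) \<longlonglongrightarrow> (0 * k) * (1 + z)"
    using p by (intro tendsto_intros LIMSEQ_power_zero) auto
  ultimately have "u z - v z \<le> (0 * k) * (1 + z)"
    by (intro LIMSEQ_le_const[of _ _ "u z - v z"]) auto
  then show ?thesis by simp
qed

lemma c_pos: "0 \<le> c"
  using u_growth[of 1] u_nonneg[of 1] by simp

text \<open>If \<open>u\<close> exceeds \<open>1 + y\<close> by at most the fraction \<delta>, then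
  the reward does so by at most \<open>(1 - p) * \<delta>\<close>: the part of weight
  \<open>p\<close> is explicit, and discounting does not enlarge \<open>1 + y\<close>. The
  combination touching \<open>1 + y\<close> at \<open>z\<close>, times \<open>k\<close>, carries the
  bound over to \<open>u z\<close>.\<close>

lemma u_le_one_plus:
  assumes "0 < z"
  shows "u z \<le> 1 + z"
proof (rule comparison[where k = c])
  show "u z - (1 + z) \<le> c * (1 + z)" if "0 < z" for z
    using u_growth[OF that] that by simp
  fix \<delta> z :: real assume \<delta>: "0 \<le> \<delta>" and le: "\<And>y. 0 < y \<Longrightarrow> u y - (1 + y) \<le> \<delta> * (1 + y)" and z: "0 < z"
  define k where "k = 1 + (1 - p) * \<delta>"
  have k: "1 \<le> k" using \<delta> p by (simp add: k_def)
  have h_le: "max 1 (P y) \<le> k * (1 + y)" if y: "0 < y" for y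
  proof -
    have u': "u y \<le> (1 + \<delta>) * (1 + y)" if "0 < y" for y
      using le[OF that] by (simp add: algebra_simps)
    have "P y \<le> p * (q + q2 * y) + (1 - p) * ((1 + \<delta>) * (q + q2 * y))"
      unfolding P_eq'[OF y] using L_le[OF u' y] p by (intro add_left_mono mult_left_mono) auto
    also have "\<dots> = k * (q + q2 * y)"
      by (simp add: k_def algebra_simps)
    also have "\<dots> \<le> k * (1 + y)"
      using affine_le[OF y] k by (intro mult_left_mono) auto
    finally have "P y \<le> k * (1 + y)" .
    moreover have "1 * 1 \<le> k * (1 + y)"
      using k y by (intro mult_mono) auto
    ultimately show ?thesis by simp
  qed
  have "u z \<le> (k * ta z) * z powr \<gamma>1 + (k * tb z) * z powr \<gamma>2"
  proof (rule u_le)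
    fix y :: real assume y: "0 < y"
    have "k * (1 + y) \<le> k * (ta z * y powr \<gamma>1 + tb z * y powr \<gamma>2)"
      using tangent_one_plus_id(4)[OF z y] k by (intro mult_left_mono) auto
    with h_le[OF y] show "max 1 (P y) \<le> (k * ta z) * y powr \<gamma>1 + (k * tb z) * y powr \<gamma>2"
      by (simp add: algebra_simps)
  qed (use k tangent_one_plus_id[OF z] z in auto)
  also have "\<dots> = k * (1 + z)"
    using tangent_one_plus_id(3)[OF z] by (simp add: mult.assoc distrib_left[symmetric])
  finally show "u z - (1 + z) \<le> (1 - p) * \<delta> * (1 + z)"
    by (simp add: k_def algebra_simps)
qed (use c_pos assms in auto)

text \<open>The reward is supported at height \<open>u z\<close> and not at its own value;
  \<open>u_le\<close> then puts all of \<open>u\<close> below the same combination.\<close>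

lemma u_support:
  assumes z: "0 < z"
  obtains a b where "0 \<le> a" "0 \<le> b" "a * z powr \<gamma>1 + b * z powr \<gamma>2 = u z"
    "\<And>y. 0 < y \<Longrightarrow> max 1 (P y) \<le> a * y powr \<gamma>1 + b * y powr \<gamma>2"
    "\<And>y. 0 < y \<Longrightarrow> u y \<le> a * y powr \<gamma>1 + b * y powr \<gamma>2"
proof -
  have "\<exists>a b. 0 \<le> a \<and> 0 \<le> b \<and> a * z powr \<gamma>1 + b * z powr \<gamma>2 = u z \<and>
    (\<forall>y>0. max 1 (P y) \<le> a * y powr \<gamma>1 + b * y powr \<gamma>2)"
    by (rule supporting_combination) (use \<gamma> z u_ge u_ge_chord in auto)
  then obtain a b where ab: "0 \<le> a" "0 \<le> b" "a * z powr \<gamma>1 + b * z powr \<gamma>2 = u z"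
    "\<And>y. 0 < y \<Longrightarrow> max 1 (P y) \<le> a * y powr \<gamma>1 + b * y powr \<gamma>2" by blast
  from that[OF ab u_le[OF ab(1,2,4)]] show thesis .
qed

lemma chord_of_support:
  assumes "chord_weights \<gamma>1 \<gamma>2 z1 z z2 A B"
    and "a * z powr \<gamma>1 + b * z powr \<gamma>2 = f z" and "\<And>y. 0 < y \<Longrightarrow> f y \<le> a * y powr \<gamma>1 + b * y powr \<gamma>2"
  shows "A * f z1 + B * f z2 \<le> f z"
proof -
  from assms(1) have w: "0 < z1" "0 < z2" "0 \<le> A" "0 \<le> B"
    "A * z1 powr \<gamma>1 + B * z2 powr \<gamma>1 = z powr \<gamma>1" "A * z1 powr \<gamma>2 + B * z2 powr \<gamma>2 = z powr \<gamma>2"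
    by (auto simp: chord_weights_def)
  have "A * f z1 + B * f z2 \<le> A * (a * z1 powr \<gamma>1 + b * z1 powr \<gamma>2) + B * (a * z2 powr \<gamma>1 + b * z2 powr \<gamma>2)"
    using w assms(3) by (intro add_mono mult_left_mono) auto
  also have "\<dots> = a * (A * z1 powr \<gamma>1 + B * z2 powr \<gamma>1) + b * (A * z1 powr \<gamma>2 + B * z2 powr \<gamma>2)"
    by (simp add: algebra_simps)
  finally show ?thesis using w assms(2) by simp
qed

lemma u_chord: "chord_weights \<gamma>1 \<gamma>2 z1 z z2 A B \<Longrightarrow> A * u z1 + B * u z2 \<le> u z"
proof -
  assume cw: "chord_weights \<gamma>1 \<gamma>2 z1 z z2 A B"
  then have "0 < z" by (auto simp: chord_weights_def)
  from u_support[OF this] obtain a b where "a * z powr \<gamma>1 + b * z powr \<gamma>2 = u z"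
    "\<And>y. 0 < y \<Longrightarrow> u y \<le> a * y powr \<gamma>1 + b * y powr \<gamma>2" by metis
  from chord_of_support[OF cw this] show ?thesis .
qed

lemma id_chord: "chord_weights \<gamma>1 \<gamma>2 z1 z z2 A B \<Longrightarrow> A * z1 + B * z2 \<le> z"
proof -
  assume cw: "chord_weights \<gamma>1 \<gamma>2 z1 z z2 A B"
  then have z: "0 < z" by (auto simp: chord_weights_def)
  let ?a = "z * \<alpha>' * z powr (- \<gamma>1)" and ?b = "z * (1 - \<alpha>') * z powr (- \<gamma>2)"
  have "?a * z powr \<gamma>1 + ?b * z powr \<gamma>2 = z"
    using z by (simp add: powr_minus algebra_simps)
  moreover have "y \<le> ?a * y powr \<gamma>1 + ?b * y powr \<gamma>2" if "0 < y" for y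
    using tangent_id[OF that z] that z by (simp add: powr_quotient algebra_simps)
  ultimately show ?thesis
    using chord_of_support[OF cw, of ?a ?b "\<lambda>y. y"] by simp
qed

lemma L_chord:
  assumes cw: "chord_weights \<gamma>1 \<gamma>2 z1 z z2 A B"
  shows "A * L z1 + B * L z2 \<le> L z"
proof -
  from cw have z: "0 < z1" "0 < z" "0 < z2" by (auto simp: chord_weights_def)
  have "A * L z1 + B * L z2 = (\<integral>s. A * (w s * u (z1 * \<Phi> s)) + B * (w s * u (z2 * \<Phi> s)) \<partial>N)"
    unfolding L_def using wu_int z by simp
  also have "\<dots> \<le> L z"
    unfolding L_def
  proof (rule integral_mono)
    fix s assume s: "s \<in> space N"
    have "A * u (\<Phi> s * z1) + B * u (\<Phi> s * z2) \<le> u (\<Phi> s * z)"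
      by (rule u_chord[OF chord_weights_scale[OF cw \<Phi>[OF s]]])
    then have "w s * (A * u (z1 * \<Phi> s) + B * u (z2 * \<Phi> s)) \<le> w s * u (z * \<Phi> s)"
      using w[OF s] by (intro mult_left_mono) (simp_all add: mult.commute)
    then show "A * (w s * u (z1 * \<Phi> s)) + B * (w s * u (z2 * \<Phi> s)) \<le> w s * u (z * \<Phi> s)"
      by (simp add: algebra_simps)
  qed (use wu_int z in auto)
  finally show ?thesis .
qed

text \<open>The summand \<open>p * q\<close> of \<open>P\<close> alone makes the coefficient of \<open>y powr \<gamma>1\<close> large as \<open>z\<close> grows.\<close>

lemma P_support:
  assumes z: "0 < z"
  obtains a b where "p * q * \<alpha> * z powr (- \<gamma>1) \<le> a" "0 \<le> b" "a * z powr \<gamma>1 + b * z powr \<gamma>2 = P z"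
    "\<And>y. 0 < y \<Longrightarrow> P y \<le> a * y powr \<gamma>1 + b * y powr \<gamma>2"
proof -
  \<comment> \<open>The constant \<open>p * q\<close> is split off and majorised by
    \<open>tangent_one\<close>; the remainder is still concave in the transformed sense.\<close>
  define R where "R y = p * q2 * y + (1 - p) * L y" for y
  have R: "P y = p * q + R y" if "0 < y" for y
    using P_eq'[OF that] by (simp add: R_def algebra_simps)
  have "\<exists>a b. 0 \<le> a \<and> 0 \<le> b \<and> a * z powr \<gamma>1 + b * z powr \<gamma>2 = R z \<and>
    (\<forall>y>0. R y \<le> a * y powr \<gamma>1 + b * y powr \<gamma>2)"
  proof (rule supporting_combination)
    show "0 \<le> R y" if "0 < y" for y
      using that p q2 L_nonneg[OF that] by (simp add: R_def)
    fix z1 z2 A B assume cw: "chord_weights \<gamma>1 \<gamma>2 z1 z z2 A B"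
    have "A * R z1 + B * R z2 = p * q2 * (A * z1 + B * z2) + (1 - p) * (A * L z1 + B * L z2)"
      by (simp add: R_def algebra_simps)
    also have "\<dots> \<le> R z"
      unfolding R_def using p q2 id_chord[OF cw] L_chord[OF cw] by (intro add_mono mult_left_mono) auto
    finally show "A * R z1 + B * R z2 \<le> R z" .
  qed (use \<gamma> z in auto)
  then obtain a b where ab: "0 \<le> a" "0 \<le> b" "a * z powr \<gamma>1 + b * z powr \<gamma>2 = R z"
    "\<And>y. 0 < y \<Longrightarrow> R y \<le> a * y powr \<gamma>1 + b * y powr \<gamma>2" by blast
  show thesis
  proof (rule that[of "p * q * \<alpha> * z powr (- \<gamma>1) + a" "p * q * (1 - \<alpha>) * z powr (- \<gamma>2) + b"])
    show "0 \<le> p * q * (1 - \<alpha>) * z powr (- \<gamma>2) + b"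
      using p q \<alpha> ab by simp
    have "(p * q * \<alpha> * z powr (- \<gamma>1) + a) * z powr \<gamma>1 + (p * q * (1 - \<alpha>) * z powr (- \<gamma>2) + b) * z powr \<gamma>2 =
        p * q + (a * z powr \<gamma>1 + b * z powr \<gamma>2)"
      using z by (simp add: powr_minus algebra_simps)
    then show "(p * q * \<alpha> * z powr (- \<gamma>1) + a) * z powr \<gamma>1 + (p * q * (1 - \<alpha>) * z powr (- \<gamma>2) + b) * z powr \<gamma>2 = P z"
      by (simp add: ab(3) R z)
    fix y :: real assume y: "0 < y"
    have "p * q * 1 \<le> p * q * (\<alpha> * (y / z) powr \<gamma>1 + (1 - \<alpha>) * (y / z) powr \<gamma>2)"
      using tangent_one[OF y z] p q by (intro mult_left_mono) auto
    then have "P y \<le> p * q * (\<alpha> * (y / z) powr \<gamma>1 + (1 - \<alpha>) * (y / z) powr \<gamma>2) + (a * y powr \<gamma>1 + b * y powr \<gamma>2)"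
      using ab(4)[OF y] R[OF y] by simp
    also have "\<dots> = (p * q * \<alpha> * z powr (- \<gamma>1) + a) * y powr \<gamma>1 + (p * q * (1 - \<alpha>) * z powr (- \<gamma>2) + b) * y powr \<gamma>2"
      using y z by (simp add: powr_quotient algebra_simps)
    finally show "P y \<le> (p * q * \<alpha> * z powr (- \<gamma>1) + a) * y powr \<gamma>1 + (p * q * (1 - \<alpha>) * z powr (- \<gamma>2) + b) * y powr \<gamma>2" .
  qed (use ab in simp)
qed

text \<open>\<open>u\<close> is compared with its dilation by \<open>l \<ge> 1\<close>. The explicit
  part of \<open>P\<close> increases under dilation, so an excess \<delta> is again damped by
  \<open>1 - p\<close>. The majorant used at \<open>z\<close> is the supporting combination at
  \<open>l * z\<close>, pulled back, plus a touching combination for the excess.\<close>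

lemma u_mono:
  assumes "0 < z" "z \<le> z'"
  shows "u z \<le> u z'"
proof -
  define l where "l = z' / z"
  have l: "1 \<le> l" "z' = l * z" using assms by (auto simp: l_def)
  have "u z \<le> u (l * z)"
  proof (rule comparison[where v = "\<lambda>z. u (l * z)" and k = c])
    show "u z - u (l * z) \<le> c * (1 + z)" if "0 < z" for z
      using u_growth[OF that] u_nonneg[of "l * z"] that l by simp
    fix \<delta> z :: real assume \<delta>: "0 \<le> \<delta>" and le: "\<And>y. 0 < y \<Longrightarrow> u y - u (l * y) \<le> \<delta> * (1 + y)" and z: "0 < z"
    have lz: "0 < l * y" if "0 < y" for y using l that by simp
    define k where "k = (1 - p) * \<delta>"
    have k: "0 \<le> k" using \<delta> p by (simp add: k_def)
    have P_le: "P y \<le> P (l * y) + k * (1 + y)" if y: "0 < y" for y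
    proof -
      have "L y \<le> L (l * y) + \<delta> * (q + q2 * y)"
      proof -
        have "L y \<le> (\<integral>s. w s * u (l * y * \<Phi> s) + w s * (\<delta> * (1 + y * \<Phi> s)) \<partial>N)"
          unfolding L_def
        proof (rule integral_mono[OF wu_int[OF y]])
          show "integrable N (\<lambda>s. w s * u (l * y * \<Phi> s) + w s * (\<delta> * (1 + y * \<Phi> s)))"
            by (intro Bochner_Integration.integrable_add wu_int affine_int lz y)
          fix s assume s: "s \<in> space N"
          have "w s * u (y * \<Phi> s) \<le> w s * (u (l * (y * \<Phi> s)) + \<delta> * (1 + y * \<Phi> s))"
            using le[of "y * \<Phi> s"] y \<Phi>[OF s] w[OF s] by (intro mult_left_mono) auto
          then show "w s * u (y * \<Phi> s) \<le> w s * u (l * y * \<Phi> s) + w s * (\<delta> * (1 + y * \<Phi> s))"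
            by (simp add: distrib_left mult.assoc)
        qed
        also have "\<dots> = L (l * y) + \<delta> * (q + q2 * y)"
          unfolding L_def by (subst Bochner_Integration.integral_add) (simp_all add: wu_int affine_int affine_integral lz y)
        finally show ?thesis .
      qed
      moreover have "y \<le> l * y" using l y by (simp add: mult_le_cancel_right1)
      ultimately have "P y \<le> p * (q + q2 * (l * y)) + (1 - p) * (L (l * y) + \<delta> * (q + q2 * y))"
        unfolding P_eq'[OF y] using p q2 by (intro add_mono mult_left_mono) auto
      also have "\<dots> = P (l * y) + k * (q + q2 * y)"
        unfolding P_eq'[OF lz[OF y]] by (simp add: k_def algebra_simps)
      also have "\<dots> \<le> P (l * y) + k * (1 + y)"
        using mult_left_mono[OF affine_le[OF y] k] by simp
      finally show ?thesis .
    qed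
    obtain a b where ab: "0 \<le> a" "0 \<le> b" "a * (l * z) powr \<gamma>1 + b * (l * z) powr \<gamma>2 = u (l * z)"
      "\<And>y. 0 < y \<Longrightarrow> max 1 (P y) \<le> a * y powr \<gamma>1 + b * y powr \<gamma>2"
      by (rule u_support[OF lz[OF z]]) blast
    let ?a = "a * l powr \<gamma>1 + k * ta z" and ?b = "b * l powr \<gamma>2 + k * tb z"
    have split: "?a * y powr \<gamma>1 + ?b * y powr \<gamma>2 = (a * (l * y) powr \<gamma>1 + b * (l * y) powr \<gamma>2) +
        k * (ta z * y powr \<gamma>1 + tb z * y powr \<gamma>2)" if "0 < y" for y
      using that l by (simp add: powr_mult algebra_simps)
    have "u z \<le> ?a * z powr \<gamma>1 + ?b * z powr \<gamma>2"
    proof (rule u_le)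
      fix y :: real assume y: "0 < y"
      have "max 1 (P y) \<le> max 1 (P (l * y)) + k * (1 + y)"
        using P_le[OF y] k y by (smt (verit) mult_nonneg_nonneg)
      also have "\<dots> \<le> (a * (l * y) powr \<gamma>1 + b * (l * y) powr \<gamma>2) + k * (ta z * y powr \<gamma>1 + tb z * y powr \<gamma>2)"
        by (intro add_mono ab(4)[OF lz[OF y]] mult_left_mono[OF tangent_one_plus_id(4)[OF z y] k])
      finally show "max 1 (P y) \<le> ?a * y powr \<gamma>1 + ?b * y powr \<gamma>2"
        unfolding split[OF y] .
    qed (use ab k tangent_one_plus_id[OF z] z in auto)
    also have "\<dots> = u (l * z) + k * (1 + z)"
      unfolding split[OF z] ab(3) tangent_one_plus_id(3)[OF z] ..
    finally show "u z - u (l * z) \<le> (1 - p) * \<delta> * (1 + z)"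
      by (simp add: k_def)
  qed (use c_pos assms in auto)
  then show ?thesis by (simp add: l)
qed

text \<open>The guaranteed increase comes from the summand \<open>p * q2 * z\<close>, the integral
  of \<open>u\<close> being monotone. This positive slope later produces the kink at the point where
  \<open>P\<close> reaches 1.\<close>

lemma P_increase:
  assumes "0 < y" "y \<le> z"
  shows "P y + p * q2 * (z - y) \<le> P z"
proof -
  have "L y \<le> L z"
    unfolding L_def
    by (rule integral_mono[OF wu_int wu_int]) (use assms w \<Phi> in \<open>auto intro!: mult_left_mono u_mono mult_right_mono simp: less_imp_le\<close>)
  then have "(1 - p) * L y \<le> (1 - p) * L z"
    using p by (intro mult_left_mono) auto
  then show ?thesis
    using assms by (simp add: P_eq' algebra_simps)
qed

lemma P_le: "0 < z \<Longrightarrow> P z \<le> q + q2 * z"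
proof -
  assume z: "0 < z"
  have "L z \<le> 1 * (q + q2 * z)"
    by (rule L_le[OF _ z]) (simp add: u_le_one_plus)
  then have "P z \<le> p * (q + q2 * z) + (1 - p) * (1 * (q + q2 * z))"
    unfolding P_eq'[OF z] using p by (intro add_left_mono mult_left_mono) auto
  then show ?thesis by (simp add: algebra_simps)
qed

lemma P_cont: "continuous_on {0<..} P"
proof -
  have "continuous_on {0<..} L"
    unfolding continuous_on_sequentially
  proof (intro allI ballI impI, elim conjE)
    fix X :: "nat \<Rightarrow> real" and z assume z: "z \<in> {0<..}" and X: "\<forall>n. X n \<in> {0<..}" "X \<longlonglongrightarrow> z"
    obtain k where k: "\<And>n. X n \<le> k"
      using convergent_imp_Bseq[OF convergentI[OF X(2)]] unfolding Bseq_def by (metis abs_le_D1 real_norm_def)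
    have "(\<lambda>n. \<integral>s. w s * u (X n * \<Phi> s) \<partial>N) \<longlonglongrightarrow> (\<integral>s. w s * u (z * \<Phi> s) \<partial>N)"
    proof (rule integral_dominated_convergence)
      show "integrable N (\<lambda>s. w s * (c * (1 + k * \<Phi> s)))"
        by (rule affine_int)
      show "(\<lambda>s. w s * u (z * \<Phi> s)) \<in> borel_measurable N" "(\<lambda>s. w s * u (X n * \<Phi> s)) \<in> borel_measurable N" for n
        using wu_int z X(1) by auto
      show "AE s in N. (\<lambda>n. w s * u (X n * \<Phi> s)) \<longlonglongrightarrow> w s * u (z * \<Phi> s)"
      proof (rule AE_I2)
        fix s assume s: "s \<in> space N"
        have "(\<lambda>n. u (X n * \<Phi> s)) \<longlonglongrightarrow> u (z * \<Phi> s)"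
          by (rule continuous_on_tendsto_compose[OF u_cont])
             (use X z \<Phi>[OF s] in \<open>auto intro!: tendsto_intros always_eventually\<close>)
        then show "(\<lambda>n. w s * u (X n * \<Phi> s)) \<longlonglongrightarrow> w s * u (z * \<Phi> s)"
          by (intro tendsto_intros)
      qed
      show "AE s in N. norm (w s * u (X n * \<Phi> s)) \<le> w s * (c * (1 + k * \<Phi> s))" for n
      proof (rule AE_I2)
        fix s assume s: "s \<in> space N"
        have pos: "0 < X n * \<Phi> s" using X(1) \<Phi>[OF s] by simp
        have "u (X n * \<Phi> s) \<le> c * (1 + X n * \<Phi> s)"
          by (rule u_growth[OF pos])
        also have "\<dots> \<le> c * (1 + k * \<Phi> s)"
          using c_pos k[of n] \<Phi>[OF s] by (intro mult_left_mono add_mono mult_right_mono) auto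
        finally show "norm (w s * u (X n * \<Phi> s)) \<le> w s * (c * (1 + k * \<Phi> s))"
          using u_nonneg[OF pos] w[OF s] by (simp add: mult_left_mono)
      qed
    qed
    then show "(L \<circ> X) \<longlonglongrightarrow> L z"
      by (simp add: L_def comp_def)
  qed
  then have "continuous_on {0<..} (\<lambda>z. p * (q + q2 * z) + (1 - p) * L z)"
    by (intro continuous_intros)
  then show ?thesis
    by (rule continuous_on_eq) (simp add: P_eq')
qed

section \<open>Shape of the continuation set\<close>

lemma u_ge_one: "0 < z \<Longrightarrow> 1 \<le> u z" and u_ge_P: "0 < z \<Longrightarrow> P z \<le> u z"
  using u_ge by (auto dest!: u_ge)

text \<open>Here \<open>P z \<le> u z\<close> reads \<open>p * (1 + z) \<le> p * u z\<close>, which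
  meets the general upper bound for \<open>u\<close>.\<close>

lemma solution_without_delay:
  assumes "\<And>z. 0 < z \<Longrightarrow> P z = p * (1 + z) + (1 - p) * u z"
  shows "\<forall>z>0. u z = 1 + z" "{z. z > 0 \<and> u z > max 1 (P z)} = {}"
proof -
  have u_eq: "u z = 1 + z" if z: "0 < z" for z
  proof (rule antisym[OF u_le_one_plus[OF z]])
    have "p * (1 + z) \<le> p * u z"
      using u_ge_P[OF z] assms[OF z] by (simp add: algebra_simps)
    then show "1 + z \<le> u z" using p by simp
  qed
  then show "\<forall>z>0. u z = 1 + z" by blast
  have "P z = 1 + z" if "0 < z" for z
    using assms[OF that] u_eq[OF that] by (simp add: algebra_simps)
  with u_eq show "{z. z > 0 \<and> u z > max 1 (P z)} = {}" by auto
qed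

text \<open>In the transformed variable, compare the line with coefficients \<open>a\<close>,
  \<open>b\<close> supporting \<open>u\<close> at \<open>z\<close> and the line with
  \<open>a'\<close>, \<open>b'\<close> supporting \<open>P\<close> at \<open>z'\<close>. Stopping at
  \<open>z\<close> puts the first below the second there, and at \<open>z'\<close> the order is
  reversed. So the second line is the flatter one and lies above the first to the left of
  \<open>z\<close>, where it therefore majorises the reward; to the right the reward is
  \<open>P\<close>. Hence the second line bounds \<open>u\<close> at \<open>z'\<close>.\<close>

lemma stop_above:
  assumes z: "0 < z" "z < z'" and "u z \<le> P z" and one: "\<And>y. z \<le> y \<Longrightarrow> 1 \<le> P y"
  shows "u z' \<le> P z'"
proof -
  have z': "0 < z'" using z by simp
  obtain a b where ab: "a * z powr \<gamma>1 + b * z powr \<gamma>2 = u z"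
    "\<And>y. 0 < y \<Longrightarrow> max 1 (P y) \<le> a * y powr \<gamma>1 + b * y powr \<gamma>2"
    by (rule u_support[OF z(1)]) blast
  obtain a' b' where ab': "p * q * \<alpha> * z' powr (- \<gamma>1) \<le> a'" "0 \<le> b'" "a' * z' powr \<gamma>1 + b' * z' powr \<gamma>2 = P z'"
    "\<And>y. 0 < y \<Longrightarrow> P y \<le> a' * y powr \<gamma>1 + b' * y powr \<gamma>2"
    by (rule P_support[OF z']) blast
  have a': "0 \<le> a'"
    using ab'(1) p q \<alpha> by (smt (verit) mult_nonneg_nonneg powr_ge_zero)
  define x where "x y = y powr (\<gamma>2 - \<gamma>1)" for y
  have fac: "k * y powr \<gamma>1 + l * y powr \<gamma>2 = y powr \<gamma>1 * (k + l * x y)" if "0 < y" for k l y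
    using that by (simp add: x_def powr_diff algebra_simps)
  have x_less: "x y < x y'" if "0 < y" "y < y'" for y y'
    unfolding x_def using that \<gamma> by (intro powr_less_mono2) auto
  have at_z: "a + b * x z \<le> a' + b' * x z"
  proof -
    have "a * z powr \<gamma>1 + b * z powr \<gamma>2 \<le> a' * z powr \<gamma>1 + b' * z powr \<gamma>2"
      using ab(1) assms(3) ab'(4)[OF z(1)] by simp
    then show ?thesis unfolding fac[OF z(1)] using z by simp
  qed
  have at_z': "a' + b' * x z' \<le> a + b * x z'"
  proof -
    have "a' * z' powr \<gamma>1 + b' * z' powr \<gamma>2 \<le> a * z' powr \<gamma>1 + b * z' powr \<gamma>2"
      using ab(2)[OF z'] ab'(3) by simp
    then show ?thesis unfolding fac[OF z'] using z' by simp
  qed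
  have slope: "b' \<le> b"
  proof -
    have "(b' - b) * (x z' - x z) \<le> 0" using at_z at_z' by (simp add: algebra_simps)
    then show ?thesis using x_less[OF z] by (simp add: mult_le_0_iff)
  qed
  have "u z' \<le> a' * z' powr \<gamma>1 + b' * z' powr \<gamma>2"
  proof (rule u_le[OF a' ab'(2) _ z'])
    fix y :: real assume y: "0 < y"
    show "max 1 (P y) \<le> a' * y powr \<gamma>1 + b' * y powr \<gamma>2"
    proof (cases "z \<le> y")
      case True
      then show ?thesis using one[OF True] ab'(4)[OF y] by simp
    next
      case False
      then have "(b' - b) * (x y - x z) \<ge> 0"
        using x_less[of y z] y slope by (intro mult_nonpos_nonpos) auto
      then have "a + b * x y \<le> a' + b' * x y"
        using at_z by (simp add: algebra_simps)
      then have "a * y powr \<gamma>1 + b * y powr \<gamma>2 \<le> a' * y powr \<gamma>1 + b' * y powr \<gamma>2"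
        unfolding fac[OF y] by (intro mult_left_mono) auto
      then show ?thesis using ab(2)[OF y] by simp
    qed
  qed
  then show ?thesis using ab'(3) by simp
qed

lemma continuation_region:
  assumes q1: "q < 1"
  defines "z0 \<equiv> Inf {z. z > 0 \<and> P z > 1}"
  shows "\<exists>z>0. P z > 1" "0 < z0"
    "\<exists>a b. 0 < a \<and> a < z0 \<and> z0 < b \<and> {z. z > 0 \<and> u z > max 1 (P z)} = {a<..<b}"
proof -
  let ?S = "{z. z > 0 \<and> P z > 1}"
  \<comment> \<open>Where the upper bound \<open>q + q2 * y\<close> of \<open>P\<close> reaches 1;
    positive because \<open>q < 1\<close>, and a lower bound for \<open>z0\<close>.\<close>
  define y0 where "y0 = (1 - q) / q2"
  have y0: "0 < y0" "q + q2 * y0 = 1"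
    using q1 q2 by (auto simp: y0_def)
  have S_ge: "y0 \<le> z" if "z \<in> ?S" for z
  proof -
    have "q + q2 * y0 < q + q2 * z" using P_le[of z] that y0(2) by simp
    then show ?thesis using q2 by simp
  qed
  show ex: "\<exists>z>0. P z > 1"
  proof (intro exI conjI)
    \<comment> \<open>At this point the summand \<open>p * q2 * z\<close> of \<open>P\<close> alone
      equals 2.\<close>
    show "0 < 2 / (p * q2)" using p q2 by simp
    have "p * (q + q2 * (2 / (p * q2))) = p * q + 2"
      using p q2 by (simp add: field_simps)
    moreover have "0 \<le> (1 - p) * L (2 / (p * q2))"
      using p q2 L_nonneg[of "2 / (p * q2)"] by simp
    moreover have "0 < p * q" using p q by simp
    ultimately show "1 < P (2 / (p * q2))"
      using p q2 by (simp only: P_eq'[of "2 / (p * q2)"] divide_pos_pos mult_pos_pos zero_less_numeral)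
  qed
  then have S_ne: "?S \<noteq> {}" by auto
  have bdd: "bdd_below ?S" by (rule bdd_belowI[of _ y0]) (use S_ge in auto)
  have "y0 \<le> z0"
    unfolding z0_def by (rule cInf_greatest[OF S_ne S_ge])
  then show z0: "0 < z0" using y0 by simp
  have contP: "isCont P z" if "0 < z" for z
    using P_cont that by (auto simp: continuous_on_eq_continuous_at)
  have below: "P z \<le> 1" if "0 < z" "z < z0" for z
  proof (rule ccontr)
    assume "\<not> P z \<le> 1"
    then have "z0 \<le> z" unfolding z0_def using that bdd by (intro cInf_lower) auto
    then show False using that by simp
  qed
  have above: "1 < P z" if "z0 < z" for z
  proof -
    from cInf_lessD[OF S_ne that[unfolded z0_def]] obtain y where y: "y \<in> ?S" "y < z"
      by blast
    then show ?thesis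
      using P_increase[of y z] p q2 by (smt (verit) mem_Collect_eq mult_nonneg_nonneg)
  qed
  have Pz0: "P z0 = 1"
  proof (rule antisym)
    have "(\<lambda>n. P (z0 - z0 / (real n + 2))) \<longlonglongrightarrow> P z0"
      by (rule isCont_tendsto_compose[OF contP[OF z0]]) real_asymp
    moreover have "P (z0 - z0 / (real n + 2)) \<le> 1" for n
      by (rule below) (use z0 in \<open>auto simp: field_simps add_pos_nonneg\<close>)
    ultimately show "P z0 \<le> 1"
      by (intro LIMSEQ_le_const2[of _ "P z0" 1]) auto
    have "(\<lambda>n. P (z0 + 1 / (real n + 1))) \<longlonglongrightarrow> P z0"
      by (rule isCont_tendsto_compose[OF contP[OF z0]]) real_asymp
    moreover have "1 \<le> P (z0 + 1 / (real n + 1))" for n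
      by (rule less_imp_le[OF above]) auto
    ultimately show "1 \<le> P z0"
      by (intro LIMSEQ_le_const[of _ "P z0" 1]) auto
  qed
  \<comment> \<open>A supporting combination of height 1 at \<open>z0\<close> would have a minimum
    there, hence derivative 0. To the right, however, it stays above \<open>P\<close>, which rises
    from 1 with slope at least \<open>p * q2\<close>.\<close>
  have uz0: "1 < u z0"
  proof (rule ccontr)
    assume "\<not> 1 < u z0"
    then have u1: "u z0 = 1" using u_ge_one[OF z0] by simp
    obtain a b where ab: "a * z0 powr \<gamma>1 + b * z0 powr \<gamma>2 = u z0"
      "\<And>y. 0 < y \<Longrightarrow> max 1 (P y) \<le> a * y powr \<gamma>1 + b * y powr \<gamma>2"
      by (rule u_support[OF z0]) blast
    define l where "l y = a * y powr \<gamma>1 + b * y powr \<gamma>2" for y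
    define d where "d = a * (\<gamma>1 * z0 powr (\<gamma>1 - 1)) + b * (\<gamma>2 * z0 powr (\<gamma>2 - 1))"
    have l: "(l has_real_derivative d) (at z0)"
      unfolding l_def[abs_def] d_def using z0
      by (intro DERIV_add DERIV_cmult has_real_derivative_powr) auto
    have l0: "l z0 = 1" using ab(1) u1 by (simp add: l_def)
    have "d = 0"
    proof (rule DERIV_local_min[OF l z0], intro allI impI)
      fix y assume "\<bar>z0 - y\<bar> < z0"
      then show "l z0 \<le> l y" using ab(2)[of y] l0 by (auto simp: l_def)
    qed
    then have "((\<lambda>h. (l (z0 + h) - l z0) / h) \<longlongrightarrow> 0) (at 0)"
      using DERIV_D[OF l] by simp
    then have "((\<lambda>h. (l (z0 + h) - l z0) / h) \<longlongrightarrow> 0) (at_right 0)"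
      by (rule filterlim_mono[OF _ order_refl]) (simp add: at_le)
    moreover have "\<forall>\<^sub>F h in at_right 0. p * q2 \<le> (l (z0 + h) - l z0) / h"
      using eventually_at_right_less[of 0]
    proof eventually_elim
      case (elim h)
      have "P z0 + p * q2 * h \<le> P (z0 + h)"
        using P_increase[OF z0, of "z0 + h"] elim by simp
      also have "\<dots> \<le> l (z0 + h)" using ab(2)[of "z0 + h"] z0 elim by (simp add: l_def)
      finally show ?case
        using elim by (simp add: le_divide_eq Pz0 l0)
    qed
    ultimately have "p * q2 \<le> 0"
      by (intro tendsto_lowerbound[of _ 0 "at_right 0"]) auto
    then show False using p q2 by (simp add: mult_le_0_iff)
  qed
  have a_ex: "\<exists>a>0. u a \<le> 1"
  proof -
    \<comment> \<open>Chosen so that the \<gamma>2-part of the combination touching 1 at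
      \<open>z\<close> equals \<open>(y / y0) powr \<gamma>2\<close>. Beyond \<open>y0\<close> this
      exceeds \<open>y / y0\<close>, an upper bound of \<open>P\<close>; up to \<open>y0\<close> the
      reward is 1.\<close>
    define k where "k = (1 - \<alpha>) * y0 powr \<gamma>2"
    have k: "0 < k" using \<alpha> y0 by (simp add: k_def)
    define z where "z = k powr (1 / \<gamma>2)"
    have z: "0 < z" "z powr \<gamma>2 = k"
      using k \<gamma> by (auto simp: z_def powr_powr)
    have bound: "max 1 (P y) \<le> \<alpha> * (y / z) powr \<gamma>1 + (1 - \<alpha>) * (y / z) powr \<gamma>2" if y: "0 < y" for y
    proof -
      have "P y \<le> \<alpha> * (y / z) powr \<gamma>1 + (1 - \<alpha>) * (y / z) powr \<gamma>2" if "y0 < y"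
      proof -
        have t: "1 \<le> y / y0" using that y0 by simp
        have "P y \<le> q + q2 * y" by (rule P_le[OF y])
        also have "\<dots> \<le> q * (y / y0) + q2 * y"
          using mult_left_mono[OF t, of q] q by simp
        also have "\<dots> = (q + q2 * y0) * (y / y0)"
          using y0(1) by (simp add: field_simps)
        also have "\<dots> = y / y0" using y0 by simp
        also have "\<dots> = (y / y0) powr 1" using y y0 by simp
        also have "\<dots> \<le> (y / y0) powr \<gamma>2"
          using t \<gamma> by (intro powr_mono) auto
        also have "\<dots> = (1 - \<alpha>) * (y / z) powr \<gamma>2"
          using y y0 z \<alpha> by (simp add: powr_divide k_def)
        also have "\<dots> \<le> \<alpha> * (y / z) powr \<gamma>1 + (1 - \<alpha>) * (y / z) powr \<gamma>2"
          using \<alpha> by simp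
        finally show ?thesis .
      qed
      moreover have "P y \<le> 1" if "\<not> y0 < y"
      proof -
        have "q2 * y \<le> q2 * y0" using that q2 by (intro mult_left_mono) auto
        then show ?thesis using P_le[OF y] y0(2) by simp
      qed
      ultimately show ?thesis
        using tangent_one[OF y z(1)] by (cases "y0 < y") auto
    qed
    have eq: "\<alpha> * (y / z) powr \<gamma>1 + (1 - \<alpha>) * (y / z) powr \<gamma>2 =
        (\<alpha> * z powr (- \<gamma>1)) * y powr \<gamma>1 + ((1 - \<alpha>) * z powr (- \<gamma>2)) * y powr \<gamma>2" if "0 < y" for y
      using that z(1) by (simp add: powr_quotient algebra_simps)
    have "u z \<le> (\<alpha> * z powr (- \<gamma>1)) * z powr \<gamma>1 + ((1 - \<alpha>) * z powr (- \<gamma>2)) * z powr \<gamma>2"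
      by (rule u_le) (use \<alpha> z bound eq in auto)
    then have "u z \<le> 1" using eq[OF z(1)] z by simp
    then show ?thesis using z by blast
  qed
  have b_ex: "\<exists>b>z0. u b \<le> P b"
  proof -
    \<comment> \<open>For \<open>z\<close> this large, the coefficient of
      \<open>y powr \<gamma>1\<close> in the combination supporting \<open>P\<close> at
      \<open>z\<close> is at least \<open>z0 powr (- \<gamma>1)\<close>. The combination is then at
      least 1 up to \<open>z0\<close>, and beyond \<open>z0\<close> the reward is
      \<open>P\<close>.\<close>
    define k where "k = z0 powr (- \<gamma>1) / (p * q * \<alpha>)"
    have k: "0 < k" using z0 p q \<alpha> by (simp add: k_def)
    define z where "z = max (z0 + 1) (k powr (1 / - \<gamma>1))"
    have z: "0 < z" "z0 < z" using z0 by (auto simp: z_def)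
    have "k = (k powr (1 / - \<gamma>1)) powr (- \<gamma>1)"
      using k \<gamma> by (simp add: powr_powr)
    also have "\<dots> \<le> z powr (- \<gamma>1)"
      using \<gamma> by (intro powr_mono2) (auto simp: z_def)
    finally have k_le: "k \<le> z powr (- \<gamma>1)" .
    obtain a b where ab: "p * q * \<alpha> * z powr (- \<gamma>1) \<le> a" "0 \<le> b" "a * z powr \<gamma>1 + b * z powr \<gamma>2 = P z"
      "\<And>y. 0 < y \<Longrightarrow> P y \<le> a * y powr \<gamma>1 + b * y powr \<gamma>2"
      by (rule P_support[OF z(1)]) blast
    have "z0 powr (- \<gamma>1) = p * q * \<alpha> * k"
      using p q \<alpha> by (simp add: k_def)
    also have "\<dots> \<le> p * q * \<alpha> * z powr (- \<gamma>1)"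
      using k_le p q \<alpha> by (intro mult_left_mono) auto
    finally have a: "z0 powr (- \<gamma>1) \<le> a" using ab(1) by simp
    then have a0: "0 \<le> a" by (rule order_trans[rotated]) simp
    have "u z \<le> a * z powr \<gamma>1 + b * z powr \<gamma>2"
    proof (rule u_le[OF a0 ab(2) _ z(1)])
      fix y :: real assume y: "0 < y"
      show "max 1 (P y) \<le> a * y powr \<gamma>1 + b * y powr \<gamma>2"
      proof (cases "y \<le> z0")
        case True
        have "1 = z0 powr (- \<gamma>1) * z0 powr \<gamma>1" using z0 by (simp add: powr_minus)
        also have "\<dots> \<le> a * y powr \<gamma>1"
          using a a0 y z0 True \<gamma> by (intro mult_mono powr_mono2') auto
        also have "\<dots> \<le> a * y powr \<gamma>1 + b * y powr \<gamma>2" using ab(2) by simp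
        finally show ?thesis using ab(4)[OF y] by simp
      next
        case False
        then show ?thesis using above[of y] ab(4)[OF y] by simp
      qed
    qed
    then show ?thesis using ab(3) z(2) by auto
  qed
  \<comment> \<open>The last point up to \<open>z0\<close> with \<open>u \<le> 1\<close>; it is
    attained because \<open>u\<close> is continuous, and it differs from \<open>z0\<close> because
    \<open>1 < u z0\<close>.\<close>
  obtain a where a: "0 < a" "a < z0" "u a \<le> 1" "\<And>z. a < z \<Longrightarrow> z \<le> z0 \<Longrightarrow> 1 < u z"
  proof -
    obtain a1 where a1: "0 < a1" "u a1 \<le> 1" using a_ex by blast
    have "a1 < z0"
    proof (rule ccontr)
      assume "\<not> a1 < z0"
      then have "u z0 \<le> u a1" using z0 by (intro u_mono) auto
      then show False using uz0 a1 by simp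
    qed
    define E where "E = {z \<in> {a1..z0}. u z \<le> 1}"
    have "closed E"
    proof -
      have "continuous_on {a1..z0} u"
        by (rule continuous_on_subset[OF u_cont]) (use a1 in auto)
      from continuous_closed_preimage[OF this closed_atLeastAtMost closed_atMost[of 1]]
      show ?thesis by (simp add: E_def vimage_def Int_def conj_commute)
    qed
    have E: "a1 \<in> E" "bdd_above E"
      using a1 \<open>a1 < z0\<close> by (auto simp: E_def intro!: bdd_aboveI[of _ z0])
    define a where "a = Sup E"
    have "a \<in> E"
      unfolding a_def by (rule closed_contains_Sup) (use E \<open>closed E\<close> in auto)
    then have "0 < a" "a \<le> z0" "u a \<le> 1" using a1 by (auto simp: E_def)
    moreover have "a \<noteq> z0" using uz0 \<open>u a \<le> 1\<close> by auto
    moreover have "1 < u z" if "a < z" "z \<le> z0" for z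
    proof (rule ccontr)
      assume "\<not> 1 < u z"
      then have "z \<in> E" using that \<open>a \<in> E\<close> by (auto simp: E_def)
      then have "z \<le> a" unfolding a_def using E by (intro cSup_upper)
      then show False using that by simp
    qed
    ultimately show thesis using that by force
  qed
  \<comment> \<open>The first stopping point after \<open>z0\<close>, attained because
    \<open>u - P\<close> is continuous.\<close>
  obtain b where b: "z0 < b" "u b \<le> P b" "\<And>z. z0 \<le> z \<Longrightarrow> z < b \<Longrightarrow> P z < u z"
  proof -
    obtain b1 where b1: "z0 < b1" "u b1 \<le> P b1" using b_ex by blast
    define E where "E = {z \<in> {z0..b1}. u z - P z \<le> 0}"
    have "closed E"
    proof -
      have "continuous_on {z0..b1} (\<lambda>z. u z - P z)"
        by (intro continuous_intros continuous_on_subset[OF u_cont] continuous_on_subset[OF P_cont]) (use z0 in auto)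
      from continuous_closed_preimage[OF this closed_atLeastAtMost closed_atMost[of 0]]
      show ?thesis by (simp add: E_def vimage_def Int_def conj_commute)
    qed
    have E: "b1 \<in> E" "bdd_below E"
      using b1 by (auto simp: E_def intro!: bdd_belowI[of _ z0])
    define b where "b = Inf E"
    have "b \<in> E"
      unfolding b_def by (rule closed_contains_Inf) (use E \<open>closed E\<close> in auto)
    then have "z0 \<le> b" "b \<le> b1" "u b \<le> P b" by (auto simp: E_def)
    moreover have "b \<noteq> z0" using uz0 Pz0 \<open>u b \<le> P b\<close> by auto
    moreover have "P z < u z" if "z0 \<le> z" "z < b" for z
    proof (rule ccontr)
      assume "\<not> P z < u z"
      then have "z \<in> E" using that \<open>b \<le> b1\<close> by (auto simp: E_def)
      then have "b \<le> z" unfolding b_def using E by (intro cInf_lower)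
      then show False using that by simp
    qed
    ultimately show thesis using that by force
  qed
  \<comment> \<open>Up to \<open>a\<close> continuation is excluded by monotonicity of
    \<open>u\<close>, from \<open>b\<close> on by \<open>stop_above\<close>.\<close>
  have "{z. z > 0 \<and> u z > max 1 (P z)} = {a<..<b}"
  proof (intro equalityI subsetI)
    fix z assume "z \<in> {z. z > 0 \<and> u z > max 1 (P z)}"
    then have z: "0 < z" "1 < u z" "P z < u z" by auto
    have "a < z"
    proof (rule ccontr)
      assume "\<not> a < z"
      then have "u z \<le> u a" using z by (intro u_mono) auto
      then show False using z a by simp
    qed
    moreover have "z < b"
    proof (rule ccontr)
      assume "\<not> z < b"
      then have "b < z" using z b(2) by (cases "z = b") auto
      have "u z \<le> P z"
        by (rule stop_above[OF _ \<open>b < z\<close> b(2)]) (use b(1) z0 above in \<open>auto intro: less_imp_le\<close>)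
      then show False using z by simp
    qed
    ultimately show "z \<in> {a<..<b}" by simp
  next
    fix z assume z: "z \<in> {a<..<b}"
    then have "0 < z" using a by simp
    moreover have "max 1 (P z) < u z"
    proof (cases "z \<le> z0")
      case True
      then have "P z \<le> 1" using below[OF \<open>0 < z\<close>] Pz0 by (cases "z = z0") auto
      then show ?thesis using a(4)[of z] True z by simp
    next
      case False
      then show ?thesis using above[of z] b(3)[of z] z by simp
    qed
    ultimately show "z \<in> {z. z > 0 \<and> u z > max 1 (P z)}" by simp
  qed
  then show "\<exists>a b. 0 < a \<and> a < z0 \<and> z0 < b \<and> {z. z > 0 \<and> u z > max 1 (P z)} = {a<..<b}"
    using a(1,2) b(1) by blast
qed

end

section \<open>The distribution of geometric Brownian motion\<close>

text \<open>The two roots of a quadratic. That its values 0 and \<mu> at the exponents 0 and 1 lie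
  below \<rho> turns into \<open>\<bar>b\<bar> < s\<close> and
  \<open>\<beta>\<^sup>2 + b < s\<close>, which place the roots.\<close>

lemma gbm_rate_roots:
  assumes \<beta>: "0 < \<beta>" and \<rho>: "0 < \<rho>" "\<mu> < \<rho>"
  obtains \<gamma>1 \<gamma>2 where "\<gamma>1 < 0" "1 < \<gamma>2" "gbm_rate \<mu> \<beta> \<gamma>1 = \<rho>" "gbm_rate \<mu> \<beta> \<gamma>2 = \<rho>"
proof -
  define b where "b = \<mu> - \<beta>\<^sup>2 / 2"
  define s where "s = sqrt (b\<^sup>2 + 2 * \<beta>\<^sup>2 * \<rho>)"
  have b2: "0 < \<beta>\<^sup>2" using \<beta> by simp
  have s2: "s\<^sup>2 = b\<^sup>2 + 2 * \<beta>\<^sup>2 * \<rho>"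
    unfolding s_def using b2 \<rho> by (intro real_sqrt_pow2) (simp add: add_nonneg_nonneg)
  have "b\<^sup>2 < s\<^sup>2" using s2 b2 \<rho> by simp
  moreover have s_nonneg: "0 \<le> s" using b2 \<rho> by (simp add: s_def)
  ultimately have sb: "\<bar>b\<bar> < s" by (metis abs_of_nonneg abs_square_less_1 power2_less_imp_less power2_abs)
  have "(\<beta>\<^sup>2 + b)\<^sup>2 < s\<^sup>2"
  proof -
    have "s\<^sup>2 - (\<beta>\<^sup>2 + b)\<^sup>2 = 2 * \<beta>\<^sup>2 * (\<rho> - \<mu>)"
      unfolding s2 by (simp add: b_def power2_eq_square field_simps)
    moreover have "0 < 2 * \<beta>\<^sup>2 * (\<rho> - \<mu>)" using b2 \<rho> by simp
    ultimately show ?thesis by (metis diff_gt_0_iff_gt)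
  qed
  then have sb': "\<beta>\<^sup>2 + b < s" by (rule power2_less_imp_less[OF _ s_nonneg])
  have root: "gbm_rate \<mu> \<beta> ((- b + t) / \<beta>\<^sup>2) = \<rho>" if "t\<^sup>2 = s\<^sup>2" for t
  proof -
    define x where "x = (- b + t) / \<beta>\<^sup>2"
    have x: "x * \<beta>\<^sup>2 = t - b" using b2 by (simp add: x_def)
    have "gbm_rate \<mu> \<beta> x * (2 * \<beta>\<^sup>2) = (x * \<beta>\<^sup>2)\<^sup>2 + 2 * b * (x * \<beta>\<^sup>2)"
      by (simp add: gbm_rate_def b_def power2_eq_square field_simps)
    also have "\<dots> = t\<^sup>2 - b\<^sup>2"
      unfolding x by (simp add: power2_eq_square algebra_simps)
    also have "\<dots> = \<rho> * (2 * \<beta>\<^sup>2)"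
      using that s2 by simp
    finally show ?thesis using b2 by (simp add: x_def)
  qed
  show thesis
  proof (rule that)
    show "(- b + - s) / \<beta>\<^sup>2 < 0" using sb b2 by (simp add: divide_neg_pos)
    show "1 < (- b + s) / \<beta>\<^sup>2" using sb' b2 by (simp add: less_divide_eq)
    show "gbm_rate \<mu> \<beta> ((- b + - s) / \<beta>\<^sup>2) = \<rho>" by (rule root) simp
    show "gbm_rate \<mu> \<beta> ((- b + s) / \<beta>\<^sup>2) = \<rho>" by (rule root) simp
  qed
qed

text \<open>Cramer's rule; the determinant \<open>d\<close> does not vanish because the quotient of
  the two powers is strictly monotone.\<close>

lemma two_point_interpolation:
  fixes \<gamma>1 \<gamma>2 z1 z2 h1 h2 :: real
  assumes "\<gamma>1 < \<gamma>2" "0 < z1" "z1 < z2"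
  obtains c1 c2 where "c1 * z1 powr \<gamma>1 + c2 * z1 powr \<gamma>2 = h1" "c1 * z2 powr \<gamma>1 + c2 * z2 powr \<gamma>2 = h2"
proof -
  define d where "d = z1 powr \<gamma>1 * z2 powr \<gamma>2 - z1 powr \<gamma>2 * z2 powr \<gamma>1"
  have "z1 powr (\<gamma>2 - \<gamma>1) < z2 powr (\<gamma>2 - \<gamma>1)"
    using assms by (intro powr_less_mono2) auto
  then have "d \<noteq> 0"
    using assms by (simp add: d_def powr_diff field_simps)
  show thesis
  proof (rule that[of "(h1 * z2 powr \<gamma>2 - h2 * z1 powr \<gamma>2) / d" "(h2 * z1 powr \<gamma>1 - h1 * z2 powr \<gamma>1) / d"])
    have "(h1 * z2 powr \<gamma>2 - h2 * z1 powr \<gamma>2) * z1 powr \<gamma>1 + (h2 * z1 powr \<gamma>1 - h1 * z2 powr \<gamma>1) * z1 powr \<gamma>2 = h1 * d"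
      "(h1 * z2 powr \<gamma>2 - h2 * z1 powr \<gamma>2) * z2 powr \<gamma>1 + (h2 * z1 powr \<gamma>1 - h1 * z2 powr \<gamma>1) * z2 powr \<gamma>2 = h2 * d"
      by (simp_all add: d_def algebra_simps)
    then show "(h1 * z2 powr \<gamma>2 - h2 * z1 powr \<gamma>2) / d * z1 powr \<gamma>1 + (h2 * z1 powr \<gamma>1 - h1 * z2 powr \<gamma>1) / d * z1 powr \<gamma>2 = h1"
      "(h1 * z2 powr \<gamma>2 - h2 * z1 powr \<gamma>2) / d * z2 powr \<gamma>1 + (h2 * z1 powr \<gamma>1 - h1 * z2 powr \<gamma>1) / d * z2 powr \<gamma>2 = h2"
      using \<open>d \<noteq> 0\<close> by (simp_all add: times_divide_eq_left add_divide_distrib[symmetric])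
  qed
qed

definition std_normal :: "real measure" where
  "std_normal = density lborel std_normal_density"

text \<open>The value at time \<open>t\<close> of the process started at 1, written as a function of
  \<open>t\<close> and one standard normal variable. The delay and the process at the delay thus
  live on a product space, where Fubini's theorem applies with explicit measurability.\<close>

definition gbm_value :: "real \<Rightarrow> real \<Rightarrow> real \<times> real \<Rightarrow> real" where
  "gbm_value \<mu> \<beta> = (\<lambda>(t, x). exp ((\<mu> - \<beta>\<^sup>2 / 2) * t + \<beta> * sqrt t * x))"

lemma prob_space_std_normal: "prob_space std_normal"
  unfolding std_normal_def by (rule prob_space_normal_density) simp

lemma sets_std_normal [measurable_cong, simp]: "sets std_normal = sets borel"
  and space_std_normal [simp]: "space std_normal = UNIV"
  by (simp_all add: std_normal_def)

lemma gbm_value_pos: "0 < gbm_value \<mu> \<beta> s"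
  by (simp add: gbm_value_def split: prod.split)

lemma gbm_value_measurable: "gbm_value \<mu> \<beta> \<in> borel_measurable (borel \<Otimes>\<^sub>M borel)"
  unfolding gbm_value_def by measurable

lemma gbm_value_moment:
  assumes "0 \<le> t"
  shows "integrable std_normal (\<lambda>x. gbm_value \<mu> \<beta> (t, x))" "(\<integral>x. gbm_value \<mu> \<beta> (t, x) \<partial>std_normal) = exp (\<mu> * t)"
proof -
  have "has_bochner_integral lborel (\<lambda>x. exp ((\<mu> - \<beta>\<^sup>2 / 2) * t) * (std_normal_density x * exp ((\<beta> * sqrt t) * x)))
      (exp ((\<mu> - \<beta>\<^sup>2 / 2) * t) * exp ((\<beta> * sqrt t)\<^sup>2 * 1\<^sup>2 / 2))"
    by (intro has_bochner_integral_mult_right normal_exp_moment) simp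
  moreover have "exp ((\<mu> - \<beta>\<^sup>2 / 2) * t) * (std_normal_density x * exp ((\<beta> * sqrt t) * x)) =
      std_normal_density x *\<^sub>R gbm_value \<mu> \<beta> (t, x)" for x
    by (simp add: gbm_value_def exp_add)
  moreover have "exp ((\<mu> - \<beta>\<^sup>2 / 2) * t) * exp ((\<beta> * sqrt t)\<^sup>2 * 1\<^sup>2 / 2) = exp (\<mu> * t)"
    using assms unfolding exp_add[symmetric] by (intro arg_cong[where f = exp]) (simp add: power_mult_distrib field_simps)
  ultimately have "has_bochner_integral lborel (\<lambda>x. std_normal_density x *\<^sub>R gbm_value \<mu> \<beta> (t, x)) (exp (\<mu> * t))"
    by simp
  then have "has_bochner_integral std_normal (\<lambda>x. gbm_value \<mu> \<beta> (t, x)) (exp (\<mu> * t))"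
    unfolding std_normal_def by (intro has_bochner_integral_density) (auto simp: gbm_value_def)
  then show "integrable std_normal (\<lambda>x. gbm_value \<mu> \<beta> (t, x))" "(\<integral>x. gbm_value \<mu> \<beta> (t, x) \<partial>std_normal) = exp (\<mu> * t)"
    by (auto simp: has_bochner_integral_iff)
qed

context brownian_basis
begin

text \<open>Only the laws at single times enter \<open>Pi_op\<close>, so \<open>W t\<close> may be
  replaced by a rescaled standard normal variable. Time 0 is treated apart because the law of
  increments is given for positive durations.\<close>

lemma gbm_distribution:
  fixes f :: "real \<Rightarrow> real"
  assumes t: "0 \<le> t" and f: "f \<in> borel_measurable borel"
  shows "(\<integral>\<omega>. f (gbm \<mu> \<beta> t \<omega>) \<partial>M) = (\<integral>x. f (gbm_value \<mu> \<beta> (t, x)) \<partial>std_normal)"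
proof (cases "t = 0")
  case True
  interpret S: prob_space std_normal by (rule prob_space_std_normal)
  have "(\<integral>\<omega>. f (gbm \<mu> \<beta> t \<omega>) \<partial>M) = (\<integral>\<omega>. f 1 \<partial>M)"
  proof (rule integral_cong_AE)
    show "(\<lambda>\<omega>. f (gbm \<mu> \<beta> t \<omega>)) \<in> borel_measurable M"
      by (rule measurable_compose[OF gbm_borel f]) (rule t)
    show "AE \<omega> in M. f (gbm \<mu> \<beta> t \<omega>) = f 1"
      using gbm_0[of \<mu> \<beta>] by eventually_elim (simp add: True)
  qed simp
  then show ?thesis
    using True S.prob_space by (simp add: gbm_value_def prob_space)
next
  case False
  then have t: "0 < t" using t by simp
  define V where "V \<omega> = (W t \<omega> - W 0 \<omega>) / sqrt t" for \<omega>
  have [measurable]: "V \<in> borel_measurable M"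
    unfolding V_def using t increment_borel[of 0 t] by simp
  have "distributed M lborel V std_normal_density"
    unfolding V_def using normal_standard_normal_convert[of "sqrt t" "\<lambda>\<omega>. W t \<omega> - W 0 \<omega>" 0] W_dist[of 0 t] t by simp
  then have V: "distr M lborel V = std_normal"
    by (simp add: distributed_def std_normal_def)
  have "(\<lambda>x. gbm_value \<mu> \<beta> (t, x)) \<in> borel_measurable borel"
    unfolding gbm_value_def by simp
  from measurable_compose[OF this f] have [measurable]: "(\<lambda>x. f (gbm_value \<mu> \<beta> (t, x))) \<in> borel_measurable borel" .
  have "(\<integral>\<omega>. f (gbm \<mu> \<beta> t \<omega>) \<partial>M) = (\<integral>\<omega>. f (gbm_value \<mu> \<beta> (t, V \<omega>)) \<partial>M)"
  proof (rule integral_cong_AE)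
    show "(\<lambda>\<omega>. f (gbm \<mu> \<beta> t \<omega>)) \<in> borel_measurable M"
      by (rule measurable_compose[OF gbm_borel f]) (use t in simp)
    show "AE \<omega> in M. f (gbm \<mu> \<beta> t \<omega>) = f (gbm_value \<mu> \<beta> (t, V \<omega>))"
      using W_0 by eventually_elim (use t in \<open>simp add: gbm_def gbm_value_def V_def\<close>)
  qed measurable
  also have "\<dots> = (\<integral>x. f (gbm_value \<mu> \<beta> (t, x)) \<partial>distr M lborel V)"
    by (rule integral_distr[symmetric]) measurable
  finally show ?thesis
    unfolding V .
qed

end

section \<open>The continuation set\<close>

lemma discounted_payoff_mono:
  "(\<And>y. 0 < y \<Longrightarrow> h y \<le> l y) \<Longrightarrow> (\<And>t. 0 \<le> t \<Longrightarrow> 0 < X t \<omega>) \<Longrightarrow>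
    discounted_payoff \<rho> h X \<tau> \<omega> \<le> discounted_payoff \<rho> l X \<tau> \<omega>"
  by (simp add: discounted_payoff_def)

lemma discounted_payoff_cong_path:
  "(\<And>t. 0 \<le> t \<Longrightarrow> X t \<omega> = Y t \<omega>) \<Longrightarrow> discounted_payoff \<rho> h X \<tau> \<omega> = discounted_payoff \<rho> h Y \<tau> \<omega>"
  by (simp add: discounted_payoff_def)

theorem theorem4p11:
  fixes M :: "'a measure" and B1 B2 W :: "real \<Rightarrow> 'a \<Rightarrow> real"
    and \<F> :: "ennreal \<Rightarrow> 'a measure"
    and \<mu>1 \<mu>2 \<sigma>1 \<sigma>2 \<nu> p r \<beta>1 \<beta>2 z0 :: real
    and D :: "real measure" and F :: "real \<Rightarrow> real"
    and Z :: "real \<Rightarrow> real \<Rightarrow> 'a \<Rightarrow> real"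
    and u \<Pi>u :: "real \<Rightarrow> real" and C :: "real set"
  assumes "prob_space M"
    and "brownian_motion M B1" and "brownian_motion M B2" and "indep_processes M B1 B2"
    and \<F>: "\<F> = completed_filtration M B1 B2"
    and "\<sigma>1 > 0" and "\<sigma>2 > 0" and "-1 \<le> \<nu>" and "\<nu> \<le> 1" and "0 < p" and "p < 1"
    and "r > 0" and "r > \<mu>1 + \<sigma>1\<^sup>2 / 2" and "r > \<mu>2 + \<sigma>2\<^sup>2 / 2"
    and "real_distribution D" and "AE t in D. 0 \<le> t" and F: "F = cdf D"
    and \<beta>1: "\<beta>1 = \<sigma>2 * \<nu> - \<sigma>1" and \<beta>2: "\<beta>2 = \<sigma>2 * sqrt (1 - \<nu>\<^sup>2)"
    and "\<beta>1\<^sup>2 + \<beta>2\<^sup>2 > 0"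
    and W: "W = (\<lambda>t \<omega>. (\<beta>1 * B1 t \<omega> + \<beta>2 * B2 t \<omega>) / sqrt (\<beta>1\<^sup>2 + \<beta>2\<^sup>2))"
    and Z: "\<And>z. z > 0 \<Longrightarrow>
      solves_sde M \<F> W (\<lambda>x. (\<mu>2 - \<mu>1) * x) (\<lambda>x. sqrt (\<beta>1\<^sup>2 + \<beta>2\<^sup>2) * x) z (Z z)"
    and \<Pi>u: "\<Pi>u = Pi_op M Z D (r - \<mu>1) p u"
    and "u \<in> A1_plus"
    and u: "\<And>z. z > 0 \<Longrightarrow>
      ennreal (u z) = stopping_value M \<F> (r - \<mu>1) (\<lambda>x. max 1 (\<Pi>u x)) (Z z)"
    and C: "C = {z. z > 0 \<and> u z > max 1 (\<Pi>u z)}"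
    and z0: "z0 = Inf {z. z > 0 \<and> \<Pi>u z > 1}"
  shows "(F 0 = 1 \<longrightarrow> C = {} \<and> (\<forall>z>0. u z = 1 + z)) \<and>
    (F 0 < 1 \<longrightarrow>
      (\<exists>z>0. \<Pi>u z > 1) \<and> z0 > 0 \<and>
      (\<exists>a b. 0 < a \<and> a < z0 \<and> z0 < b \<and> C = {a<..<b}))"
proof -
  define \<rho> where "\<rho> = r - \<mu>1"
  define \<mu> where "\<mu> = \<mu>2 - \<mu>1"
  define \<beta> where "\<beta> = sqrt (\<beta>1\<^sup>2 + \<beta>2\<^sup>2)"
  have \<beta>: "0 < \<beta>" using \<open>\<beta>1\<^sup>2 + \<beta>2\<^sup>2 > 0\<close> by (simp add: \<beta>_def)
  \<comment> \<open>The assumptions on \<open>r\<close> enter as \<open>r > \<mu>1\<close> and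
    \<open>r > \<mu>2\<close>, in the form \<open>0 < \<rho>\<close> and
    \<open>\<mu> < \<rho>\<close>.\<close>
  have "0 < \<sigma>1\<^sup>2" "0 < \<sigma>2\<^sup>2" using \<open>\<sigma>1 > 0\<close> \<open>\<sigma>2 > 0\<close> by auto
  then have \<rho>: "0 < \<rho>" "\<mu> < \<rho>"
    using \<open>r > \<mu>1 + \<sigma>1\<^sup>2 / 2\<close> \<open>r > \<mu>2 + \<sigma>2\<^sup>2 / 2\<close> unfolding \<rho>_def \<mu>_def by linarith+
  obtain \<gamma>1 \<gamma>2 where \<gamma>: "\<gamma>1 < 0" "1 < \<gamma>2" and rate: "gbm_rate \<mu> \<beta> \<gamma>1 = \<rho>" "gbm_rate \<mu> \<beta> \<gamma>2 = \<rho>"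
    by (rule gbm_rate_roots[OF \<beta> \<rho>])
  interpret M: prob_space M by fact
  have "brownian_basis (completion M) \<F> (\<lambda>t \<omega>. \<beta>1 / \<beta> * B1 t \<omega> + \<beta>2 / \<beta> * B2 t \<omega>)"
    unfolding \<F>
  proof (rule M.brownian_basis_completed_filtration)
    have "\<beta>\<^sup>2 = \<beta>1\<^sup>2 + \<beta>2\<^sup>2" using \<open>\<beta>1\<^sup>2 + \<beta>2\<^sup>2 > 0\<close> by (simp add: \<beta>_def)
    then have "(\<beta>1 / \<beta>)\<^sup>2 + (\<beta>2 / \<beta>)\<^sup>2 = \<beta>\<^sup>2 / \<beta>\<^sup>2"
      by (simp only: power_divide add_divide_distrib)
    then show "(\<beta>1 / \<beta>)\<^sup>2 + (\<beta>2 / \<beta>)\<^sup>2 = 1"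
      using \<beta> by simp
  qed fact+
  moreover have "(\<lambda>t \<omega>. \<beta>1 / \<beta> * B1 t \<omega> + \<beta>2 / \<beta> * B2 t \<omega>) = W"
    unfolding W \<beta>_def by (simp add: add_divide_distrib)
  ultimately interpret B: brownian_basis "completion M" \<F> W by simp
  have path: "AE \<omega> in completion M. \<forall>t\<ge>0. Z z t \<omega> = z * B.gbm \<mu> \<beta> t \<omega>" if "0 < z" for z
    using B.linear_sde_solution[OF refl] Z[OF that] unfolding \<mu>_def \<beta>_def by blast
  define h where "h = (\<lambda>x. max 1 (\<Pi>u x))"
  \<comment> \<open>The paths agree at all times off one null set, hence also at the random time
    \<open>\<tau>\<close>.\<close>
  have payoff_eq: "(\<integral>\<^sup>+\<omega>. ennreal (discounted_payoff \<rho> h (Z z) \<tau> \<omega>) \<partial>completion M) =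
      (\<integral>\<^sup>+\<omega>. ennreal (discounted_payoff \<rho> h (\<lambda>t \<omega>. z * B.gbm \<mu> \<beta> t \<omega>) \<tau> \<omega>) \<partial>completion M)" if "0 < z" for z \<tau>
  proof (rule nn_integral_cong_AE)
    show "AE \<omega> in completion M. ennreal (discounted_payoff \<rho> h (Z z) \<tau> \<omega>) =
        ennreal (discounted_payoff \<rho> h (\<lambda>t \<omega>. z * B.gbm \<mu> \<beta> t \<omega>) \<tau> \<omega>)"
      using path[OF that]
    proof eventually_elim
      case (elim \<omega>)
      then show ?case by (intro arg_cong[where f = ennreal] discounted_payoff_cong_path) simp
    qed
  qed
  have value_ge: "(\<integral>\<^sup>+\<omega>. ennreal (discounted_payoff \<rho> h (\<lambda>t \<omega>. z * B.gbm \<mu> \<beta> t \<omega>) \<tau> \<omega>) \<partial>completion M) \<le> ennreal (u z)"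
    if "0 < z" "stopping_time \<F> \<tau>" for z \<tau>
  proof -
    have "(\<integral>\<^sup>+\<omega>. ennreal (discounted_payoff \<rho> h (Z z) \<tau> \<omega>) \<partial>completion M) \<le> stopping_value M \<F> \<rho> h (Z z)"
      unfolding stopping_value_def by (rule SUP_upper) (use that in simp)
    then show ?thesis
      unfolding payoff_eq[OF that(1)] using u[OF that(1)] by (simp add: \<rho>_def h_def)
  qed
  have u_nonneg: "0 \<le> u z" if "0 < z" for z
    using \<open>u \<in> A1_plus\<close> that by (simp add: A1_plus_def)
  have u_cont: "continuous_on {0<..} u"
    using \<open>u \<in> A1_plus\<close> by (simp add: A1_plus_def)
  \<comment> \<open>From the norm in \<open>A1_plus\<close>, using
    \<open>1 + z\<^sup>2 \<le> (1 + z)\<^sup>2\<close>.\<close>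
  obtain c where c: "0 \<le> c" "\<And>z. 0 < z \<Longrightarrow> u z \<le> c * (1 + z)"
  proof -
    obtain K where K: "\<And>z. 0 < z \<Longrightarrow> \<bar>u z\<bar>\<^sup>2 / (1 + z\<^sup>2) \<le> K"
      using \<open>u \<in> A1_plus\<close> unfolding A1_plus_def bdd_above_def by auto
    have "0 \<le> \<bar>u 1\<bar>\<^sup>2 / (1 + 1\<^sup>2)" by simp
    then have "0 \<le> K" using K[of 1] by linarith
    have "u z \<le> sqrt K * (1 + z)" if "0 < z" for z
    proof (rule power2_le_imp_le)
      have "0 < 1 + z\<^sup>2" by (simp add: add_pos_nonneg)
      then have "(u z)\<^sup>2 \<le> K * (1 + z\<^sup>2)"
        using K[OF that] by (simp add: divide_le_eq)
      also have "\<dots> \<le> K * (1 + z)\<^sup>2"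
        using \<open>0 \<le> K\<close> that by (intro mult_left_mono) (auto simp: power2_sum)
      finally show "(u z)\<^sup>2 \<le> (sqrt K * (1 + z))\<^sup>2"
        using \<open>0 \<le> K\<close> by (simp add: power_mult_distrib)
    qed (use \<open>0 \<le> K\<close> that in simp)
    then show thesis using that[of "sqrt K"] \<open>0 \<le> K\<close> by simp
  qed
  interpret D: real_distribution D by fact
  interpret S: prob_space std_normal by (rule prob_space_std_normal)
  have D_UNIV: "measure D UNIV = 1"
    using D.prob_space by simp
  have S_UNIV: "measure std_normal UNIV = 1"
    using S.prob_space by simp
  interpret DS: pair_prob_space D std_normal ..
  define N where "N = D \<Otimes>\<^sub>M std_normal"
  \<comment> \<open>The indicator matches the domain of integration in \<open>Pi_op\<close> and
    keeps the weight between 0 and 1 for every real \<open>t\<close>, \<open>D\<close> being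
    concentrated on the half line only almost everywhere.\<close>
  define w0 where "w0 t = indicator {0..} t * exp (- \<rho> * t)" for t :: real
  define w where "w s = w0 (fst s)" for s :: "real \<times> real"
  define \<Phi> where "\<Phi> = gbm_value \<mu> \<beta>"
  have sets_N [measurable_cong]: "sets N = sets (borel \<Otimes>\<^sub>M borel)"
    unfolding N_def by (intro sets_pair_measure_cong) auto
  have \<Phi>_meas [measurable]: "\<Phi> \<in> borel_measurable N"
    using gbm_value_measurable[of \<mu> \<beta>] by (simp add: \<Phi>_def measurable_cong_sets[OF sets_N refl])
  have w0_meas [measurable]: "w0 \<in> borel_measurable borel"
    unfolding w0_def by measurable
  have [measurable]: "w \<in> borel_measurable N"
  proof -
    have "w \<in> borel_measurable (borel \<Otimes>\<^sub>M borel)" unfolding w_def by measurable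
    then show ?thesis by (simp add: measurable_cong_sets[OF sets_N refl])
  qed
  have w0_bounds: "0 \<le> w0 t" "w0 t \<le> 1" for t
    using \<rho> by (auto simp: w0_def indicator_def)
  have N_prob: "prob_space N"
    unfolding N_def by (rule DS.prob_space_axioms)
  interpret N: prob_space N by (rule N_prob)
  have w_int: "integrable N w"
    by (rule N.integrable_const_bound[of _ 1]) (use w0_bounds in \<open>auto simp: w_def\<close>)
  \<comment> \<open>Here \<open>\<mu> < \<rho>\<close> ensures that the discounted mean of the
    process does not grow.\<close>
  have mean_D: "w0 t * exp (\<mu> * t) \<le> 1" "0 \<le> w0 t * exp (\<mu> * t)" for t
    using \<rho> by (auto simp: w0_def indicator_def exp_add[symmetric] mult_right_mono)
  have inner: "(\<integral>x. w0 t * \<Phi> (t, x) \<partial>std_normal) = w0 t * exp (\<mu> * t)" "integrable std_normal (\<lambda>x. w0 t * \<Phi> (t, x))" for t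
    using gbm_value_moment[of t \<mu> \<beta>] by (cases "0 \<le> t"; simp add: \<Phi>_def w0_def)+
  have w\<Phi>_int: "integrable N (\<lambda>s. w s * \<Phi> s)"
    unfolding N_def
  proof (rule DS.Fubini_integrable)
    show "(\<lambda>s. w s * \<Phi> s) \<in> borel_measurable (D \<Otimes>\<^sub>M std_normal)"
      unfolding N_def[symmetric] by measurable
    have "norm (w (t, x) * \<Phi> (t, x)) = w0 t * \<Phi> (t, x)" for t x
      using w0_bounds[of t] gbm_value_pos[of \<mu> \<beta> "(t, x)"] by (simp add: w_def \<Phi>_def)
    then have "(\<integral>x. norm (w (t, x) * \<Phi> (t, x)) \<partial>std_normal) = w0 t * exp (\<mu> * t)" for t
      by (simp only: inner)
    then show "integrable D (\<lambda>t. \<integral>x. norm (w (t, x) * \<Phi> (t, x)) \<partial>std_normal)"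
      by (simp only:) (intro D.integrable_const_bound[of _ 1], use mean_D in auto)
    show "AE t in D. integrable std_normal (\<lambda>x. w (t, x) * \<Phi> (t, x))"
      using inner(2) by (simp only: w_def fst_conv) simp
  qed
  have q_eq: "(\<integral>s. w s \<partial>N) = (\<integral>t. w0 t \<partial>D)"
  proof -
    have "(\<integral>s. w s \<partial>N) = (\<integral>t. (\<integral>x. w (t, x) \<partial>std_normal) \<partial>D)"
      using DS.integral_fst'[OF w_int[unfolded N_def]] by (simp add: N_def)
    then show ?thesis by (simp add: w_def S_UNIV)
  qed
  have q2_eq: "(\<integral>s. w s * \<Phi> s \<partial>N) = (\<integral>t. w0 t * exp (\<mu> * t) \<partial>D)"
  proof -
    have "(\<integral>s. w s * \<Phi> s \<partial>N) = (\<integral>t. (\<integral>x. w (t, x) * \<Phi> (t, x) \<partial>std_normal) \<partial>D)"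
      using DS.integral_fst'[OF w\<Phi>_int[unfolded N_def]] by (simp add: N_def)
    then show ?thesis by (simp only: w_def fst_conv inner)
  qed
  have w0_int: "integrable D w0"
    by (rule D.integrable_const_bound[of _ 1]) (use w0_bounds in auto)
  have w0\<mu>_int: "integrable D (\<lambda>t. w0 t * exp (\<mu> * t))"
    by (rule D.integrable_const_bound[of _ 1]) (use mean_D in auto)
  have bounds_1: "(\<integral>t. f t \<partial>D) \<le> 1" if "integrable D f" "\<And>t. f t \<le> 1" for f :: "real \<Rightarrow> real"
    using integral_mono[OF that(1), of "\<lambda>_. 1"] that(2) by (simp add: D_UNIV)
  have bounds_0: "0 < (\<integral>t. f t \<partial>D)" if "integrable D f" "\<And>t. 0 \<le> t \<Longrightarrow> 0 < f t" for f :: "real \<Rightarrow> real"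
  proof -
    have "AE t in D. 0 < f t"
      using \<open>AE t in D. 0 \<le> t\<close> by eventually_elim (rule that(2))
    then have "(\<integral>t. 0 \<partial>D) < (\<integral>t. f t \<partial>D)"
      using that(1) by (intro D.integral_less_AE_space) (auto simp: D.emeasure_space_1[simplified])
    then show ?thesis by simp
  qed
  \<comment> \<open>Nothing is known about \<open>u\<close> outside the positive half line; set to 0
    there it is a Borel function.\<close>
  define ub where "ub x = indicator {0<..} x *\<^sub>R u x" for x
  have ub_meas [measurable]: "ub \<in> borel_measurable borel"
    unfolding ub_def using borel_measurable_continuous_on_indicator[OF _ u_cont] by simp
  have ub_eq: "ub x = u x" if "0 < x" for x
    using that by (simp add: ub_def)
  have u\<Phi>_int: "integrable N (\<lambda>s. w s * u (z * \<Phi> s))" if z: "0 < z" for z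
  proof (rule Bochner_Integration.integrable_bound)
    show "integrable N (\<lambda>s. c * w s + c * z * (w s * \<Phi> s))"
      using w_int w\<Phi>_int by simp
    have "(\<lambda>s. w s * ub (z * \<Phi> s)) \<in> borel_measurable N" by measurable
    then show "(\<lambda>s. w s * u (z * \<Phi> s)) \<in> borel_measurable N"
      using ub_eq gbm_value_pos[of \<mu> \<beta>] z by (simp add: \<Phi>_def)
    show "AE s in N. norm (w s * u (z * \<Phi> s)) \<le> norm (c * w s + c * z * (w s * \<Phi> s))"
    proof (rule AE_I2)
      fix s
      have pos: "0 < z * \<Phi> s" using z gbm_value_pos[of \<mu> \<beta> s] by (simp add: \<Phi>_def)
      have ws: "0 \<le> w s" using w0_bounds by (simp add: w_def)
      have "w s * u (z * \<Phi> s) \<le> w s * (c * (1 + z * \<Phi> s))"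
        using ws c(2)[OF pos] by (intro mult_left_mono)
      moreover have "0 \<le> w s * u (z * \<Phi> s)"
        using ws u_nonneg[OF pos] by simp
      ultimately show "norm (w s * u (z * \<Phi> s)) \<le> norm (c * w s + c * z * (w s * \<Phi> s))"
        by (simp add: algebra_simps)
    qed
  qed
  define k where "k z t = (\<integral>x. p * (1 + z * \<Phi> (t, x)) + (1 - p) * u (z * \<Phi> (t, x)) \<partial>std_normal)" for z t
  have \<Pi>u_D: "\<Pi>u z = (\<integral>t. w0 t * k z t \<partial>D)" if z: "0 < z" for z
  proof -
    have "(\<integral>\<omega>. p * (1 + Z z t \<omega>) + (1 - p) * u (Z z t \<omega>) \<partial>completion M) = k z t" if t: "0 \<le> t" for t
    proof -
      let ?f = "\<lambda>x. p * (1 + z * x) + (1 - p) * ub (z * x)"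
      have f: "?f \<in> borel_measurable borel" by measurable
      have g: "B.gbm \<mu> \<beta> t \<in> borel_measurable (completion M)" by (rule B.gbm_borel[OF t])
      have ae: "AE \<omega> in completion M. p * (1 + Z z t \<omega>) + (1 - p) * u (Z z t \<omega>) = ?f (B.gbm \<mu> \<beta> t \<omega>)"
        using path[OF z] by eventually_elim (use t z B.gbm_pos[of \<mu> \<beta> t] ub_eq in simp)
      have f_gbm: "(\<lambda>\<omega>. ?f (B.gbm \<mu> \<beta> t \<omega>)) \<in> borel_measurable (completion M)"
        by (rule measurable_compose[OF g f])
      have "(\<integral>\<omega>. p * (1 + Z z t \<omega>) + (1 - p) * u (Z z t \<omega>) \<partial>completion M) =
          (\<integral>\<omega>. ?f (B.gbm \<mu> \<beta> t \<omega>) \<partial>completion M)"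
        by (rule integral_cong_AE[OF B.borel_measurable_AE_eq[OF f_gbm ae] f_gbm ae])
      also have "\<dots> = (\<integral>x. ?f (gbm_value \<mu> \<beta> (t, x)) \<partial>std_normal)"
        by (rule B.gbm_distribution[OF t f])
      also have "\<dots> = k z t"
        using ub_eq z gbm_value_pos[of \<mu> \<beta>] by (simp add: k_def \<Phi>_def)
      finally show ?thesis .
    qed
    then show ?thesis
      unfolding \<Pi>u Pi_op_def set_lebesgue_integral_def \<rho>_def[symmetric]
      by (intro Bochner_Integration.integral_cong refl) (simp add: w0_def indicator_def)
  qed
  have g_int: "integrable N (\<lambda>s. w s * (p * (1 + z * \<Phi> s) + (1 - p) * u (z * \<Phi> s)))"
    and g_eq: "(\<integral>s. w s * (p * (1 + z * \<Phi> s) + (1 - p) * u (z * \<Phi> s)) \<partial>N) =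
      p * ((\<integral>s. w s \<partial>N) + (\<integral>s. w s * \<Phi> s \<partial>N) * z) + (1 - p) * (\<integral>s. w s * u (z * \<Phi> s) \<partial>N)"
    if z: "0 < z" for z
  proof -
    have eq: "w s * (p * (1 + z * \<Phi> s) + (1 - p) * u (z * \<Phi> s)) =
        p * w s + p * z * (w s * \<Phi> s) + (1 - p) * (w s * u (z * \<Phi> s))" for s
      by (simp add: algebra_simps)
    show "integrable N (\<lambda>s. w s * (p * (1 + z * \<Phi> s) + (1 - p) * u (z * \<Phi> s)))"
      unfolding eq using w_int w\<Phi>_int u\<Phi>_int[OF z] by simp
    show "(\<integral>s. w s * (p * (1 + z * \<Phi> s) + (1 - p) * u (z * \<Phi> s)) \<partial>N) =
      p * ((\<integral>s. w s \<partial>N) + (\<integral>s. w s * \<Phi> s \<partial>N) * z) + (1 - p) * (\<integral>s. w s * u (z * \<Phi> s) \<partial>N)"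
      unfolding eq using w_int w\<Phi>_int u\<Phi>_int[OF z] by (simp add: algebra_simps)
  qed
  have k_int: "integrable D (\<lambda>t. w0 t * k z t)" and \<Pi>u_N: "\<Pi>u z = (\<integral>s. w s * (p * (1 + z * \<Phi> s) + (1 - p) * u (z * \<Phi> s)) \<partial>N)"
    if z: "0 < z" for z
  proof -
    note g = g_int[OF z, unfolded N_def]
    have eq: "(\<integral>x. w (t, x) * (p * (1 + z * \<Phi> (t, x)) + (1 - p) * u (z * \<Phi> (t, x))) \<partial>std_normal) = w0 t * k z t" for t
      by (simp add: w_def k_def)
    show "integrable D (\<lambda>t. w0 t * k z t)"
      using DS.integrable_fst'[OF g] unfolding eq .
    show "\<Pi>u z = (\<integral>s. w s * (p * (1 + z * \<Phi> s) + (1 - p) * u (z * \<Phi> s)) \<partial>N)"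
      using DS.integral_fst'[OF g] unfolding eq \<Pi>u_D[OF z] N_def .
  qed
  interpret stopping_fixed_point \<gamma>1 \<gamma>2 p c N w \<Phi> u \<Pi>u
  proof
    show "(\<integral>s. w s \<partial>N) \<le> 1" unfolding q_eq by (rule bounds_1[OF w0_int w0_bounds(2)])
    show "0 < (\<integral>s. w s \<partial>N)" unfolding q_eq by (rule bounds_0[OF w0_int]) (simp add: w0_def)
    show "(\<integral>s. w s * \<Phi> s \<partial>N) \<le> 1" unfolding q2_eq by (rule bounds_1[OF w0\<mu>_int mean_D(1)])
    show "0 < (\<integral>s. w s * \<Phi> s \<partial>N)" unfolding q2_eq by (rule bounds_0[OF w0\<mu>_int]) (simp add: w0_def)
    show "\<Pi>u z = p * ((\<integral>s. w s \<partial>N) + (\<integral>s. w s * \<Phi> s \<partial>N) * z) + (1 - p) * (\<integral>s. w s * u (z * \<Phi> s) \<partial>N)" if "0 < z" for z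
      unfolding \<Pi>u_N[OF that] by (rule g_eq[OF that])
    show "max 1 (\<Pi>u z) \<le> u z" if z: "0 < z" for z
    proof -
      \<comment> \<open>The lower bound from stopping at time 0.\<close>
      have "ennreal (h z) = (\<integral>\<^sup>+\<omega>. ennreal (h z) \<partial>completion M)"
        by (simp add: B.emeasure_space_1[simplified])
      also have "\<dots> = (\<integral>\<^sup>+\<omega>. ennreal (discounted_payoff \<rho> h (\<lambda>t \<omega>. z * B.gbm \<mu> \<beta> t \<omega>) (\<lambda>_. 0) \<omega>) \<partial>completion M)"
      proof (rule nn_integral_cong_AE)
        show "AE \<omega> in completion M. ennreal (h z) =
            ennreal (discounted_payoff \<rho> h (\<lambda>t \<omega>. z * B.gbm \<mu> \<beta> t \<omega>) (\<lambda>_. 0) \<omega>)"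
          using B.gbm_0[of \<mu> \<beta>] by eventually_elim (simp add: discounted_payoff_def)
      qed
      also have "\<dots> \<le> ennreal (u z)"
        by (rule value_ge[OF z]) (simp add: stopping_time_def)
      finally show ?thesis
        using u_nonneg[OF z] by (simp add: h_def)
    qed
    show "A * max 1 (\<Pi>u z1) + B * max 1 (\<Pi>u z2) \<le> u z" if cw: "chord_weights \<gamma>1 \<gamma>2 z1 z z2 A B" for z1 z z2 A B
    proof -
      from cw have zz: "0 < z1" "z1 < z" "z < z2" and wts: "A * z1 powr \<gamma>1 + B * z2 powr \<gamma>1 = z powr \<gamma>1"
        "A * z1 powr \<gamma>2 + B * z2 powr \<gamma>2 = z powr \<gamma>2"
        by (auto simp: chord_weights_def)
      \<comment> \<open>The combination that interpolates the reward at \<open>z1\<close> and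
        \<open>z2\<close> has at \<open>z\<close> exactly the value given by the chord
        weights.\<close>
      have "\<gamma>1 < \<gamma>2" "z1 < z2" using \<gamma> zz by auto
      then obtain c1 c2 where cc: "c1 * z1 powr \<gamma>1 + c2 * z1 powr \<gamma>2 = h z1" "c1 * z2 powr \<gamma>1 + c2 * z2 powr \<gamma>2 = h z2"
        by (rule two_point_interpolation[OF _ zz(1)])
      have "0 \<le> h z1" "0 \<le> h z2" by (auto simp: h_def)
      from B.exit_time_value[OF zz rate \<rho>(1), where h = h, OF this cc] obtain \<tau> where
        \<tau>: "stopping_time \<F> \<tau>" "ennreal (c1 * z powr \<gamma>1 + c2 * z powr \<gamma>2) \<le>
          (\<integral>\<^sup>+\<omega>. ennreal (discounted_payoff \<rho> h (\<lambda>t \<omega>. z * B.gbm \<mu> \<beta> t \<omega>) \<tau> \<omega>) \<partial>completion M)"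
        by blast
      have z: "0 < z" using zz by simp
      have "ennreal (c1 * z powr \<gamma>1 + c2 * z powr \<gamma>2) \<le> ennreal (u z)"
        using \<tau>(2) value_ge[OF z \<tau>(1)] by (rule order_trans)
      then have "c1 * z powr \<gamma>1 + c2 * z powr \<gamma>2 \<le> u z"
        using u_nonneg[OF z] by simp
      moreover have "c1 * z powr \<gamma>1 + c2 * z powr \<gamma>2 = A * h z1 + B * h z2"
        unfolding wts[symmetric] cc[symmetric] by (simp add: algebra_simps)
      ultimately show ?thesis by (simp add: h_def)
    qed
    show "u z \<le> a * z powr \<gamma>1 + b * z powr \<gamma>2"
      if ab: "0 \<le> a" "0 \<le> b" and le: "\<And>y. 0 < y \<Longrightarrow> max 1 (\<Pi>u y) \<le> a * y powr \<gamma>1 + b * y powr \<gamma>2" and z: "0 < z" for a b z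
    proof -
      have "stopping_value M \<F> \<rho> h (Z z) \<le> ennreal (a * z powr \<gamma>1 + b * z powr \<gamma>2)"
        unfolding stopping_value_def
      proof (rule SUP_least)
        fix \<tau> assume "\<tau> \<in> {\<tau>. stopping_time \<F> \<tau>}"
        then have \<tau>: "stopping_time \<F> \<tau>" by simp
        have "(\<integral>\<^sup>+\<omega>. ennreal (discounted_payoff \<rho> h (Z z) \<tau> \<omega>) \<partial>completion M) \<le>
            (\<integral>\<^sup>+\<omega>. ennreal (discounted_payoff \<rho> (\<lambda>y. a * y powr \<gamma>1 + b * y powr \<gamma>2) (\<lambda>t \<omega>. z * B.gbm \<mu> \<beta> t \<omega>) \<tau> \<omega>) \<partial>completion M)"
          unfolding payoff_eq[OF z]
          by (intro nn_integral_mono ennreal_leI discounted_payoff_mono) (use le z B.gbm_pos in \<open>auto simp: h_def\<close>)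
        also have "\<dots> \<le> ennreal (a * z powr \<gamma>1 + b * z powr \<gamma>2)"
          by (rule B.harmonic_optional_sampling[OF \<tau> ab z rate])
        finally show "(\<integral>\<^sup>+\<omega>. ennreal (discounted_payoff \<rho> h (Z z) \<tau> \<omega>) \<partial>completion M) \<le> ennreal (a * z powr \<gamma>1 + b * z powr \<gamma>2)" .
      qed
      then have "ennreal (u z) \<le> ennreal (a * z powr \<gamma>1 + b * z powr \<gamma>2)"
        using u[OF z] by (simp add: \<rho>_def h_def)
      then show ?thesis
        using ab by (subst (asm) ennreal_le_iff) auto
    qed
  qed (use \<gamma> \<open>0 < p\<close> \<open>p < 1\<close> w0_bounds w_int w\<Phi>_int \<Phi>_meas gbm_value_pos u_cont u_nonneg c in \<open>auto simp: w_def \<Phi>_def\<close>)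
  have atom: "AE t in D. t = 0" if "F 0 = 1"
  proof -
    have "AE t in D. t \<in> {..0}"
      using that by (intro D.AE_prob_1) (simp add: F cdf_def)
    then show ?thesis
      using \<open>AE t in D. 0 \<le> t\<close> by eventually_elim simp
  qed
  have no_delay: "\<Pi>u z = p * (1 + z) + (1 - p) * u z" if "F 0 = 1" "0 < z" for z
  proof -
    have "\<Pi>u z = (\<integral>t. w0 0 * k z 0 \<partial>D)"
      unfolding \<Pi>u_D[OF that(2)]
      using atom[OF that(1)] k_int[OF that(2)] by (intro integral_cong_AE) (auto elim: eventually_mono)
    also have "\<dots> = p * (1 + z) + (1 - p) * u z"
      by (simp add: D_UNIV S_UNIV w0_def k_def \<Phi>_def gbm_value_def)
    finally show ?thesis .
  qed
  \<comment> \<open>Equality would force \<open>exp (- \<rho> * t) = 1\<close>, that is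
    \<open>t = 0\<close>, for almost every \<open>t\<close>.\<close>
  have "q < 1" if "F 0 < 1"
  proof (rule ccontr)
    assume "\<not> q < 1"
    then have "(\<integral>t. 1 - w0 t \<partial>D) = 0"
      using q w0_int by (simp add: q_def q_eq D_UNIV)
    then have "AE t in D. 1 - w0 t = 0"
      using w0_int w0_bounds by (subst (asm) integral_nonneg_eq_0_iff_AE) auto
    then have "AE t in D. t \<in> {..0}"
      using \<open>AE t in D. 0 \<le> t\<close>
    proof eventually_elim
      case (elim t)
      then have "exp (- \<rho> * t) = 1" by (simp add: w0_def)
      then show ?case using \<rho> by simp
    qed
    then have "F 0 = 1"
      by (subst (asm) D.AE_in_set_eq_1) (auto simp: F cdf_def)
    then show False using that by simp
  qed
  then show ?thesis
    using solution_without_delay[OF no_delay] continuation_region unfolding C z0 by blast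
qed

end
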